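(* Let $v$ be a non-identical continuous $\mathbb{R}$-action without locally dense orbits on a compact surface $S$. The following are equivalent: 1) $v$ is extended pointwise almost periodic. 2) $v$ is extended recurrent and $|\mathrm{Sing}(v)\cap\overline{O_{\mathrm{ex}}(x)}|<\infty$ for each $x\in S$. 3) $v$ consists of closed extended orbits, i.e. $O_{\mathrm{ex}}(x)$ is closed for every $x\in S$.
   Context: $S$ is a compact surface and $v$ is a continuous $\mathbb{R}$-action (flow) on $S$; $v$ is non-identical if it is not the trivial action fixing every point. For $x\in S$, $O(x)$, $O^+(x)$, $O^-(x)$ denote the orbit, positive orbit and negative orbit of $x$, and $\omega(x)$, $\alpha(x)$ its omega and alpha limit sets. $\mathrm{Sing}(v)$ is the set of singularities (fixed points) of $v$. An orbit $O$ is locally dense if $\mathrm{int}\,\overline{O}\neq\emptyset$. Saddle: a singular point $x$ is a (topological) saddle if it has a neighborhood on which the flow is locally homeomorphic (by a homeomorphism carrying orbits to orbits and preserving their direction) to the flow on a neighborhood of a saddle of a $C^1$ $\mathbb{R}$-action. We say "$\omega(x)$ is a saddle" if $\omega(x)=\{p\}$ with $p$ a saddle, and then write $W^u(\omega(x))=W^u(p)$; similarly for $\alpha$ and $W^s$. Extended orbits: put $W^u(y)=\{z\in S\mid \alpha(z)=\{y\}\}$ and $W^s(y)=\{z\in S\mid \omega(z)=\{y\}\}$. Define $O^+_0(x)=O^+(x)$, $O^+_{i+1}(x)=O^+_i(x)\cup\bigcup\{W^u(\omega(x'))\mid x'\in O^+_i(x),\ \omega(x')\text{ is a saddle}\}$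 for every ordinal $i$, and $O^+_\mu(x)=\bigcup_{\nu<\mu}O^+_\nu(x)$ for every limit ordinal $\mu$. The extended positive orbit is $O^+_{\mathrm{ex}}(x)=\bigcup_{\nu\text{ ordinal}}O^+_\nu(x)$. The extended negative orbit $O^-_{\mathrm{ex}}(x)$ is defined symmetrically, starting from $O^-(x)$ and using $W^s(\alpha(x'))$ when $\alpha(x')$ is a saddle. The extended orbit is $O_{\mathrm{ex}}(x)=O^+_{\mathrm{ex}}(x)\cup O^-_{\mathrm{ex}}(x)$. Extended recurrence: $x$ is extended positive recurrent if either $x\in\omega(x)$ (positive recurrent) or $x\in\overline{O^+_{\mathrm{ex}}(x)-O^+(x)}$; $x$ is extended negative recurrent if either $x\in\alpha(x)$ or $x\in\overline{O^-_{\mathrm{ex}}(x)-O^-(x)}$; $x$ is extended recurrent if it is both. The action $v$ is extended recurrent if every point of $S$ is. The action $v$ is extended pointwise almost periodic (extended p.a.p.) if the set $\{\overline{O_{\mathrm{ex}}(x)}\mid x\in S\}$ of closures of extended orbits is a decomposition of $S$, i.e. any two of its members are equal or disjoint (they cover $S$). *)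

theory Defs
  imports "HOL-Analysis.Analysis" "HOL-Library.Disjoint_Sets"
begin

section \<open>Surfaces and flows\<close>

definition half_plane :: "(real ^ 2) set" where
  "half_plane = {z. 0 \<le> z $ 1}"

(* Surfaces may have boundary, be non-orientable and be disconnected.  An open disc is also a
   relatively open subset of the half plane, so this covers interior points too.  Hausdorffness
   and second countability come from the type. *)
definition surface :: "'a::{t2_space, second_countable_topology} set \<Rightarrow> bool" where
  "surface S \<longleftrightarrow>
     (\<forall>x\<in>S. \<exists>U V. openin (top_of_set S) U \<and> x \<in> U \<and>
                  openin (top_of_set half_plane) V \<and> U homeomorphic V)"

definition flow_on :: "'a::topological_space set \<Rightarrow> (real \<Rightarrow> 'a \<Rightarrow> 'a) \<Rightarrow> bool" where
  "flow_on M v \<longleftrightarrow>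
     (\<forall>t. \<forall>x\<in>M. v t x \<in> M) \<and>
     (\<forall>x\<in>M. v 0 x = x) \<and>
     (\<forall>s t. \<forall>x\<in>M. v (s + t) x = v s (v t x)) \<and>
     continuous_on (UNIV \<times> M) (\<lambda>(t, x). v t x)"

definition orbit :: "(real \<Rightarrow> 'a \<Rightarrow> 'a) \<Rightarrow> 'a \<Rightarrow> 'a set" where
  "orbit v x = range (\<lambda>t. v t x)"

definition pos_orbit :: "(real \<Rightarrow> 'a \<Rightarrow> 'a) \<Rightarrow> 'a \<Rightarrow> 'a set" where
  "pos_orbit v x = (\<lambda>t. v t x) ` {0..}"

definition neg_orbit :: "(real \<Rightarrow> 'a \<Rightarrow> 'a) \<Rightarrow> 'a \<Rightarrow> 'a set" where
  "neg_orbit v x = (\<lambda>t. v t x) ` {..0}"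

definition omega_limit :: "(real \<Rightarrow> 'a::topological_space \<Rightarrow> 'a) \<Rightarrow> 'a \<Rightarrow> 'a set" where
  "omega_limit v x = (\<Inter>T. closure ((\<lambda>t. v t x) ` {T..}))"

definition alpha_limit :: "(real \<Rightarrow> 'a::topological_space \<Rightarrow> 'a) \<Rightarrow> 'a \<Rightarrow> 'a set" where
  "alpha_limit v x = (\<Inter>T. closure ((\<lambda>t. v t x) ` {..T}))"

definition Sing :: "(real \<Rightarrow> 'a \<Rightarrow> 'a) \<Rightarrow> 'a set" where
  "Sing v = {x. \<forall>t. v t x = x}"

definition non_identical :: "(real \<Rightarrow> 'a \<Rightarrow> 'a) \<Rightarrow> bool" where
  "non_identical v \<longleftrightarrow> (\<exists>t x. v t x \<noteq> x)"

definition locally_dense :: "'a::topological_space set \<Rightarrow> bool" where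
  "locally_dense A \<longleftrightarrow> interior (closure A) \<noteq> {}"


section \<open>Saddles\<close>

definition C1_flow_on :: "(real ^ 2) set \<Rightarrow> (real \<Rightarrow> real ^ 2 \<Rightarrow> real ^ 2) \<Rightarrow> bool" where
  "C1_flow_on M \<psi> \<longleftrightarrow> flow_on M \<psi> \<and>
     (\<exists>D :: real \<times> (real ^ 2) \<Rightarrow> (real \<times> (real ^ 2)) \<Rightarrow>\<^sub>L (real ^ 2).
        continuous_on (UNIV \<times> M) D \<and>
        (\<forall>z \<in> UNIV \<times> M.
           ((\<lambda>(t, x). \<psi> t x) has_derivative blinfun_apply (D z)) (at z within UNIV \<times> M)))"

(* A hyperbolic fixed point of saddle type: the linearisation at q, a linear flow on the tangent
   plane, is exp (t A) for a matrix A with eigenvalues a < 0 < b.  This is expressed through the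
   derivatives of the time-t maps, because the vector field of a C1 action need not be C1. *)
definition C1_saddle :: "(real ^ 2) set \<Rightarrow> (real \<Rightarrow> real ^ 2 \<Rightarrow> real ^ 2) \<Rightarrow> real ^ 2 \<Rightarrow> bool" where
  "C1_saddle M \<psi> q \<longleftrightarrow> C1_flow_on M \<psi> \<and> q \<in> M \<and> (\<forall>t. \<psi> t q = q) \<and>
     (\<exists>L a b u w. a < 0 \<and> 0 < b \<and> u \<noteq> 0 \<and> w \<noteq> 0 \<and>
        (\<forall>t. (\<psi> t has_derivative L t) (at q within M) \<and>
             L t u = exp (a * t) *\<^sub>R u \<and> L t w = exp (b * t) *\<^sub>R w))"

(* The interval of times around 0 during which the orbit of y has not left U; the points v t y
   with t in this interval form the local orbit of y in U. *)
definition stay_times :: "(real \<Rightarrow> 'a \<Rightarrow> 'a) \<Rightarrow> 'a set \<Rightarrow> 'a \<Rightarrow> real set" where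
  "stay_times v U y = {t. \<forall>s \<in> closed_segment 0 t. v s y \<in> U}"

(* A homeomorphism carrying local orbits onto local orbits and preserving their direction,
   i.e. up to an increasing, orbit-dependent change of the time parameter. *)
definition orbit_equivalence ::
  "(real \<Rightarrow> 'a::topological_space \<Rightarrow> 'a) \<Rightarrow> 'a set \<Rightarrow>
   (real \<Rightarrow> 'b::topological_space \<Rightarrow> 'b) \<Rightarrow> 'b set \<Rightarrow> ('a \<Rightarrow> 'b) \<Rightarrow> bool" where
  "orbit_equivalence v U \<psi> V h \<longleftrightarrow>
     (\<exists>g. homeomorphism U V h g) \<and>
     (\<forall>y\<in>U. \<exists>\<tau>. \<tau> 0 = 0 \<and> strict_mono_on (stay_times v U y) \<tau> \<and>
        \<tau> ` stay_times v U y = stay_times \<psi> V (h y) \<and>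
        (\<forall>t \<in> stay_times v U y. h (v t y) = \<psi> (\<tau> t) (h y)))"

(* The property is local, so the smooth models live on the plane or, for points on the boundary
   of the surface, on the closed half plane. *)
definition saddle :: "(real \<Rightarrow> 'a::topological_space \<Rightarrow> 'a) \<Rightarrow> 'a \<Rightarrow> bool" where
  "saddle v p \<longleftrightarrow> p \<in> Sing v \<and>
     (\<exists>M \<psi> q U V h. M \<in> {UNIV, half_plane} \<and> C1_saddle M \<psi> q \<and>
        open U \<and> p \<in> U \<and> openin (top_of_set M) V \<and>
        orbit_equivalence v U \<psi> V h \<and> h p = q)"

definition W_unstable :: "(real \<Rightarrow> 'a::topological_space \<Rightarrow> 'a) \<Rightarrow> 'a \<Rightarrow> 'a set" where
  "W_unstable v y = {z. alpha_limit v z = {y}}"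

definition W_stable :: "(real \<Rightarrow> 'a::topological_space \<Rightarrow> 'a) \<Rightarrow> 'a \<Rightarrow> 'a set" where
  "W_stable v y = {z. omega_limit v z = {y}}"


section \<open>Extended orbits\<close>

(* The transfinite sequence of stages starting from the positive orbit.  HOL has no type of all
   ordinals, so the collection of its members is generated inductively: the base stage, successor
   stages, and unions of nonempty families of earlier stages.  The sequence is increasing, so such
   a union is a limit stage or a stage that is already present. *)
inductive_set pos_stages :: "(real \<Rightarrow> 'a::topological_space \<Rightarrow> 'a) \<Rightarrow> 'a \<Rightarrow> 'a set set"
  for v x where
  base: "pos_orbit v x \<in> pos_stages v x"
| succ: "A \<in> pos_stages v x \<Longrightarrow>
    A \<union> \<Union>{W_unstable v p | p x'. x' \<in> A \<and> omega_limit v x' = {p} \<and> saddle v p}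
      \<in> pos_stages v x"
| limit: "C \<noteq> {} \<Longrightarrow> (\<And>A. A \<in> C \<Longrightarrow> A \<in> pos_stages v x) \<Longrightarrow> \<Union>C \<in> pos_stages v x"

inductive_set neg_stages :: "(real \<Rightarrow> 'a::topological_space \<Rightarrow> 'a) \<Rightarrow> 'a \<Rightarrow> 'a set set"
  for v x where
  base: "neg_orbit v x \<in> neg_stages v x"
| succ: "A \<in> neg_stages v x \<Longrightarrow>
    A \<union> \<Union>{W_stable v p | p x'. x' \<in> A \<and> alpha_limit v x' = {p} \<and> saddle v p}
      \<in> neg_stages v x"
| limit: "C \<noteq> {} \<Longrightarrow> (\<And>A. A \<in> C \<Longrightarrow> A \<in> neg_stages v x) \<Longrightarrow> \<Union>C \<in> neg_stages v x"

definition pos_ext_orbit :: "(real \<Rightarrow> 'a::topological_space \<Rightarrow> 'a) \<Rightarrow> 'a \<Rightarrow> 'a set" where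
  "pos_ext_orbit v x = \<Union>(pos_stages v x)"

definition neg_ext_orbit :: "(real \<Rightarrow> 'a::topological_space \<Rightarrow> 'a) \<Rightarrow> 'a \<Rightarrow> 'a set" where
  "neg_ext_orbit v x = \<Union>(neg_stages v x)"

definition ext_orbit :: "(real \<Rightarrow> 'a::topological_space \<Rightarrow> 'a) \<Rightarrow> 'a \<Rightarrow> 'a set" where
  "ext_orbit v x = pos_ext_orbit v x \<union> neg_ext_orbit v x"


section \<open>Extended recurrence and extended pointwise almost periodicity\<close>

definition ext_pos_recurrent_at :: "(real \<Rightarrow> 'a::topological_space \<Rightarrow> 'a) \<Rightarrow> 'a \<Rightarrow> bool" where
  "ext_pos_recurrent_at v x \<longleftrightarrow>
     x \<in> omega_limit v x \<or> x \<in> closure (pos_ext_orbit v x - pos_orbit v x)"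

definition ext_neg_recurrent_at :: "(real \<Rightarrow> 'a::topological_space \<Rightarrow> 'a) \<Rightarrow> 'a \<Rightarrow> bool" where
  "ext_neg_recurrent_at v x \<longleftrightarrow>
     x \<in> alpha_limit v x \<or> x \<in> closure (neg_ext_orbit v x - neg_orbit v x)"

definition ext_recurrent :: "(real \<Rightarrow> 'a::topological_space \<Rightarrow> 'a) \<Rightarrow> bool" where
  "ext_recurrent v \<longleftrightarrow> (\<forall>x. ext_pos_recurrent_at v x \<and> ext_neg_recurrent_at v x)"

definition ext_pap :: "(real \<Rightarrow> 'a::topological_space \<Rightarrow> 'a) \<Rightarrow> bool" where
  "ext_pap v \<longleftrightarrow> partition_on UNIV (range (\<lambda>x. closure (ext_orbit v x)))"

end

theory Submission
  imports Defs
begin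

text \<open>The three conditions are each shown to be equivalent to tameness: every regular nonperiodic
  orbit is a saddle connection, and chains of connections reach only finitely many saddles. If x is
  a counterexample, take a transversal section near its limit set. Recurrence in the limit set keeps
  the return map defined except on stable separatrices of saddles, and the closure of the orbit has
  empty interior, so the section has intervals that wander under the return map or its inverse. A
  wandering interval sweeps out an open set of nonrecurrent points whose limit sets meet the closure
  of the orbit of x; by Baire's theorem this contradicts each of the conditions, since there are
  only countably many separatrices. In a tame flow the germs of the return map permute the
  separatrices of finitely many saddles, so chains of connections are cyclic and the extended orbits
  are closed classes.\<close>

section \<open>Flows on compact spaces\<close>

text \<open>The flow is only continuous and the surface may have boundary, so transversals do not
  come from differentiability and sections can be one-sided. A last hit on a stable separatrix is a
  genuine discontinuity of the return map: its two sides may follow different unstable separatrices.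
  What survives is a map on pairs of a point and a side, given by one-sided germs; it is injective
  and defined at every such pair over the limit set. The dynamics is therefore read off the
  complementary intervals of the trace of the limit set. If infinitely many distinct ones follow
  each other, they wander. If their ends repeat, a return germ fixes an end, and a nearby point that
  it moves belongs to an interval attracted under the map or under its inverse. That is why both
  time directions occur in the conclusion. The setup is invariant under time reversal, so every
  statement on omega limits also gives its alpha version.\<close>

definition rev_flow :: "(real => 'a => 'a) => real => 'a => 'a" where
  "rev_flow v t x = v (- t) x"

lemma rev_flow_rev_flow [simp]: "rev_flow (rev_flow v) = v"
  by (auto simp: rev_flow_def fun_eq_iff)

lemma image_rev_flow: "(\<lambda>t. rev_flow v t x) ` A = (\<lambda>t. v t x) ` (uminus ` A)"
  by (auto simp: rev_flow_def image_iff)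

lemma omega_limit_rev [simp]: "omega_limit (rev_flow v) = alpha_limit v"
proof
  fix x
  have "omega_limit (rev_flow v) x = (\<Inter>T. closure ((\<lambda>t. v t x) ` {..- T}))"
    by (simp add: omega_limit_def image_rev_flow)
  also have "\<dots> = alpha_limit v x"
    unfolding alpha_limit_def
  proof (intro equalityI subsetI INT_I)
    fix y T assume "y \<in> (\<Inter>T. closure ((\<lambda>t. v t x) ` {..- T}))"
    then show "y \<in> closure ((\<lambda>t. v t x) ` {..T})"
      by (simp, drule_tac x = "- T" in spec) simp
  qed auto
  finally show "omega_limit (rev_flow v) x = alpha_limit v x" .
qed

lemma alpha_limit_rev [simp]: "alpha_limit (rev_flow v) = omega_limit v"
  using omega_limit_rev[of "rev_flow v"] by simp

lemma Sing_rev [simp]: "Sing (rev_flow v) = Sing v"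
  by (auto simp: Sing_def rev_flow_def) (metis minus_minus)

lemma orbit_rev [simp]: "orbit (rev_flow v) x = orbit v x"
  unfolding orbit_def image_rev_flow by simp

lemma pos_orbit_rev [simp]: "pos_orbit (rev_flow v) x = neg_orbit v x"
  unfolding pos_orbit_def neg_orbit_def image_rev_flow by simp

lemma neg_orbit_rev [simp]: "neg_orbit (rev_flow v) x = pos_orbit v x"
  unfolding pos_orbit_def neg_orbit_def image_rev_flow by simp

lemma W_stable_rev [simp]: "W_stable (rev_flow v) = W_unstable v"
  by (simp add: W_stable_def W_unstable_def fun_eq_iff)

lemma W_unstable_rev [simp]: "W_unstable (rev_flow v) = W_stable v"
  by (simp add: W_stable_def W_unstable_def fun_eq_iff)

definition invariant_set :: "(real => 'a => 'a) => 'a set => bool" where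
  "invariant_set v C \<longleftrightarrow> (\<forall>x\<in>C. \<forall>t. v t x \<in> C)"

definition periodic :: "(real => 'a => 'a) => 'a => bool" where
  "periodic v x \<longleftrightarrow> x \<notin> Sing v \<and> (\<exists>t>0. v t x = x)"

text \<open>Wandering under the return map yields the first alternative, wandering under its inverse
  the second. Both disjuncts quantify over all of \<open>V\<close>: one time direction serves the
  whole open set.\<close>

abbreviation captured ::
  "(real => 'a::topological_space => 'a) => 'a set => 'a set => bool" where
  "captured v V C \<equiv> (\<forall>z\<in>V. z \<notin> omega_limit v z \<and> omega_limit v z \<inter> C \<noteq> {}) \<or>
    (\<forall>z\<in>V. z \<notin> alpha_limit v z \<and> alpha_limit v z \<inter> C \<noteq> {})"

lemma invariant_set_rev [simp]: "invariant_set (rev_flow v) C = invariant_set v C"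
  unfolding invariant_set_def rev_flow_def by (metis minus_minus)

locale compact_flow =
  fixes v :: "real => 'a::{t2_space, second_countable_topology} => 'a"
  assumes compact_space: "compact (UNIV :: 'a set)"
    and flow: "flow_on UNIV v"
begin

abbreviation "om \<equiv> omega_limit v"
abbreviation "al \<equiv> alpha_limit v"

lemma v_0 [simp]: "v 0 x = x"
  and v_add: "v (s + t) x = v s (v t x)"
  using flow by (auto simp: flow_on_def)

lemma v_v [simp]: "v s (v t x) = v (s + t) x"
  by (simp add: v_add)

lemma v_eq_iff: "v s x = y \<longleftrightarrow> x = v (- s) y"
  by auto

lemma v_inj [simp]: "v s x = v s y \<longleftrightarrow> x = y"
  by (auto dest: arg_cong[of _ _ "v (-s)"])

lemma v_continuous: "continuous_on UNIV (\<lambda>(t, x). v t x)"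
  using flow by (auto simp: flow_on_def)

lemma v_tendsto [tendsto_intros]:
  assumes "(f \<longlongrightarrow> a) F" "(g \<longlongrightarrow> b) F"
  shows "((\<lambda>n. v (f n) (g n)) \<longlongrightarrow> v a b) F"
proof -
  have "isCont (\<lambda>(t, x). v t x) (a, b)"
    using v_continuous by (simp add: continuous_on_eq_continuous_at)
  then have "((\<lambda>n. (\<lambda>(t, x). v t x) (f n, g n)) \<longlongrightarrow> (\<lambda>(t, x). v t x) (a, b)) F"
    by (rule isCont_tendsto_compose) (use assms in \<open>auto intro: tendsto_Pair\<close>)
  then show ?thesis by simp
qed

lemma v_continuous_on [continuous_intros]:
  assumes "continuous_on S f" "continuous_on S g"
  shows "continuous_on S (\<lambda>z. v (f z) (g z))"
  using assms unfolding continuous_on_def by (auto intro: v_tendsto)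

text \<open>The tube lemma applied to the preimage of \<open>U\<close>. It stands in for uniform
  continuity over compact time sets, as no metric is fixed on the space.\<close>

lemma tube:
  assumes "compact I" "open U" "\<And>s. s \<in> I ==> v s y \<in> U"
  shows "\<exists>W. open W \<and> y \<in> W \<and> (\<forall>z\<in>W. \<forall>s\<in>I. v s z \<in> U)"
proof -
  have 1: "open ((\<lambda>(z, s). v s z) -` U)"
    using \<open>open U\<close> by (intro open_vimage) (auto simp: case_prod_beta intro!: continuous_intros)
  have 2: "{y} \<times> I \<subseteq> (\<lambda>(z, s). v s z) -` U"
    using assms(3) by auto
  obtain X0 where "y \<in> X0" "open X0" "X0 \<times> I \<subseteq> (\<lambda>(z, s). v s z) -` U"
    using Elementary_Topology.tube_lemma[OF assms(1) 1 2] by blast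
  then show ?thesis by fastforce
qed

text \<open>Compactness gives sequential compactness because the space is first countable; limit
  points of orbits are extracted in this way.\<close>

lemma convergent_subseq:
  obtains l :: 'a and r :: "nat => nat" where "strict_mono r" "(\<lambda>n. f (r n)) \<longlonglongrightarrow> l"
proof -
  have "seq_compact (UNIV :: 'a set)"
    by (rule compact_imp_seq_compact[OF compact_space])
  then show ?thesis using that unfolding seq_compact_def o_def by blast
qed

lemma compact_if_closed: "closed S ==> compact (S :: 'a set)"
  using compact_space closed_Int_compact by fastforce

lemma rev_compact_flow: "compact_flow (rev_flow v)"
proof
  show "flow_on UNIV (rev_flow v)"
    unfolding flow_on_def rev_flow_def
    by (auto simp: case_prod_beta algebra_simps intro!: continuous_intros)
qed (rule compact_space)

section \<open>Omega limit sets\<close>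

lemma omega_iff:
  "y \<in> om x \<longleftrightarrow> (\<forall>U T. open U --> y \<in> U --> (\<exists>t\<ge>T. v t x \<in> U))"
  unfolding omega_limit_def INT_iff closure_iff_nhds_not_empty by (simp, blast)

lemma omegaI:
  assumes "filterlim T at_top F" "((\<lambda>n. v (T n) x) \<longlongrightarrow> y) F" "F \<noteq> bot"
  shows "y \<in> om x"
  unfolding omega_iff
proof (intro allI impI)
  fix U T0 assume U: "open U" "y \<in> U"
  have "\<forall>\<^sub>F n in F. v (T n) x \<in> U"
    using assms(2) U by (rule topological_tendstoD)
  moreover have "\<forall>\<^sub>F n in F. T n \<ge> T0"
    using assms(1) by (simp add: filterlim_at_top)
  ultimately have "\<forall>\<^sub>F n in F. T n \<ge> T0 \<and> v (T n) x \<in> U"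
    by eventually_elim auto
  then show "\<exists>t\<ge>T0. v t x \<in> U"
    using assms(3) by (auto dest: eventually_happens)
qed

lemma omegaE:
  assumes "y \<in> om x"
  obtains T :: "nat => real" where "filterlim T at_top sequentially" "(\<lambda>n. v (T n) x) \<longlonglongrightarrow> y"
proof -
  obtain A :: "nat => 'a set" where A: "\<And>i. open (A i)" "\<And>i. y \<in> A i"
    "\<And>S. open S ==> y \<in> S ==> eventually (\<lambda>i. A i \<subseteq> S) sequentially"
    using countable_basis_at_decseq[of y] by blast
  have "\<forall>n. \<exists>t\<ge>real n. v t x \<in> A n"
    using assms A unfolding omega_iff by blast
  then obtain T where T: "\<And>n. T n \<ge> real n" "\<And>n. v (T n) x \<in> A n" by metis
  have "filterlim T at_top sequentially"
    by (rule filterlim_at_top_mono[OF filterlim_real_sequentially]) (simp add: T)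
  moreover have "(\<lambda>n. v (T n) x) \<longlonglongrightarrow> y"
  proof (rule topological_tendstoI)
    fix S assume "open S" "y \<in> S"
    from A(3)[OF this] show "\<forall>\<^sub>F n in sequentially. v (T n) x \<in> S"
      by eventually_elim (use T(2) in auto)
  qed
  ultimately show ?thesis by (rule that)
qed

lemma omega_closed [simp]: "closed (om x)"
  unfolding omega_limit_def by auto

lemma omega_exists_along:
  assumes "filterlim T at_top sequentially"
  obtains r y where "strict_mono (r :: nat => nat)" "(\<lambda>n. v (T (r n)) x) \<longlonglongrightarrow> y" "y \<in> om x"
proof -
  obtain r y where r: "strict_mono (r :: nat => nat)" "(\<lambda>n. v (T (r n)) x) \<longlonglongrightarrow> y"
    by (rule convergent_subseq)
  have "filterlim (\<lambda>n. T (r n)) at_top sequentially"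
    by (rule filterlim_compose[OF assms filterlim_subseq[OF r(1)]])
  with r that omegaI show ?thesis by (metis trivial_limit_sequentially)
qed

lemma omega_nonempty [simp]: "om x \<noteq> {}"
  using omega_exists_along[OF filterlim_real_sequentially] by blast

lemma omega_shift [simp]: "om (v s x) = om x"
proof -
  have "om x \<subseteq> om (v s x)" for s x
  proof
    fix y assume "y \<in> om x"
    show "y \<in> om (v s x)" unfolding omega_iff
    proof (intro allI impI)
      fix U T assume "open U" "y \<in> U"
      then obtain t where "t \<ge> T + s" "v t x \<in> U"
        using \<open>y \<in> om x\<close> unfolding omega_iff by blast
      then show "\<exists>t\<ge>T. v t (v s x) \<in> U"
        by (intro exI[of _ "t - s"]) auto
    qed
  qed
  from this[of x s] this[of "v s x" "-s"] show ?thesis by auto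
qed

lemma omega_invariant: "y \<in> om x ==> v s y \<in> om x"
proof -
  assume "y \<in> om x"
  then obtain T where T: "filterlim T at_top sequentially" "(\<lambda>n. v (T n) x) \<longlonglongrightarrow> y"
    by (rule omegaE)
  have "(\<lambda>n. v s (v (T n) x)) \<longlonglongrightarrow> v s y"
    by (intro tendsto_intros T)
  then have "(\<lambda>n. v (T n) (v s x)) \<longlonglongrightarrow> v s y"
    by (simp add: add.commute)
  with T(1) have "v s y \<in> om (v s x)"
    by (intro omegaI) auto
  then show ?thesis by simp
qed

lemma omega_invariant_set [simp]: "invariant_set v (om x)"
  by (simp add: invariant_set_def omega_invariant)

lemma omega_subset_closed:
  assumes "closed C" "\<And>t. t \<ge> T ==> v t x \<in> C"
  shows "om x \<subseteq> C"
proof -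
  have "om x \<subseteq> closure ((\<lambda>t. v t x) ` {T..})"
    by (auto simp: omega_limit_def)
  also have "\<dots> \<subseteq> C" by (rule closure_minimal) (use assms in auto)
  finally show ?thesis .
qed

lemma omega_subset:
  assumes "closed C" "invariant_set v C" "x \<in> C"
  shows "om x \<subseteq> C"
  using assms by (intro omega_subset_closed[of _ 0]) (auto simp: invariant_set_def)

lemma omega_trans: "y \<in> om x ==> om y \<subseteq> om x"
  by (rule omega_subset) auto

lemma omega_eventually:
  assumes "open U" "om x \<subseteq> U"
  shows "\<exists>T. \<forall>t\<ge>T. v t x \<in> U"
proof (rule ccontr)
  assume "\<not> ?thesis"
  then have "\<forall>n. \<exists>t\<ge>real n. v t x \<notin> U" by blast
  then obtain T where T: "\<And>n. T n \<ge> real n" "\<And>n. v (T n) x \<notin> U" by metis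
  have "filterlim T at_top sequentially"
    by (rule filterlim_at_top_mono[OF filterlim_real_sequentially]) (simp add: T)
  then obtain r y where r: "strict_mono r" "(\<lambda>n. v (T (r n)) x) \<longlonglongrightarrow> y" "y \<in> om x"
    by (rule omega_exists_along)
  have "y \<in> - U"
    by (rule closed_sequentially[of "- U" "\<lambda>n. v (T (r n)) x"]) (use assms T r in auto)
  with r assms show False by auto
qed

lemma omega_singleton_iff: "om x = {p} \<longleftrightarrow> ((\<lambda>t. v t x) \<longlongrightarrow> p) at_top"
proof
  assume "om x = {p}"
  then show "((\<lambda>t. v t x) \<longlongrightarrow> p) at_top"
    by (intro topological_tendstoI)
      (use omega_eventually in \<open>auto simp: eventually_at_top_linorder\<close>)
next
  assume *: "((\<lambda>t. v t x) \<longlongrightarrow> p) at_top"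
  have "y = p" if y: "y \<in> om x" for y
  proof -
    obtain T where T: "filterlim T at_top sequentially" "(\<lambda>n. v (T n) x) \<longlonglongrightarrow> y"
      using y by (rule omegaE)
    have "(\<lambda>n. v (T n) x) \<longlonglongrightarrow> p"
      by (rule filterlim_compose[OF * T(1)])
    with T(2) show ?thesis by (rule LIMSEQ_unique)
  qed
  then show "om x = {p}"
    using omega_nonempty by blast
qed

lemma omega_singleton_Sing: "om x = {p} ==> p \<in> Sing v"
  using omega_invariant[of p x] by (auto simp: Sing_def)

lemma omega_Sing: "x \<in> Sing v ==> om x = {x}"
  by (simp add: omega_singleton_iff Sing_def)

section \<open>Singularities, orbits and their closures\<close>

lemma Sing_closed: "closed (Sing v)"
proof -
  have "Sing v = (\<Inter>t. {x. v t x = x})" by (auto simp: Sing_def)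
  moreover have "closed {x. v t x = x}" for t
    by (intro closed_Collect_eq continuous_intros)
  ultimately show ?thesis by auto
qed

lemma Sing_v: "x \<in> Sing v ==> v t x = x"
  by (simp add: Sing_def)

lemma v_in_Sing_iff [simp]: "v t x \<in> Sing v \<longleftrightarrow> x \<in> Sing v"
proof -
  have "v t x \<in> Sing v" if "x \<in> Sing v" for t x using that by (simp add: Sing_v)
  from this[of x t] this[of "v t x" "-t"] show ?thesis by auto
qed

lemma in_orbit [simp]: "v t x \<in> orbit v x" "x \<in> orbit v x"
  using rangeI[of "\<lambda>t. v t x" 0] by (auto simp: orbit_def)

lemma orbit_v [simp]: "orbit v (v t x) = orbit v x"
proof -
  have "orbit v (v t x) \<subseteq> orbit v x" for t x by (auto simp: orbit_def)
  from this[of t x] this[of "-t" "v t x"] show ?thesis by auto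
qed

lemma orbit_eq: "y \<in> orbit v x ==> orbit v y = orbit v x"
  by (metis imageE orbit_def orbit_v)

lemma orbit_invariant [simp]: "invariant_set v (orbit v x)"
  by (auto simp: invariant_set_def orbit_def)

lemma orbit_subset: "invariant_set v C ==> x \<in> C ==> orbit v x \<subseteq> C"
  by (auto simp: invariant_set_def orbit_def)

lemma closure_invariant:
  assumes "invariant_set v C" shows "invariant_set v (closure C)"
  unfolding invariant_set_def
proof (intro ballI allI)
  fix x t assume "x \<in> closure C"
  then obtain f where f: "\<And>n. f n \<in> C" "f \<longlonglongrightarrow> x" by (auto simp: closure_sequential)
  have "(\<lambda>n. v t (f n)) \<longlonglongrightarrow> v t x" by (intro tendsto_intros f)
  moreover have "v t (f n) \<in> C" for n using f assms by (simp add: invariant_set_def)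
  ultimately show "v t x \<in> closure C" unfolding closure_sequential by (intro exI[of _ "\<lambda>n. v t (f n)"]) auto
qed

lemma omega_subset_closure_orbit: "om x \<subseteq> closure (orbit v x)"
  by (rule omega_subset_closed[of _ 0]) (auto intro: subsetD[OF closure_subset])

section \<open>Periodic orbits\<close>

lemma periodic_mult:
  assumes "v t x = x" shows "v (real n * t) x = x"
proof (induction n)
  case (Suc n)
  have "v (real (Suc n) * t) x = v t (v (real n * t) x)" by (simp add: algebra_simps)
  with Suc assms show ?case by simp
qed simp

lemma periodic_mult_int:
  assumes "v t x = x" shows "v (of_int n * t) x = x"
proof (cases "n \<ge> 0")
  case True
  then show ?thesis using periodic_mult[OF assms, of "nat n"] by simp
next
  case False
  then have "v (- of_int n * t) x = x" using periodic_mult[OF assms, of "nat (- n)"] by simp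
  then show ?thesis by (subst (asm) v_eq_iff) simp
qed

lemma periodic_rev: "periodic (rev_flow v) x = periodic v x"
proof -
  have "v (- t) x = x \<longleftrightarrow> v t x = x" for t by (metis v_eq_iff)
  then show ?thesis by (simp add: periodic_def rev_flow_def[of v _ x])
qed

lemma nonperiodic_inj:
  assumes "x \<notin> Sing v" "\<not> periodic v x" "v s x = v t x"
  shows "s = t"
proof (rule ccontr)
  assume "s \<noteq> t"
  have "v (s - t) x = x" "v (t - s) x = x"
    using assms(3) by (metis add.commute diff_add_cancel diff_self uminus_add_conv_diff v_0 v_add)+
  with \<open>s \<noteq> t\<close> assms show False unfolding periodic_def
    by (metis diff_gt_0_iff_gt linorder_neqE_linordered_idom)
qed

lemma orbit_periodic:
  assumes "v t x = x" "t > 0" shows "orbit v x = (\<lambda>s. v s x) ` {0..t}"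
proof -
  have "v s x \<in> (\<lambda>s. v s x) ` {0..t}" for s
  proof
    show "v s x = v (s - of_int \<lfloor>s / t\<rfloor> * t) x"
      using periodic_mult_int[OF assms(1), of "- \<lfloor>s/t\<rfloor>"]
      by (metis (no_types, opaque_lifting) diff_conv_add_uminus minus_mult_left of_int_minus v_v)
    have "of_int \<lfloor>s / t\<rfloor> * t \<le> s" "s / t < of_int \<lfloor>s / t\<rfloor> + 1"
      using \<open>t > 0\<close> by (auto simp flip: pos_le_divide_eq)
    then show "s - of_int \<lfloor>s / t\<rfloor> * t \<in> {0..t}"
      using \<open>t > 0\<close> by (simp add: pos_divide_less_eq algebra_simps)
  qed
  then show ?thesis by (auto simp: orbit_def)
qed

lemma orbit_periodic_closed:
  assumes "v t x = x" "t > 0" shows "closed (orbit v x)"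
  unfolding orbit_periodic[OF assms]
  by (intro compact_imp_closed compact_continuous_image continuous_intros) auto

lemma omega_periodic:
  assumes "v t x = x" "t > 0" shows "om x = orbit v x"
proof
  show "om x \<subseteq> orbit v x"
    by (rule omega_subset) (use orbit_periodic_closed[OF assms] in auto)
  have "x \<in> om x"
  proof (rule omegaI[of "\<lambda>n. real n * t"])
    show "filterlim (\<lambda>n. real n * t) at_top sequentially"
      using \<open>t > 0\<close> by (intro filterlim_at_top_mult_tendsto_pos[OF tendsto_const _ filterlim_real_sequentially])
  qed (use periodic_mult[OF assms(1)] in auto)
  then show "orbit v x \<subseteq> om x" by (intro orbit_subset) auto
qed

text \<open>Every positive time is an integral multiple of one below \<open>eta\<close>.\<close>

lemma eventually_const_Sing:
  assumes "eta > 0" "\<And>t. 0 < t ==> t < eta ==> v t x = x"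
  shows "x \<in> Sing v"
proof -
  have *: "v t x = x" if "t > 0" for t
  proof -
    obtain n :: nat where n: "t / eta < n" using reals_Archimedean2 by blast
    have n0: "n > 0" using n \<open>eta > 0\<close> that by (metis divide_pos_pos gr0I of_nat_0 order_less_trans less_irrefl)
    have "t / n < eta" using n n0 \<open>eta > 0\<close> by (simp add: field_simps)
    then have "v (t / n) x = x" using assms that n0 by simp
    from periodic_mult[OF this, of n] show ?thesis using n0 by simp
  qed
  have "v t x = x" for t
    using *[of t] *[of "-t"] v_eq_iff[of t x x] by (cases t "0::real" rule: linorder_cases) auto
  then show ?thesis by (simp add: Sing_def)
qed

end

text \<open>Each lemma on forward limits becomes one on backward limits under the prefix
  \<open>rev\<close>. The rewrite identifies the double reversal with the flow itself, which closes
  the chain of interpretations.\<close>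

sublocale compact_flow \<subseteq> rev: compact_flow "rev_flow v"
  rewrites "rev_flow (rev_flow v) = v" by (simp_all add: rev_compact_flow)

section \<open>One-dimensional dynamics of partial return maps\<close>

text \<open>An increasing homeomorphism between right neighbourhoods of 0. Continuity and the limit
  0 at 0 follow, since an increasing function onto an interval has no jumps.\<close>

definition incr_bij :: "(real => real) => real => real => bool" where
  "incr_bij phi d e \<longleftrightarrow> 0 < d \<and> 0 < e \<and> strict_mono_on {0<..<d} phi \<and> phi ` {0<..<d} = {0<..<e}"

lemma incr_bij_pos: "incr_bij phi d e ==> 0 < h ==> h < d ==> 0 < phi h \<and> phi h < e"
  unfolding incr_bij_def by (metis greaterThanLessThan_iff image_eqI)

lemma incr_bij_less_iff:
  "incr_bij phi d e ==> 0 < h ==> h < d ==> 0 < k ==> k < d ==> phi h < phi k \<longleftrightarrow> h < k"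
  unfolding incr_bij_def by (metis greaterThanLessThan_iff strict_mono_on_less)

lemma incr_bij_surj: "incr_bij phi d e ==> 0 < k ==> k < e ==> \<exists>h. 0 < h \<and> h < d \<and> phi h = k"
  unfolding incr_bij_def by (metis greaterThanLessThan_iff imageE)

lemma incr_bij_shrink:
  assumes "incr_bij phi d e" "0 < d'" "d' < d"
  shows "incr_bij phi d' (phi d')"
  unfolding incr_bij_def
proof (intro conjI)
  show "0 < phi d'" using incr_bij_pos assms by blast
  show "strict_mono_on {0<..<d'} phi"
    using assms by (auto simp: incr_bij_def intro: monotone_on_subset)
  show "phi ` {0<..<d'} = {0<..<phi d'}"
  proof (intro equalityI subsetI)
    fix k assume k: "k \<in> {0<..<phi d'}"
    then have "k < e" using incr_bij_pos[OF assms] by auto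
    then obtain h where "0 < h" "h < d" "phi h = k" using incr_bij_surj[OF assms(1)] k by auto
    with k show "k \<in> phi ` {0<..<d'}"
      using incr_bij_less_iff[OF assms(1), of h d'] assms by auto
  next
    fix k assume "k \<in> phi ` {0<..<d'}"
    then show "k \<in> {0<..<phi d'}"
      using incr_bij_pos[OF assms(1)] incr_bij_less_iff[OF assms(1)] assms by force
  qed
qed (use assms in auto)

lemma incr_bij_shrink_le:
  assumes "incr_bij phi d e" "0 < d'" "d' \<le> d"
  obtains e' where "e' \<le> e" "incr_bij phi d' e'"
proof (cases "d' = d")
  case False
  then show ?thesis
    using assms incr_bij_shrink[of phi d e d'] incr_bij_pos[of phi d e d'] by (intro that[of "phi d'"]) auto
qed (use assms that in auto)

lemma incr_bij_shrink_image:
  assumes "incr_bij phi d e" "0 < c" "c \<le> e"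
  obtains d' where "0 < d'" "d' \<le> d" "incr_bij phi d' c"
proof (cases "c = e")
  case True
  then show ?thesis using assms that[of d] by (auto simp: incr_bij_def)
next
  case False
  then obtain h where h: "0 < h" "h < d" "phi h = c" using incr_bij_surj[OF assms(1)] assms by force
  with incr_bij_shrink[OF assms(1) h(1,2)] that[of h] show ?thesis by auto
qed

lemma incr_bij_comp:
  assumes "incr_bij phi d c" "incr_bij psi c e"
  shows "incr_bij (psi \<circ> phi) d e"
  unfolding incr_bij_def
proof (intro conjI)
  show "strict_mono_on {0<..<d} (psi \<circ> phi)"
    by (rule strict_mono_onI)
      (use assms in \<open>auto simp: incr_bij_less_iff[OF assms(2)] incr_bij_less_iff[OF assms(1)] incr_bij_pos\<close>)
  show "(psi \<circ> phi) ` {0<..<d} = {0<..<e}"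
    using assms by (simp add: incr_bij_def flip: image_image[of psi phi])
qed (use assms in \<open>auto simp: incr_bij_def\<close>)

lemma incr_bij_inverse:
  assumes "incr_bij phi d e"
  shows "incr_bij (the_inv_into {0<..<d} phi) e d"
proof -
  have inj: "inj_on phi {0<..<d}" and im: "phi ` {0<..<d} = {0<..<e}"
    using assms by (auto simp: incr_bij_def strict_mono_on_imp_inj_on)
  have "the_inv_into {0<..<d} phi ` {0<..<e} = {0<..<d}"
    using the_inv_into_onto[OF inj] im by simp
  moreover have "strict_mono_on {0<..<e} (the_inv_into {0<..<d} phi)"
  proof (rule strict_mono_onI)
    fix r s assume rs: "r \<in> {0<..<e}" "s \<in> {0<..<e}" "r < s"
    have "the_inv_into {0<..<d} phi r \<in> {0<..<d}" "the_inv_into {0<..<d} phi s \<in> {0<..<d}"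
      using the_inv_into_into[OF inj] im rs by (metis subset_refl)+
    moreover have "phi (the_inv_into {0<..<d} phi r) = r" "phi (the_inv_into {0<..<d} phi s) = s"
      using f_the_inv_into_f[OF inj] im rs by metis+
    ultimately show "the_inv_into {0<..<d} phi r < the_inv_into {0<..<d} phi s"
      using incr_bij_less_iff[OF assms, of "the_inv_into {0<..<d} phi r" "the_inv_into {0<..<d} phi s"] rs
      by auto
  qed
  ultimately show ?thesis using assms by (auto simp: incr_bij_def)
qed

lemma incr_bij_continuous:
  assumes "incr_bij phi d e" shows "continuous_on {0<..<d} phi"
  by (rule continuous_onI_mono)
    (use assms in \<open>auto simp: incr_bij_def strict_mono_on_leD\<close>)

lemma incr_bij_tendsto_0:
  assumes "incr_bij phi d e" shows "(phi \<longlongrightarrow> 0) (at_right 0)"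
proof (rule order_tendstoI)
  have d: "0 < d" using assms by (simp add: incr_bij_def)
  then have ev: "\<forall>\<^sub>F h in at_right 0. 0 < h \<and> h < d"
    unfolding eventually_at_right_field by (intro exI[of _ d]) auto
  fix a :: real
  { assume "a < 0"
    from ev show "\<forall>\<^sub>F x in at_right 0. a < phi x"
      by eventually_elim (use incr_bij_pos[OF assms] \<open>a < 0\<close> in force) }
  assume "0 < a"
  define c where "c = min a e"
  have "0 < c" "c \<le> e" using \<open>0 < a\<close> assms by (auto simp: c_def incr_bij_def)
  then obtain d' where "0 < d'" "incr_bij phi d' c" using incr_bij_shrink_image[OF assms] by metis
  then show "\<forall>\<^sub>F x in at_right 0. phi x < a"
    unfolding eventually_at_right_field using incr_bij_pos[of phi d' c]
    by (intro exI[of _ d']) (fastforce simp: c_def)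
qed

text \<open>Were \<open>phi\<close> to decrease somewhere, the limit 0 and the intermediate value
  theorem would produce a value taken twice. Halving \<open>d\<close> makes the upper end of the
  image a value of \<open>phi\<close>, so that the image is exactly an open interval.\<close>

lemma incr_bij_of_continuous:
  fixes phi :: "real => real"
  assumes d: "0 < d" and cont: "continuous_on {0<..<d} phi" and inj: "inj_on phi {0<..<d}"
    and pos: "\<And>h. 0 < h ==> h < d ==> 0 < phi h" and lim: "(phi \<longlongrightarrow> 0) (at_right 0)"
  obtains e where "incr_bij phi (d/2) e"
proof -
  have mono: "phi h < phi k" if hk: "0 < h" "h < k" "k < d" for h k
  proof (rule ccontr)
    assume "\<not> phi h < phi k"
    moreover have "phi h \<noteq> phi k" using inj hk by (auto dest: inj_onD)
    ultimately have lt: "phi k < phi h" by auto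
    have "\<forall>\<^sub>F x in at_right 0. phi x < phi k"
      by (rule order_tendstoD(2)[OF lim]) (use pos[of k] hk in auto)
    moreover have "\<forall>\<^sub>F x in at_right 0. 0 < x \<and> x < h"
      unfolding eventually_at_right_field by (intro exI[of _ h]) (use hk in auto)
    ultimately have "\<forall>\<^sub>F x in at_right 0. 0 < x \<and> x < h \<and> phi x < phi k" by eventually_elim auto
    then obtain x where x: "0 < x" "x < h" "phi x < phi k"
      using eventually_happens'[OF trivial_limit_at_right_real] by blast
    have "\<exists>y\<ge>x. y \<le> h \<and> phi y = phi k"
      by (rule IVT') (use x lt hk in \<open>auto intro!: continuous_on_subset[OF cont]\<close>)
    then obtain y where "x \<le> y" "y \<le> h" "phi y = phi k" by auto
    then show False using inj_onD[OF inj, of y k] x hk by auto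
  qed
  define e where "e = phi (d/2)"
  have "incr_bij phi (d/2) e" unfolding incr_bij_def
  proof (intro conjI)
    show "0 < d/2" "0 < e" using d pos[of "d/2"] by (auto simp: e_def)
    show "strict_mono_on {0<..<d/2} phi" by (rule strict_mono_onI) (use mono in auto)
    show "phi ` {0<..<d/2} = {0<..<e}"
    proof (intro equalityI subsetI)
      fix y assume "y \<in> phi ` {0<..<d/2}"
      then show "y \<in> {0<..<e}" using pos mono d by (fastforce simp: e_def)
    next
      fix k assume k: "k \<in> {0<..<e}"
      have "\<forall>\<^sub>F x in at_right 0. phi x < k"
        by (rule order_tendstoD(2)[OF lim]) (use k in auto)
      moreover have "\<forall>\<^sub>F x in at_right 0. 0 < x \<and> x < d/2"
        unfolding eventually_at_right_field by (intro exI[of _ "d/2"]) (use d in auto)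
      ultimately have "\<forall>\<^sub>F x in at_right 0. 0 < x \<and> x < d/2 \<and> phi x < k" by eventually_elim auto
      then obtain x where x: "0 < x" "x < d/2" "phi x < k"
        using eventually_happens'[OF trivial_limit_at_right_real] by blast
      have "\<exists>y\<ge>x. y \<le> d/2 \<and> phi y = k"
        by (rule IVT') (use x k d in \<open>auto simp: e_def intro!: continuous_on_subset[OF cont]\<close>)
      then obtain y where y: "x \<le> y" "y \<le> d/2" "phi y = k" by auto
      moreover have "y \<noteq> d/2" using k y by (auto simp: e_def)
      ultimately show "k \<in> phi ` {0<..<d/2}" using x by force
    qed
  qed
  then show ?thesis by (rule that)
qed

text \<open>The behaviour of the \<open>n\<close>-th iterate on the side \<open>sg\<close> of
  \<open>a\<close>: it lands on the side \<open>rho\<close> of \<open>b\<close>, and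
  \<open>phi\<close> transforms the distance. Only points strictly beside \<open>a\<close> must lie
  in \<open>A\<close>, so \<open>a\<close> may be a discontinuity outside the domain.\<close>

definition germ ::
  "(real => real) => real set => nat => real => real => real => real => bool" where
  "germ f A n a sg b rho \<longleftrightarrow> sg \<in> {1, -1} \<and> rho \<in> {1, -1} \<and>
     (\<exists>d e phi. incr_bij phi d e \<and>
        (\<forall>h. 0 < h --> h < d --> (\<forall>i<n. (f ^^ i) (a + sg * h) \<in> A) \<and> (f ^^ n) (a + sg * h) = b + rho * phi h))"

lemma germE:
  assumes "germ f A n a sg b rho" "0 < d0" "0 < e0"
  obtains d e phi where "d \<le> d0" "e \<le> e0" "incr_bij phi d e"
    "\<And>h i. 0 < h ==> h < d ==> i < n ==> (f ^^ i) (a + sg * h) \<in> A"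
    "\<And>h. 0 < h ==> h < d ==> (f ^^ n) (a + sg * h) = b + rho * phi h"
proof -
  obtain d e phi where *: "incr_bij phi d e"
    "\<And>h i. 0 < h ==> h < d ==> i < n ==> (f ^^ i) (a + sg * h) \<in> A"
    "\<And>h. 0 < h ==> h < d ==> (f ^^ n) (a + sg * h) = b + rho * phi h"
    using assms(1) unfolding germ_def by blast
  have "0 < min d d0" using * assms by (auto simp: incr_bij_def)
  then obtain e1 where 1: "e1 \<le> e" "incr_bij phi (min d d0) e1"
    using incr_bij_shrink_le[OF *(1), of "min d d0"] by auto
  then have "0 < min e1 e0" using assms by (auto simp: incr_bij_def)
  then obtain d2 where "0 < d2" "d2 \<le> min d d0" "incr_bij phi d2 (min e1 e0)"
    using incr_bij_shrink_image[OF 1(2), of "min e1 e0"] by auto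
  with * that[of d2 "min e1 e0" phi] show ?thesis by auto
qed

lemma germ_signs: "germ f A n a sg b rho ==> sg \<in> {1,-1} \<and> rho \<in> {1,-1}"
  by (simp add: germ_def)

lemma germI:
  assumes "sg \<in> {1, -1}" "rho \<in> {1, -1}" "incr_bij phi d e"
    "\<And>h i. 0 < h ==> h < d ==> i < n ==> (f ^^ i) (a + sg * h) \<in> A"
    "\<And>h. 0 < h ==> h < d ==> (f ^^ n) (a + sg * h) = b + rho * phi h"
  shows "germ f A n a sg b rho"
  unfolding germ_def using assms by blast

lemma germ_0: "sg \<in> {1, -1} ==> germ f A 0 a sg a sg"
  by (rule germI[where phi = "\<lambda>h. h" and d = 1 and e = 1]) (auto simp: incr_bij_def strict_mono_on_def)

lemma germ_comp:
  assumes "germ f A n a sg b rho" "germ f A m b rho c kap"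
  shows "germ f A (n + m) a sg c kap"
proof -
  obtain d2 e2 psi where 2: "incr_bij psi d2 e2"
    "\<And>h i. 0 < h ==> h < d2 ==> i < m ==> (f ^^ i) (b + rho * h) \<in> A"
    "\<And>h. 0 < h ==> h < d2 ==> (f ^^ m) (b + rho * h) = c + kap * psi h"
    by (rule germE[OF assms(2), of 1 1]) auto
  then have "0 < d2" by (simp add: incr_bij_def)
  obtain d1 e1 phi where 1: "incr_bij phi d1 e1" "e1 \<le> d2"
    "\<And>h i. 0 < h ==> h < d1 ==> i < n ==> (f ^^ i) (a + sg * h) \<in> A"
    "\<And>h. 0 < h ==> h < d1 ==> (f ^^ n) (a + sg * h) = b + rho * phi h"
    by (rule germE[OF assms(1), of 1 d2]) (use \<open>0 < d2\<close> in auto)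
  then have "0 < e1" by (simp add: incr_bij_def)
  obtain e3 where 3: "incr_bij psi e1 e3" using incr_bij_shrink_le[OF 2(1) \<open>0 < e1\<close> 1(2)] by metis
  show ?thesis
  proof (rule germI[OF _ _ incr_bij_comp[OF 1(1) 3]])
    show "sg \<in> {1, -1}" "kap \<in> {1, -1}" using assms by (auto simp: germ_def)
    fix h assume h: "0 < h" "h < d1"
    have p: "0 < phi h" "phi h < d2" using incr_bij_pos[OF 1(1) h] 1(2) by auto
    show "(f ^^ (n + m)) (a + sg * h) = c + kap * (psi \<circ> phi) h"
      using 1(4)[OF h] 2(3)[OF p] by (simp add: funpow_add add.commute[of n m])
    fix i assume "i < n + m"
    show "(f ^^ i) (a + sg * h) \<in> A"
    proof (cases "i < n")
      case False
      then have "(f ^^ i) (a + sg * h) = (f ^^ (i - n)) ((f ^^ n) (a + sg * h))"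
        by (metis funpow_add comp_apply le_add_diff_inverse2 linorder_not_less)
      with 1(4)[OF h] 2(2)[OF p, of "i - n"] False \<open>i < n + m\<close> show ?thesis by simp
    qed (use 1(3)[OF h] in auto)
  qed
qed

lemma the_inv_into_funpow:
  assumes "inj_on f A" "\<And>i. i < n ==> (f ^^ i) x \<in> A" "k \<le> n"
  shows "(the_inv_into A f ^^ k) ((f ^^ n) x) = (f ^^ (n - k)) x"
  using assms(3)
proof (induction k)
  case (Suc k)
  then have "(the_inv_into A f ^^ Suc k) ((f ^^ n) x) = the_inv_into A f ((f ^^ (n - k)) x)" by simp
  also have "n - k = Suc (n - Suc k)" using Suc.prems by simp
  also have "the_inv_into A f ((f ^^ Suc (n - Suc k)) x) = (f ^^ (n - Suc k)) x"
    using the_inv_into_f_f[OF assms(1) assms(2)[of "n - Suc k"]] Suc.prems by simp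
  finally show ?case .
qed simp

text \<open>The orbit segment is read backwards: the iterates of the inverse at
  \<open>b + rho * k\<close> run through the earlier points of the segment, and those before the
  last step are in the image of \<open>A\<close>.\<close>

lemma germ_inverse:
  assumes "inj_on f A" "germ f A n a sg b rho"
  shows "germ (the_inv_into A f) (f ` A) n b rho a sg"
proof -
  obtain d e phi where *: "incr_bij phi d e"
    "\<And>h i. 0 < h ==> h < d ==> i < n ==> (f ^^ i) (a + sg * h) \<in> A"
    "\<And>h. 0 < h ==> h < d ==> (f ^^ n) (a + sg * h) = b + rho * phi h"
    by (rule germE[OF assms(2), of 1 1]) auto
  show ?thesis
  proof (rule germI[OF _ _ incr_bij_inverse[OF *(1)]])
    show "sg \<in> {1, -1}" "rho \<in> {1, -1}" using assms by (auto simp: germ_def)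
    fix k assume "0 < k" "k < e"
    then obtain h where h: "0 < h" "h < d" "phi h = k" using incr_bij_surj[OF *(1)] by blast
    have inj: "inj_on phi {0<..<d}"
      using *(1) by (auto simp: incr_bij_def strict_mono_on_imp_inj_on)
    have k: "the_inv_into {0<..<d} phi k = h"
      using the_inv_into_f_f[OF inj, of h] h by simp
    have inv: "(the_inv_into A f ^^ i) (b + rho * k) = (f ^^ (n - i)) (a + sg * h)" if "i \<le> n" for i
      using the_inv_into_funpow[OF assms(1) *(2)[OF h(1,2)] that] *(3)[OF h(1,2)] h by simp
    show "(the_inv_into A f ^^ n) (b + rho * k) = a + sg * the_inv_into {0<..<d} phi k"
      using inv[of n] k by simp
    fix i assume "i < n"
    then have "n - i = Suc (n - Suc i)" by simp
    then have "(the_inv_into A f ^^ i) (b + rho * k) = f ((f ^^ (n - Suc i)) (a + sg * h))"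
      using inv[of i] \<open>i < n\<close> by simp
    then show "(the_inv_into A f ^^ i) (b + rho * k) \<in> f ` A"
      using *(2)[OF h(1,2), of "n - Suc i"] \<open>i < n\<close> by simp
  qed
qed

text \<open>The three properties that pass to the flow: infinitely many returns, no recurrence to
  the start, and accumulation on \<open>R\<close>, which will be the trace of an orbit closure on
  the section.\<close>

definition wanders :: "(real => real) => real set => real set => real => bool" where
  "wanders f A R z \<longleftrightarrow> (\<forall>n. (f ^^ n) z \<in> A) \<and>
     (\<exists>d>0. \<exists>N. \<forall>n\<ge>N. d \<le> \<bar>(f ^^ n) z - z\<bar>) \<and>
     (\<exists>s\<in>R. \<forall>e>0. \<forall>N. \<exists>n\<ge>N. \<bar>(f ^^ n) z - s\<bar> < e)"

definition wandering_interval :: "(real => real) => real set => real set => real set => bool" where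
  "wandering_interval f A D R \<longleftrightarrow>
     (\<exists>l r. l < r \<and> {l<..<r} \<subseteq> D \<and> (\<forall>z\<in>{l<..<r}. wanders f A R z))"

abbreviation wandering_either ::
  "(real => real) => real set => real set => real set => bool" where
  "wandering_either f A D R \<equiv>
    wandering_interval f A D R \<or> wandering_interval (the_inv_into A f) (f ` A) D R"

lemma germ_limit:
  assumes "incr_bij phi d e" "\<And>h. 0 < h ==> h < d ==> g h = b + rho * phi h" "0 \<le> s" "s < d"
  shows "\<exists>c. (g \<longlongrightarrow> c) (at_right s)"
proof -
  have "\<forall>\<^sub>F h in at_right s. s < h \<and> h < d"
    unfolding eventually_at_right_field by (intro exI[of _ d]) (use assms in auto)
  then have ev: "\<forall>\<^sub>F h in at_right s. g h = b + rho * phi h"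
    by eventually_elim (use assms in auto)
  have "\<exists>c. (phi \<longlongrightarrow> c) (at_right s)"
  proof (cases "s = 0")
    case True
    then show ?thesis using incr_bij_tendsto_0[OF assms(1)] by auto
  next
    case False
    then have "isCont phi s"
      using incr_bij_continuous[OF assms(1)] assms
      by (intro continuous_on_interior[of "{0<..<d}"]) (auto simp: interior_open)
    then show ?thesis by (metis isCont_def filterlim_at_split)
  qed
  then obtain c where "(phi \<longlongrightarrow> c) (at_right s)" by blast
  then have "((\<lambda>h. b + rho * phi h) \<longlongrightarrow> b + rho * c) (at_right s)"
    by (intro tendsto_intros)
  then show ?thesis using tendsto_cong[OF ev] by blast
qed

lemma germ_steps:
  assumes "\<And>i. i < m ==> germ f A 1 (b i) (rho i) (b (Suc i)) (rho (Suc i))" "rho 0 \<in> {1, -1}" "i \<le> m"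
  shows "germ f A i (b 0) (rho 0) (b i) (rho i)"
  using assms(3)
proof (induction i)
  case 0
  show ?case by (rule germ_0[OF assms(2)])
next
  case (Suc i)
  then show ?case using germ_comp[OF Suc.IH assms(1)[of i]] by auto
qed

lemma germ_common:
  fixes m :: nat
  assumes "\<And>i. i \<le> m ==> germ f A i a sg (b i) (rho i)" "0 < d0"
  shows "\<exists>d>0. d \<le> d0 \<and> (\<forall>i\<le>m. \<exists>phi e. incr_bij phi d e \<and>
     (\<forall>h. 0 < h --> h < d --> (\<forall>j<i. (f ^^ j) (a + sg * h) \<in> A) \<and> (f ^^ i) (a + sg * h) = b i + rho i * phi h))"
  using assms(1)
proof (induction m)
  case 0
  then obtain d e phi where "d \<le> d0" "incr_bij phi d e"
    "\<And>h. 0 < h ==> h < d ==> (f ^^ 0) (a + sg * h) = b 0 + rho 0 * phi h"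
    using germE[OF 0[OF order_refl] \<open>0 < d0\<close> zero_less_one] by metis
  then show ?case by (intro exI[of _ d]) (auto simp: incr_bij_def)
next
  case (Suc m)
  then obtain d where d: "d > 0" "d \<le> d0" "\<forall>i\<le>m. \<exists>phi e. incr_bij phi d e \<and>
     (\<forall>h. 0 < h --> h < d --> (\<forall>j<i. (f ^^ j) (a + sg * h) \<in> A) \<and> (f ^^ i) (a + sg * h) = b i + rho i * phi h)"
    by (auto simp: le_Suc_eq)
  obtain d' e' phi' where d': "d' \<le> d" "incr_bij phi' d' e'"
    "\<And>h i. 0 < h ==> h < d' ==> i < Suc m ==> (f ^^ i) (a + sg * h) \<in> A"
    "\<And>h. 0 < h ==> h < d' ==> (f ^^ Suc m) (a + sg * h) = b (Suc m) + rho (Suc m) * phi' h"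
    using germE[OF Suc.prems[OF order_refl] \<open>0 < d\<close> zero_less_one] by metis
  have "0 < d'" using d' by (simp add: incr_bij_def)
  show ?case
  proof (intro exI[of _ d'] conjI allI impI)
    show "0 < d'" "d' \<le> d0" using \<open>0 < d'\<close> d d' by auto
    fix i assume i: "i \<le> Suc m"
    show "\<exists>phi e. incr_bij phi d' e \<and>
     (\<forall>h. 0 < h --> h < d' --> (\<forall>j<i. (f ^^ j) (a + sg * h) \<in> A) \<and> (f ^^ i) (a + sg * h) = b i + rho i * phi h)"
    proof (cases "i = Suc m")
      case True
      then show ?thesis using d' by blast
    next
      case False
      then obtain phi e where phi: "incr_bij phi d e"
        "\<And>h. 0 < h ==> h < d ==> (\<forall>j<i. (f ^^ j) (a + sg * h) \<in> A) \<and> (f ^^ i) (a + sg * h) = b i + rho i * phi h"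
        using d(3) i by (metis le_SucE)
      obtain e1 where "incr_bij phi d' e1" using incr_bij_shrink_le[OF phi(1) \<open>0 < d'\<close> d'(1)] by metis
      then show ?thesis using phi(2) d'(1) by (intro exI[of _ phi] exI[of _ e1]) auto
    qed
  qed
qed

text \<open>On the chosen side the \<open>m\<close>-th iterate acts as an increasing map
  \<open>phi\<close>. A point moved towards the base has decreasing iterates; they converge to some
  \<open>s\<close>, and everything between \<open>s\<close> and that point is attracted to the same
  limit. The limit lies over \<open>R\<close> because \<open>R\<close> is closed and forward
  invariant.\<close>

lemma periodic_germ_attracting:
  assumes m: "m \<ge> 1"
    and steps: "\<And>i. i < m ==> germ f A 1 (b i) (rho i) (b (Suc i)) (rho (Suc i))"
    and per: "b m = b 0" "rho m = rho 0"
    and AD: "A \<subseteq> D" and R: "closed R" "\<And>t. t \<in> A ==> t \<in> R ==> f t \<in> R"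
  shows "\<exists>d>0. \<forall>h. 0 < h --> h < d --> b 0 + rho 0 * h \<in> R -->
    rho 0 * ((f ^^ m) (b 0 + rho 0 * h) - b 0) < h --> wandering_interval f A D R"
proof -
  define a sg where "a = b 0" and "sg = rho 0"
  have sg: "sg \<in> {1, -1}" using germ_signs[OF steps[of 0]] m by (auto simp: sg_def)
  then have sg2: "sg * (sg * x) = x" for x by auto
  have g: "germ f A i a sg (b i) (rho i)" if "i \<le> m" for i
    using germ_steps[of m f A b rho i] steps sg that by (auto simp: a_def sg_def)
  obtain d where d: "d > 0" and dd: "\<And>i. i \<le> m ==> \<exists>phi e. incr_bij phi d e \<and>
     (\<forall>h. 0 < h --> h < d --> (\<forall>j<i. (f ^^ j) (a + sg * h) \<in> A) \<and> (f ^^ i) (a + sg * h) = b i + rho i * phi h)"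
    using germ_common[of m f A a sg b rho 1] g by auto
  obtain phi e where phi: "incr_bij phi d e"
    and inA: "\<And>h j. 0 < h ==> h < d ==> j < m ==> (f ^^ j) (a + sg * h) \<in> A"
    and fm: "\<And>h. 0 < h ==> h < d ==> (f ^^ m) (a + sg * h) = a + sg * phi h"
    using dd[OF order_refl] per by (auto simp: a_def sg_def)
  have "wandering_interval f A D R"
    if h0: "0 < h0" "h0 < d" "a + sg * h0 \<in> R" and lt: "sg * ((f ^^ m) (a + sg * h0) - a) < h0" for h0
  proof -
    have lt: "phi h0 < h0" using lt fm[OF h0(1,2)] by (simp add: sg2)
    have it: "0 < (phi ^^ k) h \<and> (phi ^^ k) h < d" if "0 < h" "h \<le> h0" for h k
    proof -
      have "0 < (phi ^^ k) h \<and> (phi ^^ k) h \<le> h0"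
      proof (induction k)
        case (Suc k)
        have "phi ((phi ^^ k) h) \<le> phi h0"
          using Suc incr_bij_less_iff[OF phi, of h0 "(phi ^^ k) h"] h0 by auto
        with Suc lt h0 show ?case using incr_bij_pos[OF phi, of "(phi ^^ k) h"] by auto
      qed (use that in auto)
      with h0 show ?thesis by auto
    qed
    have dec: "(phi ^^ Suc k) h0 < (phi ^^ k) h0" for k
    proof (induction k)
      case (Suc k)
      then show ?case using incr_bij_less_iff[OF phi, of "(phi ^^ Suc k) h0" "(phi ^^ k) h0"]
          it[of h0 k] it[of h0 "Suc k"] h0 by simp
    qed (use lt in simp)
    have "decseq (\<lambda>k. (phi ^^ k) h0)" using dec by (intro decseq_SucI) (auto simp: less_imp_le)
    moreover have "0 \<le> (phi ^^ k) h0" for k using it[of h0 k] h0 by auto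
    \<comment> \<open>The limit \<open>s\<close> is 0, which is the base point, or a positive fixed
      point of \<open>phi\<close>; limits from the right at \<open>s\<close> treat both cases at
      once.\<close>
    ultimately obtain s where s: "(\<lambda>k. (phi ^^ k) h0) \<longlonglongrightarrow> s" and s_le: "\<And>k. s \<le> (phi ^^ k) h0"
      using decseq_convergent[of "\<lambda>k. (phi ^^ k) h0" 0] by metis
    have s0: "0 \<le> s" using LIMSEQ_le_const[OF s] it h0 by (meson less_imp_le order_refl)
    have s_lt: "s < (phi ^^ k) h0" for k using s_le[of "Suc k"] dec[of k] by linarith
    then have sh: "s < h0" by (metis funpow_0)
    have up: "s < phi x" if "s < x" "x < d" for x
    proof (rule ccontr)
      assume "\<not> s < phi x"
      obtain k where "(phi ^^ k) h0 < x"
        using order_tendstoD(2)[OF s \<open>s < x\<close>] by (auto simp: eventually_sequentially)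
      then have "(phi ^^ Suc k) h0 < phi x"
        using incr_bij_less_iff[OF phi, of "(phi ^^ k) h0" x] it[of h0 k] h0 that by simp
      with s_lt[of "Suc k"] \<open>\<not> s < phi x\<close> show False by linarith
    qed
    have zk: "s < (phi ^^ k) z \<and> (phi ^^ k) z < d \<and> (phi ^^ k) z \<le> (phi ^^ k) h0" if z: "s < z" "z < h0" for z k
    proof (induction k)
      case (Suc k)
      then show ?case
        using up[of "(phi ^^ k) z"] it[of z "Suc k"] z s0 h0 it[of h0 k]
          incr_bij_less_iff[OF phi, of "(phi ^^ k) h0" "(phi ^^ k) z"] by auto
    qed (use z h0 in auto)
    have zlim: "(\<lambda>k. (phi ^^ k) z) \<longlonglongrightarrow> s" if z: "s < z" "z < h0" for z
      by (rule tendsto_sandwich[OF _ _ tendsto_const s]) (use zk[OF z] in \<open>auto simp: less_imp_le\<close>)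
    have fk: "(f ^^ (m * k + i)) (a + sg * z) = (f ^^ i) (a + sg * (phi ^^ k) z)"
      if z: "0 < z" "z \<le> h0" for z k i
    proof -
      have "(f ^^ (m * k)) (a + sg * z) = a + sg * (phi ^^ k) z"
      proof (induction k)
        case (Suc k)
        have "(f ^^ (m * Suc k)) (a + sg * z) = (f ^^ m) ((f ^^ (m * k)) (a + sg * z))"
          by (simp add: funpow_add)
        also have "\<dots> = a + sg * phi ((phi ^^ k) z)"
          unfolding Suc.IH by (rule fm) (use it[of z k] z in auto)
        finally show ?case by simp
      qed simp
      then show ?thesis by (simp add: funpow_add add.commute[of _ i])
    qed
    have "\<exists>c. ((\<lambda>h. (f ^^ i) (a + sg * h)) \<longlongrightarrow> c) (at_right s)" if im: "i < m" for i
    proof -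
      obtain phii ei where "incr_bij phii d ei" "\<And>h. 0 < h ==> h < d ==> (f ^^ i) (a + sg * h) = b i + rho i * phii h"
        using dd[OF less_imp_le[OF im]] by blast
      then show ?thesis
        using germ_limit[of phii d ei "\<lambda>h. (f ^^ i) (a + sg * h)" "b i" "rho i" s] s0 sh h0 by auto
    qed
    then obtain c where c: "\<And>i. i < m ==> ((\<lambda>h. (f ^^ i) (a + sg * h)) \<longlongrightarrow> c i) (at_right s)" by metis
    \<comment> \<open>An orbit attracted to the cycle accumulates only at the limits
      \<open>c i\<close>. A start outside this finite set is therefore not approached again.\<close>
    define B where "B = c ` {..<m}"
    define S where "S = {x. s < sg * (x - a) \<and> sg * (x - a) < h0} - B"
    have "finite B" by (simp add: B_def)
    have "open S" unfolding S_def
      by (intro open_Diff finite_imp_closed \<open>finite B\<close> open_Collect_conj open_Collect_less continuous_intros)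
    have "infinite {s<..<h0}" using sh by (rule infinite_Ioo)
    then have "infinite ((\<lambda>h. a + sg * h) ` {s<..<h0})"
      using sg by (subst finite_image_iff) (auto simp: inj_on_def)
    then obtain x where "x \<in> (\<lambda>h. a + sg * h) ` {s<..<h0}" "x \<notin> B"
      using \<open>finite B\<close> by (meson finite_subset subsetI)
    then have "x \<in> S" by (auto simp: S_def sg2)
    with \<open>open S\<close> obtain r where r: "r > 0" "ball x r \<subseteq> S" by (rule openE)
    have wand: "wanders f A R y" if "y \<in> S" for y
    proof -
      define z where "z = sg * (y - a)"
      have y: "y = a + sg * z" by (simp add: z_def sg2)
      have z: "s < z" "z < h0" using that by (auto simp: S_def z_def)
      then have z0: "0 < z" "z \<le> h0" using s0 by auto
      have "(f ^^ n) y \<in> A" for n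
      proof -
        have "(f ^^ n) y = (f ^^ (n mod m)) (a + sg * (phi ^^ (n div m)) z)"
          using fk[OF z0, of "n div m" "n mod m"] y by simp
        then show ?thesis using inA it[OF z0] m by simp
      qed
      moreover have "\<exists>d>0. \<exists>N. \<forall>n\<ge>N. d \<le> \<bar>(f ^^ n) y - y\<bar>"
      proof -
        have "\<exists>d>0. \<forall>i<m. d \<le> \<bar>c i - y\<bar>"
        proof -
          have "closed B" using \<open>finite B\<close> by (rule finite_imp_closed)
          moreover have "y \<notin> B" using that by (auto simp: S_def)
          ultimately obtain d where "d > 0" "ball y d \<subseteq> - B"
            using openE[of "- B" y] by auto
          then have "d \<le> \<bar>c i - y\<bar>" if "i < m" for i
            using that by (force simp: B_def dist_real_def subset_iff not_less abs_minus_commute)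
          with \<open>d > 0\<close> show ?thesis by blast
        qed
        then obtain eta where eta: "eta > 0" "\<And>i. i < m ==> eta \<le> \<bar>c i - y\<bar>" by blast
        have fil: "filterlim (\<lambda>k. (phi ^^ k) z) (at_right s) sequentially"
          unfolding filterlim_at
          by (intro conjI zlim[OF z] always_eventually allI) (use zk[OF z] in \<open>auto simp: less_le\<close>)
        have "\<forall>\<^sub>F k in sequentially. \<forall>i\<in>{..<m}. \<bar>(f ^^ i) (a + sg * (phi ^^ k) z) - c i\<bar> < eta / 2"
        proof (rule eventually_ball_finite)
          show "\<forall>i\<in>{..<m}. \<forall>\<^sub>F k in sequentially. \<bar>(f ^^ i) (a + sg * (phi ^^ k) z) - c i\<bar> < eta / 2"
          proof
            fix i assume "i \<in> {..<m}"
            then have "(\<lambda>k. (f ^^ i) (a + sg * (phi ^^ k) z)) \<longlonglongrightarrow> c i"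
              using filterlim_compose[OF c fil] by auto
            from tendstoD[OF this, of "eta/2"] eta
            show "\<forall>\<^sub>F k in sequentially. \<bar>(f ^^ i) (a + sg * (phi ^^ k) z) - c i\<bar> < eta / 2"
              by (simp add: dist_real_def)
          qed
        qed simp
        then obtain K where K: "\<And>k i. k \<ge> K ==> i < m ==> \<bar>(f ^^ i) (a + sg * (phi ^^ k) z) - c i\<bar> < eta / 2"
          by (auto simp: eventually_sequentially)
        have "eta / 2 \<le> \<bar>(f ^^ n) y - y\<bar>" if "n \<ge> m * K" for n
        proof -
          have "n div m \<ge> K" using that m
            by (metis div_le_mono nonzero_mult_div_cancel_left not_one_le_zero)
          moreover have "(f ^^ n) y = (f ^^ (n mod m)) (a + sg * (phi ^^ (n div m)) z)"
            using fk[OF z0, of "n div m" "n mod m"] y by simp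
          moreover have "n mod m < m" using m by simp
          ultimately show ?thesis using K[of "n div m" "n mod m"] eta(2)[of "n mod m"] by linarith
        qed
        with eta(1) show ?thesis by (intro exI[of _ "eta/2"] conjI exI[of _ "m * K"] allI impI) simp_all
      qed
      moreover have "\<exists>s\<in>R. \<forall>e>0. \<forall>N. \<exists>n\<ge>N. \<bar>(f ^^ n) y - s\<bar> < e"
      proof (intro bexI[of _ "a + sg * s"] allI impI)
        have iter: "(\<lambda>k. a + sg * (phi ^^ k) z) \<longlonglongrightarrow> a + sg * s"
          by (intro tendsto_intros zlim z)
        fix e :: real and N :: nat assume "e > 0"
        from tendstoD[OF iter this] obtain K where "\<And>k. k \<ge> K ==> \<bar>(a + sg * (phi ^^ k) z) - (a + sg * s)\<bar> < e"
          by (auto simp: eventually_sequentially dist_real_def)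
        then have "\<bar>(f ^^ (m * max K N + 0)) y - (a + sg * s)\<bar> < e"
          unfolding y fk[OF z0] by simp
        moreover have "m * max K N \<ge> N"
          using m by (metis max.cobounded2 mult_le_mono nat_mult_1)
        ultimately show "\<exists>n\<ge>N. \<bar>(f ^^ n) y - (a + sg * s)\<bar> < e" by (metis add_0_right)
      next
        have inR: "(f ^^ n) (a + sg * h0) \<in> R" for n
        proof (induction n)
          case (Suc n)
          have "(f ^^ n) (a + sg * h0) = (f ^^ (n mod m)) (a + sg * (phi ^^ (n div m)) h0)"
            using fk[of h0 "n div m" "n mod m"] h0 by simp
          then have "(f ^^ n) (a + sg * h0) \<in> A" using inA it[of h0] m h0 by simp
          with Suc show ?case using R(2) by simp
        qed (use h0 in simp)
        have "(\<lambda>k. a + sg * (phi ^^ k) h0) \<longlonglongrightarrow> a + sg * s" by (intro tendsto_intros s)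
        moreover have "a + sg * (phi ^^ k) h0 \<in> R" for k
          using inR[of "m * k"] fk[of h0 k 0] h0 by simp
        ultimately show "a + sg * s \<in> R" using closed_sequentially[OF R(1), of "\<lambda>k. a + sg * (phi ^^ k) h0"] by blast
      qed
      ultimately show ?thesis by (simp add: wanders_def)
    qed
    have "S \<subseteq> D"
    proof
      fix y assume "y \<in> S"
      from wand[OF this] have "(f ^^ 0) y \<in> A" unfolding wanders_def by (elim conjE allE)
      then show "y \<in> D" using AD by auto
    qed
    moreover have "{x - r<..<x + r} \<subseteq> S"
      using r(2) by (simp add: ball_eq_greaterThanLessThan)
    ultimately show ?thesis
      unfolding wandering_interval_def using r(1) wand
      by (intro exI[of _ "x - r"] exI[of _ "x + r"]) auto
  qed
  then show ?thesis
    unfolding a_def[symmetric] sg_def[symmetric] by (intro exI[of _ d] conjI d allI impI)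
qed

text \<open>A point not fixed by the \<open>m\<close>-th iterate is moved towards the base, and then
  attracted under \<open>f\<close>, or away from it. In the second case its image is moved towards
  the base by the inverse map.\<close>

lemma periodic_germ:
  assumes inj: "inj_on f A" and m: "m \<ge> 1"
    and steps: "\<And>i. i < m ==> germ f A 1 (b i) (rho i) (b (Suc i)) (rho (Suc i))"
    and per: "b m = b 0" "rho m = rho 0"
    and D: "A \<subseteq> D" "f ` A \<subseteq> D" and R: "closed R" "\<And>t. t \<in> A ==> f t \<in> R \<longleftrightarrow> t \<in> R"
  shows "\<exists>d>0. \<forall>h. 0 < h --> h < d --> b 0 + rho 0 * h \<in> R -->
    (f ^^ m) (b 0 + rho 0 * h) \<noteq> b 0 + rho 0 * h -->
    wandering_either f A D R"
proof -
  define F where "F = the_inv_into A f"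
  have F: "F (f t) = t" if "t \<in> A" for t using the_inv_into_f_f[OF inj that] by (simp add: F_def)
  have "\<exists>d>0. \<forall>h. 0 < h --> h < d --> b 0 + rho 0 * h \<in> R -->
    rho 0 * ((f ^^ m) (b 0 + rho 0 * h) - b 0) < h --> wandering_interval f A D R"
    by (rule periodic_germ_attracting[where f = f and A = A and b = b and rho = rho, OF m steps per D(1) R(1)])
      (use R(2) in auto)
  then obtain d1 where d1: "d1 > 0" "\<And>h. 0 < h ==> h < d1 ==> b 0 + rho 0 * h \<in> R ==>
    rho 0 * ((f ^^ m) (b 0 + rho 0 * h) - b 0) < h ==> wandering_interval f A D R"
    by auto
  \<comment> \<open>The cycle traversed backwards, which is a cycle of germs of the inverse
    map.\<close>
  define b' rho' where "b' = (\<lambda>i. b (m - i))" and "rho' = (\<lambda>i. rho (m - i))"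
  have steps': "germ F (f ` A) 1 (b' i) (rho' i) (b' (Suc i)) (rho' (Suc i))" if "i < m" for i
  proof -
    have "Suc (m - Suc i) = m - i" using that by simp
    then show ?thesis
      using germ_inverse[OF inj steps[of "m - Suc i"]] that by (simp add: F_def b'_def rho'_def)
  qed
  have "\<exists>d>0. \<forall>h. 0 < h --> h < d --> b' 0 + rho' 0 * h \<in> R -->
    rho' 0 * ((F ^^ m) (b' 0 + rho' 0 * h) - b' 0) < h --> wandering_interval F (f ` A) D R"
    by (rule periodic_germ_attracting[where f = F and A = "f ` A" and b = b' and rho = rho', OF m steps' _ _ D(2) R(1)])
      (use per F R(2) in \<open>auto simp: b'_def rho'_def\<close>)
  then obtain d2 where d2: "d2 > 0" "\<And>h. 0 < h ==> h < d2 ==> b 0 + rho 0 * h \<in> R ==>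
    rho 0 * ((F ^^ m) (b 0 + rho 0 * h) - b 0) < h ==> wandering_interval F (f ` A) D R"
    using per by (auto simp: b'_def rho'_def)
  have sg: "rho 0 \<in> {1, -1}" using germ_signs[OF steps[of 0]] m by auto
  have "germ f A m (b 0) (rho 0) (b m) (rho m)" by (rule germ_steps[of m f A b rho, OF steps]) (use sg in auto)
  then obtain d e phi where g: "d \<le> d1" "e \<le> d2" "incr_bij phi d e"
    "\<And>h i. 0 < h ==> h < d ==> i < m ==> (f ^^ i) (b 0 + rho 0 * h) \<in> A"
    "\<And>h. 0 < h ==> h < d ==> (f ^^ m) (b 0 + rho 0 * h) = b m + rho m * phi h"
    using germE[OF _ d1(1) d2(1)] by metis
  show ?thesis
  proof (intro exI[of _ d] conjI allI impI)
    show "0 < d" using g by (simp add: incr_bij_def)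
    fix h assume h: "0 < h" "h < d" "b 0 + rho 0 * h \<in> R" "(f ^^ m) (b 0 + rho 0 * h) \<noteq> b 0 + rho 0 * h"
    have fm: "(f ^^ m) (b 0 + rho 0 * h) = b 0 + rho 0 * phi h" using g(5)[OF h(1,2)] per by simp
    then have "phi h < h \<or> h < phi h" using h(4) by (metis linorder_neqE_linordered_idom)
    then show "wandering_either f A D R"
    proof
      assume "phi h < h"
      then show ?thesis using d1(2)[OF h(1) _ h(3)] fm g(1) h(2) sg by auto
    next
      assume "h < phi h"
      have p: "0 < phi h" "phi h < d2" using incr_bij_pos[OF g(3) h(1,2)] g(2) by auto
      have "(f ^^ i) (b 0 + rho 0 * h) \<in> R" if "i \<le> m" for i using that
        by (induction i) (use h g(4)[OF h(1,2)] R(2) in auto)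
      then have "b 0 + rho 0 * phi h \<in> R" using fm by (metis order_refl)
      moreover have "(F ^^ m) (b 0 + rho 0 * phi h) = b 0 + rho 0 * h"
        using the_inv_into_funpow[OF inj, of m "b 0 + rho 0 * h" m] g(4)[OF h(1,2)] fm by (simp add: F_def)
      ultimately show ?thesis using d2(2)[OF p] \<open>h < phi h\<close> sg by (auto simp: F_def)
    qed
  qed
qed

text \<open>\<open>Q\<close> is to be the trace of an invariant closed set on the section and
  \<open>R\<close> that of an orbit closure. At a point of \<open>Q\<close> outside \<open>A\<close>
  the nearby values cluster at a finite set \<open>U\<close> that contains no value of
  \<open>f\<close>; so a one-sided limit is never attained and the side of approach is well
  defined.\<close>

locale return_map =
  fixes D Q A R :: "real set" and f :: "real => real"
  assumes compact_D: "compact D" and closed_Q: "closed Q" and Q_sub_D: "Q \<subseteq> D"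
    and A_sub_D: "A \<subseteq> D" and f_in_D: "\<And>t. t \<in> A ==> f t \<in> D" and inj_f: "inj_on f A"
    and Q_inv: "\<And>t. t \<in> A ==> f t \<in> Q \<longleftrightarrow> t \<in> Q"
    and closed_R: "closed R" and R_inv: "\<And>t. t \<in> A ==> f t \<in> R \<longleftrightarrow> t \<in> R"
    and sides: "\<And>t sg. t \<in> D ==> sg \<in> {1, -1} ==>
      (\<exists>d>0. \<forall>h. 0 < h --> h < d --> t + sg * h \<in> D) \<or> (\<exists>d>0. \<forall>h. 0 < h --> h < d --> t + sg * h \<notin> D)"
    and some_side: "\<And>t. t \<in> D ==> \<exists>sg\<in>{1, -1}. \<exists>d>0. \<forall>h. 0 < h --> h < d --> t + sg * h \<in> D"
    and regular: "\<And>q. q \<in> Q ==>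
      \<exists>d>0. \<forall>t\<in>D. 0 < \<bar>t - q\<bar> --> \<bar>t - q\<bar> < d --> t \<in> A \<and> continuous (at t within D) f"
    and limits: "\<And>q. q \<in> Q ==> q \<in> A \<and> continuous (at q within D) f \<or>
      q \<notin> A \<and> (\<exists>U. finite U \<and> U \<subseteq> D \<and> U \<inter> f ` A = {} \<and>
        (\<forall>e>0. \<exists>d>0. \<forall>t\<in>D. 0 < \<bar>t - q\<bar> --> \<bar>t - q\<bar> < d --> (\<exists>u\<in>U. \<bar>f t - u\<bar> < e)))"
begin

section \<open>Gaps: components of the complement of \<open>Q\<close>\<close>

definition side :: "real => real => bool" where
  "side t sg \<longleftrightarrow> sg \<in> {1, -1} \<and> (\<exists>d>0. \<forall>h. 0 < h --> h < d --> t + sg * h \<in> D)"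

definition gap :: "real => real => bool" where
  "gap a sg \<longleftrightarrow> a \<in> Q \<and> sg \<in> {1, -1} \<and> (\<exists>d>0. \<forall>h. 0 < h --> h < d --> a + sg * h \<in> D - Q)"

lemma gap_side: "gap a sg ==> side a sg"
  unfolding gap_def side_def by blast

text \<open>On a side where \<open>D\<close> continues, a short segment is connected and misses
  \<open>Q\<close>, so it stays in the component; on a side where \<open>D\<close> ends there is
  nothing nearby.\<close>

lemma component_open:
  assumes X: "X \<in> components (D - Q)" and z: "z \<in> X"
  shows "\<exists>d>0. \<forall>t\<in>D. \<bar>t - z\<bar> < d --> t \<in> X"
proof -
  have zD: "z \<in> D" "z \<notin> Q" using in_components_subset[OF X] z by auto
  obtain d1 where d1: "d1 > 0" "ball z d1 \<subseteq> - Q"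
    using openE[of "- Q" z] closed_Q zD by auto
  have ex: "\<exists>d>0. \<forall>h. 0 < h --> h < d --> z + sg * h \<in> D --> z + sg * h \<in> X" if sg: "sg \<in> {1, -1}" for sg
    using sides[OF zD(1) sg]
  proof
    assume "\<exists>d>0. \<forall>h. 0 < h --> h < d --> z + sg * h \<in> D"
    then obtain d where d: "d > 0" "\<And>h. 0 < h ==> h < d ==> z + sg * h \<in> D" by blast
    have "z + sg * h \<in> X" if h: "0 < h" "h < min d d1" for h
    proof -
      define T where "T = (\<lambda>k. z + sg * k) ` {0..h}"
      have "connected T" unfolding T_def by (intro connected_continuous_image continuous_intros) auto
      moreover have "T \<subseteq> D - Q"
      proof
        fix x assume "x \<in> T"
        then obtain k where "x = z + sg * k" "k \<in> {0..h}" unfolding T_def by blast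
        then have k: "x = z + sg * k" "0 \<le> k" "k \<le> h" by auto
        have "x \<in> ball z d1" using k h sg by (auto simp: dist_real_def)
        moreover have "x \<in> D" using k h d(2)[of k] zD by (cases "k = 0") auto
        ultimately show "x \<in> D - Q" using d1 by auto
      qed
      moreover have "z \<in> T" unfolding T_def by (rule image_eqI[of _ _ 0]) (use h in auto)
      ultimately have "T \<subseteq> X" using components_maximal[OF X, of T] z by blast
      moreover have "z + sg * h \<in> T" unfolding T_def using h by auto
      ultimately show ?thesis by blast
    qed
    with d d1 show ?thesis by (intro exI[of _ "min d d1"]) auto
  qed blast
  obtain dp where dp: "dp > 0" "\<And>h. 0 < h ==> h < dp ==> z + 1 * h \<in> D ==> z + 1 * h \<in> X"
    using ex[of 1] by blast
  obtain dm where dm: "dm > 0" "\<And>h. 0 < h ==> h < dm ==> z + (-1) * h \<in> D ==> z + (-1) * h \<in> X"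
    using ex[of "-1"] by blast
  have "t \<in> X" if "t \<in> D" "\<bar>t - z\<bar> < min dp dm" for t
    using dp(2)[of "t - z"] dm(2)[of "z - t"] that z by (cases t z rule: linorder_cases) auto
  with dp dm show ?thesis by (intro exI[of _ "min dp dm"]) auto
qed

lemma component_eq: "X \<in> components (D - Q) ==> Y \<in> components (D - Q) ==> z \<in> X ==> z \<in> Y ==> X = Y"
  using components_nonoverlap[of X "D - Q" Y] by blast

lemma component_ex:
  assumes "z \<in> D" "z \<notin> Q" obtains X where "X \<in> components (D - Q)" "z \<in> X"
  using assms Union_components[of "D - Q"] by blast

text \<open>Points chosen in infinitely many such components would accumulate in the compact
  \<open>D\<close>. Near a point of \<open>Q\<close> they would enter \<open>W\<close>; near any
  other point they would lie in the component of that point, which contains only one of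
  them.\<close>

lemma finite_bad:
  assumes W: "\<And>q. q \<in> Q ==> \<exists>d>0. \<forall>t\<in>D. \<bar>t - q\<bar> < d --> t \<in> W"
  shows "finite {X \<in> components (D - Q). \<not> X \<subseteq> W}" (is "finite ?B")
proof (rule ccontr)
  assume inf: "infinite ?B"
  have "\<forall>X\<in>?B. \<exists>z. z \<in> X - W" by auto
  then obtain z where z: "\<And>X. X \<in> ?B ==> z X \<in> X - W" by metis
  have "inj_on z ?B"
    by (rule inj_onI) (use z component_eq in \<open>metis (no_types, lifting) Diff_iff mem_Collect_eq\<close>)
  then have "infinite (z ` ?B)" using inf finite_imageD by blast
  moreover have zD: "z ` ?B \<subseteq> D" using z in_components_subset by blast
  ultimately obtain p where p: "p \<in> D" "p islimpt z ` ?B"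
    using compact_D unfolding compact_eq_Bolzano_Weierstrass by blast
  show False
  proof (cases "p \<in> Q")
    case True
    then obtain d where d: "d > 0" "\<And>t. t \<in> D ==> \<bar>t - p\<bar> < d ==> t \<in> W" using W by blast
    obtain y where "y \<in> z ` ?B" "dist y p < d" using p(2) d(1) unfolding islimpt_approachable by blast
    then show False using d(2)[of y] z zD by (auto simp: dist_real_def)
  next
    case False
    then obtain X where X: "X \<in> components (D - Q)" "p \<in> X" using p component_ex by blast
    then obtain d where d: "d > 0" "\<And>t. t \<in> D ==> \<bar>t - p\<bar> < d ==> t \<in> X"
      using component_open by blast
    have "z ` ?B \<inter> ball p d \<subseteq> {z X}"
    proof
      fix y assume "y \<in> z ` ?B \<inter> ball p d"
      then obtain Y where Y: "Y \<in> ?B" "y = z Y" "dist y p < d" by (auto simp: dist_commute)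
      then have "y \<in> X" using d(2)[of y] zD by (auto simp: dist_real_def)
      then have "X = Y" using component_eq[OF X(1), of Y y] Y z by blast
      with Y show "y \<in> {z X}" by simp
    qed
    then have "finite (z ` ?B \<inter> ball p d)" by (rule finite_subset) simp
    then show False using p(2) d(1) by (simp add: islimpt_eq_infinite_ball)
  qed
qed

text \<open>All but finitely many components lie where \<open>f\<close> is defined and continuous,
  so from some index on \<open>f\<close> maps each component of the sequence into the next by
  connectedness. As no component occurs infinitely often, orbits leave their own component for good
  and accumulate only at \<open>Q\<close>.\<close>

lemma gap_sequence:
  assumes C: "\<And>n. C n \<in> components (D - Q)"
    and succ: "\<And>n::nat. \<exists>t\<in>C n. t \<in> A \<and> f t \<in> C (Suc n)"
    and fin: "\<And>X. finite {n. C n = X}"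
    and QR: "Q \<subseteq> R"
  shows "wandering_interval f A D R"
proof -
  define W where "W = {t \<in> D. t \<in> Q \<or> t \<in> A \<and> continuous (at t within D) f}"
  have "finite {X \<in> components (D - Q). \<not> X \<subseteq> W}"
  proof (rule finite_bad)
    fix q assume q: "q \<in> Q"
    then obtain d where d: "d > 0"
      "\<And>t. t \<in> D ==> 0 < \<bar>t - q\<bar> ==> \<bar>t - q\<bar> < d ==> t \<in> A \<and> continuous (at t within D) f"
      using regular by blast
    then show "\<exists>d>0. \<forall>t\<in>D. \<bar>t - q\<bar> < d --> t \<in> W"
      using q by (intro exI[of _ d]) (auto simp: W_def)
  qed
  then have "finite (\<Union>X\<in>{X \<in> components (D - Q). \<not> X \<subseteq> W}. {n. C n = X})"
    using fin by blast
  then have "finite {n. \<not> C n \<subseteq> W}"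
    by (rule rev_finite_subset) (use C in auto)
  then obtain N where N: "\<And>n. n \<ge> N ==> C n \<subseteq> W"
    by (meson finite_nat_set_iff_bounded linorder_not_less mem_Collect_eq)
  have CDQ: "C n \<subseteq> D - Q" for n using C in_components_subset by blast
  have CA: "C n \<subseteq> A" if "n \<ge> N" for n using N[OF that] CDQ[of n] by (auto simp: W_def)
  have fC: "f ` C n \<subseteq> C (Suc n)" if "n \<ge> N" for n
  proof -
    have "continuous_on (C n) f"
      unfolding continuous_on_eq_continuous_within
      using N[OF that] CDQ[of n] by (auto simp: W_def intro: continuous_within_subset)
    then have "connected (f ` C n)"
      using C in_components_connected by (blast intro: connected_continuous_image)
    moreover have "f ` C n \<subseteq> D - Q"
      using CA[OF that] CDQ[of n] f_in_D Q_inv by blast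
    moreover have "C (Suc n) \<inter> f ` C n \<noteq> {}" using succ[of n] by blast
    ultimately show ?thesis using components_maximal[OF C] by blast
  qed
  have itC: "(f ^^ k) z \<in> C (N + k)" if "z \<in> C N" for z k
  proof (induction k)
    case (Suc k)
    then show ?case using fC[of "N + k"] by auto
  qed (use that in simp)
  obtain z0 where z0: "z0 \<in> C N" using in_components_nonempty[OF C] by blast
  then obtain d0 where d0: "d0 > 0" "\<And>t. t \<in> D ==> \<bar>t - z0\<bar> < d0 ==> t \<in> C N"
    using component_open[OF C] by blast
  obtain sg d1 where d1: "sg \<in> {1, -1}" "d1 > 0" "\<And>h. 0 < h ==> h < d1 ==> z0 + sg * h \<in> D"
    using some_side[of z0] z0 CDQ by blast
  define d where "d = min d0 d1"
  have sub: "z0 + sg * h \<in> C N" if "0 < h" "h < d" for h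
    using d0(2)[of "z0 + sg * h"] d1 that by (auto simp: d_def)
  have "wanders f A R z" if z: "z \<in> C N" for z
    unfolding wanders_def
  proof (intro conjI allI)
    show "(f ^^ n) z \<in> A" for n using itC[OF z, of n] CA[of "N + n"] by auto
    obtain e where e: "e > 0" "\<And>t. t \<in> D ==> \<bar>t - z\<bar> < e ==> t \<in> C N"
      using component_open[OF C z] by blast
    have "finite {k. C (N + k) = C N}"
      using finite_vimageI[OF fin[of "C N"], of "\<lambda>k. N + k"] by (simp add: vimage_def)
    then obtain M where M: "\<And>k. C (N + k) = C N ==> k < M"
      using finite_nat_set_iff_bounded by auto
    have "e \<le> \<bar>(f ^^ k) z - z\<bar>" if "k \<ge> M" for k
    proof (rule ccontr)
      assume "\<not> ?thesis"
      then have "(f ^^ k) z \<in> C N" using e(2)[of "(f ^^ k) z"] itC[OF z, of k] CDQ by auto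
      then have "C (N + k) = C N" using component_eq[OF C C itC[OF z, of k]] by blast
      with M that show False by fastforce
    qed
    with e show "\<exists>d>0. \<exists>N. \<forall>n\<ge>N. d \<le> \<bar>(f ^^ n) z - z\<bar>" by blast
    have "\<forall>n. (f ^^ n) z \<in> D" using itC[OF z] CDQ by blast
    then obtain s r where s: "s \<in> D" "strict_mono r" "((\<lambda>n. (f ^^ n) z) \<circ> r) \<longlonglongrightarrow> s"
      using compact_D[unfolded compact_eq_seq_compact_metric] unfolding seq_compact_def by metis
    have acc: "\<exists>n\<ge>N. \<bar>(f ^^ n) z - s\<bar> < e" if "e > 0" for e N
    proof -
      from tendstoD[OF s(3) that] obtain K where K: "\<And>k. k \<ge> K ==> \<bar>(f ^^ r k) z - s\<bar> < e"
        by (auto simp: eventually_sequentially dist_real_def)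
      have "r (max K N) \<ge> N" using seq_suble[OF s(2), of "max K N"] by simp
      with K[of "max K N"] show ?thesis by auto
    qed
    \<comment> \<open>A cluster point outside \<open>Q\<close> would have a whole component as a
      neighbourhood, and the orbit would visit that component infinitely often.\<close>
    have "s \<in> Q"
    proof (rule ccontr)
      assume "s \<notin> Q"
      then obtain X where X: "X \<in> components (D - Q)" "s \<in> X" using s component_ex by blast
      then obtain d where d: "d > 0" "\<And>t. t \<in> D ==> \<bar>t - s\<bar> < d ==> t \<in> X"
        using component_open by blast
      obtain M where M: "\<And>n. C n = X ==> n < M" using fin[of X] finite_nat_set_iff_bounded by auto
      obtain n where n: "n \<ge> M" "\<bar>(f ^^ n) z - s\<bar> < d" using acc[OF d(1)] by blast
      then have "(f ^^ n) z \<in> X" using d(2) itC[OF z, of n] CDQ by blast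
      then have "C (N + n) = X" using component_eq[OF C X(1) itC[OF z, of n]] by blast
      with M n show False by fastforce
    qed
    then show "\<exists>s\<in>R. \<forall>e>0. \<forall>N. \<exists>n\<ge>N. \<bar>(f ^^ n) z - s\<bar> < e"
      using acc QR by blast
  qed
  moreover have "\<exists>l r. l < r \<and> {l<..<r} \<subseteq> C N"
  proof -
    have "d > 0" using d0 d1 by (simp add: d_def)
    from d1(1) consider "sg = 1" | "sg = -1" by auto
    then show ?thesis
    proof cases
      case 1
      have "{z0<..<z0 + d} \<subseteq> C N" using sub[of "x - z0" for x] 1 by force
      then show ?thesis using \<open>d > 0\<close> by (intro exI[of _ z0] exI[of _ "z0 + d"]) auto
    next
      case 2
      have "{z0 - d<..<z0} \<subseteq> C N" using sub[of "z0 - x" for x] 2 by force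
      then show ?thesis using \<open>d > 0\<close> by (intro exI[of _ "z0 - d"] exI[of _ z0]) auto
    qed
  qed
  ultimately show ?thesis unfolding wandering_interval_def using CDQ by blast
qed

section \<open>One-sided limits and germs at points of \<open>Q\<close>\<close>

lemma accumulation_side:
  fixes q :: real
  assumes "\<And>e. e > 0 ==> \<exists>t\<in>X. t \<noteq> q \<and> \<bar>t - q\<bar> < e"
  shows "\<exists>sg\<in>{1, -1}. \<forall>d>0. \<exists>h. 0 < h \<and> h < d \<and> q + sg * h \<in> X"
proof (rule ccontr)
  assume no: "\<not> ?thesis"
  obtain d1 where d1: "d1 > 0" "\<And>h. 0 < h ==> h < d1 ==> q + 1 * h \<notin> X"
    using no by (metis insertI1)
  obtain d2 where d2: "d2 > 0" "\<And>h. 0 < h ==> h < d2 ==> q + (-1) * h \<notin> X"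
    using no by (metis insertI1 insertI2)
  obtain t where t: "t \<in> X" "t \<noteq> q" "\<bar>t - q\<bar> < min d1 d2"
    using assms[of "min d1 d2"] d1 d2 by auto
  then show False
    using d1(2)[of "t - q"] d2(2)[of "q - t"] by (cases t q rule: linorder_cases) auto
qed

text \<open>Near 0 the connected image of \<open>g\<close> lies in disjoint balls around the points
  of \<open>U\<close>, hence in a single one; its centre then serves for every smaller
  radius.\<close>

lemma finite_limit:
  fixes g :: "real => real"
  assumes d: "0 < d" and cont: "continuous_on {0<..<d} g" and U: "finite U"
    and lim: "\<And>e. e > 0 ==> \<exists>delta>0. \<forall>h. 0 < h --> h < delta --> (\<exists>u\<in>U. \<bar>g h - u\<bar> < e)"
  shows "\<exists>u\<in>U. (g \<longlongrightarrow> u) (at_right 0)"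
proof -
  obtain delta1 where "delta1 > 0" "\<And>h. 0 < h ==> h < delta1 ==> \<exists>u\<in>U. \<bar>g h - u\<bar> < 1" using lim[of 1] by auto
  then have "U \<noteq> {}" by (metis empty_iff field_lbound_gt_zero)
  \<comment> \<open>The least distance between two points of \<open>U\<close>, or 1 if there is only
    one point.\<close>
  obtain eta where eta: "eta > 0" "\<And>u w. u \<in> U ==> w \<in> U ==> u \<noteq> w ==> eta \<le> dist u w"
  proof (cases "\<exists>u\<in>U. \<exists>w\<in>U. u \<noteq> w")
    case True
    define P where "P = (\<lambda>(u, w). dist u w) ` {(u, w) \<in> U \<times> U. u \<noteq> w}"
    have "finite {(u, w) \<in> U \<times> U. u \<noteq> w}"
      by (rule finite_subset[OF _ finite_cartesian_product[OF U U]]) auto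
    then have "finite P" by (simp add: P_def)
    moreover have "P \<noteq> {}" using True by (auto simp: P_def)
    ultimately have "Min P \<in> P" "\<And>x. x \<in> P ==> Min P \<le> x" by auto
    then have "Min P > 0" "\<And>u w. u \<in> U ==> w \<in> U ==> u \<noteq> w ==> Min P \<le> dist u w"
      by (auto simp: P_def)
    then show ?thesis by (rule that)
  next
    case False
    then show ?thesis by (intro that[of 1]) auto
  qed
  obtain delta where delta: "delta > 0" "\<And>h. 0 < h ==> h < delta ==> \<exists>u\<in>U. \<bar>g h - u\<bar> < eta / 2"
    using lim[of "eta/2"] eta(1) by auto
  define I where "I = {0<..<min delta d}"
  have conn: "connected (g ` I)"
    unfolding I_def by (intro connected_continuous_image continuous_on_subset[OF cont]) auto
  have I: "min delta d / 2 \<in> I" using delta d by (auto simp: I_def)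
  then obtain u where u: "u \<in> U" "\<bar>g (min delta d / 2) - u\<bar> < eta / 2"
    using delta(2)[of "min delta d / 2"] by (auto simp: I_def)
  define O1 O2 where "O1 = ball u (eta/2)" and "O2 = (\<Union>w\<in>U - {u}. ball w (eta/2))"
  have "g ` I \<subseteq> O1 \<union> O2"
    using delta(2) by (force simp: I_def O1_def O2_def dist_real_def abs_minus_commute)
  moreover have "O1 \<inter> O2 = {}"
  proof (rule ccontr)
    assume "O1 \<inter> O2 \<noteq> {}"
    then obtain x where x: "dist u x < eta/2" "x \<in> O2" by (auto simp: O1_def)
    from x(2) obtain w where "w \<in> U" "w \<noteq> u" "dist w x < eta/2" unfolding O2_def by auto
    with eta(2)[of u w] u x(1) show False using dist_triangle2[of u w x] by auto
  qed
  moreover have "O1 \<inter> g ` I \<noteq> {}"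
  proof -
    have "g (min delta d / 2) \<in> O1" using u by (simp add: O1_def dist_real_def abs_minus_commute)
    with I show ?thesis by blast
  qed
  moreover have "open O1" "open O2" by (auto simp: O1_def O2_def)
  ultimately have "O2 \<inter> g ` I = {}" using connectedD[OF conn, of O1 O2] by blast
  with \<open>g ` I \<subseteq> O1 \<union> O2\<close> have near: "\<bar>g h - u\<bar> < eta / 2" if "h \<in> I" for h
    using that by (force simp: O1_def dist_real_def abs_minus_commute)
  have "(g \<longlongrightarrow> u) (at_right 0)"
  proof (rule tendstoI)
    fix e :: real assume "e > 0"
    then obtain delta' where delta': "delta' > 0" "\<And>h. 0 < h ==> h < delta' ==> \<exists>w\<in>U. \<bar>g h - w\<bar> < min e (eta / 2)"
      using lim[of "min e (eta/2)"] eta(1) by auto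
    have "\<bar>g h - u\<bar> < e" if h: "0 < h" "h < min delta' (min delta d)" for h
    proof -
      obtain w where w: "w \<in> U" "\<bar>g h - w\<bar> < min e (eta/2)" using delta'(2)[of h] h by auto
      have "\<bar>g h - u\<bar> < eta/2" using near[of h] h by (auto simp: I_def)
      moreover have "\<bar>g h - w\<bar> < eta/2" using w(2) by linarith
      ultimately have "dist u w < eta" unfolding dist_real_def by linarith
      then have "u = w" using eta(2)[OF u(1) w(1)] by (cases "u = w") auto
      with w show ?thesis by simp
    qed
    then show "\<forall>\<^sub>F x in at_right 0. dist (g x) u < e"
      unfolding eventually_at_right_field using delta'(1) delta(1) d
      by (intro exI[of _ "min delta' (min delta d)"]) (auto simp: dist_real_def)
  qed
  with u show ?thesis by blast
qed

text \<open>At a continuity point the limit is \<open>f q\<close>, which injectivity forbids beside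
  \<open>q\<close>; at a point outside \<open>A\<close> it belongs to \<open>U\<close>, which
  contains no value of \<open>f\<close>. So the image of the side is connected and avoids the limit
  \<open>b\<close>, and lies entirely on one side of it.\<close>

lemma germ_step:
  assumes q: "q \<in> Q" and side: "side q sg"
  obtains b rho where "germ f A 1 q sg b rho" "b \<in> D" "q \<in> A --> b = f q"
proof -
  have sg: "sg \<in> {1, -1}" using side by (simp add: side_def)
  obtain d1 where d1: "d1 > 0" "\<And>h. 0 < h ==> h < d1 ==> q + sg * h \<in> D"
    using side unfolding side_def by blast
  obtain d2 where d2: "d2 > 0"
    "\<And>t. t \<in> D ==> 0 < \<bar>t - q\<bar> ==> \<bar>t - q\<bar> < d2 ==> t \<in> A \<and> continuous (at t within D) f"
    using regular[OF q] by blast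
  define d where "d = min d1 d2"
  have d: "d > 0" using d1 d2 by (simp add: d_def)
  have abs: "\<bar>q + sg * h - q\<bar> = h" if "0 < h" for h using sg that by auto
  have inD: "q + sg * h \<in> D" if "0 < h" "h < d" for h using d1 that by (simp add: d_def)
  have *: "q + sg * h \<in> A" "continuous (at (q + sg * h) within D) f" if "0 < h" "h < d" for h
    using d2(2)[of "q + sg * h"] inD[OF that] that abs[of h] sg by (auto simp: d_def)
  define g where "g h = f (q + sg * h)" for h
  have cont: "continuous_on {0<..<d} g"
  proof -
    have "continuous_on ((\<lambda>h. q + sg * h) ` {0<..<d}) f"
      unfolding continuous_on_eq_continuous_within
    proof
      fix x assume "x \<in> (\<lambda>h. q + sg * h) ` {0<..<d}"
      then obtain h where "x = q + sg * h" "h \<in> {0<..<d}" by blast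
      then have h: "x = q + sg * h" "0 < h" "h < d" by auto
      show "continuous (at x within (\<lambda>h. q + sg * h) ` {0<..<d}) f"
        unfolding h(1) by (rule continuous_within_subset[OF *(2)[OF h(2,3)]]) (use inD in auto)
    qed
    then show ?thesis
      unfolding g_def by (rule continuous_on_compose2[of _ f "{0<..<d}" "\<lambda>h. q + sg * h"]) (auto intro!: continuous_intros)
  qed
  have injg: "inj_on g {0<..<d}"
  proof (rule inj_onI)
    fix x y assume xy: "x \<in> {0<..<d}" "y \<in> {0<..<d}" "g x = g y"
    then have "q + sg * x = q + sg * y"
      using inj_onD[OF inj_f, of "q + sg * x" "q + sg * y"] *(1) by (simp add: g_def)
    then show "x = y" using sg by auto
  qed
  obtain b where b: "(g \<longlongrightarrow> b) (at_right 0)" "b \<in> D" "\<And>h. 0 < h ==> h < d ==> g h \<noteq> b" "q \<in> A --> b = f q"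
    using limits[OF q]
  proof
    assume qa: "q \<in> A \<and> continuous (at q within D) f"
    have "((\<lambda>h. q + sg * h) \<longlongrightarrow> q + sg * 0) (at_right 0)" by (intro tendsto_intros)
    moreover have "\<forall>\<^sub>F h in at_right 0. q + sg * h \<in> D \<and> q + sg * h \<noteq> q"
      unfolding eventually_at_right_field by (intro exI[of _ d]) (use d inD sg in auto)
    ultimately have "filterlim (\<lambda>h. q + sg * h) (at q within D) (at_right 0)"
      by (simp add: filterlim_at)
    with qa have "(g \<longlongrightarrow> f q) (at_right 0)"
      unfolding g_def continuous_within
      using filterlim_compose[of f "nhds (f q)" "at q within D" "\<lambda>h. q + sg * h" "at_right 0"] by blast
    moreover have "g h \<noteq> f q" if "0 < h" "h < d" for h
      using inj_onD[OF inj_f, of "q + sg * h" q] *(1)[OF that] qa that sg by (auto simp: g_def)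
    ultimately show ?thesis using that[of "f q"] f_in_D qa by auto
  next
    assume "q \<notin> A \<and> (\<exists>U. finite U \<and> U \<subseteq> D \<and> U \<inter> f ` A = {} \<and>
        (\<forall>e>0. \<exists>d>0. \<forall>t\<in>D. 0 < \<bar>t - q\<bar> --> \<bar>t - q\<bar> < d --> (\<exists>u\<in>U. \<bar>f t - u\<bar> < e)))"
    then obtain U where qA: "q \<notin> A" and U: "finite U" "U \<subseteq> D" "U \<inter> f ` A = {}"
        "\<And>e. e > 0 ==> \<exists>d>0. \<forall>t\<in>D. 0 < \<bar>t - q\<bar> --> \<bar>t - q\<bar> < d --> (\<exists>u\<in>U. \<bar>f t - u\<bar> < e)" by blast
    have "\<exists>u\<in>U. (g \<longlongrightarrow> u) (at_right 0)"
    proof (rule finite_limit[OF d cont U(1)])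
      fix e :: real assume "e > 0"
      then obtain d' where d': "d' > 0"
        "\<And>t. t \<in> D ==> 0 < \<bar>t - q\<bar> ==> \<bar>t - q\<bar> < d' ==> \<exists>u\<in>U. \<bar>f t - u\<bar> < e"
        using U(4) by blast
      then show "\<exists>delta>0. \<forall>h. 0 < h --> h < delta --> (\<exists>u\<in>U. \<bar>g h - u\<bar> < e)"
        using d inD abs sg by (intro exI[of _ "min d d'"]) (auto simp: g_def)
    qed
    then obtain u where u: "u \<in> U" "(g \<longlongrightarrow> u) (at_right 0)" by blast
    moreover have "g h \<noteq> u" if "0 < h" "h < d" for h
      using *(1)[OF that] U(3) u(1) unfolding g_def by blast
    ultimately show ?thesis using that[of u] U(2) qA by auto
  qed
  have "\<exists>rho\<in>{1,-1}. \<forall>h. 0 < h --> h < d --> 0 < rho * (g h - b)"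
  proof -
    have ne: "connected (g ` {0<..<d})" by (intro connected_continuous_image cont) auto
    have "(\<forall>h. 0 < h --> h < d --> b < g h) \<or> (\<forall>h. 0 < h --> h < d --> g h < b)"
    proof (rule ccontr)
      assume "\<not> ?thesis"
      then obtain x y where xy: "0 < x" "x < d" "\<not> b < g x" "0 < y" "y < d" "\<not> g y < b" by blast
      then have "b \<in> g ` {0<..<d}" using connectedD_interval[OF ne, of "g x" "g y" b] by auto
      then obtain h where "h \<in> {0<..<d}" "b = g h" by blast
      then show False using b(3)[of h] by simp
    qed
    then show ?thesis
    proof
      assume "\<forall>h. 0 < h --> h < d --> b < g h"
      then show ?thesis by (intro bexI[of _ 1]) auto
    next
      assume "\<forall>h. 0 < h --> h < d --> g h < b"
      then show ?thesis by (intro bexI[of _ "-1"]) auto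
    qed
  qed
  then obtain rho where rho: "rho \<in> {1, -1}" "\<And>h. 0 < h ==> h < d ==> 0 < rho * (g h - b)" by blast
  have "((\<lambda>h. rho * (g h - b)) \<longlongrightarrow> rho * (b - b)) (at_right 0)" by (intro tendsto_intros b)
  then have lim: "((\<lambda>h. rho * (g h - b)) \<longlongrightarrow> 0) (at_right 0)" by simp
  have inj: "inj_on (\<lambda>h. rho * (g h - b)) {0<..<d}"
    using injg rho(1) by (auto simp: inj_on_def)
  obtain e where e: "incr_bij (\<lambda>h. rho * (g h - b)) (d/2) e"
    by (rule incr_bij_of_continuous[OF d _ inj rho(2) lim]) (auto intro!: continuous_intros cont)
  have "germ f A 1 q sg b rho"
    by (rule germI[OF sg rho(1) e]) (use * d rho(1) in \<open>auto simp: g_def\<close>)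
  then show ?thesis using b that by blast
qed


lemma germ_side: "germ f A 1 a sg b rho ==> side b rho"
proof -
  assume g: "germ f A 1 a sg b rho"
  obtain d e phi where *: "incr_bij phi d e"
    "\<And>h i. 0 < h ==> h < d ==> i < 1 ==> (f ^^ i) (a + sg * h) \<in> A"
    "\<And>h. 0 < h ==> h < d ==> (f ^^ 1) (a + sg * h) = b + rho * phi h"
    by (rule germE[OF g, of 1 1]) auto
  have "b + rho * k \<in> D" if k: "0 < k" "k < e" for k
  proof -
    obtain h where h: "0 < h" "h < d" "phi h = k" using incr_bij_surj[OF *(1) k] by blast
    then show ?thesis using f_in_D[of "a + sg * h"] *(2)[of h 0] *(3)[of h] by simp
  qed
  then show ?thesis
    unfolding side_def using * germ_signs[OF g] by (auto simp: incr_bij_def)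
qed

lemma gap_step:
  assumes gap: "gap a sg" and g: "germ f A 1 a sg b rho" and b: "b \<in> Q"
  shows "gap b rho"
proof -
  obtain d0 where d0: "d0 > 0" "\<And>h. 0 < h ==> h < d0 ==> a + sg * h \<in> D - Q"
    using gap unfolding gap_def by blast
  obtain d e phi where *: "d \<le> d0" "incr_bij phi d e"
    "\<And>h i. 0 < h ==> h < d ==> i < 1 ==> (f ^^ i) (a + sg * h) \<in> A"
    "\<And>h. 0 < h ==> h < d ==> (f ^^ 1) (a + sg * h) = b + rho * phi h"
    by (rule germE[OF g d0(1), of 1]) auto
  have "b + rho * k \<in> D - Q" if k: "0 < k" "k < e" for k
  proof -
    obtain h where h: "0 < h" "h < d" "phi h = k" using incr_bij_surj[OF *(2) k] by blast
    then show ?thesis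
      using f_in_D[of "a + sg * h"] Q_inv[of "a + sg * h"] *(3)[of h 0] *(4)[of h] *(1) d0(2)[of h] by simp
  qed
  then show ?thesis
    unfolding gap_def using b * germ_signs[OF g] by (auto simp: incr_bij_def)
qed

section \<open>Chains of gaps and criteria for wandering intervals\<close>

definition adj :: "real set => real => real => bool" where
  "adj X a sg \<longleftrightarrow> X \<in> components (D - Q) \<and> (\<exists>d>0. \<forall>h. 0 < h --> h < d --> a + sg * h \<in> X)"

lemma adj_ex:
  assumes "gap a sg" obtains X where "adj X a sg"
proof -
  obtain d where d: "d > 0" "\<And>h. 0 < h ==> h < d ==> a + sg * h \<in> D - Q"
    using assms unfolding gap_def by blast
  define T where "T = (\<lambda>h. a + sg * h) ` {0<..<d}"
  have "connected T" unfolding T_def by (intro connected_continuous_image continuous_intros) auto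
  moreover have sub: "T \<subseteq> D - Q" using d(2) by (auto simp: T_def)
  moreover have mem: "a + sg * (d/2) \<in> T" unfolding T_def by (rule imageI) (use d in auto)
  ultimately obtain X where X: "X \<in> components (D - Q)" "a + sg * (d/2) \<in> X"
    using component_ex[of "a + sg * (d/2)"] by blast
  then have "T \<subseteq> X" using components_maximal[OF X(1) \<open>connected T\<close> sub] mem by blast
  then have "adj X a sg" unfolding adj_def
    by (intro conjI X exI[of _ d] allI impI subsetD[OF \<open>T \<subseteq> X\<close>]) (use d in \<open>auto simp: T_def\<close>)
  then show ?thesis by (rule that)
qed

text \<open>Two such ends of the same sign would place one of them inside the connected set
  \<open>X\<close>, which misses \<open>Q\<close>.\<close>

lemma adj_unique:
  assumes "adj X a sg" "adj X b sg" "a \<in> Q" "b \<in> Q" "sg \<in> {1, -1}"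
  shows "a = b"
proof -
  have False if ad: "adj X a sg" "adj X b sg" "b \<in> Q" and lt: "sg * a < sg * b" for a b
  proof -
    have X: "connected X" "X \<subseteq> D - Q"
      using ad in_components_connected in_components_subset unfolding adj_def by blast+
    obtain d where d: "d > 0" "\<And>h. 0 < h ==> h < d ==> a + sg * h \<in> X" using ad(1) unfolding adj_def by blast
    obtain d' where d': "d' > 0" "\<And>h. 0 < h ==> h < d' ==> b + sg * h \<in> X" using ad(2) unfolding adj_def by blast
    define h where "h = min d (sg * b - sg * a) / 2"
    have h: "0 < h" "h < d" "h < sg * b - sg * a" using d lt by (auto simp: h_def)
    have "a + sg * h \<in> X" "b + sg * (d'/2) \<in> X" using d(2) d'(2)[of "d'/2"] d'(1) h by auto
    then have "b \<in> X"
      using connectedD_interval[OF X(1), of "a + sg * h" "b + sg * (d'/2)" b]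
        connectedD_interval[OF X(1), of "b + sg * (d'/2)" "a + sg * h" b] h d' assms(5) by auto
    with X ad show False by blast
  qed
  from this[of a b] this[of b a] assms show ?thesis
    by (metis linorder_neqE_linordered_idom mult_cancel_left insertE singletonD zero_neq_neg_one zero_neq_one)
qed

text \<open>A component is adjacent to at most one point for each of the two signs. Distinct pairs
  therefore visit each component at most twice, and the components along the chain wander.\<close>

lemma germ_chain:
  assumes gap: "\<And>n. gap (a n) (sg n)"
    and steps: "\<And>n::nat. germ f A 1 (a n) (sg n) (a (Suc n)) (sg (Suc n))"
    and inj: "inj (\<lambda>n. (a n, sg n))" and QR: "Q \<subseteq> R"
  shows "wandering_interval f A D R"
proof -
  have "\<forall>n. \<exists>X. adj X (a n) (sg n)" using gap adj_ex by metis
  then obtain C where C: "\<And>n. adj (C n) (a n) (sg n)" by metis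
  show ?thesis
  proof (rule gap_sequence[where C = C])
    show "C n \<in> components (D - Q)" for n using C by (simp add: adj_def)
    show "\<exists>t\<in>C n. t \<in> A \<and> f t \<in> C (Suc n)" for n
    proof -
      obtain d1 where d1: "d1 > 0" "\<And>h. 0 < h ==> h < d1 ==> a n + sg n * h \<in> C n"
        using C[of n] unfolding adj_def by blast
      obtain d2 where d2: "d2 > 0" "\<And>h. 0 < h ==> h < d2 ==> a (Suc n) + sg (Suc n) * h \<in> C (Suc n)"
        using C[of "Suc n"] unfolding adj_def by blast
      obtain d e phi where *: "d \<le> d1" "e \<le> d2" "incr_bij phi d e"
        "\<And>h i. 0 < h ==> h < d ==> i < 1 ==> (f ^^ i) (a n + sg n * h) \<in> A"
        "\<And>h. 0 < h ==> h < d ==> (f ^^ 1) (a n + sg n * h) = a (Suc n) + sg (Suc n) * phi h"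
        by (rule germE[OF steps d1(1) d2(1)]) auto
      obtain h where h: "0 < h" "h < d" using *(3) dense[of 0 d] by (auto simp: incr_bij_def)
      then show ?thesis
        using * d1(2)[of h] d2(2)[of "phi h"] incr_bij_pos[OF *(3) h]
        by (intro bexI[of _ "a n + sg n * h"]) auto
    qed
    fix X
    have "inj_on sg {n. C n = X}"
    proof (rule inj_onI)
      fix m n assume mn: "m \<in> {n. C n = X}" "n \<in> {n. C n = X}" "sg m = sg n"
      then have "a m = a n" using adj_unique[of X "a m" "sg m" "a n"] C[of m] C[of n] gap unfolding gap_def by auto
      with mn inj show "m = n" by (auto dest: injD)
    qed
    moreover have "sg ` {n. C n = X} \<subseteq> {1, -1}" using gap unfolding gap_def by blast
    ultimately show "finite {n. C n = X}" by (meson finite.intros finite_imageD finite_subset)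
  qed (rule QR)
qed

text \<open>If no component is visited infinitely often, the visited components wander. Otherwise
  the visits accumulate at an end of a component, and the germs starting there carry the
  accumulation along. A chain of distinct ends wanders; a repeated end gives a return germ that
  moves the points \<open>t n\<close>, as these are pairwise distinct.\<close>

lemma wandering_if_nonrecurrent:
  assumes t: "\<And>n::nat. t n \<in> A" "\<And>n. t n \<notin> Q" "\<And>n. t (Suc n) = f (t n)" and inj: "inj t"
    and cluster: "\<And>s. (\<And>e N. e > 0 ==> \<exists>n\<ge>N. \<bar>t n - s\<bar> < e) ==> s \<in> Q"
    and QR: "Q \<subseteq> R" and t0: "t 0 \<in> R"
  shows "wandering_either f A D R"
proof -
  have tD: "t n \<in> D" for n using t A_sub_D by blast
  have tR: "t n \<in> R" for n by (induction n) (use t0 t R_inv in auto)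
  have "\<forall>n. \<exists>X. X \<in> components (D - Q) \<and> t n \<in> X" using component_ex tD t(2) by metis
  then obtain C where C: "\<And>n. C n \<in> components (D - Q)" "\<And>n. t n \<in> C n" by metis
  show ?thesis
  proof (cases "\<forall>X. finite {n. C n = X}")
    case True
    have "\<exists>s\<in>C n. s \<in> A \<and> f s \<in> C (Suc n)" for n
      using C(2)[of n] C(2)[of "Suc n"] t(1)[of n] t(3)[of n] by (intro bexI[of _ "t n"]) auto
    then have "wandering_interval f A D R"
      using gap_sequence[where C = C] C(1) True QR by blast
    then show ?thesis ..
  next
    case False
    then obtain X where X: "infinite {n. C n = X}" by blast
    \<comment> \<open>Accumulation of the orbit from a prescribed side, the version that germs
      transport.\<close>
    define acc where "acc a sg \<longleftrightarrow> (\<forall>d>0. \<exists>n h. 0 < h \<and> h < d \<and> t n = a + sg * h)" for a sg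
    have accQ: "a \<in> Q" if acc: "acc a sg" and sg: "sg \<in> {1, -1}" for a sg
    proof (rule cluster)
      fix e :: real and N :: nat assume "e > 0"
      \<comment> \<open>The first \<open>N\<close> points are equal to \<open>a\<close> or keep a
        positive distance from it, so a closer point different from \<open>a\<close> has index at
        least \<open>N\<close>.\<close>
      have "\<exists>d>0. \<forall>n\<in>{..<N}. t n \<noteq> a --> d \<le> \<bar>t n - a\<bar>"
        using finite_set_avoid[of "t ` {..<N}" a] by (auto simp: dist_real_def abs_minus_commute)
      then obtain d where d: "d > 0" "\<And>n. n < N ==> t n \<noteq> a ==> d \<le> \<bar>t n - a\<bar>" by auto
      obtain n h where nh: "0 < h" "h < min d e" "t n = a + sg * h"
        using acc \<open>d > 0\<close> \<open>e > 0\<close> unfolding acc_def by (meson min_less_iff_conj)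
      have ab: "\<bar>t n - a\<bar> = h" using nh sg by auto
      have "n \<ge> N"
      proof (rule ccontr)
        assume "\<not> n \<ge> N"
        then show False using d(2)[of n] ab nh sg by auto
      qed
      with ab nh show "\<exists>n\<ge>N. \<bar>t n - a\<bar> < e" by auto
    qed
    obtain p sgp where p: "gap p sgp" "acc p sgp"
    proof -
      have XD: "X \<in> components (D - Q)" using X C by (metis (mono_tags, lifting) finite.emptyI Collect_empty_eq)
      have "infinite (t ` {n. C n = X})" using X inj by (meson finite_imageD inj_on_subset subset_UNIV)
      moreover have "t ` {n. C n = X} \<subseteq> D" using tD by auto
      ultimately obtain p where pD: "p \<in> D" "p islimpt t ` {n. C n = X}"
        using compact_D unfolding compact_eq_Bolzano_Weierstrass by blast
      have near: "\<exists>n. C n = X \<and> t n \<noteq> p \<and> \<bar>t n - p\<bar> < e" if "e > 0" for e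
        using pD(2) that unfolding islimpt_approachable by (auto simp: dist_real_def)
      have "\<exists>sg\<in>{1, -1}. \<forall>d>0. \<exists>n h. 0 < h \<and> h < d \<and> C n = X \<and> t n = p + sg * h"
      proof (rule ccontr)
        assume no: "\<not> ?thesis"
        obtain d1 where d1: "d1 > 0" "\<And>n h. 0 < h ==> h < d1 ==> C n = X ==> t n \<noteq> p + 1 * h"
          using no by (metis insertI1)
        obtain d2 where d2: "d2 > 0" "\<And>n h. 0 < h ==> h < d2 ==> C n = X ==> t n \<noteq> p + (-1) * h"
          using no by (metis insertI1 insertI2)
        obtain n where n: "C n = X" "t n \<noteq> p" "\<bar>t n - p\<bar> < min d1 d2" using near[of "min d1 d2"] d1 d2 by auto
        then show False
          using d1(2)[of "t n - p" n] d2(2)[of "p - t n" n] by (cases "t n" p rule: linorder_cases) auto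
      qed
      then obtain sg where sg: "sg \<in> {1, -1}" "\<And>d. d > 0 ==> \<exists>n h. 0 < h \<and> h < d \<and> C n = X \<and> t n = p + sg * h"
        by blast
      have acc: "acc p sg" unfolding acc_def using sg(2) by blast
      then have "p \<in> Q" using accQ sg(1) by blast
      have Xc: "connected X" "X \<subseteq> D - Q" using XD in_components_connected in_components_subset by blast+
      obtain n1 h1 where h1: "0 < h1" "C n1 = X" "t n1 = p + sg * h1" using sg(2)[of 1] by auto
      have "p + sg * h \<in> X" if h: "0 < h" "h < h1" for h
      proof -
        obtain n2 h2 where h2: "0 < h2" "h2 < h" "C n2 = X" "t n2 = p + sg * h2" using sg(2)[OF h(1)] by auto
        have "t n1 \<in> X" "t n2 \<in> X" using C(2) h1 h2 by metis+
        then have X12: "p + sg * h1 \<in> X" "p + sg * h2 \<in> X" using h1 h2 by simp_all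
        from sg(1) consider "sg = 1" | "sg = -1" by blast
        then show ?thesis
        proof cases
          case 1
          show ?thesis by (rule connectedD_interval[OF Xc(1) X12(2,1)]) (use 1 h h2 in simp_all)
        next
          case 2
          show ?thesis by (rule connectedD_interval[OF Xc(1) X12]) (use 2 h h2 in simp_all)
        qed
      qed
      then have "gap p sg" unfolding gap_def using \<open>p \<in> Q\<close> sg(1) Xc(2) h1(1) by blast
      with acc that show ?thesis by blast
    qed
    have "\<exists>c. \<forall>n. (gap (fst (c n)) (snd (c n)) \<and> acc (fst (c n)) (snd (c n))) \<and>
      germ f A 1 (fst (c n)) (snd (c n)) (fst (c (Suc n))) (snd (c (Suc n)))"
    proof (rule dependent_nat_choice)
      show "\<exists>x. gap (fst x) (snd x) \<and> acc (fst x) (snd x)" using p by (intro exI[of _ "(p, sgp)"]) auto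
      fix x :: "real \<times> real" and n :: nat
      assume x: "gap (fst x) (snd x) \<and> acc (fst x) (snd x)"
      obtain a sg where [simp]: "x = (a, sg)" by fastforce
      have gap: "gap a sg" and acc: "acc a sg" using x by auto
      have aQ: "a \<in> Q" using gap by (simp add: gap_def)
      obtain b rho where g: "germ f A 1 a sg b rho" by (rule germ_step[OF aQ gap_side[OF gap]])
      have "acc b rho"
        unfolding acc_def
      proof (intro allI impI)
        fix d0 :: real assume "d0 > 0"
        obtain d e phi where *: "e \<le> d0" "incr_bij phi d e"
          "\<And>h. 0 < h ==> h < d ==> (f ^^ 1) (a + sg * h) = b + rho * phi h"
          by (rule germE[OF g zero_less_one \<open>d0 > 0\<close>]) auto
        have "0 < d" using * by (simp add: incr_bij_def)
        then obtain n h where nh: "0 < h" "h < d" "t n = a + sg * h" using acc unfolding acc_def by blast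
        then have "t (Suc n) = b + rho * phi h" using t(3) * by simp
        with incr_bij_pos[OF *(2) nh(1,2)] *(1) show "\<exists>n h. 0 < h \<and> h < d0 \<and> t n = b + rho * h"
          by (intro exI[of _ "Suc n"] exI[of _ "phi h"]) auto
      qed
      moreover from this have "gap b rho" using gap_step[OF gap g] accQ germ_signs[OF g] by blast
      ultimately show "\<exists>y. (gap (fst y) (snd y) \<and> acc (fst y) (snd y)) \<and>
        germ f A 1 (fst x) (snd x) (fst y) (snd y)" using g by (intro exI[of _ "(b, rho)"]) auto
    qed
    then obtain c where c: "\<And>n. gap (fst (c n)) (snd (c n))" "\<And>n. acc (fst (c n)) (snd (c n))"
      "\<And>n. germ f A 1 (fst (c n)) (snd (c n)) (fst (c (Suc n))) (snd (c (Suc n)))" by blast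
    show ?thesis
    proof (cases "inj c")
      case True
      have "wandering_interval f A D R"
        by (rule germ_chain[of "\<lambda>n. fst (c n)" "\<lambda>n. snd (c n)"]) (use c True QR in auto)
      then show ?thesis ..
    next
      case False
      then obtain i j where ij: "i < j" "c i = c j"
        by (metis linorder_injI)
      define m where "m = j - i"
      have m: "m \<ge> 1" "i + m = j" using ij by (auto simp: m_def)
      have "\<exists>d>0. \<forall>h. 0 < h --> h < d --> fst (c i) + snd (c i) * h \<in> R -->
        (f ^^ m) (fst (c i) + snd (c i) * h) \<noteq> fst (c i) + snd (c i) * h -->
        wandering_either f A D R"
        using periodic_germ[of f A m "\<lambda>k. fst (c (i + k))" "\<lambda>k. snd (c (i + k))" D R]
          inj_f m c(3) ij(2) A_sub_D f_in_D closed_R R_inv by (auto simp: image_subset_iff)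
      then obtain d where d: "d > 0" "\<And>h. 0 < h ==> h < d ==> fst (c i) + snd (c i) * h \<in> R ==>
        (f ^^ m) (fst (c i) + snd (c i) * h) \<noteq> fst (c i) + snd (c i) * h ==>
        wandering_either f A D R" by blast
      obtain n h where nh: "0 < h" "h < d" "t n = fst (c i) + snd (c i) * h"
        using c(2)[of i] d(1) unfolding acc_def by blast
      have "(f ^^ m) (t n) = t (m + n)" by (induction m) (auto simp: t(3))
      also have "\<dots> \<noteq> t n" using inj m(1) by (auto dest: injD)
      finally show ?thesis using d(2)[OF nh(1,2)] tR[of n] nh(3) by simp
    qed
  qed
qed

text \<open>The gap beside \<open>a\<close> is followed along the orbit of \<open>a\<close>. If the
  orbit never repeats, the gaps wander. Otherwise it reaches a periodic point \<open>c\<close>; the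
  points of \<open>X\<close> accumulate there from the side opposite to the gap, and the return germ
  on that side moves them because they are not periodic.\<close>

lemma wandering_if_recurrent:
  assumes a: "gap a sg" "\<And>n. (f ^^ n) a \<in> A" and QR: "Q \<subseteq> R"
    and X: "X \<subseteq> Q" "\<And>t. t \<in> X ==> t \<in> A ==> f t \<in> X"
    and dense: "\<And>q e. q \<in> Q ==> e > 0 ==> \<exists>t\<in>X. t \<noteq> q \<and> \<bar>t - q\<bar> < e"
    and aper: "\<And>t m. t \<in> X ==> m \<ge> 1 ==> (\<And>i. i < m ==> (f ^^ i) t \<in> A) ==> (f ^^ m) t \<noteq> t"
  shows "wandering_either f A D R"
proof -
  have aQ: "(f ^^ n) a \<in> Q" for n
    by (induction n) (use a Q_inv in \<open>auto simp: gap_def\<close>)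
  have "\<exists>s. \<forall>n. gap ((f ^^ n) a) (s n) \<and> germ f A 1 ((f ^^ n) a) (s n) ((f ^^ Suc n) a) (s (Suc n))"
  proof (rule dependent_nat_choice)
    show "\<exists>x. gap ((f ^^ 0) a) x" using a by auto
    fix x n assume x: "gap ((f ^^ n) a) x"
    obtain b rho where g: "germ f A 1 ((f ^^ n) a) x b rho" "(f ^^ n) a \<in> A --> b = f ((f ^^ n) a)"
      by (rule germ_step[OF aQ gap_side[OF x]])
    then have "b = (f ^^ Suc n) a" using a(2)[of n] by simp
    with g(1) have "germ f A 1 ((f ^^ n) a) x ((f ^^ Suc n) a) rho" by simp
    then show "\<exists>y. gap ((f ^^ Suc n) a) y \<and> germ f A 1 ((f ^^ n) a) x ((f ^^ Suc n) a) y"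
      using gap_step[OF x _ aQ] by blast
  qed
  then obtain s where s: "\<And>n. gap ((f ^^ n) a) (s n)"
    "\<And>n. germ f A 1 ((f ^^ n) a) (s n) ((f ^^ Suc n) a) (s (Suc n))" by blast
  show ?thesis
  proof (cases "inj (\<lambda>n. (f ^^ n) a)")
    case True
    have "wandering_interval f A D R"
      by (rule germ_chain[of "\<lambda>n. (f ^^ n) a" s]) (use s True QR in \<open>auto simp: inj_def\<close>)
    then show ?thesis ..
  next
    case False
    then obtain i j where ij: "i < j" "(f ^^ i) a = (f ^^ j) a"
      by (metis linorder_injI)
    define m where "m = j - i"
    define c where "c = (f ^^ i) a"
    have m: "m \<ge> 1" "m + i = j" using ij by (auto simp: m_def)
    have fc: "(f ^^ n) c = (f ^^ (n + i)) a" for n by (simp add: c_def funpow_add)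
    have cA: "(f ^^ n) c \<in> A" for n using a(2)[of "n + i"] by (simp add: fc)
    have cQ: "(f ^^ n) c \<in> Q" for n using aQ[of "n + i"] by (simp add: fc)
    have "(f ^^ m) c = (f ^^ j) a" using fc[of m] m(2) by simp
    then have c_per: "(f ^^ m) c = c" using ij(2) by (simp only: c_def)
    have c_gap: "gap c (s i)" using s(1)[of i] by (simp add: c_def)
    define acc where "acc b rho \<longleftrightarrow> (\<forall>d>0. \<exists>h. 0 < h \<and> h < d \<and> b + rho * h \<in> X)" for b rho
    have not_gap: "\<not> acc b rho" if "gap b rho" for b rho
      using that X(1) unfolding acc_def gap_def by blast
    have acc_side: "side b rho" if "acc b rho" "rho \<in> {1, -1}" "b \<in> Q" for b rho
      using sides[of b rho] that Q_sub_D X(1) unfolding acc_def side_def by blast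
    have "\<exists>tau\<in>{1, -1}. acc c tau"
      unfolding acc_def by (rule accumulation_side) (use dense[of c] cQ[of 0] in auto)
    then obtain tau where tau: "tau \<in> {1, -1}" "acc c tau" by blast
    have "\<exists>r. \<forall>n. ((n = 0 --> r n = tau) \<and> acc ((f ^^ n) c) (r n) \<and> r n \<in> {1, -1}) \<and>
      germ f A 1 ((f ^^ n) c) (r n) ((f ^^ Suc n) c) (r (Suc n))"
    proof (rule dependent_nat_choice)
      show "\<exists>x. (0 = (0::nat) --> x = tau) \<and> acc ((f ^^ 0) c) x \<and> x \<in> {1, -1}" using tau by auto
      fix x and n :: nat assume x: "(n = 0 --> x = tau) \<and> acc ((f ^^ n) c) x \<and> x \<in> {1, -1}"
      then have sd: "side ((f ^^ n) c) x" using acc_side cQ by blast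
      obtain b rho where g: "germ f A 1 ((f ^^ n) c) x b rho" "(f ^^ n) c \<in> A --> b = f ((f ^^ n) c)"
        by (rule germ_step[OF cQ sd])
      then have b: "b = (f ^^ Suc n) c" using cA[of n] by simp
      have "acc b rho" unfolding acc_def
      proof (intro allI impI)
        fix d0 :: real assume "d0 > 0"
        obtain d e phi where *: "e \<le> d0" "incr_bij phi d e"
          "\<And>h j. 0 < h ==> h < d ==> j < 1 ==> (f ^^ j) ((f ^^ n) c + x * h) \<in> A"
          "\<And>h. 0 < h ==> h < d ==> (f ^^ 1) ((f ^^ n) c + x * h) = b + rho * phi h"
          by (rule germE[OF g(1) zero_less_one \<open>d0 > 0\<close>]) auto
        have "0 < d" using * by (simp add: incr_bij_def)
        then obtain h where h: "0 < h" "h < d" "(f ^^ n) c + x * h \<in> X" using x unfolding acc_def by blast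
        then have "b + rho * phi h \<in> X" using X(2)[OF h(3)] *(3)[of h 0] *(4)[of h] by simp
        with incr_bij_pos[OF *(2) h(1,2)] *(1) show "\<exists>h. 0 < h \<and> h < d0 \<and> b + rho * h \<in> X"
          by (intro exI[of _ "phi h"]) auto
      qed
      then have acc': "acc ((f ^^ Suc n) c) rho" using b by (simp only:)
      have "germ f A 1 ((f ^^ n) c) x ((f ^^ Suc n) c) rho" using g(1) b by (simp only:)
      with acc' germ_signs[OF g(1)] show "\<exists>y. ((Suc n = 0 --> y = tau) \<and> acc ((f ^^ Suc n) c) y \<and> y \<in> {1, -1}) \<and>
        germ f A 1 ((f ^^ n) c) x ((f ^^ Suc n) c) y" by (intro exI[of _ rho] conjI impI) simp_all
    qed
    then obtain r where r: "r 0 = tau" "\<And>n. acc ((f ^^ n) c) (r n)" "\<And>n. r n \<in> {1, -1}"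
      "\<And>n. germ f A 1 ((f ^^ n) c) (r n) ((f ^^ Suc n) c) (r (Suc n))" by metis
    \<comment> \<open>After one period the side is again one from which \<open>X\<close>
      accumulates, and the gap excludes the opposite one; so the cycle of sides closes after
      \<open>m\<close> steps rather than \<open>2 * m\<close>.\<close>
    have "r m = r 0"
    proof -
      have "r m \<noteq> s i" "r 0 \<noteq> s i"
        using not_gap[OF c_gap] r(2)[of m] r(2)[of 0] c_per by auto
      then show ?thesis using r(3)[of m] r(3)[of 0] c_gap unfolding gap_def by auto
    qed
    then have "\<exists>d>0. \<forall>h. 0 < h --> h < d --> c + r 0 * h \<in> R -->
        (f ^^ m) (c + r 0 * h) \<noteq> c + r 0 * h -->
        wandering_either f A D R"
      using periodic_germ[of f A m "\<lambda>n. (f ^^ n) c" r D R]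
        inj_f m r(4) c_per A_sub_D f_in_D closed_R R_inv by (auto simp: image_subset_iff)
    then obtain d where d: "d > 0" "\<And>h. 0 < h ==> h < d ==> c + r 0 * h \<in> R ==>
        (f ^^ m) (c + r 0 * h) \<noteq> c + r 0 * h ==>
        wandering_either f A D R" by blast
    have "germ f A m ((f ^^ 0) c) (r 0) ((f ^^ m) c) (r m)"
      by (rule germ_steps[of m f A "\<lambda>n. (f ^^ n) c" r]) (use r in auto)
    then obtain d' e' phi' where d': "d' \<le> d" "incr_bij phi' d' e'"
      "\<And>h j. 0 < h ==> h < d' ==> j < m ==> (f ^^ j) ((f ^^ 0) c + r 0 * h) \<in> A"
      by (rule germE[OF _ \<open>d > 0\<close> zero_less_one]) auto
    then have "0 < d'" by (simp add: incr_bij_def)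
    then obtain h where h: "0 < h" "h < d'" "c + r 0 * h \<in> X" using r(2)[of 0] unfolding acc_def by auto
    have "(f ^^ m) (c + r 0 * h) \<noteq> c + r 0 * h"
      by (rule aper[OF h(3) m(1)]) (use d'(3)[OF h(1,2)] in auto)
    then show ?thesis using d(2)[of h] h d'(1) X(1) QR by auto
  qed
qed

text \<open>If the gap ends were finite in number, none except perhaps \<open>q\<close> would be
  close to \<open>q\<close>. But \<open>Q\<close> accumulates at \<open>q\<close> without filling an
  interval, so some gap nearby has an end in \<open>Q\<close> different from
  \<open>q\<close>.\<close>

lemma infinite_gaps:
  assumes "Q \<noteq> {}" and perfect: "\<And>q e. q \<in> Q ==> e > 0 ==> \<exists>t\<in>Q. t \<noteq> q \<and> \<bar>t - q\<bar> < e"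
    and thin: "\<And>l r. l < r ==> \<not> {l<..<r} \<subseteq> Q"
  shows "infinite {a. \<exists>sg. gap a sg}"
proof
  assume fin: "finite {a. \<exists>sg. gap a sg}"
  obtain q where q: "q \<in> Q" using assms by blast
  obtain m where m: "m > 0" "\<And>a sg. gap a sg ==> a \<noteq> q ==> m \<le> dist q a"
    using finite_set_avoid[OF fin, of q] by blast
  obtain sg where sg: "sg \<in> {1, -1}" "\<And>d. d > 0 ==> \<exists>h. 0 < h \<and> h < d \<and> q + sg * h \<in> Q"
    using accumulation_side[of Q q] perfect[OF q] by blast
  have "\<exists>d>0. \<forall>h. 0 < h --> h < d --> q + sg * h \<in> D"
    using sides[of q sg] q Q_sub_D sg by blast
  then obtain d where d: "d > 0" "\<And>h. 0 < h ==> h < d ==> q + sg * h \<in> D" by blast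
  define T where "T = (\<lambda>h. q + sg * h) -` Q"
  obtain h1 where h1: "0 < h1" "h1 < d" "h1 < m" "h1 \<in> T"
    using sg(2)[of "min d m"] d(1) m(1) by (auto simp: T_def)
  have "\<exists>h0. 0 < h0 \<and> h0 < h1 \<and> h0 \<notin> T"
  proof (rule ccontr)
    assume no: "\<not> ?thesis"
    define l r where "l = min q (q + sg * h1)" and "r = max q (q + sg * h1)"
    have "x \<in> Q" if "x \<in> {l<..<r}" for x
    proof -
      have "0 < sg * (x - q)" "sg * (x - q) < h1" "q + sg * (sg * (x - q)) = x"
        using sg(1) h1(1) that by (auto simp: l_def r_def min_def max_def split: if_splits)
      then show ?thesis using no unfolding T_def by (metis vimageE)
    qed
    moreover have "l < r" using sg(1) h1(1) by (auto simp: l_def r_def)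
    ultimately show False using thin[of l r] by blast
  qed
  then obtain h0 where h0: "0 < h0" "h0 < h1" "h0 \<notin> T" by blast
  \<comment> \<open>The distance from \<open>q\<close> of the first point of \<open>Q\<close> beyond
    the missed parameter \<open>h0\<close>; the gap at that point opens back towards
    \<open>q\<close>.\<close>
  define a where "a = Inf (T \<inter> {h0..h1})"
  have bdd: "bdd_below (T \<inter> {h0..h1})" by (rule bdd_belowI[of _ h0]) auto
  have "closed T" unfolding T_def by (intro closed_vimage closed_Q continuous_intros)
  then have aT: "a \<in> T \<inter> {h0..h1}" unfolding a_def
    by (intro closed_contains_Inf bdd closed_Int) (use h0 h1 in auto)
  then have a: "h0 < a" "a \<le> h1" using h0(3) by (auto simp: less_le)
  have "q + sg * a + - sg * k \<in> D - Q" if k: "0 < k" "k < a - h0" for k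
  proof -
    have e: "q + sg * a + - sg * k = q + sg * (a - k)" by (simp add: algebra_simps)
    have "a - k \<notin> T" using cInf_lower[OF _ bdd, of "a - k"] k a by (auto simp: a_def)
    then show ?thesis unfolding e using d(2)[of "a - k"] k a h0(1) h1(2) by (auto simp: T_def)
  qed
  then have "gap (q + sg * a) (- sg)"
    unfolding gap_def using aT sg(1) a(1) by (intro conjI exI[of _ "a - h0"]) (auto simp: T_def)
  from m(2)[OF this] show False using sg(1) a h0(1) h1(3) by (auto simp: dist_real_def)
qed

text \<open>The inverse map sends the side \<open>rho\<close> of \<open>b\<close> into both given
  sides; comparing one-sided limits identifies the points, and then the signs.\<close>

lemma germ_source_unique:
  assumes g1: "germ f A 1 a sg b rho" and g2: "germ f A 1 a' sg' b rho"
  shows "a = a' \<and> sg = sg'"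
proof -
  let ?F = "the_inv_into A f"
  obtain d e phi where 1: "incr_bij phi d e" "\<And>h. 0 < h ==> h < d ==> (?F ^^ 1) (b + rho * h) = a + sg * phi h"
    by (rule germE[OF germ_inverse[OF inj_f g1], of 1 1]) auto
  obtain d' e' phi' where 2: "incr_bij phi' d' e'" "\<And>h. 0 < h ==> h < d' ==> (?F ^^ 1) (b + rho * h) = a' + sg' * phi' h"
    by (rule germE[OF germ_inverse[OF inj_f g2], of 1 1]) auto
  have d: "0 < min d d'" using 1 2 by (auto simp: incr_bij_def)
  have eq: "a + sg * phi h = a' + sg' * phi' h" if "0 < h" "h < min d d'" for h
    using 1(2)[of h] 2(2)[of h] that by simp
  have "((\<lambda>h. a + sg * phi h) \<longlongrightarrow> a + sg * 0) (at_right 0)"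
    "((\<lambda>h. a' + sg' * phi' h) \<longlongrightarrow> a' + sg' * 0) (at_right 0)"
    by (intro tendsto_intros incr_bij_tendsto_0[OF 1(1)] incr_bij_tendsto_0[OF 2(1)])+
  moreover have "\<forall>\<^sub>F h in at_right 0. a + sg * phi h = a' + sg' * phi' h"
    unfolding eventually_at_right_field using d eq by (intro exI[of _ "min d d'"]) auto
  ultimately have "((\<lambda>h. a' + sg' * phi' h) \<longlongrightarrow> a) (at_right 0)"
    using tendsto_cong by fastforce
  then have aa: "a = a'"
    using \<open>((\<lambda>h. a' + sg' * phi' h) \<longlongrightarrow> a' + sg' * 0) (at_right 0)\<close>
    by (metis add.right_neutral mult_zero_right tendsto_unique trivial_limit_at_right_real)
  define h where "h = min d d' / 2"
  have h: "0 < h" "h < min d d'" using d by (auto simp: h_def)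
  have "sg * phi h = sg' * phi' h" using eq[OF h] aa by simp
  moreover have "0 < phi h" "0 < phi' h" using incr_bij_pos[OF 1(1)] incr_bij_pos[OF 2(1)] h by auto
  ultimately have "sg = sg'" using germ_signs[OF g1] germ_signs[OF g2] by auto
  with aa show ?thesis by blast
qed

text \<open>The germ map is injective, so a finite set of points whose germs are mapped among themselves
  receives no further germ.\<close>

lemma finite_germs_closed:
  assumes P: "finite P" "P \<subseteq> Q"
    and closed: "\<And>q sg b rho. q \<in> P ==> germ f A 1 q sg b rho ==> b \<in> P"
    and s: "germ f A 1 s sg b rho" "b \<in> P"
  shows "s \<in> P"
proof -
  define G where "G = {(q, sg). q \<in> P \<and> side q sg}"
  have "G \<subseteq> P \<times> {1, -1}" by (auto simp: G_def side_def)
  then have finG: "finite G" by (rule finite_subset) (simp add: P)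
  have "\<forall>g\<in>G. \<exists>g'. germ f A 1 (fst g) (snd g) (fst g') (snd g') \<and> g' \<in> G"
  proof
    fix g assume "g \<in> G"
    then obtain q sg where g: "g = (q, sg)" "q \<in> P" "side q sg" by (auto simp: G_def)
    obtain b rho where b: "germ f A 1 q sg b rho" using germ_step[of q sg] g P by blast
    with closed[OF g(2) b] germ_side[OF b] g show "\<exists>g'. germ f A 1 (fst g) (snd g) (fst g') (snd g') \<and> g' \<in> G"
      by (intro exI[of _ "(b, rho)"]) (auto simp: G_def)
  qed
  then obtain F where F: "\<And>g. g \<in> G ==> germ f A 1 (fst g) (snd g) (fst (F g)) (snd (F g))" "\<And>g. g \<in> G ==> F g \<in> G"
    by metis
  have "inj_on F G"
  proof (rule inj_onI)
    fix x y assume xy: "x \<in> G" "y \<in> G" "F x = F y"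
    then show "x = y" using germ_source_unique[OF F(1)[OF xy(1)], of "fst y" "snd y"] F(1)[OF xy(2)]
      by (auto simp: prod_eq_iff)
  qed
  then have "F ` G = G" using F(2) finG by (intro endo_inj_surj) auto
  moreover have "(b, rho) \<in> G" using s germ_side[OF s(1)] by (simp add: G_def)
  ultimately obtain g where g: "g \<in> G" "F g = (b, rho)" by (metis imageE)
  then have "s = fst g" using germ_source_unique[OF s(1), of "fst g" "snd g"] F(1)[OF g(1)] by auto
  then show ?thesis using g by (auto simp: G_def)
qed

end

section \<open>Cross-sections and first return maps\<close>

text \<open>The section consists of arcs \<open>tau\<close> with parameters in D. The finitely many parameters outside D'
  are those where the flow box over the section need not be a neighbourhood, such as end points.\<close>

locale cross_section = compact_flow v
  for v :: "real => 'a::{t2_space, second_countable_topology} => 'a" +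
  fixes D D' :: "real set" and tau :: "real => 'a" and eps :: real
  assumes cs_compact: "compact D" and D'_sub: "D' \<subseteq> D" and D'_finite: "finite (D - D')"
    and eps: "eps > 0" and tau_cont: "continuous_on D tau"
    and box_inj: "inj_on (\<lambda>(t, s). v s (tau t)) (D \<times> {-eps<..<eps})"
    and box_nhd: "\<And>t d e. t \<in> D' ==> 0 < d ==> 0 < e ==>
      \<exists>U. open U \<and> tau t \<in> U \<and> (\<forall>x\<in>U. \<exists>t'\<in>D. \<exists>s. \<bar>t' - t\<bar> < d \<and> \<bar>s\<bar> < e \<and> x = v s (tau t'))"
    and cs_sides: "\<And>t sg. t \<in> D ==> sg \<in> {1, -1} ==>
      (\<exists>d>0. \<forall>h. 0 < h --> h < d --> t + sg * h \<in> D) \<or> (\<exists>d>0. \<forall>h. 0 < h --> h < d --> t + sg * h \<notin> D)"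
    and cs_some_side: "\<And>t. t \<in> D ==> \<exists>sg\<in>{1, -1}. \<exists>d>0. \<forall>h. 0 < h --> h < d --> t + sg * h \<in> D"
begin

section \<open>Spacing of hits and the first return\<close>

lemma close_hits:
  assumes "t \<in> D" "t' \<in> D" "v s (tau t) = tau t'" "\<bar>s\<bar> < eps"
  shows "s = 0" "t = t'"
proof -
  have "(t, s) = (t', 0)"
    by (rule inj_onD[OF box_inj]) (use assms eps in auto)
  then show "s = 0" "t = t'" by auto
qed

lemma tau_inj: "t \<in> D ==> t' \<in> D ==> tau t = tau t' ==> t = t'"
  using close_hits[of t t' 0] eps by simp

lemma tau_inj_on: "inj_on tau D"
  by (rule inj_onI) (rule tau_inj)

lemma tau_image_closed: "closed (tau ` D)"
  by (intro compact_imp_closed compact_continuous_image tau_cont cs_compact)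

lemma tau_regular: "t \<in> D ==> tau t \<notin> Sing v"
  using close_hits[of t t "eps/2"] eps by (auto simp: Sing_def)

lemma hit_ge: "t \<in> D ==> v s (tau t) \<in> tau ` D ==> 0 < s ==> eps \<le> s"
  using close_hits[of t _ s] by fastforce

definition ret_dom :: "real set" where
  "ret_dom = {t \<in> D. \<exists>s>0. v s (tau t) \<in> tau ` D}"

definition ret_time :: "real => real" where
  "ret_time t = Inf {s. 0 < s \<and> v s (tau t) \<in> tau ` D}"

definition first_ret :: "real => real" where
  "first_ret t = the_inv_into D tau (v (ret_time t) (tau t))"

text \<open>No hit occurs at a positive time before \<open>eps\<close>, so the set of positive hit
  times is closed and its infimum is attained.\<close>

lemma ret_time:
  assumes "t \<in> ret_dom"
  shows "eps \<le> ret_time t" "v (ret_time t) (tau t) \<in> tau ` D"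
    and "\<And>s. 0 < s ==> v s (tau t) \<in> tau ` D ==> ret_time t \<le> s"
proof -
  let ?H = "{s. 0 < s \<and> v s (tau t) \<in> tau ` D}"
  have t: "t \<in> D" using assms by (simp add: ret_dom_def)
  have H: "?H = {eps..} \<inter> (\<lambda>s. v s (tau t)) -` (tau ` D)"
    using hit_ge[OF t] eps by fastforce
  have "closed ?H" unfolding H
    by (intro closed_Int closed_vimage tau_image_closed) (auto intro!: continuous_intros)
  moreover have "?H \<noteq> {}" using assms by (auto simp: ret_dom_def)
  moreover have bdd: "bdd_below ?H" by (rule bdd_belowI[of _ 0]) auto
  ultimately have "ret_time t \<in> ?H" unfolding ret_time_def by (intro closed_contains_Inf)
  then show "eps \<le> ret_time t" "v (ret_time t) (tau t) \<in> tau ` D" using hit_ge[OF t] by auto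
  show "ret_time t \<le> s" if "0 < s" "v s (tau t) \<in> tau ` D" for s
    unfolding ret_time_def using that bdd by (intro cInf_lower) auto
qed

lemma first_ret:
  assumes "t \<in> ret_dom"
  shows "first_ret t \<in> D" "tau (first_ret t) = v (ret_time t) (tau t)"
  using ret_time(2)[OF assms] unfolding first_ret_def
  by (auto simp: the_inv_into_into[OF tau_inj_on] f_the_inv_into_f[OF tau_inj_on])

lemma first_retI:
  assumes "t \<in> D" "t' \<in> D" "0 < r" "v r (tau t) = tau t'"
    and no: "\<And>s. 0 < s ==> s < r ==> v s (tau t) \<notin> tau ` D"
  shows "t \<in> ret_dom" "ret_time t = r" "first_ret t = t'"
proof -
  show dom: "t \<in> ret_dom" using assms unfolding ret_dom_def by auto
  show "ret_time t = r"
  proof (rule antisym)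
    show "ret_time t \<le> r" using ret_time(3)[OF dom, of r] assms by auto
    show "r \<le> ret_time t" using no[of "ret_time t"] ret_time(1,2)[OF dom] eps by force
  qed
  then show "first_ret t = t'"
    using first_ret[OF dom] assms tau_inj by metis
qed

lemma ret_dom_sub: "ret_dom \<subseteq> D"
  by (auto simp: ret_dom_def)

text \<open>If two points had the same return at different times, the one with the longer time would
  pass through the other before its own first return.\<close>

lemma first_ret_inj: "inj_on first_ret ret_dom"
proof (rule inj_onI)
  have "t = t'" if dom: "t \<in> ret_dom" "t' \<in> ret_dom" and eq: "first_ret t = first_ret t'"
    and le: "ret_time t \<le> ret_time t'" for t t'
  proof -
    have "v (ret_time t) (tau t) = v (ret_time t') (tau t')" using first_ret dom eq by metis
    then have *: "v (ret_time t' - ret_time t) (tau t') = tau t"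
      by (metis add.commute add_diff_cancel_left' diff_add_cancel uminus_add_conv_diff v_0 v_add right_minus)
    have "ret_time t' = ret_time t"
    proof (rule ccontr)
      assume "ret_time t' \<noteq> ret_time t"
      then have "ret_time t' \<le> ret_time t' - ret_time t"
        using ret_time(3)[OF dom(2), of "ret_time t' - ret_time t"] * le dom ret_dom_sub by auto
      then show False using ret_time(1)[OF dom(1)] eps by simp
    qed
    with * show ?thesis using tau_inj dom ret_dom_sub by (metis diff_self subsetD v_0)
  qed
  then show "t = t'" if "t \<in> ret_dom" "t' \<in> ret_dom" "first_ret t = first_ret t'" for t t'
    using that by (metis linear)
qed

text \<open>The landing point has a flow box, so nearby orbits hit at about the same time. Earlier
  hits are excluded by a tube over the middle of the time interval and by the spacing
  \<open>eps\<close> near its two ends.\<close>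

lemma first_ret_near:
  assumes t0: "t0 \<in> ret_dom" "first_ret t0 \<in> D'" and eta: "eta > 0"
  shows "\<exists>d>0. \<forall>t\<in>D. \<bar>t - t0\<bar> < d --> t \<in> ret_dom \<and> \<bar>first_ret t - first_ret t0\<bar> < eta"
proof -
  define r0 t1 where "r0 = ret_time t0" and "t1 = first_ret t0"
  have t0D: "t0 \<in> D" using t0 ret_dom_sub by auto
  have r0: "eps \<le> r0" "v r0 (tau t0) = tau t1" using ret_time(1) first_ret t0 by (auto simp: r0_def t1_def)
  obtain U where U: "open U" "tau t1 \<in> U"
    "\<And>x. x \<in> U ==> \<exists>t'\<in>D. \<exists>s. \<bar>t' - t1\<bar> < eta \<and> \<bar>s\<bar> < eps/2 \<and> x = v s (tau t')"
    using box_nhd[of t1 eta "eps/2"] t0(2) eta eps unfolding t1_def by auto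
  obtain W1 where W1: "open W1" "tau t0 \<in> W1" "\<And>z s. z \<in> W1 ==> s \<in> {eps/2..r0 - eps/2} ==> v s z \<in> - (tau ` D)"
  proof -
    have "v s (tau t0) \<in> - (tau ` D)" if "s \<in> {eps/2..r0 - eps/2}" for s
      using ret_time(3)[OF t0(1), of s] that eps unfolding r0_def by fastforce
    then show ?thesis using tube[of "{eps/2..r0 - eps/2}" "- (tau ` D)" "tau t0"] tau_image_closed that by (auto simp: open_Compl)
  qed
  obtain W2 where W2: "open W2" "tau t0 \<in> W2" "\<And>z. z \<in> W2 ==> v r0 z \<in> U"
    using tube[of "{r0}" U "tau t0"] U r0 by auto
  have "continuous (at t0 within D) tau" using tau_cont t0D by (simp add: continuous_on_eq_continuous_within)
  then have "(tau \<longlongrightarrow> tau t0) (at t0 within D)" by (simp add: continuous_within)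
  then have "\<forall>\<^sub>F t in at t0 within D. tau t \<in> W1 \<inter> W2"
    using W1 W2 by (intro topological_tendstoD) auto
  then obtain d where d: "d > 0" "\<And>t. t \<in> D ==> t \<noteq> t0 ==> \<bar>t - t0\<bar> < d ==> tau t \<in> W1 \<inter> W2"
    unfolding eventually_at by (auto simp: dist_real_def)
  have "t \<in> ret_dom \<and> \<bar>first_ret t - t1\<bar> < eta" if t: "t \<in> D" "\<bar>t - t0\<bar> < d" for t
  proof -
    have tW: "tau t \<in> W1" "tau t \<in> W2" using d(2)[OF t(1) _ t(2)] W1 W2 by (cases "t = t0"; auto)+
    obtain t' s where t': "t' \<in> D" "\<bar>t' - t1\<bar> < eta" "\<bar>s\<bar> < eps/2" "v r0 (tau t) = v s (tau t')"
      using U(3)[OF W2(3)[OF tW(2)]] by blast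
    have hit: "v (r0 - s) (tau t) = tau t'"
      using t'(4) by (metis add.commute ab_left_minus uminus_add_conv_diff v_0 v_add)
    have no: "v s' (tau t) \<notin> tau ` D" if s': "0 < s'" "s' < r0 - s" for s'
    proof
      assume h: "v s' (tau t) \<in> tau ` D"
      then have "eps \<le> s'" using hit_ge[OF t(1)] s' by blast
      moreover have "\<not> (eps/2 \<le> s' \<and> s' \<le> r0 - eps/2)" using W1(3)[OF tW(1), of s'] h by auto
      ultimately have "r0 - eps/2 < s'" using eps by auto
      obtain t'' where t'': "t'' \<in> D" "v s' (tau t) = tau t''" using h by auto
      have "v (r0 - s - s') (tau t'') = tau t'"
        unfolding t''(2)[symmetric] v_v using hit by simp
      moreover have "\<bar>r0 - s - s'\<bar> < eps" using t'(3) s' \<open>r0 - eps/2 < s'\<close> by linarith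
      ultimately have "r0 - s - s' = 0" using close_hits(1)[OF t''(1) t'(1)] by blast
      then show False using s' by simp
    qed
    have "0 < r0 - s" using t'(3) r0(1) eps by linarith
    from first_retI[OF t(1) t'(1) this hit no] t'(2) show ?thesis by auto
  qed
  then show ?thesis using d(1) unfolding t1_def by blast
qed

lemma first_ret_regular:
  assumes t0: "t0 \<in> ret_dom" "first_ret t0 \<in> D'"
  shows "continuous (at t0 within D) first_ret"
  unfolding continuous_within tendsto_iff
proof (intro allI impI)
  fix e :: real assume "e > 0"
  from first_ret_near[OF t0 this]
  show "\<forall>\<^sub>F x in at t0 within D. dist (first_ret x) (first_ret t0) < e"
    unfolding eventually_at by (auto simp: dist_real_def)
qed

section \<open>Iterated returns and limit sets\<close>

fun hit_time :: "nat => real => real" where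
  "hit_time 0 t = 0"
| "hit_time (Suc n) t = ret_time t + hit_time n (first_ret t)"

lemma hit_time:
  assumes "t \<in> D" "\<And>i. i < n ==> (first_ret ^^ i) t \<in> ret_dom"
  shows "(first_ret ^^ n) t \<in> D \<and> v (hit_time n t) (tau t) = tau ((first_ret ^^ n) t) \<and> n * eps \<le> hit_time n t"
  using assms
proof (induction n arbitrary: t)
  case (Suc n)
  have t: "t \<in> ret_dom" using Suc.prems(2)[of 0] by simp
  have "(first_ret ^^ i) (first_ret t) \<in> ret_dom" if "i < n" for i
    using Suc.prems(2)[of "Suc i"] that by (simp add: funpow_swap1)
  from Suc.IH[OF first_ret(1)[OF t] this]
  have IH: "(first_ret ^^ n) (first_ret t) \<in> D"
    "v (hit_time n (first_ret t)) (tau (first_ret t)) = tau ((first_ret ^^ n) (first_ret t))"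
    "n * eps \<le> hit_time n (first_ret t)" by auto
  have "v (hit_time (Suc n) t) (tau t) = v (hit_time n (first_ret t)) (tau (first_ret t))"
    unfolding first_ret(2)[OF t] by (simp add: add.commute)
  with IH ret_time(1)[OF t] show ?case by (simp add: funpow_swap1 algebra_simps)
qed simp

text \<open>Each return takes at least \<open>eps\<close>, which permits an induction on a bound
  \<open>k * eps\<close> for the elapsed time.\<close>

lemma hit_is_iterate:
  assumes "t \<in> D" "t' \<in> D" "0 < s" "v s (tau t) = tau t'"
  shows "\<exists>n\<ge>1. (\<forall>i<n. (first_ret ^^ i) t \<in> ret_dom) \<and> (first_ret ^^ n) t = t' \<and> hit_time n t = s"
proof -
  have "\<exists>n\<ge>1. (\<forall>i<n. (first_ret ^^ i) t \<in> ret_dom) \<and> (first_ret ^^ n) t = t' \<and> hit_time n t = s"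
    if "t \<in> D" "0 < s" "v s (tau t) = tau t'" "s < real k * eps" for t s k
    using that
  proof (induction k arbitrary: t s)
    case (Suc k)
    have t: "t \<in> ret_dom" unfolding ret_dom_def using Suc.prems assms(2) by auto
    have le: "ret_time t \<le> s" using ret_time(3)[OF t, of s] Suc.prems assms(2) by auto
    show ?case
    proof (cases "ret_time t = s")
      case True
      then have "first_ret t = t'"
        using first_ret[OF t] Suc.prems(3) assms(2) tau_inj by metis
      with True t show ?thesis by (intro exI[of _ 1]) auto
    next
      case False
      have "v (s - ret_time t) (tau (first_ret t)) = tau t'"
        unfolding first_ret(2)[OF t] using Suc.prems(3) by simp
      moreover have "s - ret_time t < real k * eps"
        using Suc.prems(4) ret_time(1)[OF t] by (simp add: algebra_simps)
      ultimately obtain n where n: "n \<ge> 1" "\<forall>i<n. (first_ret ^^ i) (first_ret t) \<in> ret_dom"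
        "(first_ret ^^ n) (first_ret t) = t'" "hit_time n (first_ret t) = s - ret_time t"
        using Suc.IH[OF first_ret(1)[OF t], of "s - ret_time t"] False le by auto
      have "\<forall>i<Suc n. (first_ret ^^ i) t \<in> ret_dom"
      proof (intro allI impI)
        fix i assume "i < Suc n"
        then show "(first_ret ^^ i) t \<in> ret_dom"
          using n(2) t by (cases i) (auto simp: funpow_swap1)
      qed
      with n show ?thesis by (intro exI[of _ "Suc n"]) (auto simp: funpow_swap1)
    qed
  qed simp
  moreover obtain k :: nat where "s / eps < k" using reals_Archimedean2 by blast
  ultimately show ?thesis using assms eps by (metis pos_divide_less_eq)
qed

lemma hit_time_mono:
  assumes "t \<in> D" "\<And>i. i < n ==> (first_ret ^^ i) t \<in> ret_dom" "m \<le> n"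
  shows "hit_time m t \<le> hit_time n t"
  using assms
proof (induction m arbitrary: n t)
  case 0
  then have "real n * eps \<le> hit_time n t" using hit_time[of t n] by blast
  moreover have "0 \<le> real n * eps" using eps by simp
  ultimately show ?case by simp
next
  case (Suc m)
  then obtain k where k: "n = Suc k" by (cases n) auto
  have t: "t \<in> ret_dom" using Suc.prems(2)[of 0] k by simp
  have "(first_ret ^^ i) (first_ret t) \<in> ret_dom" if "i < k" for i
    using Suc.prems(2)[of "Suc i"] that k by (simp add: funpow_swap1)
  from Suc.IH[OF first_ret(1)[OF t] this] Suc.prems(3) k show ?case by simp
qed

lemma recurrent_hits:
  assumes t: "t \<in> D'" and rec: "tau t \<in> om x" and "d > 0"
  shows "\<exists>t'\<in>D. \<exists>s\<ge>S. \<bar>t' - t\<bar> < d \<and> v s x = tau t'"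
proof -
  obtain U where U: "open U" "tau t \<in> U"
    "\<And>x. x \<in> U ==> \<exists>t'\<in>D. \<exists>s. \<bar>t' - t\<bar> < d \<and> \<bar>s\<bar> < 1 \<and> x = v s (tau t')"
    using box_nhd[OF t \<open>d > 0\<close>, of 1] by auto
  \<comment> \<open>The margin 1 pays for the time correction within the flow box, which is shorter
    than 1.\<close>
  obtain s where s: "s \<ge> S + 1" "v s x \<in> U" using rec U(1,2) unfolding omega_iff by blast
  obtain t' s' where t': "t' \<in> D" "\<bar>t' - t\<bar> < d" "\<bar>s'\<bar> < 1" "v s x = v s' (tau t')"
    using U(3)[OF s(2)] by blast
  have "v (s - s') x = tau t'"
    using t'(4) by (metis add.commute ab_left_minus uminus_add_conv_diff v_0 v_add)
  with t' s show ?thesis by (intro bexI[of _ t'] exI[of _ "s - s'"]) auto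
qed

text \<open>A recurrent orbit would hit the section close to \<open>t\<close> at late times; such
  hits are late iterates, and these keep away from \<open>t\<close>. An accumulation point of the
  iterates is an omega limit point because the \<open>k\<close>-th hit time is at least
  \<open>k * eps\<close>.\<close>

lemma wanders_nonrecurrent:
  assumes t: "t \<in> D'" and w: "wanders first_ret ret_dom {t \<in> D. tau t \<in> C} t"
  shows "tau t \<notin> om (tau t)" "om (tau t) \<inter> C \<noteq> {}"
proof -
  have tD: "t \<in> D" using t D'_sub by auto
  have dom: "(first_ret ^^ n) t \<in> ret_dom" for n using w by (simp add: wanders_def)
  show "tau t \<notin> om (tau t)"
  proof
    assume rec: "tau t \<in> om (tau t)"
    obtain d N where d: "d > 0" "\<And>n. n \<ge> N ==> d \<le> \<bar>(first_ret ^^ n) t - t\<bar>"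
      using w unfolding wanders_def by blast
    obtain t' s where t': "t' \<in> D" "s \<ge> max 1 (hit_time N t + 1)" "\<bar>t' - t\<bar> < d" "v s (tau t) = tau t'"
      using recurrent_hits[OF t rec d(1)] by blast
    obtain n where n: "(first_ret ^^ n) t = t'" "hit_time n t = s"
      using hit_is_iterate[OF tD t'(1) _ t'(4)] t'(2) by auto
    have "n \<ge> N"
    proof (rule ccontr)
      assume "\<not> n \<ge> N"
      then have "hit_time n t \<le> hit_time N t" using hit_time_mono[OF tD dom] by simp
      then show False using n(2) t'(2) by simp
    qed
    from d(2)[OF this] n(1) t'(3) show False by simp
  qed
  obtain s where s: "s \<in> D" "tau s \<in> C" "\<And>e N. e > 0 ==> \<exists>n\<ge>N. \<bar>(first_ret ^^ n) t - s\<bar> < e"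
    using w unfolding wanders_def by blast
  have "\<forall>k. \<exists>n\<ge>k. \<bar>(first_ret ^^ n) t - s\<bar> < inverse (real (Suc k))" using s(3) by simp
  then obtain m where m: "\<And>k. m k \<ge> k" "\<And>k. \<bar>(first_ret ^^ m k) t - s\<bar> < inverse (real (Suc k))" by metis
  have "(\<lambda>k. (first_ret ^^ m k) t - s) \<longlonglongrightarrow> 0"
    by (rule Lim_null_comparison[OF _ LIMSEQ_inverse_real_of_nat]) (use m(2) in \<open>auto simp: less_imp_le\<close>)
  then have lim: "(\<lambda>k. (first_ret ^^ m k) t) \<longlonglongrightarrow> s" by (simp add: LIM_zero_iff)
  have hits: "(first_ret ^^ n) t \<in> D \<and> v (hit_time n t) (tau t) = tau ((first_ret ^^ n) t) \<and> n * eps \<le> hit_time n t" for n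
    by (rule hit_time[OF tD dom])
  have "(\<lambda>k. tau ((first_ret ^^ m k) t)) \<longlonglongrightarrow> tau s"
    by (rule continuous_on_tendsto_compose[OF tau_cont lim s(1)]) (use hits in auto)
  then have "(\<lambda>k. v (hit_time (m k) t) (tau t)) \<longlonglongrightarrow> tau s" using hits by simp
  moreover have "filterlim (\<lambda>k. hit_time (m k) t) at_top sequentially"
  proof (rule filterlim_at_top_mono)
    show "filterlim (\<lambda>k. real k * eps) at_top sequentially"
      using eps by (intro filterlim_at_top_mult_tendsto_pos[OF tendsto_const _ filterlim_real_sequentially])
    have "real k * eps \<le> hit_time (m k) t" for k
      using hits[of "m k"] m(1)[of k] eps by (meson mult_right_mono less_imp_le of_nat_mono order_trans)
    then show "\<forall>\<^sub>F k in sequentially. real k * eps \<le> hit_time (m k) t" by simp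
  qed
  ultimately have "tau s \<in> om (tau t)" by (intro omegaI) auto
  with s(2) show "om (tau t) \<inter> C \<noteq> {}" by blast
qed

text \<open>The finitely many parameters without a flow box are removed from the interval. A flow
  box around one of the others is open, and its points lie on orbits of points of the
  interval.\<close>

lemma wandering_interval_open:
  assumes w: "wandering_interval first_ret ret_dom D {t \<in> D. tau t \<in> C}"
  shows "\<exists>V. open V \<and> V \<noteq> {} \<and> (\<forall>z\<in>V. z \<notin> om z \<and> om z \<inter> C \<noteq> {})"
proof -
  obtain l r where lr: "l < r" "{l<..<r} \<subseteq> D"
    "\<And>z. z \<in> {l<..<r} ==> wanders first_ret ret_dom {t \<in> D. tau t \<in> C} z"
    using w unfolding wandering_interval_def by blast
  have op: "open ({l<..<r} - (D - D'))"
    by (intro open_Diff finite_imp_closed D'_finite) auto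
  have "infinite {l<..<r}" using lr(1) by (rule infinite_Ioo)
  then have "{l<..<r} - (D - D') \<noteq> {}" using D'_finite by (metis Diff_eq_empty_iff finite_subset)
  then obtain t where t: "t \<in> {l<..<r} - (D - D')" by blast
  then obtain d where d: "d > 0" "ball t d \<subseteq> {l<..<r} - (D - D')" using openE[OF op] by blast
  have "t \<in> D'" using t lr by auto
  then obtain U where U: "open U" "tau t \<in> U"
    "\<And>x. x \<in> U ==> \<exists>t'\<in>D. \<exists>s. \<bar>t' - t\<bar> < d \<and> \<bar>s\<bar> < 1 \<and> x = v s (tau t')"
    using box_nhd[of t d 1] d(1) by auto
  have "z \<notin> om z \<and> om z \<inter> C \<noteq> {}" if z: "z \<in> U" for z
  proof -
    obtain t' s where t': "t' \<in> D" "\<bar>t' - t\<bar> < d" "z = v s (tau t')" using U(3)[OF z] by blast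
    have "t' \<in> ball t d" using t'(2) by (simp add: dist_real_def abs_minus_commute)
    with d(2) have t'2: "t' \<in> {l<..<r} - (D - D')" by blast
    then have "t' \<in> D'" using t'(1) by blast
    have "wanders first_ret ret_dom {t \<in> D. tau t \<in> C} t'" using t'2 lr(3) by blast
    from wanders_nonrecurrent[OF \<open>t' \<in> D'\<close> this]
    show ?thesis unfolding t'(3) using omega_invariant[of "v s (tau t')" "tau t'" "-s"] by auto
  qed
  with U show ?thesis by blast
qed

lemma rev_cross_section: "cross_section (rev_flow v) D D' tau eps"
proof (intro cross_section.intro rev_compact_flow cross_section_axioms.intro)
  show "inj_on (\<lambda>(t, s). rev_flow v s (tau t)) (D \<times> {-eps<..<eps})"
  proof (rule inj_onI)
    fix x y assume xy: "x \<in> D \<times> {-eps<..<eps}" "y \<in> D \<times> {-eps<..<eps}"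
      "(\<lambda>(t, s). rev_flow v s (tau t)) x = (\<lambda>(t, s). rev_flow v s (tau t)) y"
    obtain a b c d where [simp]: "x = (a, b)" "y = (c, d)" by fastforce
    have "(a, - b) = (c, - d)"
      by (rule inj_onD[OF box_inj]) (use xy in \<open>auto simp: rev_flow_def\<close>)
    then show "x = y" by simp
  qed
  fix t d e :: real assume "t \<in> D'" "0 < d" "0 < e"
  then obtain U where U: "open U" "tau t \<in> U"
    "\<And>x. x \<in> U ==> \<exists>t'\<in>D. \<exists>s. \<bar>t' - t\<bar> < d \<and> \<bar>s\<bar> < e \<and> x = v s (tau t')"
    using box_nhd[of t d e] by blast
  show "\<exists>U. open U \<and> tau t \<in> U \<and> (\<forall>x\<in>U. \<exists>t'\<in>D. \<exists>s. \<bar>t' - t\<bar> < d \<and> \<bar>s\<bar> < e \<and> x = rev_flow v s (tau t'))"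
  proof (intro exI conjI ballI)
    fix x assume "x \<in> U"
    then obtain t' s where "t' \<in> D" "\<bar>t' - t\<bar> < d" "\<bar>s\<bar> < e" "x = v s (tau t')" using U(3) by blast
    then show "\<exists>t'\<in>D. \<exists>s. \<bar>t' - t\<bar> < d \<and> \<bar>s\<bar> < e \<and> x = rev_flow v s (tau t')"
      by (intro bexI[of _ t'] exI[of _ "-s"]) (auto simp: rev_flow_def)
  qed (use U in auto)
qed (use cs_compact D'_sub D'_finite eps tau_cont cs_sides cs_some_side in auto)

end

text \<open>Wandering orbits stay in \<open>A\<close>, so only the values on \<open>A\<close>
  matter. This exchanges the return map of the reversed flow with the inverse
  \<open>the_inv_into\<close> of the return map.\<close>

lemma wandering_interval_cong:
  assumes "\<And>t. t \<in> A ==> f t = g t"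
  shows "wandering_interval f A D R = wandering_interval g A D R"
proof -
  have "wanders f A R z --> wanders g A R z" if eq: "\<And>t. t \<in> A ==> f t = g t" for z f g
  proof
    assume w: "wanders f A R z"
    have "(g ^^ n) z = (f ^^ n) z" for n
      by (induction n) (use w eq in \<open>auto simp: wanders_def\<close>)
    with w show "wanders g A R z" by (simp add: wanders_def)
  qed
  from this[of f g] this[of g f] assms have "wanders f A R = wanders g A R" by fastforce
  then show ?thesis by (simp add: wandering_interval_def)
qed

context cross_section
begin

interpretation bk: cross_section "rev_flow v" D D' tau eps
  by (rule rev_cross_section)

lemma back_first_ret:
  assumes "t \<in> ret_dom" shows "first_ret t \<in> bk.ret_dom" "bk.first_ret (first_ret t) = t"
proof -
  have tD: "t \<in> D" using assms ret_dom_sub by auto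
  have 1: "0 < ret_time t" using ret_time(1)[OF assms] eps by simp
  have 2: "rev_flow v (ret_time t) (tau (first_ret t)) = tau t"
    unfolding rev_flow_def first_ret(2)[OF assms] by simp
  have 3: "rev_flow v s (tau (first_ret t)) \<notin> tau ` D" if s: "0 < s" "s < ret_time t" for s
  proof -
    have "rev_flow v s (tau (first_ret t)) = v (ret_time t - s) (tau t)"
      unfolding rev_flow_def first_ret(2)[OF assms] by simp
    then show ?thesis using ret_time(3)[OF assms, of "ret_time t - s"] s by auto
  qed
  from bk.first_retI[OF first_ret(1)[OF assms] tD 1 2 3]
  show "first_ret t \<in> bk.ret_dom" "bk.first_ret (first_ret t) = t" by auto
qed

end

context cross_section
begin

interpretation bk: cross_section "rev_flow v" D D' tau eps
  by (rule rev_cross_section)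

text \<open>One inclusion is \<open>back_first_ret\<close>; the other is the same lemma for the
  reversed flow, whose reversal is the given one. The context is reopened to have that instance at
  hand.\<close>

lemma back_ret_dom: "bk.ret_dom = first_ret ` ret_dom"
proof
  show "first_ret ` ret_dom \<subseteq> bk.ret_dom" using back_first_ret by auto
  show "bk.ret_dom \<subseteq> first_ret ` ret_dom"
  proof
    fix t assume t: "t \<in> bk.ret_dom"
    from bk.back_first_ret[OF t] show "t \<in> first_ret ` ret_dom"
      by (metis image_eqI rev_flow_rev_flow)
  qed
qed

lemma wandering_interval_back_open:
  assumes "wandering_interval (the_inv_into ret_dom first_ret) (first_ret ` ret_dom) D {t \<in> D. tau t \<in> C}"
  shows "\<exists>V. open V \<and> V \<noteq> {} \<and> (\<forall>z\<in>V. z \<notin> al z \<and> al z \<inter> C \<noteq> {})"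
proof -
  have "wandering_interval bk.first_ret bk.ret_dom D {t \<in> D. tau t \<in> C}"
    unfolding back_ret_dom
    by (subst wandering_interval_cong[of _ _ "the_inv_into ret_dom first_ret"])
      (use assms back_first_ret the_inv_into_f_f[OF first_ret_inj] in auto)
  from bk.wandering_interval_open[OF this] show ?thesis by simp
qed

end

text \<open>The second alternative in the last assumption describes a point on the stable manifold of a
  saddle: nearby orbits pass the saddle and return near the points U on its unstable manifold.\<close>

locale return_system = cross_section v D D' tau eps
  for v :: "real => 'a::{t2_space, second_countable_topology} => 'a" and D D' tau eps +
  fixes K C :: "'a set"
  assumes K: "closed K" "invariant_set v K" and C: "closed C" "invariant_set v C"
    and K_D': "\<And>t. t \<in> D ==> tau t \<in> K ==> t \<in> D'"
    and passing: "\<And>q. q \<in> D ==> tau q \<in> K ==> q \<notin> ret_dom ==>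
      \<exists>U. finite U \<and> U \<subseteq> D' \<and> U \<inter> first_ret ` ret_dom = {} \<and>
        (\<forall>e>0. \<exists>d>0. \<forall>t\<in>D. 0 < \<bar>t - q\<bar> --> \<bar>t - q\<bar> < d --> t \<in> ret_dom \<and> (\<exists>u\<in>U. \<bar>first_ret t - u\<bar> < e))"
begin

lemma D'_near:
  assumes "t \<in> D'" shows "\<exists>d>0. \<forall>t'\<in>D. \<bar>t' - t\<bar> < d --> t' \<in> D'"
proof -
  obtain d where "d > 0" "\<And>x. x \<in> D - D' ==> x \<noteq> t ==> d \<le> dist t x"
    using finite_set_avoid[OF D'_finite, of t] by blast
  then show ?thesis
    using assms by (intro exI[of _ d]) (force simp: dist_real_def abs_minus_commute)
qed

lemma closed_preimage: "closed B ==> closed {t \<in> D. tau t \<in> B}"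
  using continuous_closed_preimage[OF tau_cont compact_imp_closed[OF cs_compact], of B]
  by (simp add: vimage_def Int_def conj_commute)

lemma invariant_preimage:
  assumes "invariant_set v B" "t \<in> ret_dom"
  shows "first_ret t \<in> {t \<in> D. tau t \<in> B} \<longleftrightarrow> t \<in> {t \<in> D. tau t \<in> B}"
proof -
  have "v (ret_time t) (tau t) \<in> B \<longleftrightarrow> tau t \<in> B"
    using assms(1) unfolding invariant_set_def
    by (metis add.commute ab_left_minus v_0 v_add)
  then show ?thesis using first_ret[OF assms(2)] assms(2) ret_dom_sub by auto
qed

text \<open>At a returning parameter over \<open>K\<close> the landing point is again over
  \<open>K\<close>, hence in \<open>D'\<close>, where the return map is regular. At a non-returning
  one the nearby returns land close to \<open>U\<close>, which lies in \<open>D'\<close> as well, so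
  the return map is continuous beside it.\<close>

sublocale return_map D "{t \<in> D. tau t \<in> K}" ret_dom "{t \<in> D. tau t \<in> C}" first_ret
proof
  show "closed {t \<in> D. tau t \<in> K}" "closed {t \<in> D. tau t \<in> C}"
    using closed_preimage K C by auto
  show "first_ret t \<in> {t \<in> D. tau t \<in> K} \<longleftrightarrow> t \<in> {t \<in> D. tau t \<in> K}"
    "first_ret t \<in> {t \<in> D. tau t \<in> C} \<longleftrightarrow> t \<in> {t \<in> D. tau t \<in> C}" if "t \<in> ret_dom" for t
    using invariant_preimage that K C by blast+
next
  fix q assume "q \<in> {t \<in> D. tau t \<in> K}"
  then have q: "q \<in> D" "tau q \<in> K" by auto
  have retK: "first_ret q \<in> D'" if "q \<in> ret_dom"
    using invariant_preimage[OF K(2) that] q K_D' by auto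
  show "\<exists>d>0. \<forall>t\<in>D. 0 < \<bar>t - q\<bar> --> \<bar>t - q\<bar> < d --> t \<in> ret_dom \<and> continuous (at t within D) first_ret"
  proof (cases "q \<in> ret_dom")
    case True
    obtain eta where eta: "eta > 0" "\<And>t'. t' \<in> D ==> \<bar>t' - first_ret q\<bar> < eta ==> t' \<in> D'"
      using D'_near[OF retK[OF True]] by blast
    obtain d where d: "d > 0"
      "\<And>t. t \<in> D ==> \<bar>t - q\<bar> < d ==> t \<in> ret_dom \<and> \<bar>first_ret t - first_ret q\<bar> < eta"
      using first_ret_near[OF True retK[OF True] eta(1)] by blast
    have "t \<in> ret_dom \<and> continuous (at t within D) first_ret" if "t \<in> D" "\<bar>t - q\<bar> < d" for t
      using d(2)[OF that] first_ret(1)[of t] eta(2)[of "first_ret t"] first_ret_regular[of t] by blast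
    with d(1) show ?thesis by blast
  next
    case False
    obtain U where U: "finite U" "U \<subseteq> D'" "\<And>e. e > 0 ==>
      \<exists>d>0. \<forall>t\<in>D. 0 < \<bar>t - q\<bar> --> \<bar>t - q\<bar> < d --> t \<in> ret_dom \<and> (\<exists>u\<in>U. \<bar>first_ret t - u\<bar> < e)"
      using passing[OF q False] by blast
    have "\<exists>eta>0. \<forall>u\<in>U. \<forall>t'\<in>D. \<bar>t' - u\<bar> < eta --> t' \<in> D'"
      using U(1,2)
    proof (induction U rule: finite_induct)
      case empty
      show ?case by (intro exI[of _ 1]) auto
    next
      case (insert u U)
      obtain eta1 where 1: "eta1 > 0" "\<forall>u\<in>U. \<forall>t'\<in>D. \<bar>t' - u\<bar> < eta1 --> t' \<in> D'" using insert by auto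
      obtain eta2 where 2: "eta2 > 0" "\<forall>t'\<in>D. \<bar>t' - u\<bar> < eta2 --> t' \<in> D'" using D'_near[of u] insert by auto
      show ?case using 1 2 by (intro exI[of _ "min eta1 eta2"]) auto
    qed
    then obtain eta where eta: "eta > 0" "\<And>u t'. u \<in> U ==> t' \<in> D ==> \<bar>t' - u\<bar> < eta ==> t' \<in> D'" by blast
    obtain d where d: "d > 0"
      "\<And>t. t \<in> D ==> 0 < \<bar>t - q\<bar> ==> \<bar>t - q\<bar> < d ==> t \<in> ret_dom \<and> (\<exists>u\<in>U. \<bar>first_ret t - u\<bar> < eta)"
      using U(3)[OF eta(1)] by blast
    have "t \<in> ret_dom \<and> continuous (at t within D) first_ret" if "t \<in> D" "0 < \<bar>t - q\<bar>" "\<bar>t - q\<bar> < d" for t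
      using d(2)[OF that] first_ret(1)[of t] eta(2)[of _ "first_ret t"] first_ret_regular[of t] by blast
    with d(1) show ?thesis by blast
  qed
  show "q \<in> ret_dom \<and> continuous (at q within D) first_ret \<or>
      q \<notin> ret_dom \<and> (\<exists>U. finite U \<and> U \<subseteq> D \<and> U \<inter> first_ret ` ret_dom = {} \<and>
        (\<forall>e>0. \<exists>d>0. \<forall>t\<in>D. 0 < \<bar>t - q\<bar> --> \<bar>t - q\<bar> < d --> (\<exists>u\<in>U. \<bar>first_ret t - u\<bar> < e)))"
  proof (cases "q \<in> ret_dom")
    case True
    then show ?thesis using first_ret_regular[OF True retK[OF True]] by blast
  next
    case False
    obtain U where U: "finite U" "U \<subseteq> D'" "U \<inter> first_ret ` ret_dom = {}" "\<And>e. e > 0 ==>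
      \<exists>d>0. \<forall>t\<in>D. 0 < \<bar>t - q\<bar> --> \<bar>t - q\<bar> < d --> t \<in> ret_dom \<and> (\<exists>u\<in>U. \<bar>first_ret t - u\<bar> < e)"
      using passing[OF q False] by blast
    have "\<exists>d>0. \<forall>t\<in>D. 0 < \<bar>t - q\<bar> --> \<bar>t - q\<bar> < d --> (\<exists>u\<in>U. \<bar>first_ret t - u\<bar> < e)" if "e > 0" for e
      using U(4)[OF that] by blast
    with False U D'_sub show ?thesis by (intro disjI2 conjI exI[of _ U]) auto
  qed
qed (use cs_compact ret_dom_sub first_ret first_ret_inj cs_sides cs_some_side in auto)

section \<open>From orbits with the limit set \<open>K\<close> to wandering intervals and captured
  open sets\<close>

lemma trap_open:
  assumes "wandering_either first_ret ret_dom D {t \<in> D. tau t \<in> C}"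
  shows "\<exists>V. open V \<and> V \<noteq> {} \<and> captured v V C"
  using assms wandering_interval_open[of C] wandering_interval_back_open[of C] by blast

text \<open>The orbit of \<open>x\<close> misses \<open>K\<close> but hits the section for ever. Its
  successive hits are distinct by nonperiodicity, and they cluster only over the omega limit set
  \<open>K\<close>.\<close>

lemma trap_nonrecurrent:
  assumes x: "x \<notin> Sing v" "\<not> periodic v x" and Kx: "K = om x" "x \<notin> K"
    and C_x: "C = closure (orbit v x)"
    and hits: "\<And>S. \<exists>s\<ge>S. v s x \<in> tau ` D"
  shows "wandering_either first_ret ret_dom D {t \<in> D. tau t \<in> C}"
proof -
  obtain s0 t0 where t0: "t0 \<in> D" "v s0 x = tau t0" using hits[of 0] by blast
  have dom: "(first_ret ^^ n) t0 \<in> ret_dom \<and> (\<exists>s. v s x = tau ((first_ret ^^ n) t0))" for n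
  proof (induction n)
    case 0
    obtain s where "s \<ge> s0 + 1" "v s x \<in> tau ` D" using hits by blast
    then have "0 < s - s0" "v (s - s0) (tau t0) \<in> tau ` D" unfolding t0(2)[symmetric] by simp_all
    then have "t0 \<in> ret_dom" using t0(1) unfolding ret_dom_def by blast
    then show ?case using t0 by auto
  next
    case (Suc n)
    then obtain s where s: "v s x = tau ((first_ret ^^ n) t0)" and d: "(first_ret ^^ n) t0 \<in> ret_dom" by blast
    have e: "v (ret_time ((first_ret ^^ n) t0) + s) x = tau ((first_ret ^^ Suc n) t0)"
      using first_ret(2)[OF d] s by (simp add: v_add)
    obtain s' where s': "s' \<ge> ret_time ((first_ret ^^ n) t0) + s + 1" "v s' x \<in> tau ` D" using hits by blast
    define delta where "delta = s' - (ret_time ((first_ret ^^ n) t0) + s)"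
    have "v delta (tau ((first_ret ^^ Suc n) t0)) \<in> tau ` D"
      unfolding e[symmetric] using s'(2) by (simp add: delta_def)
    moreover have "0 < delta" using s'(1) by (simp add: delta_def)
    moreover have "(first_ret ^^ Suc n) t0 \<in> D" using first_ret(1)[OF d] by simp
    ultimately have "(first_ret ^^ Suc n) t0 \<in> ret_dom" unfolding ret_dom_def by blast
    with e show ?case by blast
  qed
  define t where "t n = (first_ret ^^ n) t0" for n
  have tdom: "t n \<in> ret_dom" and orb: "\<exists>s. v s x = tau (t n)" for n using dom by (auto simp: t_def)
  have tD: "t n \<in> D" for n using tdom ret_dom_sub by blast
  have notK: "tau (t n) \<notin> K" for n
    using orb[of n] K(2) Kx(2) unfolding invariant_set_def by (metis add.commute ab_left_minus v_0 v_add)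
  show ?thesis
  proof (rule wandering_if_nonrecurrent[of t])
    show "t n \<in> ret_dom" for n by (rule tdom)
    show "t n \<notin> {t \<in> D. tau t \<in> K}" for n using notK by auto
    show "t (Suc n) = first_ret (t n)" for n by (simp add: t_def)
    show "inj t"
    proof (rule linorder_injI)
      fix i j :: nat assume ij: "i < j"
      have "v (hit_time i t0) (tau t0) = tau (t i)" "v (hit_time j t0) (tau t0) = tau (t j)"
        using hit_time[OF t0(1)] dom unfolding t_def by blast+
      moreover have "hit_time i t0 \<noteq> hit_time j t0"
      proof -
        have "hit_time (Suc i) t0 \<le> hit_time j t0"
          using hit_time_mono[OF t0(1), of j "Suc i"] dom ij by auto
        moreover have "hit_time (Suc i) t0 > hit_time i t0"
        proof -
          have "hit_time (Suc n) t = hit_time n t + ret_time ((first_ret ^^ n) t)" for n t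
            by (induction n arbitrary: t) (auto simp: funpow_swap1)
          then show ?thesis using ret_time(1)[of "(first_ret ^^ i) t0"] dom[of i] eps by simp
        qed
        ultimately show ?thesis by simp
      qed
      ultimately show "t i \<noteq> t j"
        using nonperiodic_inj[OF x, of "hit_time i t0 + s0" "hit_time j t0 + s0"]
        unfolding t0(2)[symmetric] v_v by auto
    qed
    show "{t \<in> D. tau t \<in> K} \<subseteq> {t \<in> D. tau t \<in> C}"
      using omega_subset_closure_orbit Kx C_x by auto
    show "t 0 \<in> {t \<in> D. tau t \<in> C}"
      using t0 tD[of 0] C_x closure_subset[of "orbit v x"] in_orbit(1)[of s0 x] by (auto simp: t_def)
    fix s assume acc: "\<And>e N. e > 0 ==> \<exists>n\<ge>N. \<bar>t n - s\<bar> < e"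
    have "\<forall>k. \<exists>n\<ge>k. \<bar>t n - s\<bar> < inverse (real (Suc k))" using acc by simp
    then obtain m where m: "\<And>k. m k \<ge> k" "\<And>k. \<bar>t (m k) - s\<bar> < inverse (real (Suc k))" by metis
    have "(\<lambda>k. t (m k) - s) \<longlonglongrightarrow> 0"
      by (rule Lim_null_comparison[OF _ LIMSEQ_inverse_real_of_nat]) (use m(2) in \<open>auto simp: less_imp_le\<close>)
    then have lim: "(\<lambda>k. t (m k)) \<longlonglongrightarrow> s" by (simp add: LIM_zero_iff)
    have sD: "s \<in> D" by (rule closed_sequentially[OF compact_imp_closed[OF cs_compact] _ lim]) (rule tD)
    have hit: "v (hit_time n t0) (tau t0) = tau (t n)" "real n * eps \<le> hit_time n t0" for n
      using hit_time[OF t0(1), of n] dom unfolding t_def by blast+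
    have "(\<lambda>k. tau (t (m k))) \<longlonglongrightarrow> tau s"
      by (rule continuous_on_tendsto_compose[OF tau_cont lim sD]) (use tD in auto)
    then have "(\<lambda>k. v (hit_time (m k) t0) (tau t0)) \<longlonglongrightarrow> tau s" using hit by simp
    moreover have "filterlim (\<lambda>k. hit_time (m k) t0) at_top sequentially"
    proof (rule filterlim_at_top_mono)
      show "filterlim (\<lambda>k. real k * eps) at_top sequentially"
        using eps by (intro filterlim_at_top_mult_tendsto_pos[OF tendsto_const _ filterlim_real_sequentially])
      have "real k * eps \<le> hit_time (m k) t0" for k
        using hit(2)[of "m k"] m(1)[of k] eps by (meson mult_right_mono less_imp_le of_nat_mono order_trans)
      then show "\<forall>\<^sub>F k in sequentially. real k * eps \<le> hit_time (m k) t0" by simp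
    qed
    ultimately have "tau s \<in> om (tau t0)" by (intro omegaI) auto
    also have "om (tau t0) = K" unfolding t0(2)[symmetric] Kx(1) by simp
    finally show "s \<in> {t \<in> D. tau t \<in> K}" using sD by simp
  qed
qed

text \<open>Two hits near \<open>q\<close> whose times differ in absolute value have different
  parameters, since \<open>x\<close> is not periodic; at least one of them differs from
  \<open>q\<close>.\<close>

lemma recurrent_accumulates:
  assumes x: "x \<notin> Sing v" "\<not> periodic v x" and Kx: "K = om x \<or> K = al x"
    and q: "q \<in> D" "tau q \<in> K" and e: "e > 0"
  shows "\<exists>t\<in>D. tau t \<in> orbit v x \<and> t \<noteq> q \<and> \<bar>t - q\<bar> < e"
proof -
  interpret bk: cross_section "rev_flow v" D D' tau eps by (rule rev_cross_section)
  have hits: "\<exists>t\<in>D. \<exists>s. \<bar>t - q\<bar> < e \<and> v s x = tau t \<and> S < \<bar>s\<bar>" for S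
  proof -
    have q': "q \<in> D'" using K_D' q by blast
    consider "tau q \<in> om x" | "tau q \<in> omega_limit (rev_flow v) x" using Kx q(2) by auto
    then show ?thesis
    proof cases
      case 1
      from recurrent_hits[OF q' 1 e, of "\<bar>S\<bar> + 1"] show ?thesis by force
    next
      case 2
      from bk.recurrent_hits[OF q' 2 e, of "\<bar>S\<bar> + 1"] obtain t s
        where t: "t \<in> D" "s \<ge> \<bar>S\<bar> + 1" "\<bar>t - q\<bar> < e" "v (- s) x = tau t" unfolding rev_flow_def by blast
      have "S < \<bar>- s\<bar>" using t(2) by simp
      then show ?thesis using t by blast
    qed
  qed
  obtain t1 s1 where 1: "t1 \<in> D" "\<bar>t1 - q\<bar> < e" "v s1 x = tau t1" using hits by blast
  obtain t2 s2 where 2: "t2 \<in> D" "\<bar>t2 - q\<bar> < e" "v s2 x = tau t2" "\<bar>s1\<bar> < \<bar>s2\<bar>" using hits by blast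
  have "t1 \<noteq> t2" using nonperiodic_inj[OF x, of s1 s2] 1 2 by auto
  moreover have "tau t1 \<in> orbit v x" "tau t2 \<in> orbit v x"
    using 1 2 in_orbit(1)[of s1 x] in_orbit(1)[of s2 x] by simp_all
  ultimately show ?thesis using 1 2 by metis
qed

text \<open>The hits of the orbit of \<open>x\<close> are dense in the trace of \<open>K\<close>,
  and none of them is periodic under the return map, as this would give \<open>x\<close> a
  period.\<close>

lemma trap_recurrent:
  assumes x: "x \<notin> Sing v" "\<not> periodic v x" and Kx: "K = om x \<or> K = al x" "x \<in> K"
    and C_x: "C = closure (orbit v x)"
    and a: "gap a sg" "\<And>n. (first_ret ^^ n) a \<in> ret_dom"
  shows "wandering_either first_ret ret_dom D {t \<in> D. tau t \<in> C}"
proof -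
  define X where "X = {t \<in> D. tau t \<in> orbit v x}"
  have orbK: "orbit v x \<subseteq> K" using orbit_subset[OF K(2) Kx(2)] .
  show ?thesis
  proof (rule wandering_if_recurrent[OF a, of X])
    have "al x \<subseteq> closure (orbit v x)" using rev.omega_subset_closure_orbit[of x] by simp
    then show "{t \<in> D. tau t \<in> K} \<subseteq> {t \<in> D. tau t \<in> C}"
      using omega_subset_closure_orbit Kx C_x by auto
    show "X \<subseteq> {t \<in> D. tau t \<in> K}" using orbK by (auto simp: X_def)
    show "first_ret t \<in> X" if "t \<in> X" "t \<in> ret_dom" for t
      using invariant_preimage[OF orbit_invariant that(2), of x] that(1) by (simp add: X_def)
  next
    fix q e :: real assume "q \<in> {t \<in> D. tau t \<in> K}" and e: "e > 0"
    then have q: "q \<in> D" "tau q \<in> K" by auto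
    show "\<exists>t\<in>X. t \<noteq> q \<and> \<bar>t - q\<bar> < e"
      using recurrent_accumulates[OF x Kx(1) q e] by (auto simp: X_def)
  next
    fix t and m :: nat assume t: "t \<in> X" "1 \<le> m" "\<And>i. i < m ==> (first_ret ^^ i) t \<in> ret_dom"
    show "(first_ret ^^ m) t \<noteq> t"
    proof
      assume eq: "(first_ret ^^ m) t = t"
      have tD: "t \<in> D" using t by (simp add: X_def)
      obtain s where s: "tau t = v s x" using t(1) by (auto simp: X_def orbit_def)
      have "v (hit_time m t) (tau t) = tau t" and ge: "real m * eps \<le> hit_time m t"
        using hit_time[OF tD t(3)] eq by auto
      moreover have "0 < real m * eps" using t(2) eps by simp
      then have "hit_time m t > 0" using ge by linarith
      ultimately show False using nonperiodic_inj[OF x, of "hit_time m t + s" s] s by simp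
    qed
  qed
qed

text \<open>Recurrence leaves the trace of \<open>K\<close> without isolated points, and an interval
  inside the trace would sweep out an open subset of \<open>K\<close>.\<close>

lemma infinite_gaps_if_recurrent:
  assumes x: "x \<notin> Sing v" "\<not> periodic v x" and Kx: "K = om x" "x \<in> K"
    and ne: "{t \<in> D. tau t \<in> K} \<noteq> {}" and thin: "interior K = {}"
  shows "infinite {a. \<exists>sg. gap a sg}"
proof (rule infinite_gaps[OF ne])
  have orbK: "orbit v x \<subseteq> K" using orbit_subset[OF K(2) Kx(2)] .
  fix q e :: real assume "q \<in> {t \<in> D. tau t \<in> K}" "e > 0"
  then have "\<exists>t\<in>D. tau t \<in> orbit v x \<and> t \<noteq> q \<and> \<bar>t - q\<bar> < e"
    using recurrent_accumulates[OF x disjI1[OF Kx(1)]] by blast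
  then show "\<exists>t\<in>{t \<in> D. tau t \<in> K}. t \<noteq> q \<and> \<bar>t - q\<bar> < e" using orbK by blast
next
  fix l r :: real assume "l < r"
  show "\<not> {l<..<r} \<subseteq> {t \<in> D. tau t \<in> K}"
  proof
    assume sub: "{l<..<r} \<subseteq> {t \<in> D. tau t \<in> K}"
    define t d where "t = (l + r) / 2" and "d = (r - l) / 2"
    have t: "t \<in> {l<..<r}" "d > 0" using \<open>l < r\<close> by (auto simp: t_def d_def)
    then have "t \<in> D'" using sub K_D' by auto
    then obtain U where U: "open U" "tau t \<in> U"
      "\<And>x. x \<in> U ==> \<exists>t'\<in>D. \<exists>s. \<bar>t' - t\<bar> < d \<and> \<bar>s\<bar> < 1 \<and> x = v s (tau t')"
      using box_nhd[of t d 1] t(2) by auto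
    have "U \<subseteq> K"
    proof
      fix z assume "z \<in> U"
      then obtain t' s where t': "\<bar>t' - t\<bar> < d" "z = v s (tau t')" using U(3) by blast
      then have "t' \<in> {l<..<r}" by (auto simp: t_def d_def abs_less_iff field_simps)
      then have "tau t' \<in> K" using sub by blast
      then show "z \<in> K" using t'(2) K(2) by (simp add: invariant_set_def)
    qed
    with U thin show False by (metis empty_iff interior_maximal subsetD)
  qed
qed

end

section \<open>Transversal arcs\<close>

locale surface_flow = compact_flow v
  for v :: "real => 'a::{t2_space, second_countable_topology} => 'a" +
  assumes surf: "surface (UNIV :: 'a set)"
    and not_locally_dense: "\<And>x. \<not> locally_dense (orbit v x)"
begin

lemma rev_surface_flow: "surface_flow (rev_flow v)"
  by (intro surface_flow.intro rev_compact_flow surface_flow_axioms.intro)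
    (use surf not_locally_dense in auto)

lemma orbit_interior_empty: "open B ==> B \<subseteq> orbit v x ==> B = {}"
  using not_locally_dense[of x] unfolding locally_dense_def
  by (metis closure_subset interior_maximal interior_mono interior_open subset_empty)

end

lemma convex_half_plane: "convex half_plane"
proof -
  have *: "half_plane = {z. axis 1 1 \<bullet> z \<ge> 0}"
    unfolding half_plane_def by (auto simp: inner_axis')
  show ?thesis unfolding * by (rule convex_halfspace_ge)
qed

lemma flow_times_open: "compact_flow v ==> open U ==> open {s. v s x \<in> U}"
proof -
  assume f: "compact_flow v" "open U"
  interpret compact_flow v by fact
  have "continuous_on UNIV (\<lambda>s. v s x)" by (intro continuous_intros)
  from open_vimage[OF f(2) this] show ?thesis by (simp add: vimage_def)
qed

context compact_flow
begin

text \<open>Averaging a function along the flow makes it differentiable along the flow, and the derivative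
  is the difference of two values of the function.\<close>

lemma increasing_function:
  fixes phi :: "'a => real"
  assumes U: "open U" "y \<in> U" and y: "y \<notin> Sing v"
    and phi: "continuous_on U phi" "\<And>z. z \<in> U ==> z \<noteq> y ==> 0 < phi z" "phi y = 0"
  obtains W W0 E and theta :: "'a => real" where "open W" "open W0" "y \<in> W" "E > 0" "continuous_on W0 theta"
    "\<And>z a. z \<in> W ==> \<bar>a\<bar> \<le> E ==> v a z \<in> W0 \<and> v a z \<in> U"
    "\<And>z a b. z \<in> W ==> -E \<le> a ==> a < b ==> b \<le> E ==> theta (v a z) < theta (v b z)"
proof -
  have opU: "open {s. v s y \<in> U}" by (rule flow_times_open) (use compact_flow_axioms U in auto)
  then obtain eta where eta: "eta > 0" "ball 0 eta \<subseteq> {s. v s y \<in> U}" using openE[OF opU, of 0] U by auto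
  \<comment> \<open>A regular point moves off itself at arbitrarily small times; \<open>t0\<close>
    is such a time for which the orbit segment is still in \<open>U\<close>.\<close>
  obtain t0 where t0: "0 < t0" "t0 < eta" "v t0 y \<noteq> y" using eventually_const_Sing[OF eta(1), of y] y by blast
  have inU: "v s y \<in> U" if "\<bar>s\<bar> < eta" for s using eta(2) that by (auto simp: dist_real_def)
  define m where "m = phi (v t0 y)"
  have m: "m > 0" unfolding m_def using phi(2) inU[of t0] t0 by auto
  \<comment> \<open>Low values near the start, high values near the time \<open>t0\<close>. The two
    thresholds, thirds of \<open>m\<close>, leave a definite difference between them.\<close>
  define L where "L = {z \<in> U. phi z < m/3}"
  define H where "H = {z \<in> U. 2*m/3 < phi z}"
  have "openin (top_of_set U) (U \<inter> phi -` {..<m/3})" "openin (top_of_set U) (U \<inter> phi -` {2*m/3<..})"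
    using phi(1) by (auto intro: continuous_openin_preimage_gen)
  then have op: "open L" "open H"
    using U(1) unfolding L_def H_def by (auto simp: openin_open_eq vimage_def Int_def)
  have "0 \<in> {s. v s y \<in> L}" "t0 \<in> {s. v s y \<in> H}"
    using U m inU[of t0] t0 phi(3) by (auto simp: L_def H_def m_def)
  then obtain e1 e2 where e1: "e1 > 0" "ball 0 e1 \<subseteq> {s. v s y \<in> L}" and e2: "e2 > 0" "ball t0 e2 \<subseteq> {s. v s y \<in> H}"
    using openE[OF flow_times_open[OF compact_flow_axioms op(1)]] openE[OF flow_times_open[OF compact_flow_axioms op(2)]]
    by metis
  define e where "e = min (min e1 e2) (min (eta - t0) t0) / 2"
  have "2 * e > 0" "2 * e \<le> e1" "2 * e \<le> e2" "2 * e \<le> eta - t0" "2 * e \<le> t0"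
    using e1 e2 t0 by (simp_all add: e_def)
  then have e: "e > 0" "e < e1" "e < e2" "t0 + e < eta" "e < t0" by simp_all
  obtain Wa where Wa: "open Wa" "y \<in> Wa" "\<forall>z\<in>Wa. \<forall>s\<in>{-e..t0+e}. v s z \<in> U"
  proof -
    have "v s y \<in> U" if "s \<in> {-e..t0+e}" for s
      using inU[of s] e that t0 by (auto simp: abs_less_iff)
    from tube[OF compact_Icc U(1) this] that show ?thesis by blast
  qed
  obtain Wb where Wb: "open Wb" "y \<in> Wb" "\<forall>z\<in>Wb. \<forall>s\<in>{-e..e}. v s z \<in> L"
  proof -
    have "v s y \<in> L" if "s \<in> {-e..e}" for s
    proof -
      have "s \<in> ball 0 e1" using that e by (auto simp: dist_real_def)
      then show ?thesis using e1 by blast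
    qed
    from tube[OF compact_Icc op(1) this] that show ?thesis by blast
  qed
  obtain Wc where Wc: "open Wc" "y \<in> Wc" "\<forall>z\<in>Wc. \<forall>s\<in>{t0-e..t0+e}. v s z \<in> H"
  proof -
    have "v s y \<in> H" if "s \<in> {t0-e..t0+e}" for s
    proof -
      have "s \<in> ball t0 e2" using that e by (auto simp: dist_real_def abs_less_iff)
      then show ?thesis using e2 by blast
    qed
    from tube[OF compact_Icc op(2) this] that show ?thesis by blast
  qed
  define W where "W = Wa \<inter> Wb \<inter> Wc"
  define W0 where "W0 = {z. \<forall>s\<in>{0..t0}. v s z \<in> U}"
  define theta where "theta z = integral (cbox 0 t0) (\<lambda>s. phi (v s z))" for z
  have cont0: "continuous_on (W0 \<times> cbox 0 t0) (\<lambda>(z, s). phi (v s z))"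
    unfolding case_prod_beta
  proof (rule continuous_on_compose2[OF phi(1)])
    show "continuous_on (W0 \<times> cbox 0 t0) (\<lambda>x. v (snd x) (fst x))" by (intro continuous_intros)
  qed (auto simp: W0_def)
  show ?thesis
  proof (rule that[of W W0 e theta])
    show "open W" "y \<in> W" using Wa Wb Wc by (auto simp: W_def)
    show "e > 0" by (rule e)
    show "open W0"
    proof (subst open_subopen, intro ballI)
      fix z assume "z \<in> W0"
      then have "\<exists>T. open T \<and> z \<in> T \<and> (\<forall>z\<in>T. \<forall>s\<in>{0..t0}. v s z \<in> U)"
        by (intro tube U(1)) (auto simp: W0_def)
      then show "\<exists>T. open T \<and> z \<in> T \<and> T \<subseteq> W0" by (auto simp: W0_def)
    qed
    show "continuous_on W0 theta" unfolding theta_def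
      by (rule integral_continuous_on_param[of W0 0 t0 "\<lambda>z s. phi (v s z)"]) (rule cont0)
    show "v a z \<in> W0 \<and> v a z \<in> U" if "z \<in> W" "\<bar>a\<bar> \<le> e" for z a
    proof -
      have "v s z \<in> U" if "s \<in> {-e..t0+e}" for s using Wa(3) \<open>z \<in> W\<close> that by (auto simp: W_def)
      from this[of "s + a" for s] this[of a] show ?thesis
        using \<open>\<bar>a\<bar> \<le> e\<close> t0(1) by (auto simp: W0_def abs_le_iff)
    qed
    fix z a b assume z: "z \<in> W" and ab: "-e \<le> a" "a < b" "b \<le> e"
    define psi where "psi s = phi (v s z)" for s
    have cont: "continuous_on {-e..t0+e} psi"
      unfolding psi_def by (rule continuous_on_compose2[OF phi(1)])
        (use Wa(3) z in \<open>auto intro!: continuous_intros simp: W_def\<close>)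
    have int: "psi integrable_on {l..r}" if "-e \<le> l" "r \<le> t0 + e" for l r
      by (rule integrable_continuous_interval, rule continuous_on_subset[OF cont]) (use that in auto)
    have shift: "theta (v c z) = integral {c..c+t0} psi" if "-e \<le> c" "c \<le> e" for c
    proof -
      have "integral {0..t0} (psi \<circ> (\<lambda>x. x + c)) = integral {0 + c..t0 + c} psi"
        by (rule integral_shift, rule continuous_on_subset[OF cont]) (use that in auto)
      then show ?thesis by (simp add: theta_def psi_def o_def add.commute)
    qed
    have "integral {a..b} psi + integral {b..b+t0} psi = integral {a..b+t0} psi"
      by (rule Henstock_Kurzweil_Integration.integral_combine) (use ab t0 in \<open>auto intro: int\<close>)
    moreover have "integral {a..a+t0} psi + integral {a+t0..b+t0} psi = integral {a..b+t0} psi"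
      by (rule Henstock_Kurzweil_Integration.integral_combine) (use ab t0 in \<open>auto intro: int\<close>)
    \<comment> \<open>Moving the window of length \<open>t0\<close> from \<open>a\<close> to
      \<open>b\<close> gains an integral near the time \<open>t0\<close>, where \<open>psi\<close>
      is high, and loses one near the time 0, where it is low.\<close>
    ultimately have diff: "theta (v b z) - theta (v a z) = integral {a+t0..b+t0} psi - integral {a..b} psi"
      using shift[of a] shift[of b] ab by simp
    have low: "psi s \<le> m/3" if "s \<in> {a..b}" for s
    proof -
      have "v s z \<in> L" using Wb(3) z that ab by (auto simp: W_def)
      then show ?thesis by (simp add: psi_def L_def)
    qed
    have high: "2*m/3 \<le> psi s" if "s \<in> {a+t0..b+t0}" for s
    proof -
      have "v s z \<in> H" using Wc(3) z that ab by (auto simp: W_def)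
      then show ?thesis by (simp add: psi_def H_def)
    qed
    have "integral {a..b} psi \<le> integral {a..b} (\<lambda>_. m/3)"
      by (rule integral_le[OF int _ low]) (use ab t0 in auto)
    moreover have "integral {a+t0..b+t0} (\<lambda>_. 2*m/3) \<le> integral {a+t0..b+t0} psi"
      by (rule integral_le[OF _ int high]) (use ab t0 in auto)
    moreover have "integral {a..b} (\<lambda>_. m/3) = (b - a) * (m/3)"
      "integral {a+t0..b+t0} (\<lambda>_. 2*m/3) = (b - a) * (2*m/3)"
      using ab by simp_all
    ultimately have "(b - a) * (2*m/3) - (b - a) * (m/3) \<le> theta (v b z) - theta (v a z)"
      unfolding diff by linarith
    moreover have "(b - a) * (2*m/3) - (b - a) * (m/3) = (b - a) * (m/3)" by (simp add: field_simps)
    moreover have "(b - a) * (m/3) > 0" using ab m by simp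
    ultimately show "theta (v a z) < theta (v b z)" by linarith
  qed
qed

text \<open>A local section through y: W is a neighborhood of y, and \<open>v (kap z) z\<close> is the unique nearby
  point of the orbit of z on the section.\<close>

lemma local_section:
  fixes phi :: "'a => real"
  assumes U: "open U" "y \<in> U" and y: "y \<notin> Sing v"
    and phi: "continuous_on U phi" "\<And>z. z \<in> U ==> z \<noteq> y ==> 0 < phi z" "phi y = 0"
  obtains W eps and kap :: "'a => real" where "open W" "y \<in> W" "eps > 0" "continuous_on W kap" "kap y = 0"
    "\<And>z s. z \<in> W ==> \<bar>s\<bar> < eps ==> v (s + kap z) z \<in> U"
    "\<And>z z' s s'. z \<in> W ==> z' \<in> W ==> \<bar>s\<bar> < eps ==> \<bar>s'\<bar> < eps ==>
      v (s + kap z) z = v (s' + kap z') z' ==> s = s'"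
proof -
  obtain W W0 E and theta :: "'a => real" where W: "open W" "open W0" "y \<in> W" "E > 0" "continuous_on W0 theta"
    "\<And>z a. z \<in> W ==> \<bar>a\<bar> \<le> E ==> v a z \<in> W0 \<and> v a z \<in> U"
    "\<And>z a b. z \<in> W ==> -E \<le> a ==> a < b ==> b \<le> E ==> theta (v a z) < theta (v b z)"
    by (rule increasing_function[OF U y phi], assumption+, rule that)
  have mono: "theta (v a z) < theta (v b z) \<longleftrightarrow> a < b" if "z \<in> W" "\<bar>a\<bar> \<le> E" "\<bar>b\<bar> \<le> E" for z a b
    using W(7)[OF that(1), of a b] W(7)[OF that(1), of b a] that
    by (cases a b rule: linorder_cases) (auto simp: abs_le_iff)
  have contz: "continuous_on W (\<lambda>z. theta (v a z))" if "\<bar>a\<bar> \<le> E" for a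
    by (rule continuous_on_compose2[OF W(5)]) (use W(6) that in \<open>auto intro!: continuous_intros\<close>)
  have conta: "continuous_on {-E..E} (\<lambda>a. theta (v a z))" if "z \<in> W" for z
    by (rule continuous_on_compose2[OF W(5)]) (use W(6) that in \<open>auto intro!: continuous_intros\<close>)
  have op_gt: "open {z \<in> W. c < theta (v a z)}" and op_lt: "open {z \<in> W. theta (v a z) < c}" if "\<bar>a\<bar> \<le> E" for a c
  proof -
    have "openin (top_of_set W) (W \<inter> (\<lambda>z. theta (v a z)) -` {c<..})" "openin (top_of_set W) (W \<inter> (\<lambda>z. theta (v a z)) -` {..<c})"
      using contz[OF that] by (auto intro: continuous_openin_preimage_gen)
    then show "open {z \<in> W. c < theta (v a z)}" "open {z \<in> W. theta (v a z) < c}"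
      using W(1) by (auto simp: openin_open_eq vimage_def Int_def)
  qed
  \<comment> \<open>The section is the level set of \<open>theta\<close> through \<open>y\<close>.
    With \<open>eps = E/3\<close> the times \<open>s\<close>, \<open>s'\<close> and
    \<open>kap z\<close> together stay within the range \<open>E\<close> on which
    \<open>theta\<close> increases along orbits.\<close>
  define c eps where "c = theta y" and "eps = E/3"
  have eps: "eps > 0" "eps < E" using W(4) by (auto simp: eps_def)
  define W2 where "W2 = {z \<in> W. c < theta (v eps z)} \<inter> {z \<in> W. theta (v (-eps) z) < c}"
  have "open W2" unfolding W2_def using op_gt[of eps c] op_lt[of "-eps" c] eps by auto
  have "y \<in> W2" unfolding W2_def c_def using W(3) mono[of y 0 eps] mono[of y "-eps" 0] eps by auto
  have "\<exists>a. \<bar>a\<bar> < eps \<and> theta (v a z) = c" if z: "z \<in> W2" for z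
  proof -
    have "\<exists>a\<ge>-eps. a \<le> eps \<and> theta (v a z) = c"
      by (rule IVT') (use z eps in \<open>auto simp: W2_def intro!: continuous_on_subset[OF conta]\<close>)
    then obtain a where "-eps \<le> a" "a \<le> eps" "theta (v a z) = c" by blast
    moreover from this have "a \<noteq> -eps" "a \<noteq> eps" using z by (auto simp: W2_def)
    ultimately show ?thesis by (intro exI[of _ a]) auto
  qed
  then obtain kap where kap: "\<And>z. z \<in> W2 ==> \<bar>kap z\<bar> < eps" "\<And>z. z \<in> W2 ==> theta (v (kap z) z) = c" by metis
  have WW: "z \<in> W" if "z \<in> W2" for z using that by (auto simp: W2_def)
  have uniq: "a = kap z" if "z \<in> W2" "\<bar>a\<bar> \<le> E" "theta (v a z) = c" for z a
    using mono[OF WW[OF that(1)], of a "kap z"] mono[OF WW[OF that(1)], of "kap z" a] kap[OF that(1)] that eps by auto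
  show ?thesis
  proof (rule that[of W2 eps kap])
    show "open W2" "y \<in> W2" "eps > 0" by fact+
    show "kap y = 0" using uniq[of y 0] \<open>y \<in> W2\<close> W(4) by (simp add: c_def)
    show "continuous_on W2 kap"
      unfolding continuous_on_eq_continuous_at[OF \<open>open W2\<close>] continuous_at tendsto_iff
    proof (intro ballI allI impI)
      fix z and e :: real assume z: "z \<in> W2" and "e > 0"
      define eta where "eta = min e (eps - \<bar>kap z\<bar>) / 2"
      have eta: "eta > 0" "eta < e" "\<bar>kap z\<bar> + eta < eps" using \<open>e > 0\<close> kap(1)[OF z] by (auto simp: eta_def min_def field_simps)
      define N where "N = {w \<in> W. c < theta (v (kap z + eta) w)} \<inter> {w \<in> W. theta (v (kap z - eta) w) < c} \<inter> W2"
      have "open N" unfolding N_def using eta eps by (intro open_Int op_gt op_lt \<open>open W2\<close>) auto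
      moreover have "z \<in> N" unfolding N_def
        using z WW[OF z] mono[OF WW[OF z], of "kap z" "kap z + eta"] mono[OF WW[OF z], of "kap z - eta" "kap z"]
          kap(2)[OF z] eta eps by auto
      moreover have "dist (kap w) (kap z) < e" if w: "w \<in> N" for w
      proof -
        have w2: "w \<in> W2" "w \<in> W" using w by (auto simp: N_def)
        have "kap w < kap z + eta" "kap z - eta < kap w"
          using mono[OF w2(2), of "kap w" "kap z + eta"] mono[OF w2(2), of "kap z - eta" "kap w"]
            kap[OF w2(1)] w eta eps by (auto simp: N_def)
        then show ?thesis using eta by (auto simp: dist_real_def)
      qed
      ultimately show "\<forall>\<^sub>F x in at z. dist (kap x) (kap z) < e"
        unfolding eventually_at_topological by blast
    qed
    show "v (s + kap z) z \<in> U" if "z \<in> W2" "\<bar>s\<bar> < eps" for z s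
      using W(6)[OF WW[OF that(1)], of "s + kap z"] kap(1)[OF that(1)] that(2) by (auto simp: eps_def)
    fix z z' s s' assume *: "z \<in> W2" "z' \<in> W2" "\<bar>s\<bar> < eps" "\<bar>s'\<bar> < eps" "v (s + kap z) z = v (s' + kap z') z'"
    from *(5) have "v (s - s' + kap z) z = v (kap z') z'"
      by (metis (no_types, opaque_lifting) add.assoc add.commute ab_left_minus add_0 uminus_add_conv_diff v_add v_0)
    then have "theta (v (s - s' + kap z) z) = c" using kap(2)[OF *(2)] by simp
    moreover have "\<bar>s - s' + kap z\<bar> \<le> E" using *(3,4) kap(1)[OF *(1)] by (auto simp: eps_def)
    ultimately have "s - s' + kap z = kap z" by (rule uniq[OF *(1), rotated])
    then show "s = s'" by simp
  qed
qed

end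

context surface_flow
begin

text \<open>Near a regular point there is a transversal arc, one-sided at the boundary of the surface.
  By local_section the nearby points of a local section are path connected; an arc in the
  section, moved by the flow, covers an open set by invariance of domain.\<close>

lemma transversal:
  assumes y: "y \<notin> Sing v"
  obtains X eps and c :: "real => 'a" where "X = {-1<..<1} \<or> X = {0..<1}" "eps > 0" "c 0 = y" "continuous_on X c"
    "inj_on (\<lambda>(t, s). v s (c t)) (X \<times> {-eps<..<eps})"
    "\<And>t d e. t \<in> X ==> 0 < d ==> 0 < e ==>
      \<exists>U. open U \<and> c t \<in> U \<and> (\<forall>x\<in>U. \<exists>t'\<in>X. \<exists>s. \<bar>t' - t\<bar> < d \<and> \<bar>s\<bar> < e \<and> x = v s (c t'))"
proof -
  obtain U V h g where U: "open U" "y \<in> U" and V: "openin (top_of_set half_plane) V"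
    and hom: "homeomorphism U V h g"
  proof -
    have "\<exists>U V. open U \<and> y \<in> U \<and> openin (top_of_set half_plane) V \<and> U homeomorphic V"
      using surf by (simp add: surface_def)
    with that show ?thesis unfolding homeomorphic_def by blast
  qed
  have h: "continuous_on U h" "continuous_on V g" "\<And>x. x \<in> U ==> g (h x) = x" "\<And>p. p \<in> V ==> h (g p) = p"
    "h ` U = V" "g ` V = U"
    using hom by (auto simp: homeomorphism_def)
  have open_image: "open (g ` B)" if "openin (top_of_set V) B" for B
  proof -
    have "openin (top_of_set U) (g ` B)"
      using homeomorphism_imp_open_map[OF homeomorphism_symD[OF hom] that] .
    then show ?thesis using U(1) by (simp add: openin_open_eq)
  qed
  obtain W eps and kap :: "'a => real" where W: "open W" "y \<in> W" "eps > 0" "continuous_on W kap" "kap y = 0"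
    "\<And>z s. z \<in> W ==> \<bar>s\<bar> < eps ==> v (s + kap z) z \<in> U"
    "\<And>z z' s s'. z \<in> W ==> z' \<in> W ==> \<bar>s\<bar> < eps ==> \<bar>s'\<bar> < eps ==>
      v (s + kap z) z = v (s' + kap z') z' ==> s = s'"
  proof -
    have 1: "continuous_on U (\<lambda>z. dist (h z) (h y))" by (intro continuous_intros h)
    have 2: "0 < dist (h z) (h y)" if "z \<in> U" "z \<noteq> y" for z using that h(3) U(2) by (metis zero_less_dist_iff)
    have 3: "dist (h y) (h y) = 0" by simp
    show ?thesis by (rule local_section[OF U y 1 2 3], assumption+, rule that)
  qed
  \<comment> \<open>Projection along the flow to the local section.\<close>
  define \<pi> where "\<pi> z = v (kap z) z" for z
  have \<pi>y: "\<pi> y = y" by (simp add: \<pi>_def W)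
  have \<pi>_cont: "continuous_on W \<pi>" unfolding \<pi>_def by (intro continuous_intros W)
  have \<pi>U: "v s (\<pi> z) \<in> U" if "z \<in> W" "\<bar>s\<bar> < eps" for z s using W(6)[OF that] by (simp add: \<pi>_def)
  have \<pi>_inj: "s = s' \<and> \<pi> z = \<pi> z'" if "z \<in> W" "z' \<in> W" "\<bar>s\<bar> < eps" "\<bar>s'\<bar> < eps" "v s (\<pi> z) = v s' (\<pi> z')" for z z' s s'
  proof -
    have s: "s = s'" using W(7)[OF that(1-4)] that(5) unfolding \<pi>_def v_v by blast
    then have "v s' (\<pi> z) = v s' (\<pi> z')" using that(5) by simp
    with s show ?thesis by (simp only: v_inj)
  qed
  define Bq where "Bq r = ball (h y) r \<inter> half_plane" for r
  have hyV: "h y \<in> V" using h(5) U(2) by blast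
  obtain r where r: "r > 0" "Bq r \<subseteq> V" "g ` Bq r \<subseteq> W"
  proof -
    have "continuous_on V g" by (rule h)
    then have "openin (top_of_set V) (V \<inter> g -` W)" using W(1) by (rule continuous_openin_preimage_gen)
    then have "openin (top_of_set half_plane) (V \<inter> g -` W)" using V openin_trans by blast
    moreover have "h y \<in> V \<inter> g -` W" using hyV h(3) U(2) W(2) by auto
    ultimately obtain r where "r > 0" "ball (h y) r \<inter> half_plane \<subseteq> V \<inter> g -` W"
      by (meson openin_contains_ball)
    with that show ?thesis unfolding Bq_def by blast
  qed
  have Bq_mono: "Bq r' \<subseteq> Bq r" if "r' \<le> r" for r' using that by (auto simp: Bq_def)
  have Bq_open: "openin (top_of_set V) (Bq r')" if "r' \<le> r" for r'
  proof -
    have "openin (top_of_set half_plane) (Bq r')" unfolding Bq_def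
      by (metis Int_commute open_ball openin_open_Int)
    then show ?thesis using Bq_mono[OF that] r(2) V
      by (meson openin_imp_subset openin_subset_trans subset_trans)
  qed
  have hyB: "h y \<in> Bq r'" if "r' > 0" for r'
    using that hyV V by (auto simp: Bq_def dest: openin_imp_subset)
  \<comment> \<open>The part of the local section reached from a half disc, seen in the chart. As a
    continuous image of a convex set it is path connected, hence any two of its points are joined by
    an arc.\<close>
  define P where "P r' = (\<lambda>p. h (\<pi> (g p))) ` Bq r'" for r'
  have \<pi>gU: "\<pi> (g p) \<in> U" if "p \<in> Bq r" for p using \<pi>U[of "g p" 0] r(3) that W(3) by auto
  have cont_hpg: "continuous_on (Bq r) (\<lambda>p. h (\<pi> (g p)))"
  proof -
    have "continuous_on (Bq r) g" using h(2) r(2) by (rule continuous_on_subset)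
    then have "continuous_on (Bq r) (\<lambda>p. \<pi> (g p))"
      by (rule continuous_on_compose2[OF \<pi>_cont]) (use r(3) in auto)
    then show ?thesis by (rule continuous_on_compose2[OF h(1)]) (use \<pi>gU in auto)
  qed
  have P_conn: "path_connected (P r')" if "r' \<le> r" for r'
    unfolding P_def
  proof (rule path_connected_continuous_image)
    show "continuous_on (Bq r') (\<lambda>p. h (\<pi> (g p)))" using cont_hpg Bq_mono[OF that] by (rule continuous_on_subset)
    show "path_connected (Bq r')" unfolding Bq_def
      by (intro convex_imp_path_connected convex_Int convex_ball convex_half_plane)
  qed
  have hyP: "h y \<in> P r'" if "r' > 0" for r'
    unfolding P_def by (rule image_eqI[OF _ hyB[OF that]]) (use h(3) U(2) \<pi>y in simp)
  have P_mono: "P r' \<subseteq> P r" if "r' \<le> r" for r' using Bq_mono[OF that] by (auto simp: P_def)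
  have PV: "P r \<subseteq> V" using \<pi>gU h(5) by (auto simp: P_def)
  have P_sec: "\<exists>z\<in>W. g p = \<pi> z" if p: "p \<in> P r" for p
  proof -
    obtain p' where p': "p' \<in> Bq r" "p = h (\<pi> (g p'))" using p by (auto simp: P_def)
    then show ?thesis using h(3)[OF \<pi>gU[OF p'(1)]] r(3) by auto
  qed
  have gP_inj: "s = s' \<and> p = p'"
    if pp: "p \<in> P r" "p' \<in> P r" "\<bar>s\<bar> < eps" "\<bar>s'\<bar> < eps" "v s (g p) = v s' (g p')" for p p' s s'
  proof -
    obtain z z' where z: "z \<in> W" "g p = \<pi> z" "z' \<in> W" "g p' = \<pi> z'" using P_sec pp(1,2) by metis
    have "s = s' \<and> \<pi> z = \<pi> z'" by (rule \<pi>_inj) (use z pp in auto)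
    then have "s = s'" "g p = g p'" using z by auto
    then show ?thesis using h(4) PV pp(1,2) by (metis subsetD)
  qed
  have gPU: "v s (g p) \<in> U" if "p \<in> P r" "\<bar>s\<bar> < eps" for p s
    using P_sec[OF that(1)] \<pi>U that(2) by auto
  have box_open: "open ((\<lambda>(t, s). v s (g (k t))) ` (T \<times> {-e<..<e}))"
      "inj_on (\<lambda>(t, s). v s (g (k t))) (T \<times> {-eps<..<eps})"
      "open ((\<lambda>(t, s). h (v s (g (k t)))) ` (T \<times> {-e<..<e}))"
    if k: "continuous_on T k" "k ` T \<subseteq> P r" "inj_on k T" and T: "open T" and e: "e \<le> eps" for k :: "real => real^2" and T e
  proof -
    show inj: "inj_on (\<lambda>(t, s). v s (g (k t))) (T \<times> {-eps<..<eps})"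
    proof (rule inj_onI)
      fix x x' assume x: "x \<in> T \<times> {-eps<..<eps}" "x' \<in> T \<times> {-eps<..<eps}"
        "(\<lambda>(t, s). v s (g (k t))) x = (\<lambda>(t, s). v s (g (k t))) x'"
      obtain t s t' s' where [simp]: "x = (t, s)" "x' = (t', s')" by fastforce
      have "s = s' \<and> k t = k t'" by (rule gP_inj) (use x k(2) in auto)
      then show "x = x'" using k(3) x by (auto dest: inj_onD)
    qed
    have sub: "(\<lambda>(t, s). v s (g (k t))) ` (T \<times> {-e<..<e}) \<subseteq> U"
      using gPU k(2) e by (auto simp: image_subset_iff)
    have "continuous_on (T \<times> {-e<..<e}) (\<lambda>(t, s). v s (g (k t)))"
      unfolding case_prod_beta
      by (intro continuous_intros continuous_on_compose2[OF h(2)] continuous_on_compose2[OF k(1)])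
        (use k(2) PV in \<open>auto simp: image_subset_iff subset_iff\<close>)
    then have ch: "continuous_on (T \<times> {-e<..<e}) (\<lambda>(t, s). h (v s (g (k t))))"
      using continuous_on_compose2[OF h(1) _ sub] by (auto simp: case_prod_beta)
    have ih: "inj_on (\<lambda>(t, s). h (v s (g (k t)))) (T \<times> {-e<..<e})"
    proof (rule inj_onI)
      fix x x' assume x: "x \<in> T \<times> {-e<..<e}" "x' \<in> T \<times> {-e<..<e}"
        "(\<lambda>(t, s). h (v s (g (k t)))) x = (\<lambda>(t, s). h (v s (g (k t)))) x'"
      let ?F = "\<lambda>(t, s). v s (g (k t))"
      have "?F x \<in> U" "?F x' \<in> U" using sub x(1,2) by blast+
      moreover have "h (?F x) = h (?F x')" using x(3) by (simp add: case_prod_beta)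
      ultimately have eq: "?F x = ?F x'" using h(3) by metis
      show "x = x'" by (rule inj_onD[OF inj eq]) (use x(1,2) e in auto)
    qed
    show oh: "open ((\<lambda>(t, s). h (v s (g (k t)))) ` (T \<times> {-e<..<e}))"
      by (rule invariance_of_domain_gen[OF _ ch ih]) (use T in \<open>auto intro: open_Times\<close>)
    have "(\<lambda>(t, s). h (v s (g (k t)))) ` (T \<times> {-e<..<e}) \<subseteq> V"
      using sub h(5) by (auto simp: image_subset_iff)
    then have "open (g ` ((\<lambda>(t, s). h (v s (g (k t)))) ` (T \<times> {-e<..<e})))"
      using oh by (intro open_image) (simp add: open_subset)
    moreover have "g ` ((\<lambda>(t, s). h (v s (g (k t)))) ` (T \<times> {-e<..<e})) = (\<lambda>(t, s). v s (g (k t))) ` (T \<times> {-e<..<e})"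
      unfolding image_image using sub h(3) by (intro image_cong refl) (auto simp: image_subset_iff)
    ultimately show "open ((\<lambda>(t, s). v s (g (k t))) ` (T \<times> {-e<..<e}))" by simp
  qed
  have arc_nhd: "\<exists>U. open U \<and> g (k t) \<in> U \<and> (\<forall>x\<in>U. \<exists>t'\<in>T. \<exists>s. \<bar>t' - t\<bar> < d \<and> \<bar>s\<bar> < e \<and> x = v s (g (k t')))"
    if k: "continuous_on T k" "k ` T \<subseteq> P r" "inj_on k T" and T: "open T" and t: "t \<in> T" and d: "d > 0" and e: "e > 0"
    for k :: "real => real^2" and T t d e
  proof -
    define T' where "T' = T \<inter> ball t d"
    define S where "S = (\<lambda>(t, s). v s (g (k t))) ` (T' \<times> {- min e eps<..<min e eps})"
    have "open S" unfolding S_def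
      by (rule box_open(1)) (use k T in \<open>auto simp: T'_def intro: continuous_on_subset inj_on_subset\<close>)
    moreover have "g (k t) \<in> S" unfolding S_def
      by (rule image_eqI[of _ _ "(t, 0)"]) (use t d e W(3) in \<open>auto simp: T'_def\<close>)
    moreover have "\<exists>t'\<in>T. \<exists>s. \<bar>t' - t\<bar> < d \<and> \<bar>s\<bar> < e \<and> x = v s (g (k t'))" if x: "x \<in> S" for x
    proof -
      obtain t' s where "t' \<in> T'" "s \<in> {- min e eps<..<min e eps}" "x = v s (g (k t'))"
        using x by (auto simp: S_def)
      then show ?thesis
        by (intro bexI[of _ t'] exI[of _ s]) (auto simp: T'_def dist_real_def abs_minus_commute abs_less_iff)
    qed
    ultimately show ?thesis by blast
  qed
  obtain a where a: "a \<in> P r" "a \<noteq> h y"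
  proof -
    \<comment> \<open>Otherwise an open neighbourhood of \<open>y\<close> would lie in the single
      orbit of \<open>y\<close>, which has no interior.\<close>
    have "\<not> P r \<subseteq> {h y}"
    proof
      assume one: "P r \<subseteq> {h y}"
      have "g p \<in> orbit v y" if p: "p \<in> Bq r" for p
      proof -
        have "h (\<pi> (g p)) = h y" using one p unfolding P_def by blast
        then have "\<pi> (g p) = y" using h(3)[OF \<pi>gU[OF p]] h(3)[OF U(2)] by metis
        then have "g p = v (- kap (g p)) y" unfolding \<pi>_def by (rule v_eq_iff[THEN iffD1])
        then show ?thesis using in_orbit(1)[of "- kap (g p)" y] by metis
      qed
      then have "g ` Bq r \<subseteq> orbit v y" by blast
      then have "g ` Bq r = {}" using open_image[OF Bq_open] by (intro orbit_interior_empty) auto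
      then show False using hyB[OF r(1)] by blast
    qed
    with that show ?thesis by blast
  qed
  obtain gamma where gamma: "arc gamma" "path_image gamma \<subseteq> P r" "pathstart gamma = h y" "pathfinish gamma = a"
    using P_conn[of r] a hyP[OF r(1)] unfolding path_connected_arcwise by (metis order_refl)
  have gamma_cont: "continuous_on {0..1} gamma" and gamma_inj: "inj_on gamma {0..1}" and gamma0: "gamma 0 = h y"
    and gammaP: "\<And>t. t \<in> {0..1} ==> gamma t \<in> P r"
    using gamma by (auto simp: arc_def path_def path_image_def pathstart_def)
  have avoid: "\<exists>r2>0. r2 \<le> r \<and> P r2 \<inter> gamma ` {b..1} = {}" if b: "0 < b" "b \<le> 1" for b
  proof -
    have "compact (gamma ` {b..1})"
      by (rule compact_continuous_image[OF continuous_on_subset[OF gamma_cont]]) (use b in auto)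
    then have "open (- gamma ` {b..1})" by (simp add: compact_imp_closed open_Compl)
    then have "openin (top_of_set (Bq r)) (Bq r \<inter> (\<lambda>p. h (\<pi> (g p))) -` (- gamma ` {b..1}))"
      by (rule continuous_openin_preimage_gen[OF cont_hpg])
    moreover have "openin (top_of_set half_plane) (Bq r)"
      unfolding Bq_def by (metis Int_commute open_ball openin_open_Int)
    ultimately have "openin (top_of_set half_plane) (Bq r \<inter> (\<lambda>p. h (\<pi> (g p))) -` (- gamma ` {b..1}))"
      using openin_trans by blast
    moreover have "h y \<in> Bq r \<inter> (\<lambda>p. h (\<pi> (g p))) -` (- gamma ` {b..1})"
    proof -
      have "h y \<notin> gamma ` {b..1}"
      proof
        assume "h y \<in> gamma ` {b..1}"
        then obtain x where "x \<in> {b..1}" "gamma 0 = gamma x" using gamma0 by auto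
        then show False using inj_onD[OF gamma_inj, of 0 x] b by auto
      qed
      then show ?thesis using hyB[OF r(1)] h(3)[OF U(2)] \<pi>y by simp
    qed
    ultimately obtain r2 where r2: "r2 > 0"
      "ball (h y) r2 \<inter> half_plane \<subseteq> Bq r \<inter> (\<lambda>p. h (\<pi> (g p))) -` (- gamma ` {b..1})"
      by (meson openin_contains_ball)
    have "Bq (min r r2) \<subseteq> ball (h y) r2 \<inter> half_plane" by (auto simp: Bq_def)
    then have "P (min r r2) \<inter> gamma ` {b..1} = {}" using r2(2) unfolding P_def by blast
    with r2 r(1) show ?thesis by (intro exI[of _ "min r r2"]) auto
  qed
  \<comment> \<open>Section points reached from the half disc of radius \<open>r2\<close> avoid the
    second half of \<open>gamma\<close>, so those that lie on \<open>gamma\<close> lie on its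
    initial half.\<close>
  obtain r2 where r2: "r2 > 0" "r2 \<le> r" "P r2 \<inter> gamma ` {1/2..1} = {}" using avoid[of "1/2"] by auto
  show ?thesis
  \<comment> \<open>Either \<open>gamma\<close> covers the section near \<open>y\<close>, and the
    transversal has \<open>y\<close> as its end; or some section point lies off
    \<open>gamma\<close>, and a second arc continues the transversal beyond
    \<open>y\<close>.\<close>
  proof (cases "P r2 \<subseteq> gamma ` {0..<1/2}")
    case True
    define k where "k t = gamma (t/2)" for t
    have k_cont: "continuous_on {0..<1} k" unfolding k_def
      by (rule continuous_on_compose2[OF gamma_cont]) (auto intro!: continuous_intros)
    have k_inj: "inj_on k {0..<1}"
      unfolding k_def by (rule inj_onI) (auto dest!: inj_onD[OF gamma_inj])
    have kP: "k ` {0..<1} \<subseteq> P r" using gammaP by (auto simp: k_def)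
    show ?thesis
    proof (rule that[of "{0..<1}" eps "\<lambda>t. g (k t)"])
      show "eps > 0" by (rule W)
      show "g (k 0) = y" using h(3) U(2) by (simp add: k_def gamma0)
      show "continuous_on {0..<1} (\<lambda>t. g (k t))"
        by (rule continuous_on_compose2[OF h(2) k_cont]) (use kP PV in auto)
      show "inj_on (\<lambda>(t, s). v s (g (k t))) ({0..<1} \<times> {-eps<..<eps})"
      proof (rule inj_onI)
        fix x x' assume x: "x \<in> {0..<1} \<times> {-eps<..<eps}" "x' \<in> {0..<1} \<times> {-eps<..<eps}"
          "(\<lambda>(t, s). v s (g (k t))) x = (\<lambda>(t, s). v s (g (k t))) x'"
        obtain t s t' s' where [simp]: "x = (t, s)" "x' = (t', s')" by fastforce
        have "s = s' \<and> k t = k t'" by (rule gP_inj) (use x kP in auto)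
        then show "x = x'" using k_inj x by (auto dest: inj_onD)
      qed
      fix t d e :: real assume t: "t \<in> {0..<1}" and d: "0 < d" and e: "0 < e"
      show "\<exists>U. open U \<and> g (k t) \<in> U \<and> (\<forall>x\<in>U. \<exists>t'\<in>{0..<1}. \<exists>s. \<bar>t' - t\<bar> < d \<and> \<bar>s\<bar> < e \<and> x = v s (g (k t')))"
      proof (cases "t = 0")
        case False
        have 1: "continuous_on {0<..<1} k" "k ` {0<..<1} \<subseteq> P r" "inj_on k {0<..<1}" "t \<in> {0<..<1}"
          using k_cont kP k_inj t False by (auto intro: continuous_on_subset inj_on_subset)
        obtain U where "open U" "g (k t) \<in> U" "\<forall>x\<in>U. \<exists>t'\<in>{0<..<1}. \<exists>s. \<bar>t' - t\<bar> < d \<and> \<bar>s\<bar> < e \<and> x = v s (g (k t'))"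
          using arc_nhd[OF 1(1-3) _ 1(4) d e] by auto
        then show ?thesis by (intro exI[of _ U]) (meson atLeastLessThan_iff greaterThanLessThan_iff less_imp_le)
      next
        case t0: True
        \<comment> \<open>Since \<open>k t\<close> is \<open>gamma (t/2)\<close>, parameters of
          \<open>gamma\<close> below \<open>d/2\<close> correspond to parameters of \<open>k\<close>
          below \<open>d\<close>.\<close>
        define b where "b = min (1/2) (d/2)"
        have b: "0 < b" "b \<le> 1" using d by (auto simp: b_def)
        obtain r3 where r3: "r3 > 0" "r3 \<le> r" "P r3 \<inter> gamma ` {b..1} = {}" using avoid[OF b] by blast
        define r4 where "r4 = min r2 r3"
        have r4: "r4 > 0" "r4 \<le> r" using r2 r3 by (auto simp: r4_def)
        define S where "S = g ` Bq r4 \<inter> (W \<inter> kap -` {-e<..<e})"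
        have "openin (top_of_set W) (W \<inter> kap -` {-e<..<e})"
          by (rule continuous_openin_preimage_gen[OF W(4)]) auto
        then have "open (W \<inter> kap -` {-e<..<e})" using W(1) by (simp add: openin_open_eq)
        then have "open S" unfolding S_def using open_image[OF Bq_open[OF r4(2)]] by blast
        moreover have "g (k t) \<in> S"
        proof -
          have "y \<in> g ` Bq r4" by (rule image_eqI[OF _ hyB[OF r4(1)]]) (use h(3)[OF U(2)] in simp)
          then show ?thesis unfolding S_def t0 using W(2,5) e h(3)[OF U(2)] by (simp add: k_def gamma0)
        qed
        moreover have "\<exists>t'\<in>{0..<1}. \<exists>s. \<bar>t' - t\<bar> < d \<and> \<bar>s\<bar> < e \<and> x = v s (g (k t'))" if x: "x \<in> S" for x
        proof -
          obtain p where p: "p \<in> Bq r4" "x = g p" using x by (auto simp: S_def)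
          define q where "q = h (\<pi> x)"
          have pr: "p \<in> Bq r" "p \<in> Bq r2" "p \<in> Bq r3" using p(1) r2(2) r3(2) by (auto simp: r4_def Bq_def)
          have "q \<in> P r2" "q \<in> P r3" using pr p(2) by (auto simp: P_def q_def)
          then obtain t'' where t'': "t'' \<in> {0..<1/2}" "q = gamma t''" using True by blast
          have "\<not> b \<le> t''" using \<open>q \<in> P r3\<close> r3(3) t'' by auto
          then have "2 * t'' < d" by (auto simp: b_def)
          have "g (k (2 * t'')) = \<pi> x"
            using t''(2) h(3)[OF \<pi>gU[OF pr(1)]] p(2) by (simp add: k_def q_def)
          then have "x = v (- kap x) (g (k (2 * t'')))" by (simp add: \<pi>_def)
          moreover have "\<bar>- kap x\<bar> < e" using x by (auto simp: S_def)
          ultimately show ?thesis using t''(1) \<open>2 * t'' < d\<close> t0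
            by (intro bexI[of _ "2 * t''"] exI[of _ "- kap x"]) auto
        qed
        ultimately show ?thesis by blast
      qed
    qed simp
  next
    case False
    then obtain b where b: "b \<in> P r2" "b \<notin> gamma ` {0..<1/2}" by blast
    then have bgamma: "b \<notin> gamma ` {0..1}" using r2(3) by (force simp: not_less)
    then have "b \<noteq> h y" using gamma0 by (metis atLeastAtMost_iff image_eqI order_refl zero_le_one)
    then obtain beta where beta: "arc beta" "path_image beta \<subseteq> P r2" "pathstart beta = h y" "pathfinish beta = b"
      using P_conn[OF r2(2)] b hyP[OF r2(1)] unfolding path_connected_arcwise by metis
    have beta_cont: "continuous_on {0..1} beta" and beta_inj: "inj_on beta {0..1}" and beta0: "beta 0 = h y" and beta1: "beta 1 = b"
      and betaP: "\<And>t. t \<in> {0..1} ==> beta t \<in> P r2"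
      using beta by (auto simp: arc_def path_def path_image_def pathstart_def pathfinish_def)
    have disj: "beta t \<notin> gamma ` {0..1}" if t: "0 < t" "t \<le> 1" for t
    proof
      assume bad: "beta t \<in> gamma ` {0..1}"
      define M where "M = {0..1} \<inter> beta -` (gamma ` {0..1})"
      have "compact (gamma ` {0..1})" by (rule compact_continuous_image[OF gamma_cont]) simp
      then have "closed M" unfolding M_def
        by (intro continuous_closed_preimage[OF beta_cont] compact_imp_closed) auto
      \<comment> \<open>The last parameter at which \<open>beta\<close> meets \<open>gamma\<close>.
        There \<open>gamma\<close> sweeps out an open set under the flow; \<open>beta\<close> enters
        this set just afterwards and, lying in the section, meets \<open>gamma\<close> once
        more.\<close>
      define t1 where "t1 = Sup M"
      have bdd: "bdd_above M" by (rule bdd_aboveI[of _ 1]) (auto simp: M_def)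
      have tM: "t \<in> M" using bad t by (auto simp: M_def)
      have t1M: "t1 \<in> M" unfolding t1_def by (rule closed_contains_Sup) (use tM bdd \<open>closed M\<close> in auto)
      have t1t: "t \<le> t1" unfolding t1_def using tM bdd by (rule cSup_upper)
      have t1_max: "x \<le> t1" if "x \<in> M" for x unfolding t1_def using that bdd by (rule cSup_upper)
      have t11: "t1 < 1" using t1M bgamma beta1 by (cases "t1 = 1") (auto simp: M_def)
      obtain t2 where t2: "t2 \<in> {0..1}" "beta t1 = gamma t2" using t1M by (auto simp: M_def)
      have "t2 \<noteq> 0"
      proof
        assume "t2 = 0"
        then have "t1 = 0" using inj_onD[OF beta_inj, of t1 0] t2 gamma0 beta0 t1M by (auto simp: M_def)
        then show False using t1t t by simp
      qed
      moreover have "\<not> 1/2 \<le> t2" using betaP[of t1] t1M t2 r2(3) by (auto simp: M_def)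
      ultimately have t2': "t2 \<in> {0<..<1}" using t2 by auto
      define S where "S = (\<lambda>(t, s). h (v s (g (gamma t)))) ` ({0<..<1} \<times> {-eps<..<eps})"
      have "open S" unfolding S_def
        by (rule box_open(3)) (use gammaP in \<open>auto intro: continuous_on_subset[OF gamma_cont] inj_on_subset[OF gamma_inj]\<close>)
      moreover have "beta t1 \<in> S" unfolding S_def t2(2)
        by (rule image_eqI[of _ _ "(t2, 0)"]) (use t2' W(3) gammaP[of t2] PV h(4) in auto)
      moreover have "(beta \<longlongrightarrow> beta t1) (at_right t1)"
      proof -
        have "(beta \<longlongrightarrow> beta t1) (at t1 within {0..1})" using beta_cont t1M by (auto simp: continuous_on_def M_def)
        then have "(beta \<longlongrightarrow> beta t1) (at t1 within {t1<..<1})"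
          by (rule tendsto_within_subset) (use t1M in \<open>auto simp: M_def\<close>)
        moreover have "at t1 within {t1<..<1} = at_right t1"
          by (rule at_within_nhd[of _ "{..<1}"]) (use t11 in auto)
        ultimately show ?thesis by simp
      qed
      ultimately have "\<forall>\<^sub>F x in at_right t1. beta x \<in> S" by (intro topological_tendstoD)
      moreover have "\<forall>\<^sub>F x in at_right t1. t1 < x \<and> x < 1"
        unfolding eventually_at_right_field using t11 by (intro exI[of _ 1]) auto
      ultimately have "\<forall>\<^sub>F x in at_right t1. t1 < x \<and> x < 1 \<and> beta x \<in> S" by eventually_elim auto
      then obtain x where x: "t1 < x" "x < 1" "beta x \<in> S"
        using eventually_happens'[OF trivial_limit_at_right_real] by blast
      obtain t3 s where ts: "t3 \<in> {0<..<1}" "s \<in> {-eps<..<eps}" "beta x = h (v s (g (gamma t3)))"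
        using x(3) by (auto simp: S_def)
      have x01: "x \<in> {0..1}" using x t1M by (auto simp: M_def)
      have betaxP: "beta x \<in> P r" using betaP[OF x01] P_mono[OF r2(2)] by blast
      have "v s (g (gamma t3)) \<in> U" using gPU[OF gammaP[of t3], of s] ts by auto
      then have "v 0 (g (beta x)) = v s (g (gamma t3))" using ts(3) h(3) by simp
      then have "beta x = gamma t3" using gP_inj[OF betaxP gammaP[of t3], of 0 s] ts W(3) by auto
      then have "x \<in> M" using x01 ts(1) by (auto simp: M_def)
      then show False using t1_max x(1) by fastforce
    qed
    define rho where "rho = reversepath beta +++ gamma"
    have "arc rho" unfolding rho_def
    proof (rule arc_join)
      show "path_image (reversepath beta) \<inter> path_image gamma \<subseteq> {pathstart gamma}"
      proof
        fix p assume p: "p \<in> path_image (reversepath beta) \<inter> path_image gamma"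
        then have "p \<in> path_image beta" and pgamma: "p \<in> gamma ` {0..1}" by (simp_all, simp add: path_image_def)
        then obtain t where t: "t \<in> {0..1}" "p = beta t" unfolding path_image_def by blast
        have "t = 0" using disj[of t] t pgamma by force
        then show "p \<in> {pathstart gamma}" using t beta0 gamma(3) by simp
      qed
    qed (use beta gamma in \<open>auto simp: arc_reversepath\<close>)
    have rhoP: "path_image rho \<subseteq> P r" unfolding rho_def
      using beta(2) gamma(2) P_mono[OF r2(2)] by (intro path_image_join_subset[THEN subset_trans]) auto
    have rhoh: "rho (1/2) = h y" unfolding rho_def using beta0 by (simp add: joinpaths_def reversepath_def)
    have rho_cont: "continuous_on {0..1} rho" and rho_inj: "inj_on rho {0..1}"
      using \<open>arc rho\<close> by (auto simp: arc_def path_def)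
    define k where "k t = rho ((1 + t)/2)" for t
    have k: "continuous_on {-1<..<1} k" "k ` {-1<..<1} \<subseteq> P r" "inj_on k {-1<..<1}"
    proof -
      show "continuous_on {-1<..<1} k" unfolding k_def
        by (rule continuous_on_compose2[OF rho_cont]) (auto intro!: continuous_intros)
      show "k ` {-1<..<1} \<subseteq> P r" using rhoP by (auto simp: k_def path_image_def)
      show "inj_on k {-1<..<1}" unfolding k_def by (rule inj_onI) (auto dest!: inj_onD[OF rho_inj])
    qed
    show ?thesis
    proof (rule that[of "{-1<..<1}" eps "\<lambda>t. g (k t)"])
      show "eps > 0" by (rule W)
      show "g (k 0) = y" using h(3) U(2) by (simp add: k_def rhoh)
      show "continuous_on {-1<..<1} (\<lambda>t. g (k t))"
        by (rule continuous_on_compose2[OF h(2) k(1)]) (use k(2) PV in auto)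
      show "inj_on (\<lambda>(t, s). v s (g (k t))) ({-1<..<1} \<times> {-eps<..<eps})"
        by (rule box_open(2)[OF k open_greaterThanLessThan order_refl])
    qed (use arc_nhd[OF k] in auto)
  qed
qed

end

section \<open>Hyperbolic saddles of planar flows\<close>

lemma flow_on_rev: "flow_on M psi ==> flow_on M (rev_flow psi)"
proof -
  assume f: "flow_on M psi"
  have "continuous_on (UNIV \<times> M) (\<lambda>(t, x). psi t x)" using f by (simp add: flow_on_def)
  then have "continuous_on (UNIV \<times> M) (\<lambda>z. (\<lambda>(t, x). psi t x) (- fst z, snd z))"
    by (rule continuous_on_compose2) (auto intro!: continuous_intros)
  moreover have "psi (- s - t) x = psi (- s) (psi (- t) x)" if "x \<in> M" for s t x
    using f that unfolding flow_on_def by (metis diff_conv_add_uminus)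
  ultimately show ?thesis
    using f by (auto simp: flow_on_def rev_flow_def case_prod_beta)
qed

lemma C1_flow_on_rev: "C1_flow_on M psi ==> C1_flow_on M (rev_flow psi)"
proof -
  assume c: "C1_flow_on M psi"
  then obtain D :: "real \<times> (real ^ 2) => (real \<times> (real ^ 2)) \<Rightarrow>\<^sub>L (real ^ 2)" where D: "continuous_on (UNIV \<times> M) D"
    "\<And>z. z \<in> UNIV \<times> M ==> ((\<lambda>(t, x). psi t x) has_derivative blinfun_apply (D z)) (at z within UNIV \<times> M)"
    unfolding C1_flow_on_def by blast
  define R :: "real \<times> (real^2) => real \<times> (real^2)" where "R z = (- fst z, snd z)" for z
  have R: "bounded_linear R"
    unfolding R_def by (intro bounded_linear_Pair bounded_linear_minus bounded_linear_fst bounded_linear_snd)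
  have Rim: "R ` (UNIV \<times> M) = UNIV \<times> M"
  proof
    show "UNIV \<times> M \<subseteq> R ` (UNIV \<times> M)"
    proof
      fix z :: "real \<times> (real^2)" assume "z \<in> UNIV \<times> M"
      then have "z = R (R z)" "R z \<in> UNIV \<times> M" by (auto simp: R_def)
      then show "z \<in> R ` (UNIV \<times> M)" by (rule image_eqI)
    qed
  qed (auto simp: R_def)
  define D' where "D' z = D (R z) o\<^sub>L Blinfun R" for z :: "real \<times> (real^2)"
  have "continuous_on (UNIV \<times> M) (\<lambda>z. D (R z))"
    by (rule continuous_on_compose2[OF D(1)])
      (use Rim in \<open>auto intro!: linear_continuous_on R\<close>)
  then have "continuous_on (UNIV \<times> M) D'" unfolding D'_def
    by (intro bounded_bilinear.continuous_on[OF bounded_bilinear_blinfun_compose] continuous_on_const)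
  moreover have "((\<lambda>(t, x). rev_flow psi t x) has_derivative blinfun_apply (D' z)) (at z within UNIV \<times> M)"
    if z: "z \<in> UNIV \<times> M" for z :: "real \<times> (real^2)"
  proof -
    have "R z \<in> UNIV \<times> M" using z Rim by blast
    then have "((\<lambda>(t, x). psi t x) has_derivative blinfun_apply (D (R z))) (at (R z) within R ` (UNIV \<times> M))"
      unfolding Rim by (rule D(2))
    from has_derivative_in_compose[OF bounded_linear_imp_has_derivative[OF R] this]
    have "((\<lambda>z. (\<lambda>(t, x). psi t x) (R z)) has_derivative (\<lambda>x. blinfun_apply (D (R z)) (R x))) (at z within UNIV \<times> M)" .
    moreover have "(\<lambda>z. (\<lambda>(t, x). psi t x) (R z)) = (\<lambda>(t, x). rev_flow psi t x)"
      by (auto simp: R_def rev_flow_def)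
    moreover have "(\<lambda>x. blinfun_apply (D (R z)) (R x)) = blinfun_apply (D' z)"
      by (simp add: D'_def bounded_linear_Blinfun_apply[OF R] fun_eq_iff)
    ultimately show ?thesis by simp
  qed
  ultimately show ?thesis
    using flow_on_rev c unfolding C1_flow_on_def by blast
qed

lemma C1_saddle_rev: "C1_saddle M psi q ==> C1_saddle M (rev_flow psi) q"
proof -
  assume s: "C1_saddle M psi q"
  then obtain L a b u w where L: "a < 0" "0 < b" "u \<noteq> 0" "w \<noteq> 0"
    "\<And>t. (psi t has_derivative L t) (at q within M) \<and>
             L t u = exp (a * t) *\<^sub>R u \<and> L t w = exp (b * t) *\<^sub>R w"
    unfolding C1_saddle_def by blast
  have "\<exists>L a b u w. a < 0 \<and> 0 < b \<and> u \<noteq> 0 \<and> w \<noteq> 0 \<and>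
        (\<forall>t. (rev_flow psi t has_derivative L t) (at q within M) \<and>
             L t u = exp (a * t) *\<^sub>R u \<and> L t w = exp (b * t) *\<^sub>R w)"
  proof (intro exI conjI allI)
    fix t
    have eq: "rev_flow psi t = psi (- t)" by (simp add: rev_flow_def fun_eq_iff)
    show "(rev_flow psi t has_derivative L (- t)) (at q within M)" unfolding eq using L by blast
    \<comment> \<open>Under reversal the expanding direction contracts, so the two eigenvectors
      change roles.\<close>
    show "L (- t) w = exp ((- b) * t) *\<^sub>R w" "L (- t) u = exp ((- a) * t) *\<^sub>R u"
      using L(5)[of "- t"] by auto
  qed (use L in auto)
  then show ?thesis using s C1_flow_on_rev unfolding C1_saddle_def by (auto simp: rev_flow_def)
qed

lemma stay_times_rev: "stay_times (rev_flow v) U y = uminus ` stay_times v U y"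
proof -
  have seg: "closed_segment 0 (- t) = uminus ` closed_segment 0 t" for t :: real
    by (auto simp: closed_segment_eq_real_ivl image_iff)
  have "t \<in> stay_times (rev_flow v) U y \<longleftrightarrow> - t \<in> stay_times v U y" for t
    by (simp only: stay_times_def rev_flow_def mem_Collect_eq seg ball_simps)
  note iff = this
  show ?thesis
  proof (intro equalityI subsetI)
    fix t assume "t \<in> stay_times (rev_flow v) U y"
    then have "- (- t) \<in> uminus ` stay_times v U y" using iff by (intro imageI) blast
    then show "t \<in> uminus ` stay_times v U y" by simp
  next
    fix t assume "t \<in> uminus ` stay_times v U y"
    then obtain s where "s \<in> stay_times v U y" "t = - s" by blast
    then show "t \<in> stay_times (rev_flow v) U y" using iff[of t] by simp
  qed
qed

lemma orbit_equivalence_rev: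
  assumes "orbit_equivalence v U psi V h" shows "orbit_equivalence (rev_flow v) U (rev_flow psi) V h"
  unfolding orbit_equivalence_def
proof (intro conjI ballI)
  show "\<exists>g. homeomorphism U V h g" using assms by (simp add: orbit_equivalence_def)
  fix y assume "y \<in> U"
  then obtain tau where tau: "tau 0 = 0" "strict_mono_on (stay_times v U y) tau"
    "tau ` stay_times v U y = stay_times psi V (h y)"
    "\<And>t. t \<in> stay_times v U y ==> h (v t y) = psi (tau t) (h y)"
    using assms unfolding orbit_equivalence_def by blast
  show "\<exists>tau. tau 0 = 0 \<and> strict_mono_on (stay_times (rev_flow v) U y) tau \<and>
        tau ` stay_times (rev_flow v) U y = stay_times (rev_flow psi) V (h y) \<and>
        (\<forall>t \<in> stay_times (rev_flow v) U y. h (rev_flow v t y) = rev_flow psi (tau t) (h y))"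
  proof (intro exI[of _ "\<lambda>t. - tau (- t)"] conjI ballI)
    show "strict_mono_on (stay_times (rev_flow v) U y) (\<lambda>t. - tau (- t))"
      using tau(2) unfolding stay_times_rev strict_mono_on_def by auto
    show "(\<lambda>t. - tau (- t)) ` stay_times (rev_flow v) U y = stay_times (rev_flow psi) V (h y)"
      unfolding stay_times_rev tau(3)[symmetric] by (auto simp: image_image)
  qed (use tau in \<open>auto simp: stay_times_rev rev_flow_def\<close>)
qed

lemma saddle_rev [simp]: "saddle (rev_flow v) p = saddle v p"
proof -
  have "saddle v p ==> saddle (rev_flow v) p" for v :: "real => 'a => 'a"
  proof -
    assume "saddle v p"
    then obtain M psi q U V h where *: "p \<in> Sing v" "M \<in> {UNIV, half_plane}" "C1_saddle M psi q"
      "open U" "p \<in> U" "openin (top_of_set M) V" "orbit_equivalence v U psi V h" "h p = q"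
      unfolding saddle_def by blast
    show ?thesis unfolding saddle_def Sing_rev
      using * C1_saddle_rev[OF *(3)] orbit_equivalence_rev[OF *(7)] by blast
  qed
  from this[of v] this[of "rev_flow v"] show ?thesis by auto
qed

text \<open>\<open>A\<close> is the derivative of the time-one map at \<open>q\<close>. The mean
  value inequality on a convex neighbourhood of \<open>q\<close> in \<open>M\<close> turns
  continuity of the derivative into a small Lipschitz constant for the nonlinear remainder.\<close>

lemma C1_time_one:
  assumes "C1_saddle M psi q" "M \<in> {UNIV, half_plane}"
  obtains A u w l k where "bounded_linear A" "0 < l" "l < 1" "1 < k" "u \<noteq> 0" "w \<noteq> 0"
    "A u = l *\<^sub>R u" "A w = k *\<^sub>R w"
    "\<And>e. e > 0 ==> \<exists>r>0. \<forall>x\<in>M \<inter> cball q r. \<forall>y\<in>M \<inter> cball q r.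
        norm (psi 1 x - psi 1 y - A (x - y)) \<le> e * norm (x - y)"
proof -
  obtain L a b u w where L: "a < 0" "0 < b" "u \<noteq> 0" "w \<noteq> 0"
    "\<And>t. (psi t has_derivative L t) (at q within M) \<and>
             L t u = exp (a * t) *\<^sub>R u \<and> L t w = exp (b * t) *\<^sub>R w"
    and q: "q \<in> M" and C1: "C1_flow_on M psi"
    using assms(1) unfolding C1_saddle_def by blast
  obtain D :: "real \<times> (real ^ 2) => (real \<times> (real ^ 2)) \<Rightarrow>\<^sub>L (real ^ 2)" where D: "continuous_on (UNIV \<times> M) D"
    "\<And>z. z \<in> UNIV \<times> M ==> ((\<lambda>(t, x). psi t x) has_derivative blinfun_apply (D z)) (at z within UNIV \<times> M)"
    using C1 unfolding C1_flow_on_def by blast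
  have M: "convex M" using assms(2) convex_half_plane by auto
  have der: "(psi 1 has_derivative (\<lambda>y. blinfun_apply (D (1, x)) (0, y))) (at x within M)" if x: "x \<in> M" for x
  proof -
    have "((\<lambda>x. (1::real, x)) has_derivative (\<lambda>y. (0, y))) (at x within M)"
      by (auto intro!: derivative_eq_intros)
    moreover have "((\<lambda>(t, x). psi t x) has_derivative blinfun_apply (D (1, x))) (at (1, x) within (\<lambda>x. (1::real, x)) ` M)"
      by (rule has_derivative_subset[OF D(2)]) (use x in auto)
    ultimately have "((\<lambda>x. (\<lambda>(t, x). psi t x) (1, x)) has_derivative (\<lambda>y. blinfun_apply (D (1, x)) (0, y))) (at x within M)"
      by (rule has_derivative_in_compose)
    then show ?thesis by simp
  qed
  define A where "A y = blinfun_apply (D (1, q)) (0, y)" for y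
  have A: "bounded_linear A" unfolding A_def
    using has_derivative_bounded_linear[OF der[OF q]] by simp
  \<comment> \<open>Derivatives at a boundary point of the half plane are still unique, because each
    coordinate direction can be followed in the positive sense inside \<open>M\<close>.\<close>
  have "L 1 = A"
  proof (rule frechet_derivative_unique_within)
    show "(psi 1 has_derivative L 1) (at q within M)" using L(5) by blast
    show "(psi 1 has_derivative A) (at q within M)" unfolding A_def using der[OF q] .
    fix i :: "real^2" and e :: real assume i: "i \<in> Basis" "0 < e"
    then obtain j where j: "i = axis j 1" by (auto simp: Basis_vec_def)
    show "\<exists>d. 0 < \<bar>d\<bar> \<and> \<bar>d\<bar> < e \<and> q + d *\<^sub>R i \<in> M"
      using assms(2) q i(2) by (intro exI[of _ "e/2"]) (auto simp: half_plane_def j axis_def)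
  qed
  then have Au: "A u = exp a *\<^sub>R u" "A w = exp b *\<^sub>R w" using L(5)[of 1] by auto
  have strict: "\<exists>r>0. \<forall>x\<in>M \<inter> cball q r. \<forall>y\<in>M \<inter> cball q r.
        norm (psi 1 x - psi 1 y - A (x - y)) \<le> e * norm (x - y)" if e: "e > 0" for e
  proof -
    have "continuous_on M (\<lambda>x. D (1, x))"
      by (rule continuous_on_compose2[OF D(1)]) (auto intro!: continuous_intros)
    then have "((\<lambda>x. D (1, x)) \<longlongrightarrow> D (1, q)) (at q within M)" using q by (simp add: continuous_on_def)
    then have "\<forall>\<^sub>F x in at q within M. dist (D (1, x)) (D (1, q)) < e" using e by (rule tendstoD)
    then obtain d where d: "d > 0" "\<And>x. x \<in> M ==> x \<noteq> q ==> dist x q < d ==> dist (D (1, x)) (D (1, q)) < e"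
      unfolding eventually_at by blast
    have near: "norm (D (1, x) - D (1, q)) \<le> e" if "x \<in> M \<inter> cball q (d/2)" for x
    proof (cases "x = q")
      case False
      have "dist x q < d" using that d(1) by (auto simp: dist_commute)
      then show ?thesis using d(2)[of x] False that by (auto simp: dist_norm)
    qed (use e in simp)
    show ?thesis
    proof (intro exI[of _ "d/2"] conjI ballI)
      fix x y assume xy: "x \<in> M \<inter> cball q (d/2)" "y \<in> M \<inter> cball q (d/2)"
      have "norm ((psi 1 x - A x) - (psi 1 y - A y)) \<le> e * norm (x - y)"
      proof (rule differentiable_bound[OF _ _ _ xy])
        show "convex (M \<inter> cball q (d/2))" by (intro convex_Int M convex_cball)
        fix z assume z: "z \<in> M \<inter> cball q (d/2)"
        show "((\<lambda>x. psi 1 x - A x) has_derivative (\<lambda>h. blinfun_apply (D (1, z)) (0, h) - A h)) (at z within M \<inter> cball q (d/2))"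
          by (rule has_derivative_diff[OF has_derivative_subset[OF der] bounded_linear_imp_has_derivative[OF A]])
            (use z in auto)
        show "onorm (\<lambda>h. blinfun_apply (D (1, z)) (0, h) - A h) \<le> e"
        proof (rule onorm_le)
          fix h :: "real^2"
          have "blinfun_apply (D (1, z)) (0, h) - A h = blinfun_apply (D (1, z) - D (1, q)) (0, h)"
            by (simp add: A_def blinfun.diff_left)
          also have "norm \<dots> \<le> norm (D (1, z) - D (1, q)) * norm (0::real, h)" by (rule norm_blinfun)
          also have "\<dots> \<le> e * norm h"
            using near[OF z] e by (intro mult_mono) (auto simp: norm_Pair)
          finally show "norm (blinfun_apply (D (1, z)) (0, h) - A h) \<le> e * norm h" .
        qed
      qed
      then show "norm (psi 1 x - psi 1 y - A (x - y)) \<le> e * norm (x - y)"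
        using bounded_linear.linear[OF A] by (simp add: linear_diff algebra_simps)
    qed (use d in simp)
  qed
  show ?thesis by (rule that[OF A _ _ _ L(3,4) Au strict]) (use L in auto)
qed

text \<open>Eigenvectors for different eigenvalues are independent, so the determinant
  \<open>d\<close> is nonzero; \<open>alpha\<close> and \<open>beta\<close> are the coordinates
  given by Cramer's rule.\<close>

lemma eigen_coordinates:
  fixes A :: "real^2 => real^2"
  assumes A: "bounded_linear A" and eig: "A u = l *\<^sub>R u" "A w = k *\<^sub>R w" "u \<noteq> 0" "w \<noteq> 0" "l \<noteq> k"
  obtains alpha beta :: "real^2 => real" where "bounded_linear alpha" "bounded_linear beta"
    "\<And>z. z = alpha z *\<^sub>R u + beta z *\<^sub>R w" "\<And>z. alpha (A z) = l * alpha z" "\<And>z. beta (A z) = k * beta z"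
proof -
  define d where "d = u$1 * w$2 - u$2 * w$1"
  have lin: "linear A" using A by (rule bounded_linear.linear)
  have "d \<noteq> 0"
  proof
    assume "d = 0"
    have "\<exists>c. w = c *\<^sub>R u"
    proof (cases "u$1 = 0")
      case True
      then have "u$2 \<noteq> 0" using eig(3) by (auto simp: vec_eq_iff forall_2)
      then show ?thesis using \<open>d = 0\<close> True
        by (intro exI[of _ "w$2 / u$2"]) (auto simp: vec_eq_iff forall_2 d_def)
    next
      case False
      then show ?thesis using \<open>d = 0\<close>
        by (intro exI[of _ "w$1 / u$1"]) (auto simp: vec_eq_iff forall_2 d_def field_simps)
    qed
    then obtain c where c: "w = c *\<^sub>R u" by blast
    then have "A w = (c * l) *\<^sub>R u" using eig(1) lin by (simp add: linear_cmul)
    then have "(c * l) *\<^sub>R u = (k * c) *\<^sub>R u" using eig(2) c by simp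
    then have "c * l = k * c" using eig(3) by simp
    then have "c = 0" using eig(5) by simp
    then show False using c eig(4) by simp
  qed
  define alpha beta where "alpha z = (z$1 * w$2 - z$2 * w$1) / d" and "beta z = (u$1 * z$2 - u$2 * z$1) / d" for z :: "real^2"
  have bl: "bounded_linear alpha" "bounded_linear beta"
    unfolding alpha_def beta_def
    by (intro bounded_linear_sub bounded_linear_mult_const bounded_linear_const_mult bounded_linear_divide
        bounded_linear_compose[OF bounded_linear_divide] bounded_linear_vec_nth)+
  have rep: "z = alpha z *\<^sub>R u + beta z *\<^sub>R w" for z
  proof -
    have "d * (z$1) = (z$1 * w$2 - z$2 * w$1) * u$1 + (u$1 * z$2 - u$2 * z$1) * w$1"
      "d * (z$2) = (z$1 * w$2 - z$2 * w$1) * u$2 + (u$1 * z$2 - u$2 * z$1) * w$2"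
      by (simp_all add: d_def algebra_simps)
    then have "z$1 = ((z$1 * w$2 - z$2 * w$1) * u$1 + (u$1 * z$2 - u$2 * z$1) * w$1) / d"
      "z$2 = ((z$1 * w$2 - z$2 * w$1) * u$2 + (u$1 * z$2 - u$2 * z$1) * w$2) / d"
      using \<open>d \<noteq> 0\<close> by (metis nonzero_mult_div_cancel_left)+
    then show ?thesis
      by (simp add: vec_eq_iff forall_2 alpha_def beta_def add_divide_distrib)
  qed
  have alphabeta: "alpha u = 1" "alpha w = 0" "beta u = 0" "beta w = 1"
    using \<open>d \<noteq> 0\<close> by (auto simp: alpha_def beta_def d_def)
  have l: "linear alpha" "linear beta" using bl bounded_linear.linear by auto
  have Az: "A z = (alpha z * l) *\<^sub>R u + (beta z * k) *\<^sub>R w" for z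
    by (subst rep[of z]) (simp add: linear_add[OF lin] linear_cmul[OF lin] eig(1,2))
  have "alpha (A z) = l * alpha z" "beta (A z) = k * beta z" for z
    unfolding Az[of z] by (simp_all add: linear_add[OF l(1)] linear_add[OF l(2)] linear_cmul[OF l(1)] linear_cmul[OF l(2)] alphabeta)
  with bl rep that show ?thesis by blast
qed

text \<open>Cone argument: differences of two points whose forward orbits stay near the saddle lie in the
  cone where the contracted coordinate dominates, so the contracted coordinate is injective on
  these points, and each of its two signs is taken by at most one orbit.\<close>

lemma C1_saddle_stable_set:
  assumes saddle: "C1_saddle M psi q" and M: "M \<in> {UNIV, half_plane}"
  obtains r and sg :: "real^2 => bool" where "r > 0"
    "\<And>z. z \<in> M ==> \<forall>t\<ge>0. psi t z \<in> cball q r ==> ((\<lambda>t. psi t z) \<longlongrightarrow> q) at_top"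
    "\<And>z z'. z \<in> M ==> z' \<in> M ==> z \<noteq> q ==> z' \<noteq> q ==> sg z = sg z' ==>
      \<forall>t\<ge>0. psi t z \<in> cball q r ==> \<forall>t\<ge>0. psi t z' \<in> cball q r ==> \<exists>t\<ge>0. psi t z = z' \<or> psi t z' = z"
    "\<And>z. z \<in> M ==> \<forall>t. psi t z \<in> cball q r ==> z = q"
proof -
  obtain A u w l k where A: "bounded_linear A" "0 < l" "l < 1" "1 < k" "u \<noteq> 0" "w \<noteq> 0"
    "A u = l *\<^sub>R u" "A w = k *\<^sub>R w"
    "\<And>e. e > 0 ==> \<exists>r>0. \<forall>x\<in>M \<inter> cball q r. \<forall>y\<in>M \<inter> cball q r.
        norm (psi 1 x - psi 1 y - A (x - y)) \<le> e * norm (x - y)"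
    by (rule C1_time_one[OF saddle M], rule that)
  obtain alpha beta :: "real^2 => real" where bl: "bounded_linear alpha" "bounded_linear beta"
    and rep: "\<And>z. z = alpha z *\<^sub>R u + beta z *\<^sub>R w" and alphaA: "\<And>z. alpha (A z) = l * alpha z" and betaA: "\<And>z. beta (A z) = k * beta z"
    using eigen_coordinates[OF A(1,7,8,5,6)] A(3,4) by (metis less_trans less_irrefl)
  have fl: "flow_on M psi" and qM: "q \<in> M" and fix_q: "\<And>t. psi t q = q"
    using saddle by (auto simp: C1_saddle_def C1_flow_on_def)
  have inM: "psi t z \<in> M" and z0: "psi 0 z = z" and add: "psi (s + t) z = psi s (psi t z)" if "z \<in> M" for s t z
    using fl that by (auto simp: flow_on_def)
  have lin: "linear alpha" "linear beta" using bl bounded_linear.linear by auto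
  obtain Ca where Ca: "Ca > 0" "\<And>z. \<bar>alpha z\<bar> \<le> norm z * Ca"
    using bounded_linear.pos_bounded[OF bl(1)] by auto
  obtain Cb where Cb: "Cb > 0" "\<And>z. \<bar>beta z\<bar> \<le> norm z * Cb"
    using bounded_linear.pos_bounded[OF bl(2)] by auto
  define B where "B = norm u + norm w"
  have B: "B > 0" using A(5) by (simp add: B_def add_pos_nonneg)
  have nB: "norm z \<le> (\<bar>alpha z\<bar> + \<bar>beta z\<bar>) * B" for z
  proof -
    have "norm z \<le> norm (alpha z *\<^sub>R u) + norm (beta z *\<^sub>R w)" by (subst rep) (rule norm_triangle_ineq)
    also have "\<dots> \<le> \<bar>alpha z\<bar> * B + \<bar>beta z\<bar> * B" by (auto simp: B_def intro!: add_mono mult_left_mono)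
    finally show ?thesis by (simp add: algebra_simps)
  qed
  \<comment> \<open>Small enough that the contraction rate \<open>l + 2 * delta\<close> stays below
    1 and the expansion rate \<open>k - 2 * delta\<close> above 1.\<close>
  define delta where "delta = min (1 - l) (k - 1) / 4"
  have delta: "delta > 0" "l + 2 * delta < 1" "1 < k - 2 * delta" using A(2-4) by (auto simp: delta_def min_def field_simps)
  \<comment> \<open>The factor \<open>B * max Ca Cb\<close> is the cost of passing from the
    coordinates to the norm and back.\<close>
  define e where "e = delta / (B * max Ca Cb)"
  have e: "e > 0" using delta B Ca Cb by (simp add: e_def less_max_iff_disj)
  obtain r where r: "r > 0" "\<And>x y. x \<in> M \<inter> cball q r ==> y \<in> M \<inter> cball q r ==>
        norm (psi 1 x - psi 1 y - A (x - y)) \<le> e * norm (x - y)"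
    using A(9)[OF e] by blast
  have err: "\<bar>alpha (psi 1 x - psi 1 y) - l * alpha (x - y)\<bar> \<le> delta * (\<bar>alpha (x - y)\<bar> + \<bar>beta (x - y)\<bar>)"
      "\<bar>beta (psi 1 x - psi 1 y) - k * beta (x - y)\<bar> \<le> delta * (\<bar>alpha (x - y)\<bar> + \<bar>beta (x - y)\<bar>)"
    if "x \<in> M \<inter> cball q r" "y \<in> M \<inter> cball q r" for x y
  proof -
    let ?E = "psi 1 x - psi 1 y - A (x - y)" and ?N = "\<bar>alpha (x - y)\<bar> + \<bar>beta (x - y)\<bar>"
    have "norm ?E * max Ca Cb \<le> e * (?N * B) * max Ca Cb"
      using r(2)[OF that] nB[of "x - y"] e Ca
      by (intro mult_right_mono) (auto intro: order_trans mult_left_mono simp: le_max_iff_disj)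
    also have "\<dots> = delta * ?N" using B Ca by (simp add: e_def field_simps less_max_iff_disj)
    finally have E: "norm ?E * max Ca Cb \<le> delta * ?N" .
    have "\<bar>alpha ?E\<bar> \<le> norm ?E * max Ca Cb" "\<bar>beta ?E\<bar> \<le> norm ?E * max Ca Cb"
      by (auto intro!: order_trans[OF Ca(2)[of ?E]] order_trans[OF Cb(2)[of ?E]] mult_left_mono)
    moreover have "alpha ?E = alpha (psi 1 x - psi 1 y) - l * alpha (x - y)" "beta ?E = beta (psi 1 x - psi 1 y) - k * beta (x - y)"
      by (simp_all add: linear_diff[OF lin(1), of _ "A (x - y)"] linear_diff[OF lin(2), of _ "A (x - y)"] alphaA betaA)
    ultimately show "\<bar>alpha (psi 1 x - psi 1 y) - l * alpha (x - y)\<bar> \<le> delta * ?N"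
      "\<bar>beta (psi 1 x - psi 1 y) - k * beta (x - y)\<bar> \<le> delta * ?N" using E by linarith+
  qed
  define S where "S = {z \<in> M. \<forall>t\<ge>0. psi t z \<in> cball q r}"
  have S_M: "z \<in> M" if "z \<in> S" for z using that by (simp add: S_def)
  have S_ball: "psi t z \<in> M \<inter> cball q r" if "z \<in> S" "t \<ge> 0" for z t
    using that inM by (auto simp: S_def)
  have S_b: "z \<in> M \<inter> cball q r" if "z \<in> S" for z using S_ball[OF that, of 0] z0[OF S_M[OF that]] by simp
  have S_inv: "psi t z \<in> S" if "z \<in> S" "t \<ge> 0" for z t
  proof -
    have "psi s (psi t z) \<in> cball q r" if "s \<ge> 0" for s
      using S_ball[OF \<open>z \<in> S\<close>, of "s + t"] add[OF S_M[OF \<open>z \<in> S\<close>], of s t] that \<open>t \<ge> 0\<close> by simp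
    then show ?thesis using inM[OF S_M[OF that(1)]] by (simp add: S_def)
  qed
  have qS: "q \<in> S" using qM fix_q r(1) by (simp add: S_def)
  \<comment> \<open>If the expanded coordinate dominated a difference, it would keep dominating and
    grow by the factor \<open>nu\<close> at each step, although the two orbits stay within distance
    \<open>2 * r\<close> of each other.\<close>
  have cone: "\<bar>beta (x - y)\<bar> < \<bar>alpha (x - y)\<bar>" if x: "x \<in> S" and y: "y \<in> S" and ne: "x \<noteq> y" for x y
  proof (rule ccontr)
    assume "\<not> ?thesis"
    then have le: "\<bar>alpha (x - y)\<bar> \<le> \<bar>beta (x - y)\<bar>" by simp
    define nu where "nu = k - 2 * delta"
    have step: "\<bar>alpha (psi 1 a - psi 1 b)\<bar> \<le> \<bar>beta (psi 1 a - psi 1 b)\<bar> \<and> nu * \<bar>beta (a - b)\<bar> \<le> \<bar>beta (psi 1 a - psi 1 b)\<bar>"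
      if ab: "a \<in> S" "b \<in> S" "\<bar>alpha (a - b)\<bar> \<le> \<bar>beta (a - b)\<bar>" for a b
    proof -
      let ?a = "\<bar>alpha (a - b)\<bar>" and ?b = "\<bar>beta (a - b)\<bar>"
      have "delta * (?a + ?b) \<le> delta * (2 * ?b)" using ab(3) delta(1) by (intro mult_left_mono) auto
      then have d: "delta * (?a + ?b) \<le> 2 * delta * ?b" by simp
      have "k * ?b - delta * (?a + ?b) \<le> \<bar>beta (psi 1 a - psi 1 b)\<bar>"
        using err(2)[OF S_b[OF ab(1)] S_b[OF ab(2)]] A(4) abs_mult[of k "beta (a - b)"] by linarith
      then have 1: "nu * ?b \<le> \<bar>beta (psi 1 a - psi 1 b)\<bar>" using d by (simp add: nu_def algebra_simps)
      have "\<bar>alpha (psi 1 a - psi 1 b)\<bar> \<le> l * ?a + delta * (?a + ?b)"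
        using err(1)[OF S_b[OF ab(1)] S_b[OF ab(2)]] A(2) abs_mult[of l "alpha (a - b)"] by linarith
      also have "\<dots> \<le> l * ?b + 2 * delta * ?b" using d ab(3) A(2) by (intro add_mono mult_left_mono) auto
      also have "\<dots> = (l + 2 * delta) * ?b" by (simp add: algebra_simps)
      also have "\<dots> \<le> nu * ?b" using delta by (intro mult_right_mono) (auto simp: nu_def)
      finally show ?thesis using 1 by linarith
    qed
    have it: "\<bar>alpha (psi (real n) x - psi (real n) y)\<bar> \<le> \<bar>beta (psi (real n) x - psi (real n) y)\<bar> \<and>
      nu ^ n * \<bar>beta (x - y)\<bar> \<le> \<bar>beta (psi (real n) x - psi (real n) y)\<bar>" for n
    proof (induction n)
      case 0
      then show ?case using le z0 S_M x y by simp
    next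
      case (Suc n)
      have eq: "psi (real (Suc n)) z = psi 1 (psi (real n) z)" if "z \<in> S" for z
        using add[OF S_M[OF that], of 1 "real n"] by (simp add: add.commute)
      have st: "\<bar>alpha (psi (real (Suc n)) x - psi (real (Suc n)) y)\<bar> \<le> \<bar>beta (psi (real (Suc n)) x - psi (real (Suc n)) y)\<bar> \<and>
        nu * \<bar>beta (psi (real n) x - psi (real n) y)\<bar> \<le> \<bar>beta (psi (real (Suc n)) x - psi (real (Suc n)) y)\<bar>"
        unfolding eq[OF x] eq[OF y] by (rule step) (use Suc S_inv x y in auto)
      moreover have "nu * (nu ^ n * \<bar>beta (x - y)\<bar>) \<le> nu * \<bar>beta (psi (real n) x - psi (real n) y)\<bar>"
        using Suc delta(3) by (intro mult_left_mono) (auto simp: nu_def)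
      ultimately show ?case by (simp add: mult.assoc)
    qed
    have "beta (x - y) \<noteq> 0"
    proof
      assume "beta (x - y) = 0"
      then have "alpha (x - y) = 0" using le by simp
      with \<open>beta (x - y) = 0\<close> rep[of "x - y"] ne show False by simp
    qed
    then have pos: "\<bar>beta (x - y)\<bar> > 0" by simp
    have bd: "nu ^ n * \<bar>beta (x - y)\<bar> \<le> 2 * r * Cb" for n
    proof -
      have "norm (psi (real n) x - psi (real n) y) \<le> 2 * r"
        using S_ball[OF x, of "real n"] S_ball[OF y, of "real n"]
          norm_triangle_ineq4[of "psi (real n) x - q" "psi (real n) y - q"]
        by (auto simp: dist_norm norm_minus_commute)
      then have "norm (psi (real n) x - psi (real n) y) * Cb \<le> 2 * r * Cb" using Cb(1) by (intro mult_right_mono) auto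
      then show ?thesis using it[of n] Cb(2)[of "psi (real n) x - psi (real n) y"] by linarith
    qed
    obtain n where "2 * r * Cb / \<bar>beta (x - y)\<bar> < nu ^ n"
      using real_arch_pow[of nu "2 * r * Cb / \<bar>beta (x - y)\<bar>"] delta(3) by (auto simp: nu_def)
    then show False using bd[of n] pos by (simp add: pos_divide_less_eq)
  qed
  have cone_q: "\<bar>beta (x - q)\<bar> \<le> \<bar>alpha (x - q)\<bar>" if "x \<in> S" for x
    using cone[OF that qS] by (cases "x = q") (auto simp: linear_0[OF lin(1)] linear_0[OF lin(2)])
  define kap where "kap = l + 2 * delta"
  have kap: "0 < kap" "kap < 1" using A(2) delta by (auto simp: kap_def)
  have contr1: "\<bar>alpha (psi 1 x - q)\<bar> \<le> kap * \<bar>alpha (x - q)\<bar>" if x: "x \<in> S" for x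
  proof -
    have "delta * (\<bar>alpha (x - q)\<bar> + \<bar>beta (x - q)\<bar>) \<le> delta * (2 * \<bar>alpha (x - q)\<bar>)"
      using cone_q[OF x] delta(1) by (intro mult_left_mono) auto
    moreover have "\<bar>alpha (psi 1 x - q)\<bar> \<le> l * \<bar>alpha (x - q)\<bar> + delta * (\<bar>alpha (x - q)\<bar> + \<bar>beta (x - q)\<bar>)"
      using err(1)[OF S_b[OF x] S_b[OF qS]] A(2) abs_mult[of l "alpha (x - q)"] fix_q by simp
    ultimately show ?thesis by (simp add: kap_def algebra_simps)
  qed
  have contr: "\<bar>alpha (psi (real n) x - q)\<bar> \<le> kap ^ n * \<bar>alpha (x - q)\<bar>" if x: "x \<in> S" for x n
  proof (induction n)
    case (Suc n)
    have "psi (real (Suc n)) x = psi 1 (psi (real n) x)"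
      using add[OF S_M[OF x], of 1 "real n"] by (simp add: add.commute)
    then have "\<bar>alpha (psi (real (Suc n)) x - q)\<bar> \<le> kap * \<bar>alpha (psi (real n) x - q)\<bar>"
      using contr1[OF S_inv[OF x, of "real n"]] by simp
    also have "\<dots> \<le> kap * (kap ^ n * \<bar>alpha (x - q)\<bar>)" using Suc kap by (intro mult_left_mono) auto
    finally show ?case by simp
  qed (use z0 S_M x in simp)
  have alpha_bd: "\<bar>alpha (x - q)\<bar> \<le> r * Ca" if "x \<in> S" for x
  proof -
    have "norm (x - q) * Ca \<le> r * Ca" using S_b[OF that] Ca(1)
      by (intro mult_right_mono) (auto simp: dist_norm norm_minus_commute)
    then show ?thesis using Ca(2)[of "x - q"] by linarith
  qed
  have small: "norm (psi (real n) x - q) \<le> kap ^ n * (2 * r * Ca * B)" if x: "x \<in> S" for x n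
  proof -
    have "\<bar>alpha (psi (real n) x - q)\<bar> \<le> kap ^ n * (r * Ca)"
      by (rule order_trans[OF contr[OF x] mult_left_mono[OF alpha_bd[OF x]]]) (use kap in simp)
    moreover have "\<bar>beta (psi (real n) x - q)\<bar> \<le> \<bar>alpha (psi (real n) x - q)\<bar>"
      by (rule cone_q[OF S_inv[OF x]]) simp
    ultimately have "\<bar>alpha (psi (real n) x - q)\<bar> + \<bar>beta (psi (real n) x - q)\<bar> \<le> 2 * (kap ^ n * (r * Ca))" by linarith
    then have "(\<bar>alpha (psi (real n) x - q)\<bar> + \<bar>beta (psi (real n) x - q)\<bar>) * B \<le> 2 * (kap ^ n * (r * Ca)) * B"
      using B by (intro mult_right_mono) auto
    then show ?thesis using nB[of "psi (real n) x - q"] by (simp add: algebra_simps)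
  qed
  have lim0: "(\<lambda>n. kap ^ n * (2 * r * Ca * B)) \<longlonglongrightarrow> 0"
    using tendsto_mult[OF LIMSEQ_realpow_zero[of kap] tendsto_const[of "2 * r * Ca * B"]] kap by simp
  have conv: "((\<lambda>t. psi t x) \<longlongrightarrow> q) at_top" if x: "x \<in> S" for x
  proof (rule tendstoI)
    fix eta :: real assume "eta > 0"
    then obtain n where n: "kap ^ n * (2 * r * Ca * B) < eta"
      using order_tendstoD(2)[OF lim0] by (auto simp: eventually_sequentially)
    have "dist (psi t x) q < eta" if t: "t \<ge> real n" for t
    proof -
      have "psi t x = psi (real n) (psi (t - real n) x)" using add[OF S_M[OF x], of "real n" "t - real n"] by simp
      then show ?thesis using small[OF S_inv[OF x, of "t - real n"], of n] n t by (simp add: dist_norm)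
    qed
    then show "\<forall>\<^sub>F t in at_top. dist (psi t x) q < eta" by (auto simp: eventually_at_top_linorder)
  qed
  define sg where "sg z = (0 < alpha (z - q))" for z
  have alpha0: "alpha (x - q) \<noteq> 0" if "x \<in> S" "x \<noteq> q" for x
    using cone[OF that(1) qS that(2)] by auto
  \<comment> \<open>The intermediate value theorem finds a time at which the orbit of
    \<open>x\<close> has the contracted coordinate of \<open>y\<close>; by the cone condition the
    two points then coincide.\<close>
  have same: "\<exists>t\<ge>0. psi t x = y"
    if x: "x \<in> S" "x \<noteq> q" and y: "y \<in> S" "y \<noteq> q" and sg: "sg x = sg y" and le: "\<bar>alpha (y - q)\<bar> \<le> \<bar>alpha (x - q)\<bar>" for x y
  proof -
    define s where "s = sgn (alpha (x - q))"
    have s: "s * alpha (x - q) = \<bar>alpha (x - q)\<bar>" "s * alpha (y - q) = \<bar>alpha (y - q)\<bar>" "s \<noteq> 0"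
      using alpha0[OF x] alpha0[OF y] sg by (auto simp: s_def sg_def sgn_if abs_if)
    define F where "F = (\<lambda>t. s * alpha (psi t x - q))"
    have "continuous_on UNIV (\<lambda>t. (\<lambda>(t, x). psi t x) (t, x))"
      by (rule continuous_on_compose2[of "UNIV \<times> M" "\<lambda>(t, x). psi t x"])
        (use fl S_M[OF x(1)] in \<open>auto simp: flow_on_def intro!: continuous_intros\<close>)
    then have "continuous_on UNIV (\<lambda>t. psi t x)" by simp
    then have F: "continuous_on UNIV F" unfolding F_def
      by (intro continuous_intros bounded_linear.continuous_on[OF bl(1)])
    have "((\<lambda>t. s * alpha (psi t x - q)) \<longlongrightarrow> s * alpha (q - q)) at_top"
      by (intro tendsto_intros bounded_linear.tendsto[OF bl(1)] conv x)
    then have "(F \<longlongrightarrow> 0) at_top" by (simp add: F_def linear_0[OF lin(1)])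
    moreover have "0 < \<bar>alpha (y - q)\<bar>" using alpha0[OF y] by simp
    ultimately have "\<forall>\<^sub>F t in at_top. F t < \<bar>alpha (y - q)\<bar>" by (rule order_tendstoD)
    then obtain T where T: "\<And>t. t \<ge> T ==> F t < \<bar>alpha (y - q)\<bar>" by (auto simp: eventually_at_top_linorder)
    have "\<exists>t\<ge>0. t \<le> max T 0 \<and> F t = \<bar>alpha (y - q)\<bar>"
    proof (rule IVT2')
      show "F (max T 0) \<le> \<bar>alpha (y - q)\<bar>" using T[of "max T 0"] by simp
      show "\<bar>alpha (y - q)\<bar> \<le> F 0" using le s z0 S_M x by (simp add: F_def)
    qed (use continuous_on_subset[OF F] in auto)
    then obtain t where t: "t \<ge> 0" "F t = s * alpha (y - q)" using s by auto
    have "psi t x = y"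
    proof (rule ccontr)
      assume "psi t x \<noteq> y"
      from cone[OF S_inv[OF x(1) t(1)] y(1) this]
      have "alpha (psi t x - y) \<noteq> 0" by auto
      moreover have "alpha (psi t x - y) = alpha (psi t x - q) - alpha (y - q)"
        using linear_diff[OF lin(1), of "psi t x - q" "y - q"] by simp
      ultimately show False using t(2) s(3) by (simp add: F_def)
    qed
    with t show ?thesis by blast
  qed
  show ?thesis
  proof (rule that[of r sg])
    show "r > 0" by (rule r)
    show "((\<lambda>t. psi t z) \<longlongrightarrow> q) at_top" if "z \<in> M" "\<forall>t\<ge>0. psi t z \<in> cball q r" for z
      by (rule conv) (use that in \<open>auto simp: S_def\<close>)
    show "\<exists>t\<ge>0. psi t z = z' \<or> psi t z' = z" if "z \<in> M" "z' \<in> M" "z \<noteq> q" "z' \<noteq> q" "sg z = sg z'"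
      "\<forall>t\<ge>0. psi t z \<in> cball q r" "\<forall>t\<ge>0. psi t z' \<in> cball q r" for z z'
      using same[of z z'] same[of z' z] that by (cases "\<bar>alpha (z' - q)\<bar> \<le> \<bar>alpha (z - q)\<bar>") (auto simp: S_def)
    show "z = q" if z: "z \<in> M" "\<forall>t. psi t z \<in> cball q r" for z
    proof -
      have zS: "psi t z \<in> S" for t
        using z inM[OF z(1)] add[OF z(1), symmetric] by (auto simp: S_def)
      \<comment> \<open>The estimate starts \<open>n\<close> time units in the past. As the whole
        orbit stays near \<open>q\<close>, the point \<open>z\<close> has already been contracted
        for as long as desired.\<close>
      have "norm (z - q) \<le> kap ^ n * (2 * r * Ca * B)" for n
        using small[OF zS[of "- real n"], of n] add[OF z(1), of "real n" "- real n"] z0[OF z(1)] by simp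
      then have "norm (z - q) \<le> 0" by (intro LIMSEQ_le_const[OF lim0]) auto
      then show ?thesis by simp
    qed
  qed
qed

text \<open>The time change could miss a positive time only if the model orbit left \<open>V\<close>
  after a finite time. Up to the supremum \<open>m\<close> of the admissible times it runs in the
  closed set \<open>B\<close>, so it is in \<open>V\<close> at \<open>m\<close> too; then
  \<open>tau\<close> attains \<open>m\<close>, and strict monotonicity leads beyond it.\<close>

lemma orbit_equivalence_forward:
  fixes psi :: "real => 'b::t2_space => 'b"
  assumes oe: "orbit_equivalence v U psi V h" and stay: "\<And>t. t \<ge> 0 ==> v t y \<in> U" and y: "y \<in> U"
    and B: "closed B" "B \<subseteq> V" "\<And>t. t \<ge> 0 ==> h (v t y) \<in> B"
    and cont: "continuous_on UNIV (\<lambda>s. psi s (h y))"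
  obtains tau :: "real => real" where "\<And>t t'. 0 \<le> t ==> t \<le> t' ==> tau t \<le> tau t'"
    "\<And>t. 0 \<le> t ==> 0 \<le> tau t \<and> h (v t y) = psi (tau t) (h y)" "\<And>s. 0 \<le> s ==> \<exists>t\<ge>0. tau t = s"
proof -
  let ?T = "stay_times v U y" and ?J = "stay_times psi V (h y)"
  obtain tau where tau: "tau 0 = 0" "strict_mono_on ?T tau" "tau ` ?T = ?J"
    "\<And>t. t \<in> ?T ==> h (v t y) = psi (tau t) (h y)"
    using oe y unfolding orbit_equivalence_def by blast
  have T: "t \<in> ?T" if "t \<ge> 0" for t
    using stay that by (auto simp: stay_times_def closed_segment_eq_real_ivl)
  have mono: "tau t \<le> tau t'" if "0 \<le> t" "t \<le> t'" for t t'
    using strict_mono_on_leD[OF tau(2) T T] that by auto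
  have pre: "\<exists>t\<ge>0. tau t = s" if s: "s \<in> ?J" "s \<ge> 0" for s
  proof -
    have "s \<in> tau ` ?T" using s(1) tau(3) by simp
    then obtain t where t: "t \<in> ?T" "tau t = s" by fastforce
    have "t \<ge> 0"
    proof (rule ccontr)
      assume "\<not> t \<ge> 0"
      then have "tau t < tau 0" using strict_mono_onD[OF tau(2) t(1) T[of 0]] by simp
      then show False using t(2) s(2) tau(1) by simp
    qed
    with t show ?thesis by blast
  qed
  have inB: "psi s (h y) \<in> B" if "s \<in> ?J" "s \<ge> 0" for s
    using pre[OF that] tau(4) T B(3) by metis
  have down: "s \<in> ?J" if "s' \<in> ?J" "0 \<le> s" "s \<le> s'" for s s'
    using that by (auto simp: stay_times_def closed_segment_eq_real_ivl)
  have "s0 \<in> ?J" if s0: "s0 \<ge> 0" for s0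
  proof (rule ccontr)
    assume no: "s0 \<notin> ?J"
    let ?P = "?J \<inter> {0..}"
    have bdd: "bdd_above ?P"
    proof (rule bdd_aboveI)
      fix s assume "s \<in> ?P"
      then show "s \<le> s0" using down[of s s0] no s0 by (cases "s \<le> s0") auto
    qed
    have "tau 0 \<in> ?J" using imageI[OF T[of 0], of tau] tau(3) by simp
    then have ne: "0 \<in> ?P" using tau(1) by simp
    define m where "m = Sup ?P"
    have m: "0 \<le> m" unfolding m_def using ne bdd by (intro cSup_upper)
    have below: "s \<in> ?J" if s: "0 \<le> s" "s < m" for s
    proof -
      have "\<exists>s'\<in>?P. s < s'" using s(2) ne less_cSup_iff[of ?P s] bdd unfolding m_def by blast
      then show ?thesis using down[of _ s] s(1) by force
    qed
    have "psi m (h y) \<in> B"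
    proof (cases "m = 0")
      case True
      then show ?thesis using inB ne by auto
    next
      case False
      have "((\<lambda>s. psi s (h y)) \<longlongrightarrow> psi m (h y)) (at_left m)"
        using cont[unfolded continuous_on_def] by (blast intro: tendsto_within_subset)
      moreover have "\<forall>\<^sub>F s in at_left m. psi s (h y) \<in> B"
        unfolding eventually_at_left_field using False m inB[OF below] by (intro exI[of _ 0]) auto
      ultimately show ?thesis by (intro Lim_in_closed_set[OF B(1) _ trivial_limit_at_left_real])
    qed
    then have "psi s (h y) \<in> V" if "0 \<le> s" "s \<le> m" for s
      using inB[OF below that(1)] that subsetD[OF B(2)] that by (cases "s = m") auto
    then have "m \<in> ?J" using m by (simp add: stay_times_def closed_segment_eq_real_ivl)
    then obtain t where t: "t \<ge> 0" "tau t = m" using pre[OF _ m] by auto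
    have "tau (t + 1) \<in> ?J" using imageI[OF T[of "t + 1"], of tau] t(1) tau(3) by simp
    moreover have "m < tau (t + 1)" using strict_mono_onD[OF tau(2) T[of t] T[of "t + 1"]] t by simp
    ultimately have "tau (t + 1) \<in> ?P" "m < tau (t + 1)" using m by auto
    then show False using cSup_upper[OF _ bdd, of "tau (t + 1)"] unfolding m_def by simp
  qed
  then have surj: "\<exists>t\<ge>0. tau t = s" if "0 \<le> s" for s using pre[of s] that by blast
  show ?thesis
  proof (rule that[OF mono _ surj])
    fix t :: real assume "0 \<le> t"
    then show "0 \<le> tau t \<and> h (v t y) = psi (tau t) (h y)" using mono[of 0 t] tau(1,4) T by auto
  qed
qed

context compact_flow
begin

text \<open>The properties of the model are pulled back through \<open>h\<close>. \<open>U0\<close>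
  is the preimage of a ball so small that the closed ball in \<open>M\<close> lies in
  \<open>V\<close>, which allows the transfer of infinite forward times; \<open>sg\<close> records
  the branch of the stable set.\<close>

lemma saddle_forward:
  assumes "saddle v p"
  obtains U0 and sg :: "'a => bool" where "open U0" "p \<in> U0"
    "\<And>y. \<forall>t\<ge>0. v t y \<in> U0 ==> om y = {p}"
    "\<And>y y'. \<forall>t\<ge>0. v t y \<in> U0 ==> \<forall>t\<ge>0. v t y' \<in> U0 ==> y \<noteq> p ==> y' \<noteq> p ==> sg y = sg y' ==> y' \<in> orbit v y"
    "\<And>y. \<forall>t. v t y \<in> U0 ==> y = p"
proof -
  obtain M psi q U V h where M: "M \<in> {UNIV, half_plane}" and C1: "C1_saddle M psi q"
    and U: "open U" "p \<in> U" and V: "openin (top_of_set M) V"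
    and oe: "orbit_equivalence v U psi V h" and hp: "h p = q"
    using assms unfolding saddle_def by blast
  obtain g where hom: "homeomorphism U V h g" using oe unfolding orbit_equivalence_def by blast
  have h: "continuous_on U h" "continuous_on V g" "\<And>x. x \<in> U ==> g (h x) = x" "h ` U = V"
    using hom by (auto simp: homeomorphism_def)
  have fl: "flow_on M psi" and qM: "q \<in> M" using C1 by (auto simp: C1_saddle_def C1_flow_on_def)
  have closedM: "closed M"
  proof -
    have "closed {z :: real^2. 0 \<le> z $ 1}" by (intro closed_Collect_le continuous_intros)
    then show ?thesis using M by (auto simp: half_plane_def)
  qed
  have VM: "V \<subseteq> M" using V by (rule openin_imp_subset)
  obtain r0 and sg :: "real^2 => bool" where r0: "r0 > 0"
    "\<And>z. z \<in> M ==> \<forall>t\<ge>0. psi t z \<in> cball q r0 ==> ((\<lambda>t. psi t z) \<longlongrightarrow> q) at_top"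
    "\<And>z z'. z \<in> M ==> z' \<in> M ==> z \<noteq> q ==> z' \<noteq> q ==> sg z = sg z' ==>
      \<forall>t\<ge>0. psi t z \<in> cball q r0 ==> \<forall>t\<ge>0. psi t z' \<in> cball q r0 ==> \<exists>t\<ge>0. psi t z = z' \<or> psi t z' = z"
    "\<And>z. z \<in> M ==> \<forall>t. psi t z \<in> cball q r0 ==> z = q"
    by (rule C1_saddle_stable_set[OF C1 M], rule that)
  have "q \<in> V" using U(2) h(4) hp by blast
  then obtain r1 where r1: "r1 > 0" "ball q r1 \<inter> M \<subseteq> V"
    using V by (meson openin_contains_ball)
  define r where "r = min r0 (r1/2)"
  have r: "r > 0" "r \<le> r0" "r < r1" using r0(1) r1(1) by (auto simp: r_def)
  define B where "B = cball q r \<inter> M"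
  have B: "closed B" "B \<subseteq> V" using closedM r1(2) r(3) by (auto simp: B_def)
  define U0 where "U0 = U \<inter> h -` ball q r"
  have "openin (top_of_set U) U0" unfolding U0_def
    by (rule continuous_openin_preimage_gen[OF h(1)]) simp
  then have opU0: "open U0" using U(1) by (simp add: openin_open_eq)
  have pU0: "p \<in> U0" using U(2) hp r(1) by (simp add: U0_def)
  have contpsi: "continuous_on UNIV (\<lambda>s. psi s z)" if "z \<in> M" for z
  proof -
    have "continuous_on UNIV (\<lambda>t. (\<lambda>(t, x). psi t x) (t, z))"
      by (rule continuous_on_compose2[of "UNIV \<times> M" "\<lambda>(t, x). psi t x"])
        (use fl that in \<open>auto simp: flow_on_def intro!: continuous_intros\<close>)
    then show ?thesis by simp
  qed
  have U0B: "y \<in> U \<and> h y \<in> B" if "y \<in> U0" for y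
    using that h(4) VM by (auto simp: U0_def B_def)
  have fw: "\<exists>tau. (\<forall>t t'. 0 \<le> t --> t \<le> t' --> tau t \<le> tau t') \<and>
    (\<forall>t\<ge>0. 0 \<le> tau t \<and> h (v t y) = psi (tau t) (h y)) \<and> (\<forall>s\<ge>0. \<exists>t\<ge>0. tau t = s)"
    if st: "\<forall>t\<ge>0. v t y \<in> U0" for y
  proof -
    have y0: "y \<in> U0" using st by (metis order_refl v_0)
    obtain tau :: "real => real" where "\<And>t t'. 0 \<le> t ==> t \<le> t' ==> tau t \<le> tau t'"
      "\<And>t. 0 \<le> t ==> 0 \<le> tau t \<and> h (v t y) = psi (tau t) (h y)" "\<And>s. 0 \<le> s ==> \<exists>t\<ge>0. tau t = s"
      by (rule orbit_equivalence_forward[OF oe _ _ B])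
        (use st U0B y0 VM h(4) in \<open>auto intro!: contpsi\<close>)
    then show ?thesis by blast
  qed
  have hB: "\<forall>s\<ge>0. psi s (h y) \<in> cball q r" if st: "\<forall>t\<ge>0. v t y \<in> U0" for y
  proof (intro allI impI)
    fix s :: real assume "s \<ge> 0"
    then obtain t where "t \<ge> 0" "h (v t y) = psi s (h y)" using fw[OF st] by metis
    then show "psi s (h y) \<in> cball q r" using st U0B unfolding B_def by force
  qed
  have hM: "h y \<in> M" if st: "\<forall>t\<ge>0. v t y \<in> U0" for y
  proof -
    have "y \<in> U0" using st by (metis order_refl v_0)
    then show ?thesis using U0B by (simp add: B_def)
  qed
  have hB0: "\<forall>s\<ge>0. psi s (h y) \<in> cball q r0" if "\<forall>t\<ge>0. v t y \<in> U0" for y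
    using hB[OF that] r(2) by auto
  have hne: "h y \<noteq> q" if "\<forall>t\<ge>0. v t y \<in> U0" "y \<noteq> p" for y
    using that U0B[of "v 0 y"] h(3) U(2) hp by (metis order_refl v_0)
  show ?thesis
  proof (rule that[of U0 "\<lambda>y. sg (h y)"])
    show "open U0" "p \<in> U0" by fact+
    show "om y = {p}" if st: "\<forall>t\<ge>0. v t y \<in> U0" for y
      unfolding omega_singleton_iff
    proof -
      obtain tau where tau: "\<And>t t'. 0 \<le> t ==> t \<le> t' ==> tau t \<le> tau t'"
        "\<And>t. 0 \<le> t ==> h (v t y) = psi (tau t) (h y)" "\<And>s. 0 \<le> s ==> \<exists>t\<ge>0. tau t = s"
        using fw[OF st] by blast
      have "filterlim tau at_top at_top"
        unfolding filterlim_at_top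
      proof
        fix Z :: real
        obtain t where "t \<ge> 0" "tau t = max Z 0" using tau(3)[of "max Z 0"] by auto
        then have "Z \<le> tau t'" if "t' \<ge> t" for t' using tau(1)[of t t'] that by auto
        then show "\<forall>\<^sub>F x in at_top. Z \<le> tau x" by (auto simp: eventually_at_top_linorder)
      qed
      from filterlim_compose[OF r0(2)[OF hM[OF st] hB0[OF st]] this]
      have "((\<lambda>t. psi (tau t) (h y)) \<longlongrightarrow> q) at_top" .
      moreover have "\<forall>\<^sub>F t in at_top. psi (tau t) (h y) = h (v t y)"
        unfolding eventually_at_top_linorder using tau(2) by (intro exI[of _ 0]) simp
      ultimately have lim: "((\<lambda>t. h (v t y)) \<longlongrightarrow> q) at_top"
        by (rule Lim_transform_eventually)
      have evU: "\<forall>\<^sub>F t in at_top. v t y \<in> U"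
        unfolding eventually_at_top_linorder using st U0B by blast
      then have evV: "\<forall>\<^sub>F t in at_top. h (v t y) \<in> V" by (rule eventually_mono) (use h(4) in blast)
      have "((\<lambda>t. g (h (v t y))) \<longlongrightarrow> g q) at_top"
        by (rule continuous_on_tendsto_compose[OF h(2) lim \<open>q \<in> V\<close> evV])
      moreover have "\<forall>\<^sub>F t in at_top. g (h (v t y)) = v t y" using evU by (rule eventually_mono) (rule h(3))
      ultimately have "((\<lambda>t. v t y) \<longlongrightarrow> g q) at_top" by (rule Lim_transform_eventually)
      then show "((\<lambda>t. v t y) \<longlongrightarrow> p) at_top" using h(3)[OF U(2)] hp by simp
    qed
    have orb: "y' \<in> orbit v y" if st: "\<forall>t\<ge>0. v t y \<in> U0" and st': "\<forall>t\<ge>0. v t y' \<in> U0" and s: "s \<ge> 0" "psi s (h y) = h y'" for y y' s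
    proof -
      obtain t where t: "t \<ge> 0" "h (v t y) = psi s (h y)" using fw[OF st] s(1) by metis
      have "v 0 y' \<in> U" using st' U0B[of "v 0 y'"] by blast
      then have "y' \<in> U" by (simp only: v_0)
      moreover have "v t y \<in> U" using st t(1) U0B[of "v t y"] by blast
      moreover have "h (v t y) = h y'" using t(2) s(2) by (rule trans)
      ultimately have "v t y = y'" using h(3) by metis
      then show ?thesis using in_orbit(1)[of t y] by metis
    qed
    show "y' \<in> orbit v y" if st: "\<forall>t\<ge>0. v t y \<in> U0" "\<forall>t\<ge>0. v t y' \<in> U0" "y \<noteq> p" "y' \<noteq> p" "sg (h y) = sg (h y')" for y y'
    proof -
      obtain t where "t \<ge> 0" "psi t (h y) = h y' \<or> psi t (h y') = h y"
        using r0(3)[OF hM[OF st(1)] hM[OF st(2)] hne[OF st(1,3)] hne[OF st(2,4)] st(5) hB0[OF st(1)] hB0[OF st(2)]] by blast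
      then consider "y' \<in> orbit v y" | "y \<in> orbit v y'"
        using orb[OF st(1,2)] orb[OF st(2,1)] by blast
      then show ?thesis
      proof cases
        case 2
        then have "orbit v y = orbit v y'" by (rule orbit_eq)
        then show ?thesis using in_orbit(2)[of y'] by simp
      qed
    qed
    show "y = p" if st: "\<forall>t. v t y \<in> U0" for y
    proof (rule ccontr)
      assume "y \<noteq> p"
      have st0: "\<forall>t\<ge>0. v t y \<in> U0" using st by blast
      interpret rv: compact_flow "rev_flow v" by (rule rev_compact_flow)
      have y0: "y \<in> U0" using st by (metis v_0)
      have "\<forall>s\<ge>0. psi (- s) (h y) \<in> cball q r"
      proof -
        obtain tau :: "real => real" where tau: "\<And>t. 0 \<le> t ==> 0 \<le> tau t \<and> h (rev_flow v t y) = rev_flow psi (tau t) (h y)"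
          "\<And>s. 0 \<le> s ==> \<exists>t\<ge>0. tau t = s"
        proof (rule orbit_equivalence_forward[OF orbit_equivalence_rev[OF oe] _ _ B, of y])
          have "continuous_on UNIV (\<lambda>s. psi (- s) (h y))"
            by (rule continuous_on_compose2[OF contpsi[OF hM[OF st0]]]) (auto intro!: continuous_intros)
          then show "continuous_on UNIV (\<lambda>s. rev_flow psi s (h y))" by (simp add: rev_flow_def)
        qed (use st U0B y0 that in \<open>auto simp: rev_flow_def\<close>)
        show ?thesis
        proof (intro allI impI)
          fix s :: real assume "s \<ge> 0"
          then obtain t where "t \<ge> 0" "h (v (- t) y) = psi (- s) (h y)" using tau unfolding rev_flow_def by metis
          then show "psi (- s) (h y) \<in> cball q r" using st U0B unfolding B_def by (metis IntD1)
        qed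
      qed
      then have "psi s (h y) \<in> cball q r0" for s
        using hB[OF st0] r(2) by (cases "s \<ge> 0") (auto dest: spec[of _ "- s"])
      then have "h y = q" using r0(4)[OF hM[OF st0]] by blast
      then show False using hne[OF st0 \<open>y \<noteq> p\<close>] by simp
    qed
  qed
qed

end

section \<open>Neighbourhoods of saddles\<close>

text \<open>S and U contain one point of each stable and unstable separatrix of p.\<close>

locale saddle_box = compact_flow v
  for v :: "real => 'a::{t2_space, second_countable_topology} => 'a" +
  fixes p :: 'a and N S U :: "'a set"
  assumes p_Sing: "p \<in> Sing v" and N: "open N" "p \<in> N" and S_finite: "finite S" and U_finite: "finite U"
    and forward: "\<And>y. (\<And>t. t \<ge> 0 ==> v t y \<in> closure N) ==> omega_limit v y = {p} \<and> (y = p \<or> (\<exists>s\<in>S. y \<in> orbit v s))"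
    and backward: "\<And>y. (\<And>t. t \<le> 0 ==> v t y \<in> closure N) ==> alpha_limit v y = {p} \<and> (y = p \<or> (\<exists>u\<in>U. y \<in> orbit v u))"
    and whole: "\<And>y. (\<And>t. v t y \<in> closure N) ==> y = p"
    and S: "\<And>s. s \<in> S ==> s \<noteq> p" "\<And>s t. s \<in> S ==> t \<ge> 0 ==> v t s \<in> N" "\<And>s s'. s \<in> S ==> s' \<in> S ==> s' \<in> orbit v s ==> s' = s"
    and U: "\<And>u. u \<in> U ==> u \<noteq> p" "\<And>u t. u \<in> U ==> t \<le> 0 ==> v t u \<in> N" "\<And>u u'. u \<in> U ==> u' \<in> U ==> u' \<in> orbit v u ==> u' = u"
begin

section \<open>Separatrices and passages through a saddle box\<close>

lemma rev_saddle_box: "saddle_box (rev_flow v) p N U S"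
proof (intro saddle_box.intro rev_compact_flow, unfold_locales)
  show "omega_limit (rev_flow v) y = {p} \<and> (y = p \<or> (\<exists>s\<in>U. y \<in> orbit (rev_flow v) s))"
    if "\<And>t. t \<ge> 0 ==> rev_flow v t y \<in> closure N" for y
    using backward[of y] that[of "- t" for t] by (simp add: rev_flow_def)
  show "alpha_limit (rev_flow v) y = {p} \<and> (y = p \<or> (\<exists>s\<in>S. y \<in> orbit (rev_flow v) s))"
    if "\<And>t. t \<le> 0 ==> rev_flow v t y \<in> closure N" for y
    using forward[of y] that[of "- t" for t] by (simp add: rev_flow_def)
  show "y = p" if "\<And>t. rev_flow v t y \<in> closure N" for y
    using whole[of y] that[of "- t" for t] by (simp add: rev_flow_def)
  show "rev_flow v t s \<in> N" if "s \<in> U" "0 \<le> t" for s t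
    using U(2)[OF that(1), of "- t"] that(2) by (simp add: rev_flow_def)
  show "rev_flow v t s \<in> N" if "s \<in> S" "t \<le> 0" for s t
    using S(2)[OF that(1), of "- t"] that(2) by (simp add: rev_flow_def)
  show "s' = s" if "s \<in> U" "s' \<in> U" "s' \<in> orbit (rev_flow v) s" for s s'
    using U(3)[OF that(1,2)] that(3) by (simp only: orbit_rev)
  show "s' = s" if "s \<in> S" "s' \<in> S" "s' \<in> orbit (rev_flow v) s" for s s'
    using S(3)[OF that(1,2)] that(3) by (simp only: orbit_rev)
  show "p \<in> Sing (rev_flow v)" using p_Sing by (simp only: Sing_rev)
qed (fact N S_finite U_finite S(1) U(1))+

lemma closure_N: "x \<in> N ==> x \<in> closure N"
  using closure_subset by blast

lemma S_omega: "s \<in> S ==> om s = {p}"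
  using forward[of s] S(2) closure_N by blast

lemma U_alpha: "u \<in> U ==> al u = {p}"
  using backward[of u] U(2) closure_N by blast

lemma N_not_exit: "y = p" if "\<And>t. v t y \<in> N"
  using whole[of y] that closure_N by blast

text \<open>Otherwise the future of \<open>s\<close> and the past of \<open>u\<close> would together
  cover the orbit, which would then lie entirely in \<open>N\<close>.\<close>

lemma S_U_disjoint: "s \<in> S ==> u \<in> U ==> u = v r s ==> r < 0"
proof (rule ccontr)
  assume su: "s \<in> S" "u \<in> U" "u = v r s" and "\<not> r < 0"
  have "v t s \<in> N" for t
  proof (cases "t \<ge> 0")
    case False
    then have "v (t - r) u \<in> N" using \<open>\<not> r < 0\<close> by (intro U(2) su) simp
    then show ?thesis using su(3) by simp
  qed (use S(2) su in simp)
  then show False using N_not_exit S(1) su(1) by blast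
qed

lemma S_regular: "s \<in> S ==> s \<notin> Sing v"
  using whole[of s] S(1) S(2)[of s 0] closure_N Sing_v[of s] by (metis order_refl)

lemma S_not_backward: "s \<in> S ==> \<exists>t<0. v t s \<notin> closure N"
  using whole[of s] S(1,2) closure_N by (meson not_le)

lemma stable_orbit:
  assumes "om y = {p}" "y \<noteq> p" shows "\<exists>s\<in>S. y \<in> orbit v s"
proof -
  obtain T where T: "\<And>t. t \<ge> T ==> v t y \<in> N" using omega_eventually[OF N(1), of y] assms(1) N(2) by auto
  have "v t (v T y) \<in> closure N" if "t \<ge> 0" for t using T[of "t + T"] that closure_N by simp
  then have "v T y = p \<or> (\<exists>s\<in>S. v T y \<in> orbit v s)" using forward by blast
  moreover have "v T y \<noteq> p"
  proof
    assume "v T y = p"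
    then have "v (- T) (v T y) = v (- T) p" by (simp only:)
    then show False using assms(2) Sing_v[OF p_Sing] by simp
  qed
  ultimately obtain s where s: "s \<in> S" "v T y \<in> orbit v s" by blast
  have "orbit v y = orbit v s" using orbit_eq[OF s(2)] by simp
  then show ?thesis using s(1) in_orbit(2)[of y] by blast
qed

lemma W_stable_eq: "W_stable v p = {p} \<union> (\<Union>s\<in>S. orbit v s)"
proof -
  have "y \<in> W_stable v p \<longleftrightarrow> y = p \<or> (\<exists>s\<in>S. y \<in> orbit v s)" for y
  proof
    show "y = p \<or> (\<exists>s\<in>S. y \<in> orbit v s)" if "y \<in> W_stable v p"
      using stable_orbit[of y] that unfolding W_stable_def by blast
    assume "y = p \<or> (\<exists>s\<in>S. y \<in> orbit v s)"
    then consider "y = p" | s t where "s \<in> S" "y = v t s" unfolding orbit_def by blast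
    then have "om y = {p}"
    proof cases
      case 1
      then show ?thesis using omega_Sing[OF p_Sing] by simp
    next
      case 2
      then show ?thesis using S_omega[OF 2(1)] by simp
    qed
    then show "y \<in> W_stable v p" by (simp add: W_stable_def)
  qed
  then show ?thesis by blast
qed

text \<open>The longer the stay in \<open>N\<close>, the longer the past of the exit point lies in
  \<open>N\<close>. A limit of exit points has its whole past in the closure of \<open>N\<close>,
  hence lies on an unstable separatrix; being outside \<open>N\<close>, it comes after the
  representative \<open>u\<close>.\<close>

lemma exit_limit:
  fixes x :: "nat => 'a" and e :: "nat => real"
  assumes e: "filterlim e at_top sequentially"
    and stay: "\<And>n s. 0 \<le> s ==> s < e n ==> v s (x n) \<in> N" and out: "\<And>n. v (e n) (x n) \<notin> N"
  obtains k u r where "strict_mono (k :: nat => nat)" "u \<in> U" "0 < r" "(\<lambda>n. v (e (k n)) (x (k n))) \<longlonglongrightarrow> v r u"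
proof -
  obtain k w where k: "strict_mono (k :: nat => nat)" and w: "(\<lambda>n. v (e (k n)) (x (k n))) \<longlonglongrightarrow> w"
    by (rule convergent_subseq[of "\<lambda>n. v (e n) (x n)"])
  have ek: "filterlim (\<lambda>n. e (k n)) at_top sequentially"
    by (rule filterlim_compose[OF e filterlim_subseq[OF k]])
  have bwd: "v (- s) w \<in> closure N" if s: "s > 0" for s
  proof (rule Lim_in_closed_set[OF closed_closure _ sequentially_bot])
    show "(\<lambda>n. v (- s) (v (e (k n)) (x (k n)))) \<longlonglongrightarrow> v (- s) w" by (intro tendsto_intros w)
    have "\<forall>\<^sub>F n in sequentially. s \<le> e (k n)" using ek unfolding filterlim_at_top by blast
    then show "\<forall>\<^sub>F n in sequentially. v (- s) (v (e (k n)) (x (k n))) \<in> closure N"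
      by (rule eventually_mono) (use stay s closure_N in simp)
  qed
  have wN: "w \<notin> N"
  proof -
    have "w \<in> - N"
      by (rule Lim_in_closed_set[OF _ _ sequentially_bot w]) (use N(1) out in auto)
    then show ?thesis by simp
  qed
  have "v t (v (- 1) w) \<in> closure N" if "t \<le> 0" for t
    using bwd[of "1 - t"] that by simp
  then consider "v (- 1) w = p" | u where "u \<in> U" "v (- 1) w \<in> orbit v u" using backward by blast
  then show ?thesis
  proof cases
    case 1
    then have "v 1 (v (- 1) w) = v 1 p" by (simp only:)
    then have "w = v 1 p" by simp
    then show ?thesis using wN N(2) Sing_v[OF p_Sing] by simp
  next
    case 2
    then obtain r where "v (- 1) w = v r u" unfolding orbit_def by auto
    then have "v 1 (v (- 1) w) = v 1 (v r u)" by (simp only:)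
    then have r: "w = v (1 + r) u" by simp
    have "1 + r > 0" using U(2)[OF 2(1), of "1 + r"] wN r by (cases "1 + r \<le> 0") auto
    then show ?thesis using that[OF k 2(1)] w r by simp
  qed
qed

lemma exit_time:
  assumes "t0 \<ge> 0" "v t0 y \<notin> N" "y \<in> N"
  obtains e where "0 < e" "v e y \<notin> N" "\<And>s. 0 \<le> s ==> s < e ==> v s y \<in> N"
proof -
  let ?H = "{0..} \<inter> (\<lambda>s. v s y) -` (- N)"
  have cl: "closed ?H" by (intro closed_Int closed_vimage) (use N(1) in \<open>auto intro!: continuous_intros\<close>)
  have bdd: "bdd_below ?H" by (rule bdd_belowI[of _ 0]) auto
  have "t0 \<in> ?H" using assms by simp
  then have m: "Inf ?H \<in> ?H" using closed_contains_Inf[OF _ bdd cl] by blast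
  show ?thesis
  proof (rule that)
    show "v (Inf ?H) y \<notin> N" using m by simp
    then show "0 < Inf ?H" using m assms(3) by (cases "Inf ?H = 0") auto
    show "v s y \<in> N" if "0 \<le> s" "s < Inf ?H" for s
      using cInf_lower[OF _ bdd, of s] that by force
  qed
qed

lemma exit_times_unbounded:
  fixes x :: "nat => 'a" and e :: "nat => real"
  assumes x: "x \<longlonglongrightarrow> y" and y: "\<And>s. s \<ge> 0 ==> v s y \<in> N" and out: "\<And>n. v (e n) (x n) \<notin> N" "\<And>n. 0 \<le> e n"
  shows "filterlim e at_top sequentially"
  unfolding filterlim_at_top
proof
  fix Z :: real
  obtain W where W: "open W" "y \<in> W" "\<And>z s. z \<in> W ==> s \<in> {0..Z} ==> v s z \<in> N"
    using tube[of "{0..Z}" N y] N(1) y by auto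
  have "\<forall>\<^sub>F n in sequentially. x n \<in> W" using topological_tendstoD[OF x W(1,2)] .
  then show "\<forall>\<^sub>F n in sequentially. Z \<le> e n"
    by (rule eventually_mono) (use W(3) out in \<open>metis atLeastAtMost_iff le_cases\<close>)
qed

text \<open>The orbit of \<open>y\<close> comes arbitrarily close to \<open>p\<close> but leaves
  \<open>N\<close> each time, after longer and longer stays. The exit points accumulate on an
  unstable separatrix, and the limit set is invariant. This is the Butler-McGehee argument.\<close>

lemma omega_hits_unstable:
  assumes "p \<in> om y" "om y \<noteq> {p}"
  shows "\<exists>u\<in>U. u \<in> om y"
proof -
  obtain T :: "nat => real" where T: "filterlim T at_top sequentially" "(\<lambda>n. v (T n) y) \<longlonglongrightarrow> p"
    by (rule omegaE[OF assms(1)])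
  have "\<forall>\<^sub>F n in sequentially. v (T n) y \<in> N" by (rule topological_tendstoD[OF T(2) N])
  then obtain n0 where n0: "\<And>n. n \<ge> n0 ==> v (T n) y \<in> N" by (auto simp: eventually_sequentially)
  have "\<exists>e. 0 < e \<and> v e (v (T n) y) \<notin> N \<and> (\<forall>s. 0 \<le> s --> s < e --> v s (v (T n) y) \<in> N)" if n: "n \<ge> n0" for n
  proof -
    have "\<exists>t0\<ge>0. v t0 (v (T n) y) \<notin> N"
    proof (rule ccontr)
      assume "\<not> ?thesis"
      then have "om (v (T n) y) = {p}" using forward closure_N by blast
      then show False using assms(2) by (simp only: omega_shift)
    qed
    then show ?thesis using exit_time[OF _ _ n0[OF n]] by metis
  qed
  then have "\<forall>n. \<exists>e. 0 < e \<and> v e (v (T (n + n0)) y) \<notin> N \<and> (\<forall>s. 0 \<le> s --> s < e --> v s (v (T (n + n0)) y) \<in> N)"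
    by simp
  then obtain e where e: "\<And>n. 0 < e n" "\<And>n. v (e n) (v (T (n + n0)) y) \<notin> N"
    "\<And>n s. 0 \<le> s ==> s < e n ==> v s (v (T (n + n0)) y) \<in> N" by metis
  define x where "x n = v (T (n + n0)) y" for n
  have x: "x \<longlonglongrightarrow> p" unfolding x_def by (rule LIMSEQ_ignore_initial_segment[OF T(2)])
  have et: "filterlim e at_top sequentially"
    by (rule exit_times_unbounded[OF x]) (use N(2) Sing_v[OF p_Sing] e in \<open>auto simp: x_def less_imp_le\<close>)
  obtain k u r where k: "strict_mono (k :: nat => nat)" "u \<in> U" "0 < r" "(\<lambda>n. v (e (k n)) (x (k n))) \<longlonglongrightarrow> v r u"
    by (rule exit_limit[OF et, of x]) (use e in \<open>auto simp: x_def\<close>)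
  have "filterlim (\<lambda>n. e n + T (n + n0)) at_top sequentially"
    by (rule filterlim_at_top_add_at_top[OF et filterlim_compose[OF T(1) filterlim_add_const_nat_at_top]])
  then have "filterlim (\<lambda>n. e (k n) + T (k n + n0)) at_top sequentially"
    by (rule filterlim_compose[OF _ filterlim_subseq[OF k(1)]])
  then have "v r u \<in> om y"
    by (rule omegaI) (use k(4) in \<open>simp_all add: x_def\<close>)
  from omega_invariant[OF this, of "- r"] have "u \<in> om y" by simp
  with k(2) show ?thesis by blast
qed

end

section \<open>Existence of saddle boxes\<close>

context compact_flow
begin

text \<open>A compact Hausdorff space is regular.\<close>

lemma shrink_nbhd:
  fixes p :: 'a
  assumes "open G" "p \<in> G"
  obtains N where "open N" "p \<in> N" "closure N \<subseteq> G"
proof -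
  have "Hausdorff_space (euclidean :: 'a topology)"
    unfolding Hausdorff_space_def using hausdorff by (fastforce simp: disjnt_def)
  then have "regular_space (euclidean :: 'a topology)"
    using compact_space compact_Hausdorff_imp_regular_space[of "euclidean :: 'a topology"]
    by (simp add: compact_space_def)
  then have "\<forall>C (a::'a). closed C \<and> a \<notin> C --> (\<exists>U. open U \<and> (\<exists>V. open V \<and> a \<in> U \<and> C \<subseteq> V \<and> disjnt U V))"
    by (simp add: regular_space_def)
  from this[rule_format, of "- G" p] assms
  obtain A B where AB: "open A" "open B" "p \<in> A" "- G \<subseteq> B" "disjnt A B" by auto
  have "closure A \<subseteq> - B"
    by (rule closure_minimal) (use AB in \<open>auto simp: disjnt_def\<close>)
  then show ?thesis using that[OF AB(1,3)] AB(4) by blast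
qed

text \<open>Points with the same value of \<open>sg\<close> share an orbit, so apart from
  \<open>p\<close> at most two orbits contain a point whose future stays in \<open>U0\<close>. On
  each of them a point is chosen late enough for its future to remain in \<open>N\<close>.\<close>

lemma stable_representatives:
  fixes sg :: "'a => bool"
  assumes N: "open N" "p \<in> N"
    and conv: "\<And>y. \<forall>t\<ge>0. v t y \<in> U0 ==> om y = {p}"
    and sg: "\<And>y y'. \<forall>t\<ge>0. v t y \<in> U0 ==> \<forall>t\<ge>0. v t y' \<in> U0 ==> y \<noteq> p ==> y' \<noteq> p ==> sg y = sg y' ==> y' \<in> orbit v y"
  obtains S where "finite S" "\<And>y. \<forall>t\<ge>0. v t y \<in> U0 ==> y \<noteq> p ==> \<exists>s\<in>S. y \<in> orbit v s"
    "\<And>s. s \<in> S ==> s \<noteq> p" "\<And>s t. s \<in> S ==> t \<ge> 0 ==> v t s \<in> N" "\<And>s s'. s \<in> S ==> s' \<in> S ==> s' \<in> orbit v s ==> s' = s"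
proof -
  define R where "R = {y. y \<noteq> p \<and> (\<forall>t\<ge>0. v t y \<in> U0)}"
  have "orbit v ` R \<subseteq> (\<lambda>b. orbit v (SOME y. y \<in> R \<and> sg y = b)) ` UNIV"
  proof
    fix c assume "c \<in> orbit v ` R"
    then obtain y where y: "y \<in> R" "c = orbit v y" by blast
    define z where "z = (SOME z. z \<in> R \<and> sg z = sg y)"
    have z: "z \<in> R" "sg z = sg y" using someI[of "\<lambda>z. z \<in> R \<and> sg z = sg y" y] y(1) by (auto simp: z_def)
    have "z \<in> orbit v y" using sg[of y z] y(1) z by (auto simp: R_def)
    then have "c = orbit v z" using orbit_eq y(2) by metis
    then show "c \<in> (\<lambda>b. orbit v (SOME y. y \<in> R \<and> sg y = b)) ` UNIV" by (auto simp: z_def)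
  qed
  then have fin: "finite (orbit v ` R)" by (rule finite_subset) simp
  have "\<exists>g. g \<noteq> p \<and> (\<forall>t\<ge>0. v t g \<in> N) \<and> orbit v g = c" if c: "c \<in> orbit v ` R" for c
  proof -
    obtain y where y: "y \<in> R" "c = orbit v y" using c by blast
    have lim: "om y = {p}" using conv y(1) by (simp add: R_def)
    obtain T where T: "\<And>t. t \<ge> T ==> v t y \<in> N" using omega_eventually[OF N(1), of y] lim N(2) by auto
    have "v T y \<noteq> p"
    proof
      assume "v T y = p"
      then have "v (- T) (v T y) = v (- T) p" by (simp only:)
      then have "y = v (- T) p" by simp
      then show False using y(1) Sing_v[OF omega_singleton_Sing[OF lim]] by (simp add: R_def)
    qed
    then show ?thesis using T y(2) by (intro exI[of _ "v T y"]) auto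
  qed
  then obtain g where g: "\<And>c. c \<in> orbit v ` R ==> g c \<noteq> p \<and> (\<forall>t\<ge>0. v t (g c) \<in> N) \<and> orbit v (g c) = c"
    by metis
  show ?thesis
  proof (rule that[of "g ` orbit v ` R"])
    show "finite (g ` orbit v ` R)" using fin by simp
    show "\<exists>s\<in>g ` orbit v ` R. y \<in> orbit v s" if "\<forall>t\<ge>0. v t y \<in> U0" "y \<noteq> p" for y
    proof
      have yR: "orbit v y \<in> orbit v ` R" using that by (auto simp: R_def)
      then show "y \<in> orbit v (g (orbit v y))" using g by simp
      show "g (orbit v y) \<in> g ` orbit v ` R" using yR by blast
    qed
    fix s assume "s \<in> g ` orbit v ` R"
    then obtain c where c: "c \<in> orbit v ` R" "s = g c" by blast
    show "s \<noteq> p" using g[OF c(1)] c(2) by simp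
    show "v t s \<in> N" if "t \<ge> 0" for t using g[OF c(1)] c(2) that by simp
    fix s' assume "s' \<in> g ` orbit v ` R" and o: "s' \<in> orbit v s"
    then obtain c' where c': "c' \<in> orbit v ` R" "s' = g c'" by blast
    have "c' = c" using orbit_eq[OF o] g[OF c(1)] g[OF c'(1)] c(2) c'(2) by metis
    then show "s' = s" using c(2) c'(2) by simp
  qed
qed

end

context compact_flow
begin

text \<open>The stable side comes from the flow and the unstable side from its reversal;
  \<open>N\<close> is shrunk until its closure lies in both neighbourhoods.\<close>

lemma saddle_box_exists:
  assumes p: "saddle v p" and G: "open G" "p \<in> G"
  obtains N S U where "saddle_box v p N S U" "N \<subseteq> G"
proof -
  obtain Uf and sgf :: "'a => bool" where f: "open Uf" "p \<in> Uf"
    "\<And>y. \<forall>t\<ge>0. v t y \<in> Uf ==> om y = {p}"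
    "\<And>y y'. \<forall>t\<ge>0. v t y \<in> Uf ==> \<forall>t\<ge>0. v t y' \<in> Uf ==> y \<noteq> p ==> y' \<noteq> p ==> sgf y = sgf y' ==> y' \<in> orbit v y"
    "\<And>y. \<forall>t. v t y \<in> Uf ==> y = p"
    by (rule saddle_forward[OF p], rule that)
  obtain Ub and sgb :: "'a => bool" where b: "open Ub" "p \<in> Ub"
    "\<And>y. \<forall>t\<ge>0. rev_flow v t y \<in> Ub ==> omega_limit (rev_flow v) y = {p}"
    "\<And>y y'. \<forall>t\<ge>0. rev_flow v t y \<in> Ub ==> \<forall>t\<ge>0. rev_flow v t y' \<in> Ub ==> y \<noteq> p ==> y' \<noteq> p ==> sgb y = sgb y' ==> y' \<in> orbit (rev_flow v) y"
    "\<And>y. \<forall>t. rev_flow v t y \<in> Ub ==> y = p"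
    by (rule rev.saddle_forward) (use p in simp, rule that)
  obtain N where N: "open N" "p \<in> N" "closure N \<subseteq> Uf \<inter> Ub \<inter> G"
    by (rule shrink_nbhd[of "Uf \<inter> Ub \<inter> G" p]) (use f b G in auto)
  obtain S where S: "finite S" "\<And>y. \<forall>t\<ge>0. v t y \<in> Uf ==> y \<noteq> p ==> \<exists>s\<in>S. y \<in> orbit v s"
    "\<And>s. s \<in> S ==> s \<noteq> p" "\<And>s t. s \<in> S ==> t \<ge> 0 ==> v t s \<in> N" "\<And>s s'. s \<in> S ==> s' \<in> S ==> s' \<in> orbit v s ==> s' = s"
    by (rule stable_representatives[OF N(1,2) f(3,4)]) (assumption+, rule that)
  obtain U where U: "finite U" "\<And>y. \<forall>t\<ge>0. rev_flow v t y \<in> Ub ==> y \<noteq> p ==> \<exists>s\<in>U. y \<in> orbit (rev_flow v) s"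
    "\<And>s. s \<in> U ==> s \<noteq> p" "\<And>s t. s \<in> U ==> t \<ge> 0 ==> rev_flow v t s \<in> N"
    "\<And>s s'. s \<in> U ==> s' \<in> U ==> s' \<in> orbit (rev_flow v) s ==> s' = s"
    by (rule rev.stable_representatives[OF N(1,2) b(3,4)]) (assumption+, rule that)
  have "saddle_box v p N S U"
  proof
    show "p \<in> Sing v" using p by (simp add: saddle_def)
    show "open N" "p \<in> N" "finite S" "finite U" by fact+
    show "om y = {p} \<and> (y = p \<or> (\<exists>s\<in>S. y \<in> orbit v s))" if "\<And>t. t \<ge> 0 ==> v t y \<in> closure N" for y
    proof -
      have "\<forall>t\<ge>0. v t y \<in> Uf" using that N(3) by blast
      then show ?thesis using f(3) S(2) by blast
    qed
    show "al y = {p} \<and> (y = p \<or> (\<exists>u\<in>U. y \<in> orbit v u))" if st: "\<And>t. t \<le> 0 ==> v t y \<in> closure N" for y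
    proof -
      have "rev_flow v t y \<in> Ub" if "t \<ge> 0" for t using st[of "- t"] that N(3) by (auto simp: rev_flow_def)
      then have "\<forall>t\<ge>0. rev_flow v t y \<in> Ub" by blast
      from b(3)[OF this] U(2)[OF this] show ?thesis by (auto simp only: omega_limit_rev orbit_rev)
    qed
    show "y = p" if "\<And>t. v t y \<in> closure N" for y
      using f(5)[of y] that N(3) by blast
    show "v t u \<in> N" if "u \<in> U" "t \<le> 0" for u t
      using U(4)[OF that(1), of "- t"] that(2) by (simp add: rev_flow_def)
    show "u' = u" if "u \<in> U" "u' \<in> U" "u' \<in> orbit v u" for u u'
      using U(5)[OF that(1,2)] that(3) by (simp only: orbit_rev)
  qed (fact S U(3))+
  then show ?thesis using that N(3) closure_subset[of N] by blast
qed

end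

section \<open>Sections through finitely many points\<close>

text \<open>\<open>J\<close> consists of parameters at which the arc has a flow box. It may contain
  an end, as happens at the boundary of the surface, and it must contain every parameter over
  \<open>K\<close>.\<close>

definition section_arc ::
  "(real => 'a::topological_space => 'a) => 'a set => 'a => real => 'a set => (real => 'a) => real => real => real set => bool" where
  "section_arc v K y eps W c l r J \<longleftrightarrow> l < r \<and> {l..r} \<subseteq> {-1<..<1} \<and>
     c 0 = y \<and> 0 \<in> J \<and> J \<subseteq> {l..r} \<and> finite ({l..r} - J) \<and> continuous_on {l..r} c \<and> c ` {l..r} \<subseteq> W \<and>
     inj_on (\<lambda>(t, s). v s (c t)) ({l..r} \<times> {-eps<..<eps}) \<and> (\<forall>t\<in>{l..r}. c t \<in> K --> t \<in> J) \<and>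
     (\<forall>t\<in>J. \<forall>d>0. \<forall>e>0. \<exists>U. open U \<and> c t \<in> U \<and> (\<forall>x\<in>U. \<exists>t'\<in>{l..r}. \<exists>s. \<bar>t' - t\<bar> < d \<and> \<bar>s\<bar> < e \<and> x = v s (c t')))"

context surface_flow
begin

text \<open>\<open>eps\<close> precedes \<open>W\<close>, so that the arc can be shrunk later while
  its flow box keeps the time \<open>eps\<close>. Ends created by the shrinking are placed off
  \<open>K\<close>.\<close>

lemma transversal_arc:
  assumes y: "y \<notin> Sing v" and K: "invariant_set v K" "interior K = {}"
  obtains eps where "eps > 0" "\<And>W. open W ==> y \<in> W ==> \<exists>c l r J. section_arc v K y eps W c l r J"
proof -
  obtain X eps and c :: "real => 'a" where X: "X = {-1<..<1} \<or> X = {0..<1}" and eps: "eps > 0" and c: "c 0 = y" "continuous_on X c"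
    and inj: "inj_on (\<lambda>(t, s). v s (c t)) (X \<times> {-eps<..<eps})"
    and nhd: "\<And>t d e. t \<in> X ==> 0 < d ==> 0 < e ==>
      \<exists>U. open U \<and> c t \<in> U \<and> (\<forall>x\<in>U. \<exists>t'\<in>X. \<exists>s. \<bar>t' - t\<bar> < d \<and> \<bar>s\<bar> < e \<and> x = v s (c t'))"
    by (rule transversal[OF y], rule that)
  show ?thesis
  proof (rule that[OF eps])
    fix W :: "'a set" assume W: "open W" "y \<in> W"
    have 0: "0 \<in> X" using X by auto
    have "\<forall>\<^sub>F t in at 0 within X. c t \<in> W"
      using c(2) 0 W c(1) topological_tendstoD unfolding continuous_on_def by metis
    then obtain d where d: "d > 0" "\<And>t. t \<in> X ==> \<bar>t\<bar> < d ==> c t \<in> W"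
      unfolding eventually_at using W(2) c(1) by (force simp: dist_real_def)
    \<comment> \<open>A piece of the arc inside the invariant set \<open>K\<close> would sweep out
      an open subset of \<open>K\<close>.\<close>
    have outside: "\<exists>t. a < t \<and> t < b \<and> c t \<notin> K" if ab: "a < b" "{a<..<b} \<subseteq> X" for a b
    proof (rule ccontr)
      assume no: "\<not> ?thesis"
      let ?m = "(a + b) / 2"
      obtain U where U: "open U" "c ?m \<in> U" "\<And>x. x \<in> U ==> \<exists>t'\<in>X. \<exists>s. \<bar>t' - ?m\<bar> < (b - a) / 2 \<and> \<bar>s\<bar> < 1 \<and> x = v s (c t')"
      proof -
        have "?m \<in> {a<..<b}" using ab(1) by simp
        then have "?m \<in> X" using ab(2) by blast
        from nhd[OF this, of "(b - a) / 2" 1] ab(1) show ?thesis using that by (simp, metis)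
      qed
      have "U \<subseteq> K"
      proof
        fix x assume "x \<in> U"
        then obtain t' s where t': "\<bar>t' - ?m\<bar> < (b - a) / 2" "x = v s (c t')" using U(3) by blast
        have "a < t'" using abs_less_iff[THEN iffD1, OF t'(1)] by argo
        moreover have "t' < b" using abs_less_iff[THEN iffD1, OF t'(1)] by argo
        ultimately have "c t' \<in> K" using no by blast
        then show "x \<in> K" using t'(2) K(1) by (auto simp: invariant_set_def)
      qed
      then show False using U(1,2) K(2) interior_maximal by blast
    qed
    define m where "m = min d 1"
    have m: "0 < m" "m \<le> d" "m \<le> 1" using d(1) by (auto simp: m_def)
    obtain r where r: "0 < r" "r < m" "c r \<notin> K" 
    proof -
      have "{0<..<m} \<subseteq> X" using X m by auto
      then show ?thesis using outside[OF m(1)] that by blast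
    qed
    obtain l J where l: "l \<le> 0" "- m < l" "{l..r} \<subseteq> X" and J: "0 \<in> J" "J \<subseteq> {l..r}" "finite ({l..r} - J)"
      "\<And>t. t \<in> {l..r} ==> c t \<in> K ==> t \<in> J" "\<And>t. t \<in> J ==> \<exists>d>0. \<forall>t'\<in>X. \<bar>t' - t\<bar> < d --> t' \<in> {l..r}"
    proof (cases "X = {0..<1}")
      case True
      show ?thesis
      proof (rule that[of 0 "{0..<r}"])
        have "{0..r} - {0..<r} \<subseteq> {r}" by auto
        then show "finite ({0..r} - {0..<r})" by (rule finite_subset) simp
        show "\<exists>d>0. \<forall>t'\<in>X. \<bar>t' - t\<bar> < d --> t' \<in> {0..r}" if "t \<in> {0..<r}" for t
          using that True by (intro exI[of _ "r - t"]) auto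
        show "t \<in> {0..<r}" if "t \<in> {0..r}" "c t \<in> K" for t using that r(3) by (cases "t = r") auto
      qed (use True r m in auto)
    next
      case False
      then have X': "X = {-1<..<1}" using X by blast
      obtain l where l: "- m < l" "l < 0" "c l \<notin> K" 
      proof -
        have "{- m<..<0} \<subseteq> X" using X' m by auto
        then show ?thesis using outside[of "- m" 0] m(1) that by auto
      qed
      show ?thesis
      proof (rule that[of l "{l<..<r}"])
        have "{l..r} - {l<..<r} \<subseteq> {l, r}" by auto
        then show "finite ({l..r} - {l<..<r})" by (rule finite_subset) simp
        show "\<exists>d>0. \<forall>t'\<in>X. \<bar>t' - t\<bar> < d --> t' \<in> {l..r}" if "t \<in> {l<..<r}" for t
          using that by (intro exI[of _ "min (r - t) (t - l)"]) auto
        show "t \<in> {l<..<r}" if "t \<in> {l..r}" "c t \<in> K" for t using that r(3) l(3) by (cases "t = r"; cases "t = l") auto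
      qed (use X' r m l in auto)
    qed
    have box: "\<exists>U. open U \<and> c t \<in> U \<and> (\<forall>x\<in>U. \<exists>t'\<in>{l..r}. \<exists>s. \<bar>t' - t\<bar> < d \<and> \<bar>s\<bar> < e \<and> x = v s (c t'))"
      if t: "t \<in> J" and de: "d > 0" "e > 0" for t d e
    proof -
      obtain d' where d': "d' > 0" "\<And>t'. t' \<in> X ==> \<bar>t' - t\<bar> < d' ==> t' \<in> {l..r}" using J(5)[OF t] by blast
      obtain U where "open U" "c t \<in> U" "\<And>x. x \<in> U ==> \<exists>t'\<in>X. \<exists>s. \<bar>t' - t\<bar> < min d d' \<and> \<bar>s\<bar> < e \<and> x = v s (c t')"
      proof -
        have "t \<in> X" "0 < min d d'" using t J(2) l(3) de(1) d'(1) by auto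
        from nhd[OF this de(2)] show ?thesis using that by blast
      qed
      then show ?thesis using d'(2) by (intro exI[of _ U]) fastforce
    qed
    show "\<exists>c l r J. section_arc v K y eps W c l r J"
      unfolding section_arc_def
    proof (rule exI[of _ c], rule exI[of _ l], rule exI[of _ r], rule exI[of _ J], intro conjI ballI allI impI)
      show "l < r" using l r by simp
      show "{l..r} \<subseteq> {-1<..<1}" using l r m by auto
      show "c ` {l..r} \<subseteq> W"
      proof
        fix x assume "x \<in> c ` {l..r}"
        then obtain t where t: "t \<in> {l..r}" "x = c t" by blast
        then have "\<bar>t\<bar> < d" using l r m by auto
        then show "x \<in> W" using d(2) l(3) t by blast
      qed
      show "continuous_on {l..r} c" by (rule continuous_on_subset[OF c(2) l(3)])
      show "inj_on (\<lambda>(t, s). v s (c t)) ({l..r} \<times> {-eps<..<eps})"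
        by (rule inj_on_subset[OF inj]) (use l(3) in blast)
    qed (use c(1) J(1-4) box in auto)
  qed
qed

lemma separated_nbhds:
  assumes "\<And>s. \<bar>s\<bar> \<le> a ==> v s z \<noteq> z'"
  obtains A B where "open A" "z \<in> A" "open B" "z' \<in> B" "\<And>x s. x \<in> A ==> \<bar>s\<bar> \<le> a ==> v s x \<notin> B"
proof -
  let ?M = "(\<lambda>s. v s z) ` {-a..a}"
  have "compact ?M" by (intro compact_continuous_image continuous_intros) auto
  then have "open (- ?M)" by (simp add: compact_imp_closed open_Compl)
  moreover have "z' \<in> - ?M" using assms by force
  ultimately obtain B where B: "open B" "z' \<in> B" "closure B \<subseteq> - ?M" by (rule shrink_nbhd)
  have "v s z \<in> - closure B" if "s \<in> {-a..a}" for s using B(3) that by blast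
  then obtain A where A: "open A" "z \<in> A" "\<forall>x\<in>A. \<forall>s\<in>{-a..a}. v s x \<in> - closure B"
    using tube[of "{-a..a}" "- closure B" z] by (metis closed_closure compact_Icc open_Compl)
  show ?thesis
  proof (rule that[OF A(1,2) B(1,2)])
    fix x s assume "x \<in> A" "\<bar>s\<bar> \<le> a"
    moreover from this have "s \<in> {-a..a}" by auto
    ultimately have "v s x \<in> - closure B" using A(3) by blast
    then show "v s x \<notin> B" using closure_subset[of B] by blast
  qed
qed

text \<open>\<open>eps\<close> is again independent of \<open>W\<close>, because the neighbourhoods
  will be chosen to avoid separatrices after the time \<open>eps\<close>. The arcs through different
  points of \<open>Z\<close> are placed apart on the parameter line and cannot reach each other
  within the time \<open>2 * eps\<close>.\<close>

lemma section_through: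
  assumes Z: "finite Z" "\<And>z. z \<in> Z ==> z \<notin> Sing v" and K: "invariant_set v K" "interior K = {}"
  obtains eps where "eps > 0" "\<forall>W. (\<forall>z\<in>Z. open (W z) \<and> z \<in> W z) --> (\<exists>D D' tau. cross_section v D D' tau eps \<and>
     (\<forall>z\<in>Z. \<exists>t\<in>D'. tau t = z) \<and> (\<forall>t\<in>D. tau t \<in> K --> t \<in> D') \<and> tau ` D \<subseteq> (\<Union>z\<in>Z. W z))"
proof -
  have "\<exists>eps. eps > 0 \<and> (\<forall>W. open W --> z \<in> W --> (\<exists>c l r J. section_arc v K z eps W c l r J))" if z: "z \<in> Z" for z
    by (rule transversal_arc[OF Z(2)[OF z] K]) blast
  then obtain e where e: "\<And>z. z \<in> Z ==> e z > 0" and arc: "\<And>z W. z \<in> Z ==> open W ==> z \<in> W ==>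
     \<exists>c l r J. section_arc v K z (e z) W c l r J"
    by metis
  have "\<exists>d>0. \<forall>s. \<bar>s\<bar> < d --> v s z \<noteq> z'" if "z \<noteq> z'" for z z'
  proof -
    have "((\<lambda>s. v s z) \<longlongrightarrow> v 0 z) (at 0)" by (intro tendsto_intros)
    then have "\<forall>\<^sub>F s in at 0. v s z \<noteq> z'" using that by (intro tendsto_imp_eventually_ne) auto
    then obtain d where d: "d > 0" "\<And>s. s \<noteq> 0 ==> \<bar>s\<bar> < d ==> v s z \<noteq> z'"
      unfolding eventually_at by (auto simp only: dist_real_def diff_0_right)
    have "v s z \<noteq> z'" if "\<bar>s\<bar> < d" for s using d(2)[OF _ that] \<open>z \<noteq> z'\<close> by (cases "s = 0") auto
    with d(1) show ?thesis by blast
  qed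
  then obtain d where d: "\<And>z z'. z \<noteq> z' ==> d z z' > 0" "\<And>z z' s. z \<noteq> z' ==> \<bar>s\<bar> < d z z' ==> v s z \<noteq> z'"
    by metis
  \<comment> \<open>Dividing by 3 gives \<open>2 * eps < d z z'\<close>, enough for the difference
    of two times below \<open>eps\<close>; the element 1 keeps the set nonempty.\<close>
  define E where "E = insert 1 (e ` Z \<union> (\<lambda>(z, z'). d z z' / 3) ` {(z, z') \<in> Z \<times> Z. z \<noteq> z'})"
  have finE: "finite E" unfolding E_def using Z(1) finite_subset[of "{(z, z') \<in> Z \<times> Z. z \<noteq> z'}" "Z \<times> Z"] by auto
  define eps where "eps = Min E"
  have eps: "eps > 0" unfolding eps_def using finE e d(1) by (subst Min_gr_iff) (auto simp: E_def)
  have eps_le: "eps \<le> e z" if "z \<in> Z" for z unfolding eps_def using finE that by (intro Min_le) (auto simp: E_def)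
  have eps_d: "eps \<le> d z z' / 3" if "z \<in> Z" "z' \<in> Z" "z \<noteq> z'" for z z'
    unfolding eps_def using finE that by (intro Min_le) (auto simp: E_def)
  show ?thesis
  proof (rule that[OF eps], intro allI impI)
    fix W assume "\<forall>z\<in>Z. open (W z) \<and> z \<in> W z"
    then have W: "\<And>z. z \<in> Z ==> open (W z) \<and> z \<in> W z" by blast
    define sep where "sep z z' A B \<longleftrightarrow> open A \<and> z \<in> A \<and> open B \<and> z' \<in> B \<and>
      (\<forall>x\<in>A. \<forall>s. \<bar>s\<bar> \<le> 2 * eps --> v s x \<notin> B)" for z z' A B
    have "\<exists>A B. sep z z' A B" if zz: "z \<in> Z" "z' \<in> Z" "z \<noteq> z'" for z z'
    proof -
      have "v s z \<noteq> z'" if "\<bar>s\<bar> \<le> 2 * eps" for s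
        using d(2)[OF zz(3), of s] eps_d[OF zz] d(1)[OF zz(3)] that by argo
      then obtain A B where "open A" "z \<in> A" "open B" "z' \<in> B" "\<And>x s. x \<in> A ==> \<bar>s\<bar> \<le> 2 * eps ==> v s x \<notin> B"
        using separated_nbhds[of "2 * eps" z z'] by blast
      then show ?thesis by (auto simp: sep_def)
    qed
    then obtain A B where "\<And>z z'. z \<in> Z ==> z' \<in> Z ==> z \<noteq> z' ==> sep z z' (A z z') (B z z')" by metis
    then have AB: "\<And>z z'. z \<in> Z ==> z' \<in> Z ==> z \<noteq> z' ==> open (A z z') \<and> z \<in> A z z' \<and> open (B z z') \<and> z' \<in> B z z'"
      "\<And>z z' x s. z \<in> Z ==> z' \<in> Z ==> z \<noteq> z' ==> x \<in> A z z' ==> \<bar>s\<bar> \<le> 2 * eps ==> v s x \<notin> B z z'"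
      unfolding sep_def by simp_all
    define W' where "W' z = W z \<inter> (\<Inter>z'\<in>Z - {z}. A z z' \<inter> B z' z)" for z
    have W': "open (W' z)" "z \<in> W' z" if "z \<in> Z" for z
    proof -
      show "open (W' z)" unfolding W'_def using W[OF that] Z(1) AB(1)[OF that] AB(1)[OF _ that]
        by (intro open_Int open_INT ballI) auto
      have "z \<in> A z z' \<inter> B z' z" if "z' \<in> Z - {z}" for z'
        using AB(1)[of z z'] AB(1)[of z' z] that \<open>z \<in> Z\<close> by auto
      then show "z \<in> W' z" unfolding W'_def using W[OF that] by blast
    qed
    have "\<forall>z\<in>Z. \<exists>c l r J. section_arc v K z (e z) (W' z) c l r J" using arc[OF _ W'] by blast
    then obtain c l r J where good: "\<And>z. z \<in> Z ==> section_arc v K z (e z) (W' z) (c z) (l z) (r z) (J z)" by metis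
    have lr: "l z < r z" "{l z..r z} \<subseteq> {-1<..<1}" "c z 0 = z" "0 \<in> J z" "J z \<subseteq> {l z..r z}" "finite ({l z..r z} - J z)"
      "continuous_on {l z..r z} (c z)" "c z ` {l z..r z} \<subseteq> W' z" "\<And>t. t \<in> {l z..r z} ==> c z t \<in> K ==> t \<in> J z"
      and inj: "inj_on (\<lambda>(t, s). v s (c z t)) ({l z..r z} \<times> {-e z<..<e z})"
      and nhd: "\<And>t d e. t \<in> J z ==> d > 0 ==> e > 0 ==>
        \<exists>U. open U \<and> c z t \<in> U \<and> (\<forall>x\<in>U. \<exists>t'\<in>{l z..r z}. \<exists>s. \<bar>t' - t\<bar> < d \<and> \<bar>s\<bar> < e \<and> x = v s (c z t'))"
      if "z \<in> Z" for z
      using good[OF that] unfolding section_arc_def by blast+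
    obtain n :: "'a => nat" where n: "inj_on n Z" using finite_imp_inj_to_nat_seg[OF Z(1)] by blast
    \<comment> \<open>The parameters of an arc differ from its offset by less than 1, so offsets
      that are distinct multiples of 3 keep the arcs disjoint.\<close>
    define off where "off z = 3 * real (n z)" for z
    have off: "z = z'" if "z \<in> Z" "z' \<in> Z" "\<bar>off z - off z'\<bar> < 3" for z z'
    proof -
      have "n z = n z'" using that(3) by (simp add: off_def)
      then show ?thesis using n that(1,2) by (simp add: inj_on_def)
    qed
    define I where "I z = {off z + l z..off z + r z}" for z
    have I_off: "\<bar>t - off z\<bar> < 1" if "z \<in> Z" "t \<in> I z" for z t
    proof -
      have "t - off z \<in> {l z..r z}" using that(2) by (auto simp: I_def)
      then have "t - off z \<in> {-1<..<1}" using lr(2)[OF that(1)] by blast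
      then show ?thesis by auto
    qed
    define D where "D = (\<Union>z\<in>Z. I z)"
    define D' where "D' = (\<Union>z\<in>Z. (\<lambda>t. off z + t) ` J z)"
    define zz where "zz t = (SOME z. z \<in> Z \<and> \<bar>t - off z\<bar> < 1)" for t
    have zz: "zz t = z" if "z \<in> Z" "\<bar>t - off z\<bar> < 1" for t z
    proof -
      have "zz t \<in> Z \<and> \<bar>t - off (zz t)\<bar> < 1" unfolding zz_def by (rule someI[of _ z]) (use that in simp)
      then show ?thesis using that by (intro off) auto
    qed
    define tau where "tau t = c (zz t) (t - off (zz t))" for t
    have tau: "tau t = c z (t - off z)" if "z \<in> Z" "t \<in> I z" for t z
      using zz[OF that(1) I_off[OF that]] by (simp add: tau_def)
    have tauoff: "tau (off z + t) = c z t" "off z + t \<in> I z" if "z \<in> Z" "t \<in> {l z..r z}" for t z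
    proof -
      show "off z + t \<in> I z" using that(2) by (simp add: I_def)
      then show "tau (off z + t) = c z t" using tau[OF that(1)] by simp
    qed
    have ID: "z \<in> Z ==> I z \<subseteq> D" for z by (auto simp: D_def)
    have D_loc: "t' \<in> I z" if tz: "z \<in> Z" "t' \<in> D" "\<bar>t' - off z\<bar> < 1" for z t'
    proof -
      obtain z' where z': "z' \<in> Z" "t' \<in> I z'" using tz(2) by (auto simp: D_def)
      have "z' = z" using I_off[OF z'] tz(3) by (intro off z'(1) tz(1)) auto
      then show ?thesis using z'(2) by simp
    qed
    have tauW: "tau t \<in> W' z" if "z \<in> Z" "t \<in> I z" for t z
    proof -
      have "t - off z \<in> {l z..r z}" using that(2) by (auto simp: I_def)
      then show ?thesis using lr(8)[OF that(1)] tau[OF that] by auto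
    qed
    have "cross_section v D D' tau eps"
    proof (intro cross_section.intro cross_section_axioms.intro)
      show "compact_flow v" by unfold_locales
      show "compact D" unfolding D_def I_def using Z(1) by (intro compact_UN) auto
      show "D' \<subseteq> D" using lr(5) tauoff(2) unfolding D'_def D_def by blast
      have "D - D' \<subseteq> (\<Union>z\<in>Z. (\<lambda>t. off z + t) ` ({l z..r z} - J z))"
      proof
        fix t assume t: "t \<in> D - D'"
        then obtain z where z: "z \<in> Z" "t \<in> I z" by (auto simp: D_def)
        have "off z + (t - off z) \<in> D'" if "t - off z \<in> J z"
          unfolding D'_def using z(1) that by blast
        then have "t - off z \<notin> J z" using t by auto
        moreover have "t - off z \<in> {l z..r z}" using z by (auto simp: I_def)
        ultimately have "t \<in> (\<lambda>t. off z + t) ` ({l z..r z} - J z)" by (intro image_eqI[of _ _ "t - off z"]) auto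
        then show "t \<in> (\<Union>z\<in>Z. (\<lambda>t. off z + t) ` ({l z..r z} - J z))" using z(1) by blast
      qed
      then show "finite (D - D')" by (rule finite_subset) (use Z(1) lr(6) in auto)
      show "eps > 0" by fact
      show "continuous_on D tau" unfolding D_def
      proof (rule continuous_on_closed_Union[OF Z(1)])
        fix z assume z: "z \<in> Z"
        show "closed (I z)" by (simp add: I_def)
        have "continuous_on (I z) (\<lambda>t. c z (t - off z))"
          by (rule continuous_on_compose2[OF lr(7)[OF z]]) (auto simp: I_def intro!: continuous_intros)
        then show "continuous_on (I z) tau" using tau[OF z] by (simp cong: continuous_on_cong)
      qed
      show "inj_on (\<lambda>(t, s). v s (tau t)) (D \<times> {-eps<..<eps})"
      proof (rule inj_onI, clarify)
        fix t s t' s' assume t: "t \<in> D" "t' \<in> D" and s: "s \<in> {-eps<..<eps}" "s' \<in> {-eps<..<eps}" and eq: "v s (tau t) = v s' (tau t')"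
        obtain z where z: "z \<in> Z" "t \<in> I z" using t by (auto simp: D_def)
        obtain z' where z': "z' \<in> Z" "t' \<in> I z'" using t by (auto simp: D_def)
        have "z = z'"
        proof (rule ccontr)
          assume ne: "z \<noteq> z'"
          have A: "tau t \<in> A z z'" using tauW[OF z] z'(1) ne by (auto simp: W'_def)
          have B: "tau t' \<in> B z z'" using tauW[OF z'] z(1) ne by (auto simp: W'_def)
          have "v (s - s') (tau t) = v (- s') (v s (tau t))" by simp
          then have "v (s - s') (tau t) = tau t'" unfolding eq by simp
          moreover have "\<bar>s - s'\<bar> \<le> 2 * eps" using s by auto
          ultimately show False using AB(2)[OF z(1) z'(1) ne A] B by metis
        qed
        then have tz: "t \<in> I z" "t' \<in> I z" using z z' by auto
        have "(t - off z, s) = (t' - off z, s')"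
          by (rule inj_onD[OF inj[OF z(1)]])
            (use eq tau[OF z(1) tz(1)] tau[OF z(1) tz(2)] tz s eps_le[OF z(1)] in \<open>auto simp: I_def\<close>)
        then show "t = t' \<and> s = s'" by auto
      qed
      show "\<exists>U. open U \<and> tau t \<in> U \<and> (\<forall>x\<in>U. \<exists>t'\<in>D. \<exists>s. \<bar>t' - t\<bar> < d \<and> \<bar>s\<bar> < e \<and> x = v s (tau t'))"
        if t: "t \<in> D'" and de: "0 < d" "0 < e" for t d e
      proof -
        obtain z j where z: "z \<in> Z" and j: "j \<in> J z" "t = off z + j" using t by (auto simp: D'_def)
        obtain U where U: "open U" "c z j \<in> U"
          "\<And>x. x \<in> U ==> \<exists>t'\<in>{l z..r z}. \<exists>s. \<bar>t' - j\<bar> < d \<and> \<bar>s\<bar> < e \<and> x = v s (c z t')"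
          using nhd[OF z j(1) de] by blast
        have "tau t = c z j" using tauoff[OF z] j lr(5)[OF z] by blast
        moreover have "\<exists>t'\<in>D. \<exists>s. \<bar>t' - t\<bar> < d \<and> \<bar>s\<bar> < e \<and> x = v s (tau t')" if xU: "x \<in> U" for x
        proof -
          obtain t' s where t': "t' \<in> {l z..r z}" "\<bar>t' - j\<bar> < d" "\<bar>s\<bar> < e" "x = v s (c z t')" using U(3)[OF xU] by blast
          show ?thesis
            using tauoff[OF z t'(1)] ID[OF z] t' j(2) by (intro bexI[of _ "off z + t'"] exI[of _ s]) auto
        qed
        ultimately show ?thesis using U(1,2) by (intro exI[of _ U]) auto
      qed
      show "(\<exists>d>0. \<forall>h. 0 < h --> h < d --> t + sg * h \<in> D) \<or> (\<exists>d>0. \<forall>h. 0 < h --> h < d --> t + sg * h \<notin> D)"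
        if t: "t \<in> D" and sg: "sg \<in> {1, -1}" for t sg
      proof -
        obtain z where z: "z \<in> Z" "t \<in> I z" using t by (auto simp: D_def)
        define b where "b = (if sg = 1 then off z + r z else off z + l z)"
        show ?thesis
        proof (cases "t = b")
          case True
          have "t + sg * h \<notin> D" if h: "0 < h" "h < 1 - \<bar>t - off z\<bar>" for h
          proof
            assume "t + sg * h \<in> D"
            moreover have "\<bar>t + sg * h - off z\<bar> < 1" using h sg by auto
            ultimately have "t + sg * h \<in> I z" using D_loc[OF z(1)] by blast
            then show False using True h sg by (auto simp: b_def I_def)
          qed
          then show ?thesis using I_off[OF z] by (intro disjI2 exI[of _ "1 - \<bar>t - off z\<bar>"]) auto
        next
          case False
          have "t + sg * h \<in> D" if h: "0 < h" "h < \<bar>t - b\<bar>" for h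
          proof -
            have "t + sg * h \<in> I z" using z(2) h sg by (auto simp: b_def I_def)
            then show ?thesis using ID[OF z(1)] by blast
          qed
          then show ?thesis using False by (intro disjI1 exI[of _ "\<bar>t - b\<bar>"]) auto
        qed
      qed
      show "\<exists>sg\<in>{1, -1}. \<exists>d>0. \<forall>h. 0 < h --> h < d --> t + sg * h \<in> D" if t: "t \<in> D" for t
      proof -
        obtain z where z: "z \<in> Z" "t \<in> I z" using t by (auto simp: D_def)
        show ?thesis
        proof (cases "t < off z + r z")
          case True
          have "t + 1 * h \<in> D" if "0 < h" "h < off z + r z - t" for h
            using ID[OF z(1)] z(2) that by (auto simp: I_def)
          then show ?thesis using True by (intro bexI[of _ 1] exI[of _ "off z + r z - t"]) auto
        next
          case False
          have "t + (-1) * h \<in> D" if "0 < h" "h < r z - l z" for h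
            using ID[OF z(1)] z(2) that False by (auto simp: I_def)
          then show ?thesis using lr(1)[OF z(1)] by (intro bexI[of _ "-1"] exI[of _ "r z - l z"]) auto
        qed
      qed
    qed
    moreover have "\<forall>z\<in>Z. \<exists>t\<in>D'. tau t = z"
    proof
      fix z assume z: "z \<in> Z"
      have "0 \<in> {l z..r z}" using lr(4,5)[OF z] by blast
      then have "tau (off z + 0) = z" using tauoff(1)[OF z, of 0] lr(3)[OF z] by simp
      moreover have "off z + 0 \<in> D'" unfolding D'_def using z lr(4)[OF z] by blast
      ultimately show "\<exists>t\<in>D'. tau t = z" by blast
    qed
    moreover have "\<forall>t\<in>D. tau t \<in> K --> t \<in> D'"
    proof (intro ballI impI)
      fix t assume t: "t \<in> D" "tau t \<in> K"
      then obtain z where z: "z \<in> Z" "t \<in> I z" by (auto simp: D_def)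
      have "t - off z \<in> {l z..r z}" using z(2) by (auto simp: I_def)
      then have "t - off z \<in> J z" using lr(9)[OF z(1)] t(2) tau[OF z] by simp
      then have "off z + (t - off z) \<in> D'" unfolding D'_def using z(1) by blast
      then show "t \<in> D'" by simp
    qed
    moreover have "tau ` D \<subseteq> (\<Union>z\<in>Z. W z)" using tauW by (auto simp: D_def W'_def)
    ultimately show "\<exists>D D' tau. cross_section v D D' tau eps \<and>
     (\<forall>z\<in>Z. \<exists>t\<in>D'. tau t = z) \<and> (\<forall>t\<in>D. tau t \<in> K --> t \<in> D') \<and> tau ` D \<subseteq> (\<Union>z\<in>Z. W z)"
      by blast
  qed
qed

end

section \<open>Sections across the separatrices of finitely many saddles\<close>

lemma bounded_below_seq_cases:
  fixes f :: "nat => real"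
  assumes "\<And>n. A \<le> f n"
  obtains "filterlim f at_top sequentially" |
    j l where "strict_mono (j :: nat => nat)" "(\<lambda>n. f (j n)) \<longlonglongrightarrow> l"
proof (cases "filterlim f at_top sequentially")
  case False
  then obtain Z where Z: "\<exists>\<^sub>F n in sequentially. f n < Z"
    unfolding filterlim_at_top frequently_def not_less by blast
  then have inf: "infinite {n. f n < Z}"
    by (simp add: frequently_cofinite[symmetric] cofinite_eq_sequentially)
  define i where "i = enumerate {n. f n < Z}"
  have i: "strict_mono i" "\<And>n. f (i n) < Z"
    using strict_mono_enumerate[OF inf] enumerate_in_set[OF inf] by (auto simp: i_def)
  have "\<forall>n. f (i n) \<in> {A..Z}" using assms i(2) by (auto simp: less_imp_le)
  then obtain l j where "strict_mono (j :: nat => nat)" "((\<lambda>n. f (i n)) \<circ> j) \<longlonglongrightarrow> l"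
    using compact_Icc[of A Z] unfolding compact_def by metis
  then show ?thesis using that(2)[of "\<lambda>n. i (j n)" l] strict_mono_o[OF i(1), of j] by (simp add: o_def)
next
  case True
  then show ?thesis by (rule that(1))
qed

context cross_section
begin

text \<open>Different hits are separated by a time of at least \<open>eps\<close>, so each interval
  of length \<open>eps\<close> accounts for at most one of them.\<close>

lemma finite_hits: "finite {t \<in> D. \<exists>r\<in>{a..b}. tau t = v r y}"
proof -
  let ?H = "{t \<in> D. \<exists>r\<in>{a..b}. tau t = v r y}"
  obtain r where r: "\<And>t. t \<in> ?H ==> r t \<in> {a..b} \<and> tau t = v (r t) y" by (atomize_elim, rule choice) blast
  have "inj_on (\<lambda>t. \<lfloor>r t / eps\<rfloor>) ?H"
  proof (rule inj_onI)
    fix t t' assume t: "t \<in> ?H" "t' \<in> ?H" and fl: "\<lfloor>r t / eps\<rfloor> = \<lfloor>r t' / eps\<rfloor>"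
    have "\<bar>r t' / eps - r t / eps\<bar> < 1" using fl by linarith
    then have "\<bar>(r t' - r t) / eps\<bar> < 1" by (simp add: diff_divide_distrib)
    then have "\<bar>r t' - r t\<bar> < eps" using eps by (simp add: abs_divide)
    moreover have "v (r t' - r t) (tau t) = tau t'" using r[OF t(1)] r[OF t(2)] by simp
    ultimately show "t = t'" using close_hits(2)[of t t'] t by blast
  qed
  moreover have "(\<lambda>t. \<lfloor>r t / eps\<rfloor>) ` ?H \<subseteq> {\<lfloor>a / eps\<rfloor>..\<lfloor>b / eps\<rfloor>}"
  proof (rule image_subsetI)
    fix t assume "t \<in> ?H"
    then have "r t \<in> {a..b}" using r by blast
    then have "a \<le> r t" "r t \<le> b" by simp_all
    then show "\<lfloor>r t / eps\<rfloor> \<in> {\<lfloor>a / eps\<rfloor>..\<lfloor>b / eps\<rfloor>}"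
      using eps by (simp add: floor_mono divide_right_mono)
  qed
  then have "finite ((\<lambda>t. \<lfloor>r t / eps\<rfloor>) ` ?H)" by (rule finite_subset) simp
  ultimately show ?thesis by (rule finite_imageD[rotated])
qed

end

text \<open>The representative on each stable separatrix is its last hit of the section, and that on
  each unstable separatrix its first. This pins the discontinuities of the return map caused by the
  saddles in \<open>P\<close>, and the limits there, to finitely many points.\<close>

locale saddle_section = cross_section v D D' tau eps
  for v :: "real => 'a::{t2_space, second_countable_topology} => 'a" and D D' tau eps +
  fixes P :: "'a set" and N S U :: "'a => 'a set"
  assumes P_finite: "finite P" and box: "\<And>p. p \<in> P ==> saddle_box v p (N p) (S p) (U p)"
    and S_hit: "\<And>p s. p \<in> P ==> s \<in> S p ==> s \<in> tau ` D'"
    and U_hit: "\<And>p u. p \<in> P ==> u \<in> U p ==> u \<in> tau ` D'"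
    and S_last: "\<And>p s r. p \<in> P ==> s \<in> S p ==> 0 < r ==> v r s \<notin> tau ` D"
    and U_first: "\<And>p u r. p \<in> P ==> u \<in> U p ==> r < 0 ==> v r u \<notin> tau ` D"
begin

lemma rev_saddle_section: "saddle_section (rev_flow v) D D' tau eps P N U S"
proof (intro saddle_section.intro saddle_section_axioms.intro rev_cross_section)
  show "saddle_box (rev_flow v) p (N p) (U p) (S p)" if "p \<in> P" for p
    by (rule saddle_box.rev_saddle_box[OF box[OF that]])
  show "rev_flow v r s \<notin> tau ` D" if "p \<in> P" "s \<in> U p" "0 < r" for p s r
    using U_first[OF that(1,2), of "- r"] that(3) by (simp add: rev_flow_def)
  show "rev_flow v r u \<notin> tau ` D" if "p \<in> P" "u \<in> S p" "r < 0" for p u r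
    using S_last[OF that(1,2), of "- r"] that(3) by (simp add: rev_flow_def)
qed (fact P_finite S_hit U_hit)+

lemma last_hit:
  assumes q: "q \<in> D" "q \<notin> ret_dom" and p: "p \<in> P" "om (tau q) = {p}"
  shows "tau q \<in> S p"
proof -
  interpret B: saddle_box v p "N p" "S p" "U p" by (rule box[OF p(1)])
  have "tau q \<noteq> p" using tau_regular[OF q(1)] B.p_Sing by metis
  then obtain s r where s: "s \<in> S p" and r: "tau q = v r s"
    using B.stable_orbit[OF p(2)] unfolding orbit_def by blast
  have "\<not> 0 < r" using S_last[OF p(1) s] r q(1) by (metis imageI)
  moreover have "\<not> r < 0"
  proof
    assume "r < 0"
    moreover have "v (- r) (tau q) = s" using r by simp
    moreover have "s \<in> tau ` D" using S_hit[OF p(1) s] D'_sub by blast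
    ultimately show False using q by (auto simp: ret_dom_def dest: spec[of _ "- r"])
  qed
  ultimately have "r = 0" by simp
  then show ?thesis using r s by simp
qed

text \<open>A section point that never leaves \<open>N p\<close> lies on a stable separatrix, not
  after the representative \<open>s\<close> and not before the time \<open>a s\<close> at which the
  separatrix is outside \<open>N p\<close>. Such points are finite in number.\<close>

lemma leaves:
  assumes p: "p \<in> P"
  shows "\<exists>d>0. \<forall>t\<in>D. 0 < \<bar>t - q\<bar> --> \<bar>t - q\<bar> < d --> (\<exists>r\<ge>0. v r (tau t) \<notin> N p)"
proof -
  interpret B: saddle_box v p "N p" "S p" "U p" by (rule box[OF p])
  obtain a where a: "\<And>s. s \<in> S p ==> a s < 0 \<and> v (a s) s \<notin> closure (N p)" using B.S_not_backward by metis
  define F where "F = (\<Union>s\<in>S p. {t \<in> D. \<exists>r\<in>{a s..0}. tau t = v r s})"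
  have "finite F" unfolding F_def by (intro finite_UN_I B.S_finite finite_hits)
  from finite_set_avoid[OF this, of q] obtain d where d: "d > 0" "\<And>x. x \<in> F ==> x \<noteq> q ==> d \<le> dist q x"
    by blast
  have "t \<in> F" if t: "t \<in> D" and stay: "\<And>r. r \<ge> 0 ==> v r (tau t) \<in> N p" for t
  proof -
    have "tau t = p \<or> (\<exists>s\<in>S p. tau t \<in> orbit v s)" using B.forward stay B.closure_N by blast
    moreover have "tau t \<noteq> p" using tau_regular[OF t] B.p_Sing by metis
    ultimately obtain s r where s: "s \<in> S p" "tau t = v r s" unfolding orbit_def by blast
    have "r \<le> 0" using S_last[OF p s(1), of r] s(2) t by (metis imageI not_le)
    moreover have "a s \<le> r"
    proof (rule ccontr)
      assume "\<not> a s \<le> r"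
      then have "v (a s - r) (tau t) \<in> N p" by (intro stay) simp
      then have "v (a s) s \<in> closure (N p)" using s(2) B.closure_N by simp
      then show False using a[OF s(1)] by blast
    qed
    ultimately have "r \<in> {a s..0}" by simp
    then show ?thesis using s t unfolding F_def by blast
  qed
  then show ?thesis using d by (intro exI[of _ d]) (fastforce simp: dist_real_def abs_minus_commute)
qed

text \<open>Three regimes. If the return times are bounded along a subsequence, \<open>w\<close> is
  a later hit of the stable separatrix, which is impossible. If the time left from the return to the
  exit is bounded along a subsequence, \<open>w\<close> lies on the orbit of \<open>u\<close>, not
  before \<open>u\<close> and less than \<open>eps\<close> after it, so it is \<open>u\<close>. If
  both times tend to infinity, the whole orbit of \<open>w\<close> stays in the closure of
  \<open>N p\<close>, so \<open>w\<close> is the singular point \<open>p\<close>.\<close>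

lemma passing_limit:
  fixes x :: "nat => 'a" and e rho :: "nat => real"
  assumes p: "p \<in> P" and s: "s \<in> S p" and u: "u \<in> U p" and x: "x \<longlonglongrightarrow> s"
    and rho: "\<And>n. eps \<le> rho n" "(\<lambda>n. v (rho n) (x n)) \<longlonglongrightarrow> w" and w: "w \<in> tau ` D"
    and stay: "\<And>n t. 0 \<le> t ==> t < e n ==> v t (x n) \<in> N p"
    and y: "(\<lambda>n. v (e n - r) (x n)) \<longlonglongrightarrow> u" and low: "\<And>n. - eps / 2 \<le> e n - r - rho n"
  shows "w = u"
proof -
  interpret B: saddle_box v p "N p" "S p" "U p" by (rule box[OF p])
  obtain t where t: "t \<in> D" "w = tau t" using w by blast
  obtain tu where tu: "tu \<in> D" "u = tau tu" using U_hit[OF p u] D'_sub by blast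
  consider "filterlim rho at_top sequentially" | j l where "strict_mono (j :: nat => nat)" "(\<lambda>n. rho (j n)) \<longlonglongrightarrow> l"
    by (rule bounded_below_seq_cases[of eps rho, OF rho(1)])
  then show ?thesis
  proof cases
    case 2
    have "(\<lambda>n. v (rho (j n)) (x (j n))) \<longlonglongrightarrow> v l s"
      using 2(2) LIMSEQ_subseq_LIMSEQ[OF x 2(1)] by (intro tendsto_intros) (auto simp: o_def)
    moreover have "(\<lambda>n. v (rho (j n)) (x (j n))) \<longlonglongrightarrow> w"
      using LIMSEQ_subseq_LIMSEQ[OF rho(2) 2(1)] by (simp add: o_def)
    ultimately have "w = v l s" by (rule LIMSEQ_unique[rotated])
    moreover have "eps \<le> l" by (rule LIMSEQ_le_const[OF 2(2)]) (use rho(1) in auto)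
    ultimately show ?thesis using S_last[OF p s, of l] w eps by simp
  next
    case 1
    consider "filterlim (\<lambda>n. e n - r - rho n) at_top sequentially" |
      j l where "strict_mono (j :: nat => nat)" "(\<lambda>n. e (j n) - r - rho (j n)) \<longlonglongrightarrow> l"
      by (rule bounded_below_seq_cases[of "- eps / 2" "\<lambda>n. e n - r - rho n", OF low])
    then show ?thesis
    proof cases
      case (2 j l)
      have "(\<lambda>n. v (- (e (j n) - r - rho (j n))) (v (e (j n) - r) (x (j n)))) \<longlonglongrightarrow> v (- l) u"
        using 2(2) LIMSEQ_subseq_LIMSEQ[OF y 2(1)] by (intro tendsto_intros) (auto simp: o_def)
      then have "(\<lambda>n. v (rho (j n)) (x (j n))) \<longlonglongrightarrow> v (- l) u" by simp
      moreover have "(\<lambda>n. v (rho (j n)) (x (j n))) \<longlonglongrightarrow> w"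
        using LIMSEQ_subseq_LIMSEQ[OF rho(2) 2(1)] by (simp add: o_def)
      ultimately have wl: "w = v (- l) u" by (rule LIMSEQ_unique[rotated])
      have "- eps / 2 \<le> l" by (rule LIMSEQ_le_const[OF 2(2)]) (use low in auto)
      moreover have "\<not> - l < 0" using U_first[OF p u, of "- l"] wl w by metis
      ultimately have "\<bar>- l\<bar> < eps" using eps by simp
      moreover have "v (- l) (tau tu) = tau t" using wl t tu by simp
      ultimately show ?thesis using close_hits(2)[OF tu(1) t(1)] t tu by blast
    next
      case d: 1
      have "v a w \<in> closure (N p)" for a
      proof (rule Lim_in_closed_set[OF closed_closure _ sequentially_bot])
        show "(\<lambda>n. v a (v (rho n) (x n))) \<longlonglongrightarrow> v a w" by (intro tendsto_intros rho)
        have "\<forall>\<^sub>F n in sequentially. - a \<le> rho n" "\<forall>\<^sub>F n in sequentially. a + 1 - r \<le> e n - r - rho n"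
          using 1 d unfolding filterlim_at_top by blast+
        then show "\<forall>\<^sub>F n in sequentially. v a (v (rho n) (x n)) \<in> closure (N p)"
          by eventually_elim (use stay B.closure_N in simp)
      qed
      then have "w = p" by (rule B.whole)
      then show ?thesis using tau_regular[OF t(1)] t(2) B.p_Sing by simp
    qed
  qed
qed

text \<open>\<open>T\<close> consists of the first hits of the unstable separatrices.
  Counterexamples tending to \<open>q\<close> would stay in \<open>N p\<close> ever longer and leave
  it along some unstable separatrix; by \<open>passing_limit\<close> their returns accumulate at its
  representative.\<close>

lemma passing:
  assumes p: "p \<in> P" and s: "tau q \<in> S p" and q: "q \<in> D"
  obtains T where "finite T" "T \<subseteq> D'" "tau ` T \<subseteq> U p" "T \<inter> first_ret ` ret_dom = {}"
    "\<And>e. e > 0 ==> \<exists>d>0. \<forall>t\<in>D. 0 < \<bar>t - q\<bar> --> \<bar>t - q\<bar> < d --> t \<in> ret_dom \<and> (\<exists>u\<in>T. \<bar>first_ret t - u\<bar> < e)"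
proof
  interpret B: saddle_box v p "N p" "S p" "U p" by (rule box[OF p])
  define T where "T = {t \<in> D'. tau t \<in> U p}"
  show "T \<subseteq> D'" "tau ` T \<subseteq> U p" by (auto simp: T_def)
  show "finite T"
    by (rule finite_subset[OF _ finite_vimage_IntI[OF B.U_finite tau_inj_on]]) (use D'_sub in \<open>auto simp: T_def\<close>)
  show "T \<inter> first_ret ` ret_dom = {}"
  proof (rule ccontr)
    assume "T \<inter> first_ret ` ret_dom \<noteq> {}"
    then obtain t where t: "t \<in> ret_dom" "first_ret t \<in> T" by blast
    have "v (- ret_time t) (tau (first_ret t)) = tau t" using first_ret(2)[OF t(1)] by simp
    moreover have "v (- ret_time t) (tau (first_ret t)) \<notin> tau ` D"
      using t ret_time(1)[OF t(1)] eps by (intro U_first[OF p]) (auto simp: T_def)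
    ultimately show False using ret_dom_sub t(1) by auto
  qed
  fix eta :: real assume eta: "eta > 0"
  show "\<exists>d>0. \<forall>t\<in>D. 0 < \<bar>t - q\<bar> --> \<bar>t - q\<bar> < d --> t \<in> ret_dom \<and> (\<exists>u\<in>T. \<bar>first_ret t - u\<bar> < eta)" (is "\<exists>d>0. ?Q d")
  proof (rule ccontr)
    assume neg: "\<not> ?thesis"
    obtain d1 where d1: "d1 > 0" "\<And>t. t \<in> D ==> 0 < \<bar>t - q\<bar> ==> \<bar>t - q\<bar> < d1 ==> \<exists>r\<ge>0. v r (tau t) \<notin> N p"
      using leaves[OF p, of q] by blast
    have qN: "tau q \<in> N p" using B.S(2)[OF s, of 0] by simp
    have "\<forall>\<^sub>F t in at q within D. tau t \<in> N p"
      using tau_cont q qN B.N(1) topological_tendstoD unfolding continuous_on_def by metis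
    then obtain d2 where d2: "d2 > 0" "\<And>t. t \<in> D ==> \<bar>t - q\<bar> < d2 ==> tau t \<in> N p"
      unfolding eventually_at using qN by (force simp: dist_real_def)
    define d where "d n = min (min d1 d2) (inverse (real (Suc n)))" for n
    have "d n > 0" for n using d1(1) d2(1) by (simp add: d_def)
    then have "\<forall>n. \<exists>t. t \<in> D \<and> 0 < \<bar>t - q\<bar> \<and> \<bar>t - q\<bar> < d n \<and> \<not> (t \<in> ret_dom \<and> (\<exists>u\<in>T. \<bar>first_ret t - u\<bar> < eta))"
      using neg by blast
    then obtain t where t: "\<And>n. t n \<in> D" "\<And>n. 0 < \<bar>t n - q\<bar>" "\<And>n. \<bar>t n - q\<bar> < d n"
      and bad: "\<And>n. \<not> (t n \<in> ret_dom \<and> (\<exists>u\<in>T. \<bar>first_ret (t n) - u\<bar> < eta))" by metis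
    have tq: "t \<longlonglongrightarrow> q"
    proof (rule LIM_zero_cancel, rule Lim_null_comparison[OF _ LIMSEQ_inverse_real_of_nat])
      have "norm (t n - q) \<le> inverse (real (Suc n))" for n using t(3)[of n] by (simp add: d_def)
      then show "\<forall>\<^sub>F n in sequentially. norm (t n - q) \<le> inverse (real (Suc n))" by simp
    qed
    define x where "x n = tau (t n)" for n
    have x: "x \<longlonglongrightarrow> tau q" unfolding x_def
      by (rule continuous_on_tendsto_compose[OF tau_cont tq q]) (use t(1) in simp)
    have xN: "x n \<in> N p" and out: "\<exists>r\<ge>0. v r (x n) \<notin> N p" for n
      using d1(2)[OF t(1,2)[of n]] d2(2)[OF t(1)[of n]] t(3)[of n] by (auto simp: x_def d_def)
    have "\<exists>e. 0 < e \<and> v e (x n) \<notin> N p \<and> (\<forall>a. 0 \<le> a --> a < e --> v a (x n) \<in> N p)" for n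
      using out[of n] B.exit_time[OF _ _ xN[of n]] by metis
    then obtain e where e: "\<And>n. 0 < e n" "\<And>n. v (e n) (x n) \<notin> N p"
      "\<And>n a. 0 \<le> a ==> a < e n ==> v a (x n) \<in> N p" by metis
    have et: "filterlim e at_top sequentially"
      by (rule B.exit_times_unbounded[OF x]) (use B.S(2)[OF s] e(2) less_imp_le[OF e(1)] in auto)
    obtain k u r where k: "strict_mono (k :: nat => nat)" and u: "u \<in> U p" and r: "0 < r"
      and lim: "(\<lambda>n. v (e (k n)) (x (k n))) \<longlonglongrightarrow> v r u"
      by (rule B.exit_limit[OF et, of x]) (use e in auto)
    have "(\<lambda>n. v (- r) (v (e (k n)) (x (k n)))) \<longlonglongrightarrow> v (- r) (v r u)" by (intro tendsto_intros lim)
    then have y: "(\<lambda>n. v (e (k n) - r) (x (k n))) \<longlonglongrightarrow> u" by simp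
    obtain tu where tu: "tu \<in> D'" "tau tu = u" using U_hit[OF p u] by blast
    have "0 < eps / 2" using eps by simp
    \<comment> \<open>A flow box of time \<open>eps / 2\<close> turns closeness to \<open>u\<close>
      into an actual hit, so the first return comes at most \<open>eps / 2\<close> after the passage
      near \<open>u\<close>.\<close>
    from box_nhd[OF tu(1) zero_less_one this, unfolded tu(2)] obtain V where V: "open V" "u \<in> V"
      "\<forall>z\<in>V. \<exists>t'\<in>D. \<exists>a. \<bar>t' - tu\<bar> < 1 \<and> \<bar>a\<bar> < eps / 2 \<and> z = v a (tau t')" by (elim exE conjE)
    have ek: "filterlim (\<lambda>n. e (k n)) at_top sequentially" by (rule filterlim_compose[OF et filterlim_subseq[OF k]])
    have "\<forall>\<^sub>F n in sequentially. v (e (k n) - r) (x (k n)) \<in> V" "\<forall>\<^sub>F n in sequentially. r + eps \<le> e (k n)"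
      using topological_tendstoD[OF y V(1,2)] ek unfolding filterlim_at_top by blast+
    then have "\<forall>\<^sub>F n in sequentially. v (e (k n) - r) (x (k n)) \<in> V \<and> r + eps \<le> e (k n)" by (rule eventually_conj)
    then obtain n0 where n0: "\<And>n. n \<ge> n0 ==> v (e (k n) - r) (x (k n)) \<in> V \<and> r + eps \<le> e (k n)"
      by (auto simp: eventually_sequentially)
    have ret: "t (k n) \<in> ret_dom \<and> - eps / 2 \<le> e (k n) - r - ret_time (t (k n))" if n: "n \<ge> n0" for n
    proof -
      obtain t' a where t': "t' \<in> D" "\<bar>a\<bar> < eps / 2" "v (e (k n) - r) (x (k n)) = v a (tau t')"
        using bspec[OF V(3) conjunct1[OF n0[OF n]]] by blast
      have "v (- a) (v (e (k n) - r) (x (k n))) = v (- a) (v a (tau t'))" using t'(3) by (simp only:)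
      then have hit: "v (e (k n) - r - a) (tau (t (k n))) \<in> tau ` D" using t'(1) by (simp add: x_def algebra_simps)
      have pos: "0 < e (k n) - r - a" using n0[OF n] t'(2) eps by linarith
      have rd: "t (k n) \<in> ret_dom" using hit pos t(1) unfolding ret_dom_def by blast
      moreover have "ret_time (t (k n)) \<le> e (k n) - r - a" by (rule ret_time(3)[OF rd pos hit])
      ultimately show ?thesis using t'(2) by (auto simp: abs_less_iff)
    qed
    define i where "i n = k (n + n0)" for n
    have i: "strict_mono i" using k by (auto simp: i_def strict_mono_def)
    have i_ret: "t (i n) \<in> ret_dom" "- eps / 2 \<le> e (i n) - r - ret_time (t (i n))" for n
      using ret[of "n + n0"] by (auto simp: i_def)
    have "\<forall>n. first_ret (t (i n)) \<in> D" using first_ret(1)[OF i_ret(1)] by blast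
    then obtain t0 j where t0: "t0 \<in> D" and j: "strict_mono (j :: nat => nat)"
      and lim0: "((\<lambda>n. first_ret (t (i n))) \<circ> j) \<longlonglongrightarrow> t0"
      using cs_compact unfolding compact_def by metis
    have lim0': "(\<lambda>n. first_ret (t (i (j n)))) \<longlonglongrightarrow> t0" using lim0 by (simp add: o_def)
    have "tau t0 = u"
    proof (rule passing_limit[OF p s u, of "\<lambda>n. x (i (j n))" "\<lambda>n. ret_time (t (i (j n)))" _ "\<lambda>n. e (i (j n))" r])
      show "(\<lambda>n. x (i (j n))) \<longlonglongrightarrow> tau q"
        using LIMSEQ_subseq_LIMSEQ[OF LIMSEQ_subseq_LIMSEQ[OF x i] j] by (simp add: o_def)
      have "(\<lambda>n. tau (first_ret (t (i (j n))))) \<longlonglongrightarrow> tau t0"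
        by (rule continuous_on_tendsto_compose[OF tau_cont lim0' t0]) (use first_ret(1)[OF i_ret(1)] in simp)
      then show "(\<lambda>n. v (ret_time (t (i (j n)))) (x (i (j n)))) \<longlonglongrightarrow> tau t0"
        using first_ret(2)[OF i_ret(1)] by (simp add: x_def)
      have "(\<lambda>n. v (e (i n) - r) (x (i n))) \<longlonglongrightarrow> u"
        using LIMSEQ_ignore_initial_segment[OF y, of n0] by (simp add: i_def)
      from LIMSEQ_subseq_LIMSEQ[OF this j] show "(\<lambda>n. v (e (i (j n)) - r) (x (i (j n)))) \<longlonglongrightarrow> u"
        by (simp add: o_def)
    qed (use ret_time(1)[OF i_ret(1)] i_ret(2) e(3) t0 in auto)
    then have "t0 = tu" using tau_inj[OF t0, of tu] tu D'_sub by auto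
    then have "t0 \<in> T" using tu u by (simp add: T_def)
    have "\<forall>\<^sub>F n in sequentially. dist (first_ret (t (i (j n)))) t0 < eta" using tendstoD[OF lim0' eta] .
    then obtain n where "dist (first_ret (t (i (j n)))) t0 < eta" by (auto simp: eventually_sequentially)
    then show False using bad[of "i (j n)"] i_ret(1) \<open>t0 \<in> T\<close> by (auto simp: dist_real_def)
  qed
qed

lemma return_system:
  assumes K: "closed K" "invariant_set v K" and C: "closed C" "invariant_set v C"
    and K_D': "\<And>t. t \<in> D ==> tau t \<in> K ==> t \<in> D'"
    and last: "\<And>q. q \<in> D ==> tau q \<in> K ==> q \<notin> ret_dom ==> \<exists>p\<in>P. om (tau q) = {p}"
  shows "return_system v D D' tau eps K C"
proof
  fix q assume q: "q \<in> D" "tau q \<in> K" "q \<notin> ret_dom"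
  then obtain p where p: "p \<in> P" "om (tau q) = {p}" using last by blast
  obtain T where "finite T" "T \<subseteq> D'" "T \<inter> first_ret ` ret_dom = {}"
    "\<And>e. e > 0 ==> \<exists>d>0. \<forall>t\<in>D. 0 < \<bar>t - q\<bar> --> \<bar>t - q\<bar> < d --> t \<in> ret_dom \<and> (\<exists>u\<in>T. \<bar>first_ret t - u\<bar> < e)"
    using passing[OF p(1) last_hit[OF q(1,3) p] q(1)] by metis
  then show "\<exists>U. finite U \<and> U \<subseteq> D' \<and> U \<inter> first_ret ` ret_dom = {} \<and>
        (\<forall>e>0. \<exists>d>0. \<forall>t\<in>D. 0 < \<bar>t - q\<bar> --> \<bar>t - q\<bar> < d --> t \<in> ret_dom \<and> (\<exists>u\<in>U. \<bar>first_ret t - u\<bar> < e))"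
    by blast
qed (fact K C K_D')+

text \<open>The orbit of a saddle connection meets the section only between the last hit near its source
  and the first hit near its target.\<close>

lemma finite_connection_hits:
  assumes p: "p \<in> P" "om y = {p}" and p': "p' \<in> P" "al y = {p'}" and y: "y \<notin> Sing v"
  shows "finite {t \<in> D. tau t \<in> orbit v y}"
proof -
  interpret B: saddle_box v p "N p" "S p" "U p" by (rule box[OF p(1)])
  interpret B': saddle_box "rev_flow v" p' "N p'" "U p'" "S p'" by (rule saddle_box.rev_saddle_box[OF box[OF p'(1)]])
  have "y \<noteq> p" "y \<noteq> p'" using y B.p_Sing B'.p_Sing by auto
  then obtain s r u r' where s: "s \<in> S p" "y = v r s" and u: "u \<in> U p'" "y = v r' u"
    using B.stable_orbit[OF p(2)] B'.stable_orbit[of y] p'(2) unfolding omega_limit_rev orbit_rev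
    unfolding orbit_def by blast
  have "{t \<in> D. tau t \<in> orbit v y} \<subseteq> {t \<in> D. \<exists>c\<in>{- r'..- r}. tau t = v c y}"
  proof
    fix t assume "t \<in> {t \<in> D. tau t \<in> orbit v y}"
    then obtain c where c: "t \<in> D" "tau t = v c y" by (auto simp: orbit_def)
    have "tau t = v (c + r) s" unfolding c(2) s(2) by simp
    then have "\<not> 0 < c + r" using S_last[OF p(1) s(1)] c(1) by (metis imageI)
    moreover have "tau t = v (c + r') u" unfolding c(2) u(2) by simp
    then have "\<not> c + r' < 0" using U_first[OF p'(1) u(1)] c(1) by (metis imageI)
    ultimately show "t \<in> {t \<in> D. \<exists>c\<in>{- r'..- r}. tau t = v c y}" using c by auto
  qed
  then show ?thesis using finite_hits by (rule finite_subset)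
qed

end

section \<open>Limit sets with finitely many saddles\<close>

text \<open>Along the germ the values of \<open>f\<close> tend to \<open>b\<close>, while near
  \<open>q\<close> they cluster only at the finite set \<open>T\<close>.\<close>

lemma germ_target:
  assumes g: "germ f A 1 q sg b rho" and T: "finite T" and AD: "A \<subseteq> D"
    and near: "\<And>e. e > 0 ==> \<exists>d>0. \<forall>t\<in>D. 0 < \<bar>t - q\<bar> --> \<bar>t - q\<bar> < d --> (\<exists>u\<in>T. \<bar>f t - u\<bar> < e)"
  shows "b \<in> T"
proof (rule ccontr)
  assume "b \<notin> T"
  then obtain m where m: "m > 0" "\<And>u. u \<in> T ==> m \<le> dist b u"
    using finite_set_avoid[OF T, of b] by metis
  obtain d where d: "d > 0" "\<And>t. t \<in> D ==> 0 < \<bar>t - q\<bar> ==> \<bar>t - q\<bar> < d ==> \<exists>u\<in>T. \<bar>f t - u\<bar> < m / 2"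
    using near[of "m / 2"] m(1) by auto
  obtain d' e' phi where g': "d' \<le> d" "e' \<le> m / 2" "incr_bij phi d' e'"
    "\<And>h i. 0 < h ==> h < d' ==> i < 1 ==> (f ^^ i) (q + sg * h) \<in> A"
    "\<And>h. 0 < h ==> h < d' ==> (f ^^ 1) (q + sg * h) = b + rho * phi h"
    by (rule germE[OF g d(1), of "m / 2"]) (use m(1) in simp, rule that)
  define h where "h = d' / 2"
  have h: "0 < h" "h < d'" using g'(3) by (auto simp: h_def incr_bij_def)
  have s: "sg \<in> {1, -1}" "rho \<in> {1, -1}" using germ_signs[OF g] by auto
  have "q + sg * h \<in> D" using g'(4)[OF h, of 0] AD by auto
  moreover have "\<bar>(q + sg * h) - q\<bar> = h" using s h by auto
  ultimately obtain u where u: "u \<in> T" "\<bar>f (q + sg * h) - u\<bar> < m / 2"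
    using d(2)[of "q + sg * h"] h g'(1) by auto
  have "\<bar>f (q + sg * h) - b\<bar> < m / 2"
    using g'(5)[OF h] incr_bij_pos[OF g'(3) h] g'(2) s by auto
  then show False using m(2)[OF u(1)] u(2) by (auto simp: dist_real_def abs_if split: if_splits)
qed

lemma finite_disjoint_nbhds:
  fixes P :: "'a::t2_space set"
  assumes "finite P"
  obtains G where "\<And>p. p \<in> P ==> open (G p) \<and> p \<in> G p" "\<And>p q. p \<in> P ==> q \<in> P ==> p \<noteq> q ==> G p \<inter> G q = {}"
proof -
  define sep where "sep p q A B \<longleftrightarrow> open A \<and> open B \<and> p \<in> A \<and> q \<in> B \<and> A \<inter> B = {}" for p q :: 'a and A B
  have "\<exists>A B. sep p q A B" if "p \<noteq> q" for p q
    using hausdorff[OF that] unfolding sep_def by simp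
  then obtain A B where sep: "\<And>p q. p \<noteq> q ==> sep p q (A p q) (B p q)" by metis
  then have AB: "\<And>p q. p \<noteq> q ==> open (A p q) \<and> open (B p q) \<and> p \<in> A p q \<and> q \<in> B p q \<and> A p q \<inter> B p q = {}"
    by (simp add: sep_def)
  define G where "G p = (\<Inter>q\<in>P - {p}. A p q \<inter> B q p)" for p
  show ?thesis
  proof (rule that[of G])
    fix p assume "p \<in> P"
    have "open (A p q \<inter> B q p) \<and> p \<in> A p q \<inter> B q p" if "q \<in> P - {p}" for q
      using AB[of p q] AB[of q p] that by auto
    then show "open (G p) \<and> p \<in> G p" using assms unfolding G_def by (auto intro!: open_INT)
  next
    fix p q assume pq: "p \<in> P" "q \<in> P" "p \<noteq> q"
    then have "G p \<subseteq> A p q" "G q \<subseteq> B p q" by (auto simp: G_def)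
    then show "G p \<inter> G q = {}" using AB[OF pq(3)] by blast
  qed
qed

section \<open>Orbits that stop returning\<close>

context cross_section
begin

lemma no_return:
  assumes "q \<in> D" "q \<notin> ret_dom" "t \<in> D'"
  shows "tau t \<notin> om (tau q)"
proof
  assume "tau t \<in> om (tau q)"
  from recurrent_hits[OF assms(3) this zero_less_one, of 1]
  obtain t' s where "t' \<in> D" "s \<ge> 1" "v s (tau q) = tau t'" by blast
  then have "s > 0" "v s (tau q) \<in> tau ` D" by auto
  then show False using assms(1,2) unfolding ret_dom_def by blast
qed

end

context saddle_section
begin

text \<open>Every connection into a saddle of \<open>P\<close> contains one of finitely many
  representatives, and it meets the section finitely often.\<close>

lemma finite_connections:
  "finite {t \<in> D. \<exists>p\<in>P. \<exists>p'\<in>P. om (tau t) = {p} \<and> al (tau t) = {p'}}" (is "finite ?F")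
proof -
  define S' where "S' = (\<Union>p\<in>P. {s \<in> S p. \<exists>p'\<in>P. al s = {p'}})"
  have "finite S'" unfolding S'_def using P_finite saddle_box.S_finite[OF box] by auto
  moreover have "finite {t \<in> D. tau t \<in> orbit v s}" if sS: "s \<in> S'" for s
  proof -
    obtain p p' where *: "p \<in> P" "s \<in> S p" "p' \<in> P" "al s = {p'}" using sS by (auto simp: S'_def)
    interpret B: saddle_box v p "N p" "S p" "U p" by (rule box[OF *(1)])
    show ?thesis by (rule finite_connection_hits[OF *(1) B.S_omega[OF *(2)] *(3,4) B.S_regular[OF *(2)]])
  qed
  ultimately have "finite (\<Union>s\<in>S'. {t \<in> D. tau t \<in> orbit v s})" by simp
  moreover have "?F \<subseteq> (\<Union>s\<in>S'. {t \<in> D. tau t \<in> orbit v s})"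
  proof
    fix t assume "t \<in> ?F"
    then obtain p p' where t: "t \<in> D" "p \<in> P" "p' \<in> P" "om (tau t) = {p}" "al (tau t) = {p'}" by blast
    interpret B: saddle_box v p "N p" "S p" "U p" by (rule box[OF t(2)])
    have "tau t \<noteq> p" using tau_regular[OF t(1)] B.p_Sing by metis
    then obtain s where s: "s \<in> S p" "tau t \<in> orbit v s" using B.stable_orbit[OF t(4)] by blast
    obtain r where "tau t = v r s" using s(2) by (auto simp: orbit_def)
    then have "al s = {p'}" using t(5) rev.omega_shift[of "- r" s] by (simp add: rev_flow_def)
    then have "s \<in> S'" using s(1) t(2,3) by (auto simp: S'_def)
    then show "t \<in> (\<Union>s\<in>S'. {t \<in> D. tau t \<in> orbit v s})" using s(2) t(1) by blast
  qed
  ultimately show ?thesis by (rule finite_subset[rotated])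
qed

text \<open>A larger limit set would contain a point of \<open>U p\<close>. That point is a
  parameter in \<open>D'\<close>, so the orbit would hit the section again.\<close>

lemma last_hit_saddle:
  assumes q: "q \<in> D" "q \<notin> ret_dom" and p: "p \<in> P" "p \<in> om (tau q)"
  shows "om (tau q) = {p}"
proof (rule ccontr)
  interpret B: saddle_box v p "N p" "S p" "U p" by (rule box[OF p(1)])
  assume "om (tau q) \<noteq> {p}"
  then obtain u where u: "u \<in> U p" "u \<in> om (tau q)" using B.omega_hits_unstable[OF p(2)] by blast
  then show False using U_hit[OF p(1) u(1)] no_return[OF q] by auto
qed

end

context return_system
begin

text \<open>The limit set is constant along an orbit, whereas a point over \<open>K\<close> that
  fails to return has its limit set in \<open>L\<close>.\<close>

lemma iterates_return:
  assumes a: "a \<in> D" "tau a \<in> K" and L: "\<And>q. q \<in> D ==> tau q \<in> K ==> q \<notin> ret_dom ==> om (tau q) \<in> L"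
    and aL: "om (tau a) \<notin> L"
  shows "(first_ret ^^ n) a \<in> ret_dom"
proof (induction n rule: less_induct)
  case (less n)
  from hit_time[OF a(1) less] have n: "(first_ret ^^ n) a \<in> D" "v (hit_time n a) (tau a) = tau ((first_ret ^^ n) a)" by auto
  have "tau ((first_ret ^^ n) a) \<in> K" using K(2) a(2) unfolding n(2)[symmetric] invariant_set_def by blast
  moreover have "om (tau ((first_ret ^^ n) a)) \<notin> L" using aL unfolding n(2)[symmetric] by simp
  ultimately show ?case using L n(1) by blast
qed

end

context surface_flow
begin

lemma closure_orbit: "closure (orbit v x) = orbit v x \<union> om x \<union> al x"
proof
  show "orbit v x \<union> om x \<union> al x \<subseteq> closure (orbit v x)"
    using closure_subset omega_subset_closure_orbit rev.omega_subset_closure_orbit[of x] by auto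
  show "closure (orbit v x) \<subseteq> orbit v x \<union> om x \<union> al x"
  proof
    fix y assume y: "y \<in> closure (orbit v x)"
    show "y \<in> orbit v x \<union> om x \<union> al x"
    proof (rule ccontr)
      assume no: "\<not> ?thesis"
      let ?f = "\<lambda>t. v t x"
      obtain T where T: "y \<notin> closure (?f ` {T..})" using no by (auto simp: omega_limit_def)
      obtain T' where T': "y \<notin> closure (?f ` {..T'})" using no by (auto simp: alpha_limit_def)
      have "closed (?f ` {T'..T})"
        by (intro compact_imp_closed compact_continuous_image continuous_intros) simp
      moreover have "?f ` {T'..T} \<subseteq> orbit v x" by (auto simp: orbit_def)
      ultimately have M: "y \<notin> closure (?f ` {T'..T})" using no by (auto simp: closure_closed)
      have "UNIV = {..T'} \<union> {T'..T} \<union> {T..}" by auto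
      then have "orbit v x = ?f ` {..T'} \<union> ?f ` {T'..T} \<union> ?f ` {T..}"
        unfolding orbit_def by (metis image_Un)
      then show False using y T T' M by (simp add: closure_Un)
    qed
  qed
qed

lemma interior_closure_orbits_empty:
  assumes "finite Y" shows "interior (\<Union>y\<in>Y. closure (orbit v y)) = {}"
  using assms
proof (induction Y rule: finite_induct)
  case (insert y Y)
  have "interior (closure (orbit v y)) = {}" using not_locally_dense[of y] by (simp add: locally_dense_def)
  then show ?case using insert.IH interior_closed_Un_empty_interior[of "closure (orbit v y)"] by simp
qed simp

end

section \<open>Sections that separatrices leave for good\<close>

context compact_flow
begin

text \<open>The tail converges to \<open>p\<close>, so from some time on it is separated from
  \<open>z\<close>, and what remains is a compact segment.\<close>

lemma avoid_tail:
  assumes w: "om s = {p}" and z: "z \<noteq> p" "\<And>t. t \<ge> eps ==> v t s \<noteq> z"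
  obtains W where "open W" "z \<in> W" "\<And>t. t \<ge> eps ==> v t s \<notin> W"
proof -
  obtain A B where AB: "open A" "open B" "z \<in> A" "p \<in> B" "A \<inter> B = {}" using hausdorff[OF z(1)] by blast
  obtain T where T: "\<And>t. t \<ge> T ==> v t s \<in> B" using omega_eventually[OF AB(2), of s] w AB(4) by auto
  let ?M = "(\<lambda>t. v t s) ` {eps..T}"
  have "closed ?M" by (intro compact_imp_closed compact_continuous_image continuous_intros) simp
  show ?thesis
  proof (rule that[of "A - ?M"])
    show "open (A - ?M)" using AB(1) \<open>closed ?M\<close> by (rule open_Diff)
    show "z \<in> A - ?M" using AB(3) z(2) by fastforce
    show "v t s \<notin> A - ?M" if "t \<ge> eps" for t using that T[of t] AB(5) by (cases "t \<le> T") auto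
  qed
qed

lemma omega_singleton_not_periodic:
  assumes "om s = {p}" "s \<noteq> p" "t > 0" shows "v t s \<noteq> s"
proof
  assume "v t s = s"
  then have "s \<in> om s" using omega_periodic[OF _ assms(3)] in_orbit(2)[of s] by simp
  then show False using assms by simp
qed

text \<open>The boxes are disjoint and the future of \<open>s\<close> lies in its own box, so a
  representative \<open>z\<close> on it belongs to the same saddle. A stable one would be
  \<open>s\<close> itself, which is not periodic; an unstable one comes before \<open>s\<close> on
  the orbit.\<close>

lemma avoid_separatrix:
  assumes box: "\<And>p. p \<in> P ==> saddle_box v p (N p) (S p) (U p)"
    and disj: "\<And>p q x. p \<in> P ==> q \<in> P ==> x \<in> N p ==> x \<in> N q ==> p = q"
    and p: "p \<in> P" "s \<in> S p" and z: "z \<in> (\<Union>q\<in>P. S q \<union> U q)" "z \<notin> Sing v" and eps: "eps > 0"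
  shows "\<exists>W. open W \<and> z \<in> W \<and> (\<forall>t\<ge>eps. v t s \<notin> W)"
proof -
  interpret B: saddle_box v p "N p" "S p" "U p" by (rule box[OF p(1)])
  have "v t s \<noteq> z" if t: "t \<ge> eps" for t
  proof
    assume eq: "v t s = z"
    have zN: "z \<in> N p" using B.S(2)[OF p(2), of t] t eps eq by simp
    obtain q where q: "q \<in> P" "z \<in> S q \<or> z \<in> U q" using z by blast
    then have "z \<in> N q"
      using saddle_box.S(2)[OF box[OF q(1)], of z 0] saddle_box.U(2)[OF box[OF q(1)], of z 0] by auto
    then have "q = p" using disj[OF q(1) p(1)] zN by blast
    with q(2) consider "z \<in> S p" | "z \<in> U p" by blast
    then show False
    proof cases
      case 1
      then have "z = s" using B.S(3)[OF p(2)] in_orbit(1)[of t s] eq by blast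
      then show False
        using omega_singleton_not_periodic[OF B.S_omega[OF p(2)] B.S(1)[OF p(2)], of t] t eps eq by simp
    next
      case 2
      from B.S_U_disjoint[OF p(2) this eq[symmetric]] show False using t eps by linarith
    qed
  qed
  moreover have "z \<noteq> p" using z(2) B.p_Sing by blast
  ultimately obtain W where "open W" "z \<in> W" "\<And>t. t \<ge> eps ==> v t s \<notin> W"
    using avoid_tail[OF B.S_omega[OF p(2)]] by metis
  then show ?thesis by blast
qed

end

context surface_flow
begin

text \<open>A section through all representatives is shrunk until it avoids the stable separatrices
  after the time \<open>eps\<close> and the unstable ones before the time \<open>- eps\<close>; the
  flow boxes exclude hits in between. \<open>Z0\<close> serves the case without saddles only, since
  the tail of a separatrix might run through a prescribed point.\<close>

lemma saddle_section_exists: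
  assumes P: "finite P" "\<And>p. p \<in> P ==> saddle v p" and Z0: "finite Z0" "\<And>z. z \<in> Z0 ==> z \<notin> Sing v"
    and PZ: "P = {} \<or> Z0 = {}" and K: "invariant_set v K" "interior K = {}"
  obtains eps D D' tau N S U where "saddle_section v D D' tau eps P N S U" "Z0 \<subseteq> tau ` D'"
    "\<And>t. t \<in> D ==> tau t \<in> K ==> t \<in> D'"
proof -
  obtain G where G: "\<And>p. p \<in> P ==> open (G p) \<and> p \<in> G p" "\<And>p q. p \<in> P ==> q \<in> P ==> p \<noteq> q ==> G p \<inter> G q = {}"
    by (rule finite_disjoint_nbhds[OF P(1)]) (rule that)
  have "\<exists>N S U. saddle_box v p N S U \<and> N \<subseteq> G p" if "p \<in> P" for p
    using saddle_box_exists[OF P(2)[OF that]] G(1)[OF that] by metis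
  then obtain N S U where box: "\<And>p. p \<in> P ==> saddle_box v p (N p) (S p) (U p)" and NG: "\<And>p. p \<in> P ==> N p \<subseteq> G p"
    by metis
  have rbox: "saddle_box (rev_flow v) p (N p) (U p) (S p)" if "p \<in> P" for p
    by (rule saddle_box.rev_saddle_box[OF box[OF that]])
  have disj: "p = q" if "p \<in> P" "q \<in> P" "x \<in> N p" "x \<in> N q" for p q x
    using G(2)[OF that(1,2)] NG that by blast
  define SS where "SS = (\<Union>p\<in>P. S p)"
  define UU where "UU = (\<Union>p\<in>P. U p)"
  define Z where "Z = Z0 \<union> SS \<union> UU"
  have fin: "finite SS" "finite UU" "finite Z"
    using P(1) Z0(1) saddle_box.S_finite[OF box] saddle_box.U_finite[OF box] by (auto simp: SS_def UU_def Z_def)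
  have reg: "z \<notin> Sing v" if z: "z \<in> Z" for z
  proof -
    consider "z \<in> Z0" | p where "p \<in> P" "z \<in> S p" | p where "p \<in> P" "z \<in> U p" using z by (auto simp: Z_def SS_def UU_def)
    then show ?thesis
    proof cases
      case 1 then show ?thesis by (rule Z0(2))
    next
      case 2 then show ?thesis using saddle_box.S_regular[OF box] by blast
    next
      case 3
      from saddle_box.S_regular[OF rbox[OF 3(1)] 3(2)] show ?thesis by (simp only: Sing_rev not_False_eq_True)
    qed
  qed
  obtain eps where eps: "eps > 0" and sec: "\<forall>W. (\<forall>z\<in>Z. open (W z) \<and> z \<in> W z) --> (\<exists>D D' tau. cross_section v D D' tau eps \<and>
     (\<forall>z\<in>Z. \<exists>t\<in>D'. tau t = z) \<and> (\<forall>t\<in>D. tau t \<in> K --> t \<in> D') \<and> tau ` D \<subseteq> (\<Union>z\<in>Z. W z))"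
    by (rule section_through[OF fin(3) _ K], erule reg, rule that)
  have ZP: "z \<in> (\<Union>q\<in>P. S q \<union> U q)" if "z \<in> Z" "p \<in> P" for z p
    using that PZ by (auto simp: Z_def SS_def UU_def)
  have "\<exists>W. open W \<and> z \<in> W \<and> (\<forall>t\<ge>eps. v t s \<notin> W)" if z: "z \<in> Z" and s: "s \<in> SS" for z s
  proof -
    obtain p where p: "p \<in> P" "s \<in> S p" using s by (auto simp: SS_def)
    show ?thesis by (rule avoid_separatrix[OF box disj p ZP[OF z p(1)] reg[OF z] eps])
  qed
  then obtain A where A: "\<And>z s. z \<in> Z ==> s \<in> SS ==> open (A z s) \<and> z \<in> A z s \<and> (\<forall>t\<ge>eps. v t s \<notin> A z s)"
    by metis
  have "\<exists>W. open W \<and> z \<in> W \<and> (\<forall>t\<ge>eps. v (- t) u \<notin> W)" if z: "z \<in> Z" and u: "u \<in> UU" for z u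
  proof -
    obtain p where p: "p \<in> P" "u \<in> U p" using u by (auto simp: UU_def)
    have "z \<in> (\<Union>q\<in>P. U q \<union> S q)" "z \<notin> Sing (rev_flow v)" using ZP[OF z p(1)] reg[OF z] by auto
    from rev.avoid_separatrix[OF rbox disj p this eps] show ?thesis unfolding rev_flow_def .
  qed
  then obtain B where B: "\<And>z u. z \<in> Z ==> u \<in> UU ==> open (B z u) \<and> z \<in> B z u \<and> (\<forall>t\<ge>eps. v (- t) u \<notin> B z u)"
    by metis
  define W where "W z = (\<Inter>s\<in>SS. A z s) \<inter> (\<Inter>u\<in>UU. B z u)" for z
  have W: "open (W z) \<and> z \<in> W z" if "z \<in> Z" for z
  proof
    show "open (W z)" unfolding W_def
      by (intro open_Int open_INT fin ballI) (use A[OF that] B[OF that] in blast)+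
    show "z \<in> W z" unfolding W_def using A[OF that] B[OF that] by blast
  qed
  have "\<forall>z\<in>Z. open (W z) \<and> z \<in> W z" using W by blast
  from mp[OF spec[OF sec] this] obtain D D' tau where cs: "cross_section v D D' tau eps"
    and thr': "\<forall>z\<in>Z. \<exists>t\<in>D'. tau t = z" and DK: "\<forall>t\<in>D. tau t \<in> K --> t \<in> D'" and DW: "tau ` D \<subseteq> (\<Union>z\<in>Z. W z)"
    by (elim exE conjE) (rule that)
  have thr: "z \<in> tau ` D'" if "z \<in> Z" for z using thr' that by (metis imageI)
  interpret cs: cross_section v D D' tau eps by (rule cs)
  have near: "v r y \<notin> tau ` D" if y: "y \<in> Z" and r: "r \<noteq> 0" "\<bar>r\<bar> < eps" for r y
  proof
    assume "v r y \<in> tau ` D"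
    then obtain t' where t': "t' \<in> D" "v r y = tau t'" by blast
    obtain t where t: "t \<in> D" "tau t = y" using thr[OF y] cs.D'_sub by blast
    have "v r (tau t) = tau t'" unfolding t(2) by (rule t'(2))
    then show False using cs.close_hits(1)[OF t(1) t'(1) _ r(2)] r(1) by blast
  qed
  have "saddle_section v D D' tau eps P N S U"
  proof (intro saddle_section.intro saddle_section_axioms.intro cs P(1) box)
    show "s \<in> tau ` D'" if "p \<in> P" "s \<in> S p" for p s by (rule thr) (use that in \<open>auto simp: Z_def SS_def\<close>)
    show "s \<in> tau ` D'" if "p \<in> P" "s \<in> U p" for p s by (rule thr) (use that in \<open>auto simp: Z_def UU_def\<close>)
    show "v r s \<notin> tau ` D" if p: "p \<in> P" "s \<in> S p" "0 < r" for p s r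
    proof (cases "r < eps")
      case True
      then show ?thesis using near[of s r] p by (auto simp: Z_def SS_def)
    next
      case False
      have "s \<in> SS" using p by (auto simp: SS_def)
      then have "v r s \<notin> W z" if "z \<in> Z" for z using A[OF that] False unfolding W_def by (meson INT_D IntD1 not_less)
      then show ?thesis using DW by blast
    qed
    show "v r u \<notin> tau ` D" if p: "p \<in> P" "u \<in> U p" "r < 0" for p u r
    proof (cases "- r < eps")
      case True
      then show ?thesis using near[of u r] p by (auto simp: Z_def UU_def)
    next
      case False
      have "u \<in> UU" using p by (auto simp: UU_def)
      then have "v r u \<notin> W z" if "z \<in> Z" for z
      proof -
        have "v (- (- r)) u \<notin> B z u" using B[OF that \<open>u \<in> UU\<close>] False by (meson not_less)
        then show ?thesis using \<open>u \<in> UU\<close> unfolding W_def by auto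
      qed
      then show ?thesis using DW by blast
    qed
  qed
  moreover have "Z0 \<subseteq> tau ` D'" using thr unfolding Z_def by blast
  ultimately show ?thesis using DK by (intro that[of D D' tau eps N S U]) blast+
qed

text \<open>If the limit set K of x carries enough recurrence, a first return map near K has a wandering
  interval, which sweeps out an open set of points whose orbits are captured by the closure of the
  orbit of x.\<close>

lemma trap:
  assumes x: "x \<notin> Sing v" "\<not> periodic v x" and K: "K = om x"
    and fin: "finite {p \<in> K. saddle v p}" and nonsad: "\<And>p. saddle v p ==> K \<noteq> {p}"
    and fw: "\<And>y. y \<in> K ==> y \<notin> Sing v ==> y \<in> om y \<or> (\<exists>p. saddle v p \<and> p \<in> om y)"
    and bw: "\<And>y. y \<in> K ==> y \<notin> Sing v ==> y \<in> al y \<or> (\<exists>p. saddle v p \<and> p \<in> al y)"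
    and rec: "(\<And>p. p \<in> K ==> \<not> saddle v p) ==> x \<in> K"
  shows "\<exists>V. open V \<and> V \<noteq> {} \<and> captured v V (closure (orbit v x))"
proof -
  define P where "P = {p \<in> K. saddle v p}"
  \<comment> \<open>Without saddles in \<open>K\<close> the section goes through \<open>x\<close>
    itself; otherwise the unstable separatrices provide section points over
    \<open>K\<close>.\<close>
  define Z0 where "Z0 = (if P = {} then {x} else {})"
  define C where "C = closure (orbit v x)"
  have Kc: "closed K" "invariant_set v K" by (simp_all add: K)
  have Cc: "closed C" "invariant_set v C" by (simp_all add: C_def closure_invariant)
  have "K \<subseteq> C" unfolding K C_def by (rule omega_subset_closure_orbit)
  moreover have "interior C = {}" using not_locally_dense[of x] by (simp add: locally_dense_def C_def)
  ultimately have thin: "interior K = {}" using interior_mono by blast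
  obtain eps D D' tau N S U where sec: "saddle_section v D D' tau eps P N S U" and Z0: "Z0 \<subseteq> tau ` D'"
    and K_D': "\<And>t. t \<in> D ==> tau t \<in> K ==> t \<in> D'"
  proof (rule saddle_section_exists[of P Z0 K])
    show "finite P" "\<And>p. p \<in> P ==> saddle v p" using fin by (auto simp: P_def)
    show "finite Z0" "\<And>z. z \<in> Z0 ==> z \<notin> Sing v" "P = {} \<or> Z0 = {}" using x by (auto simp: Z0_def split: if_splits)
  qed (use Kc thin in auto)
  interpret F: saddle_section v D D' tau eps P N S U by (rule sec)
  interpret B: saddle_section "rev_flow v" D D' tau eps P N U S by (rule F.rev_saddle_section)
  \<comment> \<open>A point that never returns is not recurrent, so by hypothesis its limit set
    contains a saddle, and then it converges to that saddle.\<close>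
  have lastF: "\<exists>p\<in>P. om (tau q) = {p}" if q: "q \<in> D" "tau q \<in> K" "q \<notin> F.ret_dom" for q
  proof -
    have "tau q \<notin> om (tau q)" by (rule F.no_return[OF q(1,3) K_D'[OF q(1,2)]])
    then obtain p where p: "saddle v p" "p \<in> om (tau q)" using fw[OF q(2) F.tau_regular[OF q(1)]] by blast
    have "p \<in> P" using p omega_subset[OF Kc q(2)] by (auto simp: P_def)
    then show ?thesis using F.last_hit_saddle[OF q(1,3) _ p(2)] by blast
  qed
  have lastB: "\<exists>p\<in>P. omega_limit (rev_flow v) (tau q) = {p}" if q: "q \<in> D" "tau q \<in> K" "q \<notin> B.ret_dom" for q
  proof -
    have "tau q \<notin> omega_limit (rev_flow v) (tau q)" by (rule B.no_return[OF q(1,3) K_D'[OF q(1,2)]])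
    then obtain p where p: "saddle v p" "p \<in> omega_limit (rev_flow v) (tau q)"
      using bw[OF q(2) F.tau_regular[OF q(1)]] by auto
    have "p \<in> P" using p rev.omega_subset[of K "tau q"] Kc q(2) by (auto simp: P_def)
    then show ?thesis using B.last_hit_saddle[OF q(1,3) _ p(2)] by blast
  qed
  interpret FR: return_system v D D' tau eps K C
    by (rule F.return_system[OF Kc Cc K_D' lastF])
  interpret BR: return_system "rev_flow v" D D' tau eps K C
    by (rule B.return_system) (use Kc Cc K_D' lastB in simp_all)
  have hit: "\<exists>t\<in>D'. tau t \<in> K" if ne: "P \<noteq> {}"
  proof -
    from ne obtain p where p: "p \<in> P" by blast
    then have "p \<in> om x" "om x \<noteq> {p}" using nonsad K by (auto simp: P_def)
    then obtain u where u: "u \<in> U p" "u \<in> K"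
      using saddle_box.omega_hits_unstable[OF F.box[OF p]] K by blast
    then show ?thesis using F.U_hit[OF p u(1)] by blast
  qed
  have Fdone: ?thesis if "wandering_either F.first_ret F.ret_dom D {t \<in> D. tau t \<in> C}"
    using FR.trap_open[OF that] unfolding C_def .
  show ?thesis
  proof (cases "x \<in> K")
    case False
    then have "P \<noteq> {}" using rec by (auto simp: P_def)
    then obtain t where t: "t \<in> D'" "tau t \<in> om x" using hit K by blast
    have "\<exists>s\<ge>S. v s x \<in> tau ` D" for S using F.recurrent_hits[OF t zero_less_one, of S] by auto
    then show ?thesis by (rule Fdone[OF FR.trap_nonrecurrent[OF x K False C_def]])
  next
    case xK: True
    have ne: "{t \<in> D. tau t \<in> K} \<noteq> {}"
    proof (cases "P = {}")
      case True
      then have "x \<in> tau ` D'" using Z0 by (simp add: Z0_def)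
      then show ?thesis using xK F.D'_sub by blast
    next
      case False
      then show ?thesis using hit F.D'_sub by blast
    qed
    \<comment> \<open>There are infinitely many gap ends, but only finitely many parameters on
      connections between saddles of \<open>P\<close>. Hence some gap end returns for ever, forwards
      or backwards.\<close>
    have "infinite {a. \<exists>sg. FR.gap a sg}" by (rule FR.infinite_gaps_if_recurrent[OF x K xK ne thin])
    then have "\<not> {a. \<exists>sg. FR.gap a sg} \<subseteq> {t \<in> D. \<exists>p\<in>P. \<exists>p'\<in>P. om (tau t) = {p} \<and> al (tau t) = {p'}}"
      using finite_subset[OF _ F.finite_connections] by (rule contrapos_nn)
    then obtain a where "a \<in> {a. \<exists>sg. FR.gap a sg}"
      and nc: "a \<notin> {t \<in> D. \<exists>p\<in>P. \<exists>p'\<in>P. om (tau t) = {p} \<and> al (tau t) = {p'}}"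
      unfolding subset_iff not_all not_imp by (elim exE conjE)
    then obtain sg where gap: "FR.gap a sg" by (elim CollectE exE)
    have a: "a \<in> D" "tau a \<in> K" using gap by (auto simp: FR.gap_def)
    consider "\<not> (\<exists>p\<in>P. om (tau a) = {p})" | "\<not> (\<exists>p\<in>P. al (tau a) = {p})"
      using nc a by blast
    then show ?thesis
    proof cases
      case 1
      have it: "(F.first_ret ^^ n) a \<in> F.ret_dom" for n
        by (rule FR.iterates_return[OF a, of "(\<lambda>p. {p}) ` P"]) (use lastF in blast, use 1 in blast)
      show ?thesis by (rule Fdone, rule FR.trap_recurrent[OF x disjI1[OF K] xK C_def gap it])
    next
      case 2
      have it: "(B.first_ret ^^ n) a \<in> B.ret_dom" for n
        by (rule BR.iterates_return[OF a, of "(\<lambda>p. {p}) ` P"]) (use lastB in blast, use 2 in \<open>simp only: omega_limit_rev; blast\<close>)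
      have "\<exists>V. open V \<and> V \<noteq> {} \<and> captured (rev_flow v) V C"
        by (rule BR.trap_open, rule BR.trap_recurrent[OF _ _ _ xK _ gap it]) (simp_all add: x K C_def periodic_rev)
      then show ?thesis unfolding C_def by (auto simp only: omega_limit_rev alpha_limit_rev)
    qed
  qed
qed

end

section \<open>Saddle connections\<close>

context surface_flow
begin

lemma W_unstable_finite:
  assumes "saddle v p"
  obtains U where "finite U" "W_unstable v p = {p} \<union> (\<Union>u\<in>U. orbit v u)" "\<And>u. u \<in> U ==> u \<notin> Sing v"
proof -
  obtain N S U where box: "saddle_box v p N S U" by (rule saddle_box_exists[OF assms open_UNIV UNIV_I])
  interpret R: saddle_box "rev_flow v" p N U S by (rule saddle_box.rev_saddle_box[OF box])
  show ?thesis
    by (rule that[of U]) (use R.S_finite R.W_stable_eq R.S_regular in simp_all)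
qed

text \<open>The constant orbit at a saddle counts as a connection, so the relation is reflexive on
  saddles.\<close>

definition connections :: "('a \<times> 'a) set" where
  "connections = {(p, q). saddle v p \<and> saddle v q \<and> (\<exists>z. al z = {p} \<and> om z = {q})}"

lemma alpha_shift: "al (v t y) = al y"
  using rev.omega_shift[of "- t" y] by (simp add: rev_flow_def)

text \<open>The unstable manifolds consist of finitely many orbits whose limit sets are singletons
  in \<open>R\<close>, so taking orbit closures adds nothing.\<close>

lemma unstable_union:
  assumes R: "finite R" "\<And>q. q \<in> R ==> saddle v q"
    and step: "\<And>q y. q \<in> R ==> al y = {q} ==> y \<notin> Sing v ==> \<exists>r\<in>R. om y = {r}"
  shows "invariant_set v (\<Union>q\<in>R. W_unstable v q)"
    and "\<exists>Y. finite Y \<and> (\<Union>q\<in>R. W_unstable v q) = (\<Union>y\<in>Y. closure (orbit v y))"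
proof -
  define K where "K = (\<Union>q\<in>R. W_unstable v q)"
  define sep where "sep q V \<longleftrightarrow> finite V \<and> W_unstable v q = {q} \<union> (\<Union>u\<in>V. orbit v u) \<and> (\<forall>u\<in>V. u \<notin> Sing v)" for q V
  have "\<exists>V. sep q V" if "q \<in> R" for q
    by (rule W_unstable_finite[OF R(2)[OF that]]) (unfold sep_def, blast)
  then obtain U0 where "\<And>q. q \<in> R ==> sep q (U0 q)" by metis
  then have U0: "\<And>q. q \<in> R ==> finite (U0 q) \<and> W_unstable v q = {q} \<union> (\<Union>u\<in>U0 q. orbit v u) \<and> (\<forall>u\<in>U0 q. u \<notin> Sing v)"
    unfolding sep_def .
  define Y where "Y = R \<union> (\<Union>q\<in>R. U0 q)"
  have WU: "W_unstable v q = {q} \<union> (\<Union>u\<in>U0 q. orbit v u)" if "q \<in> R" for q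
    using U0[OF that] by (elim conjE)
  have U0_reg: "u \<notin> Sing v" if "q \<in> R" "u \<in> U0 q" for q u using U0[OF that(1)] that(2) by blast
  have finU0: "finite (U0 q)" if "q \<in> R" for q using U0[OF that] by (elim conjE)
  have Y: "finite Y" unfolding Y_def by (intro finite_UnI finite_UN_I R(1) finU0)
  have inK: "y \<in> K \<longleftrightarrow> (\<exists>q\<in>R. al y = {q})" for y unfolding K_def W_unstable_def by blast
  have RK: "q \<in> K" if "q \<in> R" for q
    using WU[OF that] that unfolding K_def by blast
  show Kinv: "invariant_set v (\<Union>q\<in>R. W_unstable v q)"
    unfolding K_def[symmetric] invariant_set_def by (intro ballI allI) (simp only: inK alpha_shift)
  have "K = (\<Union>y\<in>Y. closure (orbit v y))"
  proof
    show "K \<subseteq> (\<Union>y\<in>Y. closure (orbit v y))"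
    proof
      fix y assume "y \<in> K"
      then obtain q where q: "q \<in> R" "y \<in> W_unstable v q" by (auto simp: K_def)
      then have "y = q \<or> (\<exists>u\<in>U0 q. y \<in> orbit v u)" unfolding WU[OF q(1)] by blast
      then have "\<exists>y'\<in>Y. y \<in> orbit v y'" using q(1) in_orbit(2)[of q] unfolding Y_def by blast
      then show "y \<in> (\<Union>y\<in>Y. closure (orbit v y))" using closure_subset by fast
    qed
    show "(\<Union>y\<in>Y. closure (orbit v y)) \<subseteq> K"
    proof (rule UN_least)
      fix y assume y: "y \<in> Y"
      show "closure (orbit v y) \<subseteq> K"
      proof (cases "y \<in> R")
        case True
        then have "y \<in> Sing v" using R(2) by (auto simp: saddle_def)
        then have "orbit v y = {y}" by (auto simp: orbit_def Sing_def)
        then show ?thesis using RK[OF True] by simp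
      next
        case False
        then obtain q where q: "q \<in> R" "y \<in> U0 q" using y by (auto simp: Y_def)
        then have yK: "y \<in> K" using WU[OF q(1)] in_orbit(2)[of y] unfolding K_def by blast
        then obtain q' where q': "q' \<in> R" "al y = {q'}" using inK by blast
        have "y \<notin> Sing v" by (rule U0_reg[OF q])
        then obtain r where r: "r \<in> R" "om y = {r}" using step[OF q'] by blast
        show ?thesis unfolding closure_orbit q' r
          using orbit_subset[OF Kinv[folded K_def] yK] RK q'(1) r(1) by blast
      qed
    qed
  qed
  then show "\<exists>Y. finite Y \<and> (\<Union>q\<in>R. W_unstable v q) = (\<Union>y\<in>Y. closure (orbit v y))"
    using Y unfolding K_def by blast
qed

text \<open>The hits of the unstable separatrices of the saddles reachable from p form a finite set that is
  closed under germs of the return map. Since germs are injective, the separatrix entering p belongs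
  to it.\<close>

lemma connection_returns:
  assumes pp: "(p0, p) \<in> connections"
    and fin: "finite (connections\<^sup>* `` {p})"
    and conn: "\<And>q y. q \<in> connections\<^sup>* `` {p} ==> al y = {q} ==> y \<notin> Sing v ==>
      \<exists>r. saddle v r \<and> om y = {r}"
  shows "(p, p0) \<in> connections\<^sup>*"
proof -
  define R where "R = connections\<^sup>* `` {p}"
  have p: "saddle v p" "saddle v p0" using pp by (auto simp: connections_def)
  have Rs: "saddle v q" if "q \<in> R" for q
  proof -
    have "(p, q) \<in> connections\<^sup>*" using that by (simp add: R_def)
    then show ?thesis by (cases rule: rtranclE) (use p in \<open>auto simp: connections_def\<close>)
  qed
  have pR: "p \<in> R" by (simp add: R_def)
  have step: "\<exists>r\<in>R. om y = {r}" if q: "q \<in> R" "al y = {q}" "y \<notin> Sing v" for q y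
  proof -
    obtain r where r: "saddle v r" "om y = {r}" using conn q unfolding R_def by blast
    have "(q, r) \<in> connections" using Rs[OF q(1)] r q(2) by (auto simp: connections_def)
    then have "r \<in> R" using q(1) by (auto simp: R_def intro: rtrancl.rtrancl_into_rtrancl)
    with r show ?thesis by blast
  qed
  obtain z where z: "al z = {p0}" "om z = {p}" using pp by (auto simp: connections_def)
  show ?thesis
  proof (cases "z \<in> Sing v")
    case True
    then have "p0 = p" using z omega_Sing rev.omega_Sing[of z] by simp
    then show ?thesis by simp
  next
    case z_reg: False
    define K where "K = (\<Union>q\<in>R. W_unstable v q)"
    \<comment> \<open>The orbit of \<open>z\<close> is added so that its last hit near
      \<open>p\<close> is a parameter to which the germ analysis applies; the union is still closed,
      invariant and without interior.\<close>
    define K' where "K' = K \<union> closure (orbit v z)"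
    have finR: "finite R" unfolding R_def by (rule fin)
    have inK: "y \<in> K \<longleftrightarrow> (\<exists>q\<in>R. al y = {q})" for y unfolding K_def W_unstable_def by blast
    have Kinv: "invariant_set v K"
      unfolding K_def by (rule unstable_union(1)[OF finR Rs step])
    have "\<exists>Y. finite Y \<and> K = (\<Union>y\<in>Y. closure (orbit v y))"
      unfolding K_def by (rule unstable_union(2)[OF finR Rs step])
    then obtain Y where Y: "finite Y" and "K = (\<Union>y\<in>Y. closure (orbit v y))" by (elim exE conjE)
    then have K'_eq: "K' = (\<Union>y\<in>insert z Y. closure (orbit v y))" by (auto simp: K'_def)
    have K': "closed K'" "invariant_set v K'" "interior K' = {}"
    proof -
      show "closed K'" unfolding K'_eq using Y by (intro closed_UN) auto
      show "invariant_set v K'" using Kinv closure_invariant[OF orbit_invariant[of z]] by (auto simp: K'_def invariant_set_def)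
      show "interior K' = {}" unfolding K'_eq by (rule interior_closure_orbits_empty) (use Y in simp)
    qed
    obtain eps D D' tau N S U where sec: "saddle_section v D D' tau eps R N S U"
      and K_D': "\<And>t. t \<in> D ==> tau t \<in> K' ==> t \<in> D'"
      by (rule saddle_section_exists[of R "{}" K']) (use fin Rs K' in \<open>auto simp: R_def\<close>)
    interpret F: saddle_section v D D' tau eps R N S U by (rule sec)
    have target: "\<exists>r\<in>R. om (tau q) = {r}" if q: "q \<in> D" "tau q \<in> K'" for q
    proof -
      have reg: "tau q \<notin> Sing v" by (rule F.tau_regular[OF q(1)])
      consider "tau q \<in> K" | "tau q \<in> orbit v z" | "tau q = p \<or> tau q = p0"
        using q(2) z by (auto simp: K'_def closure_orbit)
      then show ?thesis
      proof cases
        case 1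
        then show ?thesis using step reg inK by blast
      next
        case 2
        then show ?thesis using z(2) pR by (auto simp: orbit_def)
      next
        case 3
        then show ?thesis using reg p by (auto simp: saddle_def)
      qed
    qed
    interpret FR: return_system v D D' tau eps K' UNIV
    proof (rule F.return_system)
      show "invariant_set v UNIV" by (simp add: invariant_set_def)
    qed (use K'(1,2) K_D' target in simp_all)
    \<comment> \<open>The hits of unstable separatrices of \<open>R\<close>. They are finite in
      number because each of these separatrices connects two saddles of \<open>R\<close>.\<close>
    define H where "H = {t \<in> D. tau t \<in> K}"
    have HQ: "H \<subseteq> {t \<in> D. tau t \<in> K'}" by (auto simp: H_def K'_def)
    have Hfin: "finite H"
    proof (rule finite_subset[OF _ F.finite_connections])
      show "H \<subseteq> {t \<in> D. \<exists>p\<in>R. \<exists>p'\<in>R. om (tau t) = {p} \<and> al (tau t) = {p'}}"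
      proof
        fix t assume t: "t \<in> H"
        then have "t \<in> D" "tau t \<in> K'" using HQ by auto
        from target[OF this] obtain p1 where "p1 \<in> R" "om (tau t) = {p1}" by blast
        moreover obtain p2 where "p2 \<in> R" "al (tau t) = {p2}" using t inK unfolding H_def by blast
        ultimately show "t \<in> {t \<in> D. \<exists>p\<in>R. \<exists>p'\<in>R. om (tau t) = {p} \<and> al (tau t) = {p'}}"
          using \<open>t \<in> D\<close> by blast
      qed
    qed
    \<comment> \<open>At a last hit before a saddle \<open>r\<close> the germ leads to the first hit
      of an unstable separatrix of \<open>r\<close>, hence into \<open>H\<close>.\<close>
    have last: "b \<in> H" if q: "q \<in> D" "tau q \<in> K'" "q \<notin> F.ret_dom" and g: "germ F.first_ret F.ret_dom 1 q sg b rho" for q sg b rho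
    proof -
      obtain r where r: "r \<in> R" "om (tau q) = {r}" using target[OF q(1,2)] by blast
      obtain T where T: "finite T" "T \<subseteq> D'" "tau ` T \<subseteq> U r"
        "\<And>e. e > 0 ==> \<exists>d>0. \<forall>t\<in>D. 0 < \<bar>t - q\<bar> --> \<bar>t - q\<bar> < d --> t \<in> F.ret_dom \<and> (\<exists>u\<in>T. \<bar>F.first_ret t - u\<bar> < e)"
        by (rule F.passing[OF r(1) F.last_hit[OF q(1,3) r] q(1)]) (rule that)
      have "b \<in> T" by (rule germ_target[OF g T(1) F.ret_dom_sub]) (use T(4) in blast)
      moreover have "al (tau b) = {r}" if "b \<in> T"
        using saddle_box.U_alpha[OF F.box[OF r(1)]] T(3) that by blast
      ultimately show "b \<in> H" using T(2) F.D'_sub r(1) by (auto simp: H_def inK)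
    qed
    have closed: "b \<in> H" if q: "q \<in> H" and g: "germ F.first_ret F.ret_dom 1 q sg b rho" for q sg b rho
    proof (cases "q \<in> F.ret_dom")
      case True
      have qD: "q \<in> D" "tau q \<in> K" using q by (auto simp: H_def)
      have fK: "F.first_ret q \<in> H" using FR.invariant_preimage[OF Kinv True] qD by (simp add: H_def)
      have "F.first_ret q \<in> D'" using fK K_D' by (auto simp: H_def K'_def)
      then have "\<exists>d>0. \<forall>t\<in>D. 0 < \<bar>t - q\<bar> --> \<bar>t - q\<bar> < d --> (\<exists>u\<in>{F.first_ret q}. \<bar>F.first_ret t - u\<bar> < e)" if "e > 0" for e
        using F.first_ret_near[OF True _ that] by blast
      then have "b \<in> {F.first_ret q}" by (intro germ_target[OF g _ F.ret_dom_sub]) auto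
      then show ?thesis using fK by simp
    next
      case False
      then show ?thesis using last[OF _ _ False g] q HQ by blast
    qed
    interpret Bp: saddle_box v p "N p" "S p" "U p" by (rule F.box[OF pR])
    have "z \<noteq> p" using z_reg Bp.p_Sing by blast
    then obtain s where s: "s \<in> S p" "z \<in> orbit v s" using Bp.stable_orbit[OF z(2)] by blast
    obtain t where t: "t \<in> D'" "tau t = s" using F.S_hit[OF pR s(1)] by blast
    have tD: "t \<in> D" using t F.D'_sub by blast
    have oz: "orbit v z = orbit v s" by (rule orbit_eq[OF s(2)])
    then have "s \<in> orbit v z" using in_orbit(2)[of s] by simp
    then have tK: "tau t \<in> K'" using t(2) closure_subset[of "orbit v z"] by (auto simp: K'_def)
    have tr: "t \<notin> F.ret_dom" using F.S_last[OF pR s(1)] t(2) by (auto simp: F.ret_dom_def)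
    obtain sg where sg: "FR.side t sg" using F.cs_some_side[OF tD] unfolding FR.side_def by blast
    obtain b rho where g: "germ F.first_ret F.ret_dom 1 t sg b rho"
      by (rule FR.germ_step[OF _ sg]) (use tD tK in auto)
    have "t \<in> H"
      by (rule FR.finite_germs_closed[OF Hfin HQ closed g last[OF tD tK tr g]])
    then obtain q where q: "q \<in> R" "al s = {q}" using t(2) by (auto simp: H_def inK)
    obtain r where "z = v r s" using s(2) by (auto simp: orbit_def)
    then have "al z = {q}" using q(2) rev.omega_shift[of "- r" s] by (simp add: rev_flow_def)
    then have "q = p0" using z(1) by simp
    then show ?thesis using q(1) by (simp add: R_def)
  qed
qed

end

section \<open>Extended orbits\<close>

lemma pos_ext_orbit_base: "pos_orbit v x \<subseteq> pos_ext_orbit v x"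
  unfolding pos_ext_orbit_def by (rule Union_upper[OF pos_stages.base])

lemma pos_ext_orbit_step:
  assumes "x' \<in> pos_ext_orbit v x" "omega_limit v x' = {p}" "saddle v p"
  shows "W_unstable v p \<subseteq> pos_ext_orbit v x"
proof -
  obtain A where A: "A \<in> pos_stages v x" "x' \<in> A" using assms(1) unfolding pos_ext_orbit_def by blast
  show ?thesis unfolding pos_ext_orbit_def using pos_stages.succ[OF A(1)] A(2) assms(2,3) by blast
qed

text \<open>With \<open>pos_ext_orbit_base\<close> and \<open>pos_ext_orbit_step\<close> this makes
  the extended orbit the least set that contains the positive orbit and is closed under adjoining
  unstable manifolds; later proofs use this in place of transfinite stages.\<close>

lemma pos_ext_orbit_least:
  assumes "pos_orbit v x \<subseteq> B" "\<And>x' p. x' \<in> B ==> omega_limit v x' = {p} ==> saddle v p ==> W_unstable v p \<subseteq> B"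
  shows "pos_ext_orbit v x \<subseteq> B"
proof -
  have "A \<subseteq> B" if "A \<in> pos_stages v x" for A
    using that
  proof (induction rule: pos_stages.induct)
    case base
    show ?case by (rule assms(1))
  next
    case (succ A)
    show ?case using succ.IH assms(2) by blast
  next
    case (limit C)
    show ?case using limit.IH by blast
  qed
  then show ?thesis unfolding pos_ext_orbit_def by blast
qed

lemma pos_stages_rev: "pos_stages (rev_flow v) x = neg_stages v x"
proof (intro equalityI subsetI)
  fix A
  show "A \<in> neg_stages v x" if "A \<in> pos_stages (rev_flow v) x"
    using that
  proof (induction rule: pos_stages.induct)
    case base
    show ?case using neg_stages.base[of v x] by simp
  next
    case (succ A)
    show ?case using neg_stages.succ[OF succ.IH] by simp
  next
    case (limit C)
    show ?case by (rule neg_stages.limit[OF limit.hyps(1) limit.IH])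
  qed
  show "A \<in> pos_stages (rev_flow v) x" if "A \<in> neg_stages v x"
    using that
  proof (induction rule: neg_stages.induct)
    case base
    show ?case using pos_stages.base[of "rev_flow v" x] by simp
  next
    case (succ A)
    show ?case using pos_stages.succ[OF succ.IH] by simp
  next
    case (limit C)
    show ?case by (rule pos_stages.limit[OF limit.hyps(1) limit.IH])
  qed
qed

lemma pos_ext_orbit_rev [simp]: "pos_ext_orbit (rev_flow v) x = neg_ext_orbit v x"
  by (simp add: pos_ext_orbit_def neg_ext_orbit_def pos_stages_rev)

lemma neg_ext_orbit_rev [simp]: "neg_ext_orbit (rev_flow v) x = pos_ext_orbit v x"
  using pos_ext_orbit_rev[of "rev_flow v" x] by simp

lemma ext_orbit_rev [simp]: "ext_orbit (rev_flow v) = ext_orbit v"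
  by (simp add: ext_orbit_def fun_eq_iff Un_commute)

section \<open>Points that converge to saddles\<close>

definition to_saddle :: "(real => 'a::topological_space => 'a) => 'a => bool" where
  "to_saddle v x \<longleftrightarrow> (\<exists>p. saddle v p \<and> omega_limit v x = {p})"

lemma to_saddle_rev: "to_saddle (rev_flow v) x \<longleftrightarrow> (\<exists>p. saddle v p \<and> alpha_limit v x = {p})"
  by (simp add: to_saddle_def)

definition separatrices :: "(real => 'a::topological_space => 'a) => 'a set" where
  "separatrices v = {x. to_saddle v x \<or> to_saddle (rev_flow v) x}"

lemma separatrices_rev [simp]: "separatrices (rev_flow v) = separatrices v"
  by (auto simp: separatrices_def)

context compact_flow
begin

lemma orbit_pos_neg: "orbit v x = pos_orbit v x \<union> neg_orbit v x"
proof -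
  have "(UNIV :: real set) = {0..} \<union> {..0}" by auto
  then show ?thesis unfolding orbit_def pos_orbit_def neg_orbit_def by (metis image_Un)
qed

lemma pos_ext_orbit_plain:
  assumes "\<not> to_saddle v x" shows "pos_ext_orbit v x = pos_orbit v x"
proof
  show "pos_ext_orbit v x \<subseteq> pos_orbit v x"
  proof (rule pos_ext_orbit_least)
    fix x' p assume *: "x' \<in> pos_orbit v x" "om x' = {p}" "saddle v p"
    obtain t where "x' = v t x" using *(1) unfolding pos_orbit_def by blast
    then have "om x = {p}" using *(2) by simp
    then show "W_unstable v p \<subseteq> pos_orbit v x" using assms *(3) unfolding to_saddle_def by blast
  qed simp
qed (rule pos_ext_orbit_base)

lemma orbit_subset_ext: "orbit v x \<subseteq> ext_orbit v x"
  using pos_ext_orbit_base[of v x] pos_ext_orbit_base[of "rev_flow v" x]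
  unfolding ext_orbit_def orbit_pos_neg pos_ext_orbit_rev pos_orbit_rev by (rule Un_mono)

lemma in_ext_orbit [simp]: "x \<in> ext_orbit v x"
  using orbit_subset_ext in_orbit(2)[of x] by blast

lemma not_periodic_if_to_saddle:
  assumes "x \<notin> Sing v" "to_saddle v x" shows "\<not> periodic v x"
proof -
  obtain p where p: "om x = {p}" using assms(2) by (auto simp: to_saddle_def)
  then have "x \<noteq> p" using omega_singleton_Sing assms(1) by blast
  then show ?thesis using omega_singleton_not_periodic[OF p] unfolding periodic_def by blast
qed

text \<open>With its subspace topology the closed set \<open>M\<close> is compact Hausdorff, hence a
  Baire space.\<close>

lemma baire:
  fixes M :: "'a set"
  assumes M: "closed M" "M \<noteq> {}" and G: "countable \<G>" "\<And>G. G \<in> \<G> ==> closed G" "M \<subseteq> \<Union>\<G>"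
  obtains G W where "G \<in> \<G>" "open W" "M \<inter> W \<noteq> {}" "M \<inter> W \<subseteq> G"
proof -
  let ?X = "top_of_set M"
  have "Hausdorff_space (euclidean :: 'a topology)"
    unfolding Hausdorff_space_def using hausdorff by (fastforce simp: disjnt_def)
  then have H: "Hausdorff_space ?X" by (rule Hausdorff_space_subtopology)
  have C: "compact_space ?X" using compact_if_closed[OF M(1)] by (simp add: compact_space_subtopology)
  have "locally_compact_space ?X \<and> regular_space ?X"
    using H C compact_Hausdorff_imp_regular_space compact_imp_locally_compact_space by blast
  then have B: "?X interior_of \<Union>((\<inter>) M ` \<G>) = {}" if "\<And>T. T \<in> (\<inter>) M ` \<G> ==> closedin ?X T \<and> ?X interior_of T = {}"
    by (intro Baire_category_alt that disjI2 countable_image G(1))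
  have "\<Union>((\<inter>) M ` \<G>) = topspace ?X" using G(3) by auto
  then have "?X interior_of \<Union>((\<inter>) M ` \<G>) \<noteq> {}"
    using M(2) interior_of_topspace[of ?X] by (simp only: topspace_euclidean_subtopology) simp
  then obtain G where GG: "G \<in> \<G>" and "\<not> (closedin ?X (M \<inter> G) \<and> ?X interior_of (M \<inter> G) = {})"
    using B by auto
  moreover have "closedin ?X (M \<inter> G)" using G(2)[OF GG] by (auto simp: closedin_closed)
  ultimately obtain x where "x \<in> ?X interior_of (M \<inter> G)" by blast
  then obtain T where T: "openin ?X T" "x \<in> T" "T \<subseteq> M \<inter> G" by (auto simp: interior_of_def)
  then obtain W where "open W" "T = M \<inter> W" by (auto simp: openin_open)
  then show ?thesis using that[OF GG, of W] T by auto
qed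

end

section \<open>Countability and thinness of the separatrices\<close>

context surface_flow
begin

lemma saddle_isolated:
  assumes "saddle v p"
  obtains N where "open N" "N \<inter> Sing v = {p}"
proof -
  obtain N S U where box: "saddle_box v p N S U" by (rule saddle_box_exists[OF assms open_UNIV UNIV_I])
  interpret saddle_box v p N S U by (rule box)
  have "y = p" if "y \<in> N" "y \<in> Sing v" for y
    by (rule N_not_exit) (simp add: that Sing_v[OF that(2)])
  then show ?thesis using that[OF N(1)] N(2) p_Sing by blast
qed

text \<open>Saddles are isolated among the singularities, and the set in question is
  compact.\<close>

lemma finite_Sing_saddles:
  assumes "closed F" "\<And>y. y \<in> F ==> y \<in> Sing v ==> saddle v y"
  shows "finite (Sing v \<inter> F)"
proof -
  have "\<exists>N. open N \<and> N \<inter> Sing v = {y}" if "y \<in> Sing v \<inter> F" for y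
    using assms(2)[of y] that by (metis IntD1 IntD2 saddle_isolated)
  then obtain N where N: "\<And>y. y \<in> Sing v \<inter> F ==> open (N y) \<and> N y \<inter> Sing v = {y}" by metis
  have "compact (Sing v \<inter> F)" using compact_if_closed[OF closed_Int[OF Sing_closed assms(1)]] .
  then obtain C where C: "C \<subseteq> Sing v \<inter> F" "finite C" "Sing v \<inter> F \<subseteq> (\<Union>y\<in>C. N y)"
    by (rule compactE_image[of _ "Sing v \<inter> F" N]) (use N in blast)+
  have "y \<in> C" if y: "y \<in> Sing v \<inter> F" for y
  proof -
    obtain c where c: "c \<in> C" "y \<in> N c" using C(3) y by blast
    then have "y \<in> N c \<inter> Sing v" using y by simp
    then have "y = c" using N[of c] C(1) c(1) by auto
    then show ?thesis using c(1) by simp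
  qed
  then have "Sing v \<inter> F \<subseteq> C" by blast
  then show ?thesis using C(2) finite_subset by blast
qed

text \<open>Each saddle is the only singularity in some member of a countable basis.\<close>

lemma countable_saddles: "countable {p. saddle v p}"
proof -
  obtain B :: "'a set set" where B: "countable B" "topological_basis B" using ex_countable_basis by blast
  have "\<exists>b. b \<in> B \<and> b \<inter> Sing v = {p}" if p: "saddle v p" for p
  proof -
    obtain N where N: "open N" "N \<inter> Sing v = {p}" by (rule saddle_isolated[OF p])
    then obtain b where "b \<in> B" "p \<in> b" "b \<subseteq> N" using topological_basisE[OF B(2) N(1), of p] by blast
    then show ?thesis using N(2) by blast
  qed
  then obtain b where b: "\<And>p. saddle v p ==> b p \<in> B \<and> b p \<inter> Sing v = {p}" by metis
  have "inj_on b {p. saddle v p}"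
    by (rule inj_onI) (use b in \<open>metis mem_Collect_eq singleton_inject\<close>)
  moreover have "b ` {p. saddle v p} \<subseteq> B" using b by blast
  ultimately show ?thesis using B(1) by (metis countable_image_inj_on countable_subset)
qed

lemma W_stable_finite:
  assumes "saddle v p"
  obtains S where "finite S" "W_stable v p = {p} \<union> (\<Union>s\<in>S. orbit v s)"
proof -
  obtain N S U where box: "saddle_box v p N S U" by (rule saddle_box_exists[OF assms open_UNIV UNIV_I])
  interpret saddle_box v p N S U by (rule box)
  show ?thesis by (rule that[OF S_finite W_stable_eq])
qed

lemma separatrices_of_saddle:
  assumes p: "saddle v p"
  shows "\<exists>V. finite V \<and> W_stable v p \<union> W_unstable v p \<subseteq> (\<Union>y\<in>V. orbit v y)"
proof -
  obtain S where S: "finite S" "W_stable v p = {p} \<union> (\<Union>s\<in>S. orbit v s)" by (rule W_stable_finite[OF p])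
  obtain U where U: "finite U" "W_unstable v p = {p} \<union> (\<Union>u\<in>U. orbit v u)" by (rule W_unstable_finite[OF p])
  have "finite (insert p (S \<union> U))" using S(1) U(1) by simp
  moreover have "W_stable v p \<union> W_unstable v p \<subseteq> (\<Union>y\<in>insert p (S \<union> U). orbit v y)"
    unfolding S(2) U(2) using in_orbit(2)[of p] by blast
  ultimately show ?thesis by blast
qed

lemma separatrices_orbits:
  obtains Y where "countable Y" "separatrices v \<subseteq> (\<Union>y\<in>Y. orbit v y)"
proof -
  obtain V where V: "\<And>p. saddle v p ==> finite (V p) \<and> W_stable v p \<union> W_unstable v p \<subseteq> (\<Union>y\<in>V p. orbit v y)"
    using separatrices_of_saddle by metis
  show ?thesis
  proof (rule that[of "\<Union>p\<in>{p. saddle v p}. V p"])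
    show "countable (\<Union>p\<in>{p. saddle v p}. V p)"
    proof (intro countable_UN countable_saddles)
      fix p assume "p \<in> {p. saddle v p}"
      then have "finite (V p)" using V[of p] by blast
      then show "countable (V p)" by (rule countable_finite)
    qed
    show "separatrices v \<subseteq> (\<Union>y\<in>\<Union>p\<in>{p. saddle v p}. V p. orbit v y)"
    proof
      fix x assume "x \<in> separatrices v"
      then obtain p where p: "saddle v p" "x \<in> W_stable v p \<union> W_unstable v p"
        unfolding separatrices_def mem_Collect_eq to_saddle_rev
        unfolding to_saddle_def W_stable_def W_unstable_def by blast
      then have "x \<in> (\<Union>y\<in>V p. orbit v y)" using V[OF p(1)] by blast
      then show "x \<in> (\<Union>y\<in>\<Union>p\<in>{p. saddle v p}. V p. orbit v y)" using p(1) by blast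
    qed
  qed
qed

text \<open>The separatrices lie on countably many orbits, whose closures have no interior.\<close>

lemma separatrices_thin:
  assumes V: "open V" "V \<subseteq> separatrices v" shows "V = {}"
proof (rule ccontr)
  assume ne: "V \<noteq> {}"
  obtain Y where Y: "countable Y" "separatrices v \<subseteq> (\<Union>y\<in>Y. orbit v y)" by (rule separatrices_orbits)
  \<comment> \<open>Baire's theorem is applied in \<open>closure V\<close>; the part
    \<open>closure V - V\<close> completes the cover, and it misses \<open>V\<close>.\<close>
  let ?G = "insert (closure V - V) ((\<lambda>y. closure (orbit v y)) ` Y)"
  obtain G W where G: "G \<in> ?G" and W: "open W" "closure V \<inter> W \<noteq> {}" "closure V \<inter> W \<subseteq> G"
  proof (rule baire[of "closure V" ?G])
    show "closed G" if "G \<in> ?G" for G using that V(1) by (auto intro: closed_Diff)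
    have "V \<subseteq> (\<Union>y\<in>Y. closure (orbit v y))" 
      using subset_trans[OF V(2) Y(2)] UN_mono[OF subset_refl closure_subset] by (rule subset_trans)
    then show "closure V \<subseteq> \<Union>?G" by blast
  qed (use ne Y(1) in auto)
  have VW: "V \<inter> W \<noteq> {}" using W(1,2) open_Int_closure_eq_empty[of W V] by (simp add: Int_commute)
  have VG: "V \<inter> W \<subseteq> G" using W(3) closure_subset by blast
  have "G \<noteq> closure V - V" using VW VG by blast
  then obtain y where "G = closure (orbit v y)" using G by blast
  then have "V \<inter> W \<subseteq> interior (closure (orbit v y))" using VG V(1) W(1) by (intro interior_maximal) auto
  then show False using VW not_locally_dense[of y] by (simp add: locally_dense_def)
qed

text \<open>The limit set is covered by countably many compact orbit arcs, so by Baire's theorem an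
  open set \<open>W\<close> meets it inside a single arc. The orbit of \<open>x\<close> visits
  \<open>W\<close> at arbitrarily late times, whereas a nonperiodic orbit runs through an arc in
  bounded time.\<close>

lemma periodic_if_recurrent_thin:
  assumes x: "x \<notin> Sing v" "x \<in> om x" and sub: "om x \<subseteq> orbit v x \<union> separatrices v"
  shows "periodic v x"
proof (rule ccontr)
  assume np: "\<not> periodic v x"
  obtain Y where Y: "countable Y" "separatrices v \<subseteq> (\<Union>y\<in>Y. orbit v y)" by (rule separatrices_orbits)
  define arc where "arc = (\<lambda>(y, k::nat). (\<lambda>t. v t y) ` {- real k..real k})"
  let ?G = "arc ` (insert x Y \<times> UNIV)"
  obtain G W where G: "G \<in> ?G" and W: "open W" "om x \<inter> W \<noteq> {}" "om x \<inter> W \<subseteq> G"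
  proof (rule baire[of "om x" ?G])
    show "countable ?G" using Y(1) by simp
    show "closed G" if "G \<in> ?G" for G
      using that unfolding arc_def
      by (auto intro!: compact_imp_closed compact_continuous_image continuous_intros)
    show "om x \<subseteq> \<Union>?G"
    proof
      fix y assume "y \<in> om x"
      then obtain y' t where y: "y' \<in> insert x Y" "y = v t y'" using sub Y(2) by (fastforce simp: orbit_def)
      obtain k :: nat where "\<bar>t\<bar> \<le> real k" using real_arch_simple by blast
      then have "t \<in> {- real k..real k}" by (simp add: abs_le_iff)
      then have "y \<in> arc (y', k)" unfolding arc_def prod.case y(2) by (rule imageI)
      then show "y \<in> \<Union>?G" using y(1) by blast
    qed
  qed simp_all
  obtain y k where yk: "G = arc (y, k)" using G by auto
  have orb: "v t x \<in> om x" for t using omega_invariant[OF x(2)] .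
  obtain w where w: "w \<in> om x" "w \<in> W" using W(2) by blast
  have hit: "\<exists>t\<ge>T. v t x \<in> W" for T using w W(1) omega_iff[of w x] by blast
  obtain t0 where "v t0 x \<in> W" using hit by blast
  then have "v t0 x \<in> arc (y, k)" using W(3) orb yk by blast
  then obtain r0 where r0: "v t0 x = v r0 y" by (auto simp: arc_def)
  obtain t1 where t1: "t1 \<ge> real k - r0 + t0 + 1" "v t1 x \<in> W" using hit by blast
  then have "v t1 x \<in> arc (y, k)" using W(3) orb yk by blast
  then obtain r1 where r1: "v t1 x = v r1 y" "r1 \<le> real k" by (auto simp: arc_def)
  have "v (r1 - r0) (v t0 x) = v t1 x" unfolding r0 r1(1) by simp
  then have "v (r1 - r0 + t0) x = v t1 x" by simp
  then have "r1 - r0 + t0 = t1" by (rule nonperiodic_inj[OF x(1) np])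
  then show False using t1(1) r1(2) by simp
qed

lemma connections_rev: "surface_flow.connections (rev_flow v) = connections\<inverse>"
proof -
  interpret rv: surface_flow "rev_flow v" by (rule rev_surface_flow)
  show ?thesis unfolding rv.connections_def connections_def by auto
qed

text \<open>A point of the unstable manifold of a saddle \<open>q\<close> that converges to a saddle
  \<open>r\<close> is itself a connection from \<open>q\<close> to \<open>r\<close>. So the
  construction adjoins the unstable manifolds of exactly the saddles reachable from
  \<open>p\<close>.\<close>

lemma pos_ext_orbit_saddle:
  assumes p: "om x = {p}" "saddle v p"
  shows "pos_ext_orbit v x = pos_orbit v x \<union> (\<Union>q\<in>connections\<^sup>* `` {p}. W_unstable v q)" (is "_ = ?B")
proof
  have "om x' = {p}" if x': "x' \<in> pos_orbit v x" for x'
  proof -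
    obtain t where "x' = v t x" using x' unfolding pos_orbit_def by blast
    then show ?thesis using p(1) by simp
  qed
  moreover have sad: "saddle v q" if "(p, q) \<in> connections\<^sup>*" for q
    using that by (cases rule: rtranclE) (use p in \<open>auto simp: connections_def\<close>)
  ultimately show "pos_ext_orbit v x \<subseteq> ?B"
  proof (intro pos_ext_orbit_least)
    fix x' r assume x': "x' \<in> ?B" and r: "om x' = {r}" "saddle v r"
      and po: "\<And>x'. x' \<in> pos_orbit v x ==> om x' = {p}"
    have "(p, r) \<in> connections\<^sup>*"
    proof (cases "x' \<in> pos_orbit v x")
      case True
      then show ?thesis using po r(1) by simp
    next
      case False
      then obtain q where q: "(p, q) \<in> connections\<^sup>*" "al x' = {q}" using x' unfolding W_unstable_def by blast
      then have "(q, r) \<in> connections" using sad r unfolding connections_def by blast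
      then show ?thesis using q(1) by simp
    qed
    then show "W_unstable v r \<subseteq> ?B" by blast
  qed blast
  have "W_unstable v q \<subseteq> pos_ext_orbit v x" if "(p, q) \<in> connections\<^sup>*" for q
    using that
  proof (induction rule: rtrancl_induct)
    case base
    have "x \<in> pos_orbit v x" unfolding pos_orbit_def by (intro image_eqI[of _ _ 0]) simp_all
    then have "x \<in> pos_ext_orbit v x" using pos_ext_orbit_base by blast
    then show ?case by (rule pos_ext_orbit_step[OF _ p])
  next
    case (step q r)
    then obtain z where z: "al z = {q}" "om z = {r}" "saddle v r" by (auto simp: connections_def)
    have "z \<in> pos_ext_orbit v x" using step.IH z(1) by (auto simp: W_unstable_def)
    then show ?case by (rule pos_ext_orbit_step[OF _ z(2,3)])
  qed
  then show "?B \<subseteq> pos_ext_orbit v x" using pos_ext_orbit_base by blast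
qed

lemma pos_ext_orbit_subset: "pos_ext_orbit v x \<subseteq> pos_orbit v x \<union> {z. to_saddle (rev_flow v) z}"
proof (rule pos_ext_orbit_least)
  fix x' p assume "saddle v p"
  then show "W_unstable v p \<subseteq> pos_orbit v x \<union> {z. to_saddle (rev_flow v) z}"
    unfolding W_unstable_def to_saddle_rev by blast
qed blast

lemma neg_ext_orbit_subset: "neg_ext_orbit v x \<subseteq> neg_orbit v x \<union> {z. to_saddle v z}"
proof -
  interpret rv: surface_flow "rev_flow v" by (rule rev_surface_flow)
  show ?thesis using rv.pos_ext_orbit_subset[of x] by simp
qed

lemma ext_orbit_subset: "ext_orbit v x \<subseteq> orbit v x \<union> separatrices v"
  using pos_ext_orbit_subset[of x] neg_ext_orbit_subset[of x]
  unfolding ext_orbit_def orbit_pos_neg separatrices_def by blast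

lemma separatrices_Sing: "y \<in> separatrices v ==> y \<in> Sing v ==> saddle v y"
  using omega_Sing[of y] rev.omega_Sing[of y] by (auto simp: separatrices_def to_saddle_def)

text \<open>The half orbits are not invariant separately, but together they form the orbit; the
  parts adjoined to them consist of full unstable or stable manifolds, which are invariant.\<close>

lemma ext_orbit_invariant: "invariant_set v (ext_orbit v x)"
proof -
  have W: "v t z \<in> pos_ext_orbit v x" if z: "z \<in> pos_ext_orbit v x - pos_orbit v x" for t z x
  proof -
    have ts: "to_saddle v x" using pos_ext_orbit_plain z by blast
    then obtain p where p: "om x = {p}" "saddle v p" by (auto simp: to_saddle_def)
    obtain q where q: "(p, q) \<in> connections\<^sup>*" "al z = {q}"
      using z unfolding pos_ext_orbit_saddle[OF p] W_unstable_def by blast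
    have "al (v t z) = {q}" using rev.omega_shift[of "- t" z] q(2) by (simp add: rev_flow_def)
    then show ?thesis using q(1) unfolding pos_ext_orbit_saddle[OF p] W_unstable_def by blast
  qed
  interpret rv: surface_flow "rev_flow v" by (rule rev_surface_flow)
  have W': "v t z \<in> neg_ext_orbit v x" if z: "z \<in> neg_ext_orbit v x - neg_orbit v x" for t z
  proof -
    have ts: "to_saddle (rev_flow v) x" using rev.pos_ext_orbit_plain[of x] z by auto
    then obtain p where p: "omega_limit (rev_flow v) x = {p}" "saddle (rev_flow v) p" by (auto simp: to_saddle_def)
    obtain q where q: "(p, q) \<in> rv.connections\<^sup>*" "om z = {q}"
      using z rv.pos_ext_orbit_saddle[OF p] unfolding W_unstable_rev W_stable_def by auto
    have "om (v t z) = {q}" using q(2) by simp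
    then show ?thesis using q(1) rv.pos_ext_orbit_saddle[OF p] unfolding W_unstable_rev W_stable_def by auto
  qed
  show ?thesis unfolding invariant_set_def
  proof (intro ballI allI)
    fix z t assume "z \<in> ext_orbit v x"
    then consider "z \<in> orbit v x" | "z \<in> pos_ext_orbit v x - pos_orbit v x" | "z \<in> neg_ext_orbit v x - neg_orbit v x"
      unfolding ext_orbit_def orbit_pos_neg by blast
    then show "v t z \<in> ext_orbit v x"
    proof cases
      case 1
      then have "v t z \<in> orbit v x" using orbit_invariant[of x] unfolding invariant_set_def by blast
      then show ?thesis using orbit_subset_ext by blast
    next
      case 2 then show ?thesis using W unfolding ext_orbit_def by blast
    next
      case 3 then show ?thesis using W' unfolding ext_orbit_def by blast
    qed
  qed
qed

end

section \<open>Flows all of whose nonperiodic orbits are saddle connections\<close>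

context surface_flow
begin

definition tame :: bool where
  "tame \<longleftrightarrow> (\<forall>x. x \<notin> Sing v --> \<not> periodic v x --> to_saddle v x \<and> to_saddle (rev_flow v) x) \<and>
     (\<forall>p. saddle v p --> finite (connections\<^sup>* `` {p}))"

lemma tame_finite: "tame ==> saddle v p ==> finite (connections\<^sup>* `` {p})"
  unfolding tame_def by blast

text \<open>A singular point of this kind is itself a saddle. A regular one is not periodic, as it
  converges to a saddle at one end, so tameness supplies the other end.\<close>

lemma tame_ends:
  assumes tame "to_saddle v x \<or> to_saddle (rev_flow v) x"
  shows "\<exists>p q. saddle v p \<and> saddle v q \<and> al x = {p} \<and> om x = {q} \<and> (p, q) \<in> connections"
proof -
  have "to_saddle v x \<and> to_saddle (rev_flow v) x"
  proof (cases "x \<in> Sing v")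
    case True
    then show ?thesis using assms(2) omega_Sing[OF True] rev.omega_Sing[of x] by (auto simp: to_saddle_def)
  next
    case False
    then have "\<not> periodic v x"
      using False assms(2) not_periodic_if_to_saddle[of x] rev.not_periodic_if_to_saddle[of x, unfolded Sing_rev periodic_rev] by blast
    then show ?thesis using assms(1) False unfolding tame_def by blast
  qed
  then obtain p q where "saddle v p" "saddle v q" "al x = {p}" "om x = {q}"
    unfolding to_saddle_rev unfolding to_saddle_def by blast
  then show ?thesis unfolding connections_def by blast
qed

lemma connections_saddles: "(p, q) \<in> connections ==> saddle v p \<and> saddle v q"
  by (simp add: connections_def)

lemma reachable_saddle: "saddle v p ==> (p, q) \<in> connections\<^sup>* ==> saddle v q"
  by (erule rtranclE) (use connections_saddles in blast)+

lemma reaching_saddle: "saddle v q ==> (p, q) \<in> connections\<^sup>* ==> saddle v p"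
  by (erule converse_rtranclE) (use connections_saddles in blast)+

text \<open>\<open>connection_returns\<close> leads back along a single connection; a chain is
  reversed link by link.\<close>

lemma tame_sym:
  assumes tame "saddle v p" "(p, q) \<in> connections\<^sup>*"
  shows "(q, p) \<in> connections\<^sup>*"
  using assms(3)
proof (induction rule: rtrancl_induct)
  case (step q r)
  have r: "saddle v r" using step.hyps(2) by (simp add: connections_def)
  have "(r, q) \<in> connections\<^sup>*"
  proof (rule connection_returns[OF step.hyps(2)])
    show "finite (connections\<^sup>* `` {r})" by (rule tame_finite[OF assms(1) r])
    fix s y assume s: "s \<in> connections\<^sup>* `` {r}" "al y = {s}"
    have "to_saddle (rev_flow v) y" unfolding to_saddle_rev using s reachable_saddle[OF r] by blast
    then show "\<exists>r. saddle v r \<and> om y = {r}" using tame_ends[OF assms(1) disjI2, of y] by blast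
  qed
  then show ?case using step.IH by (rule rtrancl_trans)
qed simp

lemma reachable_step:
  assumes t: tame and p: "saddle v p" and q: "q \<in> connections\<^sup>* `` {p}" "al y = {q}"
  shows "\<exists>r\<in>connections\<^sup>* `` {p}. om y = {r}"
proof -
  have pq: "(p, q) \<in> connections\<^sup>*" using q(1) by simp
  have "to_saddle (rev_flow v) y" unfolding to_saddle_rev using q(2) reachable_saddle[OF p pq] by blast
  then obtain a b where ab: "al y = {a}" "om y = {b}" "(a, b) \<in> connections"
    using tame_ends[OF t disjI2, of y] by blast
  have "a = q" using ab(1) q(2) by simp
  then have "(p, b) \<in> connections\<^sup>*" using rtrancl_into_rtrancl[OF pq] ab(3) by blast
  then have "b \<in> connections\<^sup>* `` {p}" by (rule ImageI) simp
  with ab(2) show ?thesis by (rule bexI)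
qed

text \<open>As reachability is symmetric, following unstable manifolds forwards and stable manifolds
  backwards collects the same orbits, and both halves reduce to one union.\<close>

lemma tame_ext_orbit_saddle:
  assumes t: tame and p: "saddle v p" "om x = {p}"
  shows "ext_orbit v x = (\<Union>q\<in>connections\<^sup>* `` {p}. W_unstable v q)" (is "_ = ?E")
proof -
  interpret rv: surface_flow "rev_flow v" by (rule rev_surface_flow)
  have fin: "finite (connections\<^sup>* `` {p})" by (rule tame_finite[OF t p(1)])
  have stable: "W_stable v q \<subseteq> ?E" if q: "(p, q) \<in> connections\<^sup>*" for q
  proof
    fix z assume z: "z \<in> W_stable v q"
    then have zq: "om z = {q}" by (simp add: W_stable_def)
    have "to_saddle v z" using zq reachable_saddle[OF p(1) q] unfolding to_saddle_def by blast
    then obtain a b where ab: "saddle v a" "al z = {a}" "om z = {b}" "(a, b) \<in> connections"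
      using tame_ends[OF t disjI1, of z] by blast
    have "b = q" using ab(3) zq by simp
    then have "(a, q) \<in> connections\<^sup>*" using ab(4) by blast
    then have "(q, a) \<in> connections\<^sup>*" by (rule tame_sym[OF t ab(1)])
    then have "(p, a) \<in> connections\<^sup>*" by (rule rtrancl_trans[OF q])
    then show "z \<in> ?E" using ab(2) unfolding W_unstable_def by blast
  qed
  have xE: "x \<in> ?E" using stable[OF rtrancl_refl] p(2) unfolding W_stable_def by blast
  have "invariant_set v ?E"
  proof (rule unstable_union(1)[OF fin])
    show "saddle v q" if "q \<in> connections\<^sup>* `` {p}" for q using that reachable_saddle[OF p(1)] by blast
    show "\<exists>r\<in>connections\<^sup>* `` {p}. om y = {r}" if "q \<in> connections\<^sup>* `` {p}" "al y = {q}" for q y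
      by (rule reachable_step[OF t p(1) that])
  qed
  from orbit_subset[OF this xE] have orb: "orbit v x \<subseteq> ?E" .
  have pos: "pos_ext_orbit v x = pos_orbit v x \<union> ?E" by (rule pos_ext_orbit_saddle[OF p(2,1)])
  have ts: "to_saddle v x" using p unfolding to_saddle_def by blast
  obtain a b where a: "saddle v a" "al x = {a}" "om x = {b}" "(a, b) \<in> connections"
    using tame_ends[OF t disjI1[OF ts]] by blast
  then have "b = p" using p(2) by simp
  then have "(a, p) \<in> connections\<^sup>*" using a(4) by blast
  then have pa: "(p, a) \<in> connections\<^sup>*" by (rule tame_sym[OF t a(1)])
  have "neg_ext_orbit v x = neg_orbit v x \<union> (\<Union>q\<in>(connections\<inverse>)\<^sup>* `` {a}. W_stable v q)"
    using rv.pos_ext_orbit_saddle[of x a] a by (simp add: connections_rev)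
  moreover have "W_stable v q \<subseteq> ?E" if q: "(a, q) \<in> (connections\<inverse>)\<^sup>*" for q
  proof -
    have qa: "(q, a) \<in> connections\<^sup>*" using q by (simp add: rtrancl_converse)
    have "saddle v q" by (rule reaching_saddle[OF a(1) qa])
    then have "(a, q) \<in> connections\<^sup>*" by (rule tame_sym[OF t _ qa])
    then show ?thesis by (intro stable rtrancl_trans[OF pa])
  qed
  ultimately have "neg_ext_orbit v x \<subseteq> neg_orbit v x \<union> ?E" by blast
  then show ?thesis using pos orb unfolding ext_orbit_def orbit_pos_neg by blast
qed

lemma ext_orbit_plain:
  assumes "\<not> to_saddle v x" "\<not> to_saddle (rev_flow v) x" shows "ext_orbit v x = orbit v x"
  using pos_ext_orbit_plain[OF assms(1)] rev.pos_ext_orbit_plain[OF assms(2)]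
  unfolding ext_orbit_def orbit_pos_neg by simp

lemma tame_cases:
  assumes t: tame
  obtains p where "saddle v p" "om x = {p}" "ext_orbit v x = (\<Union>q\<in>connections\<^sup>* `` {p}. W_unstable v q)"
  | "\<not> to_saddle v x" "\<not> to_saddle (rev_flow v) x" "ext_orbit v x = orbit v x" "closed (orbit v x)"
    "x \<in> om x"
proof (cases "to_saddle v x \<or> to_saddle (rev_flow v) x")
  case True
  obtain p q where "saddle v p" "saddle v q" "al x = {p}" "om x = {q}" "(p, q) \<in> connections"
    using tame_ends[OF t True] by blast
  then show ?thesis using that(1)[of q] tame_ext_orbit_saddle[OF t, of q x] by simp
next
  case False
  have "x \<in> Sing v \<or> periodic v x" using t False unfolding tame_def by blast
  then have "closed (orbit v x) \<and> x \<in> om x"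
  proof
    assume x: "x \<in> Sing v"
    then have "orbit v x = {x}" by (auto simp: orbit_def Sing_def)
    then show ?thesis using omega_Sing[OF x] by simp
  next
    assume "periodic v x"
    then obtain t where "t > 0" "v t x = x" by (auto simp: periodic_def)
    then show ?thesis using orbit_periodic_closed[of t x] omega_periodic[of t x] in_orbit(2)[of x] by simp
  qed
  then show ?thesis using that(2) False ext_orbit_plain by blast
qed

section \<open>Tameness implies each of the three conditions\<close>

lemma tame_closed:
  assumes t: tame shows "closed (ext_orbit v x)"
proof (cases rule: tame_cases[OF t, of x])
  case (1 p)
  have fin: "finite (connections\<^sup>* `` {p})" by (rule tame_finite[OF t 1(1)])
  have "\<exists>Y. finite Y \<and> (\<Union>q\<in>connections\<^sup>* `` {p}. W_unstable v q) = (\<Union>y\<in>Y. closure (orbit v y))"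
  proof (rule unstable_union(2)[OF fin])
    show "saddle v q" if "q \<in> connections\<^sup>* `` {p}" for q using that reachable_saddle[OF 1(1)] by blast
    show "\<exists>r\<in>connections\<^sup>* `` {p}. om y = {r}" if "q \<in> connections\<^sup>* `` {p}" "al y = {q}" for q y
      by (rule reachable_step[OF t 1(1) that])
  qed
  then obtain Y where "finite Y" "ext_orbit v x = (\<Union>y\<in>Y. closure (orbit v y))" using 1(3) by auto
  then show ?thesis by (simp add: closed_UN)
next
  case 2
  then show ?thesis by simp
qed

lemma tame_eq:
  assumes t: tame and z: "z \<in> ext_orbit v x" shows "ext_orbit v z = ext_orbit v x"
proof (cases rule: tame_cases[OF t, of x])
  case (1 p)
  obtain q where q: "(p, q) \<in> connections\<^sup>*" "al z = {q}"
    using z unfolding 1(3) W_unstable_def by blast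
  have "to_saddle (rev_flow v) z" unfolding to_saddle_rev using q reachable_saddle[OF 1(1)] by blast
  then obtain a b where ab: "saddle v b" "al z = {a}" "om z = {b}" "(a, b) \<in> connections"
    using tame_ends[OF t disjI2, of z] by blast
  have "(q, b) \<in> connections" using ab(2,4) q(2) by simp
  then have pb: "(p, b) \<in> connections\<^sup>*" using q(1) by simp
  then have bp: "(b, p) \<in> connections\<^sup>*" by (rule tame_sym[OF t 1(1)])
  have "connections\<^sup>* `` {p} = connections\<^sup>* `` {b}"
    using rtrancl_trans[OF pb] rtrancl_trans[OF bp] by blast
  then show ?thesis using 1(3) tame_ext_orbit_saddle[OF t ab(1,3)] by simp
next
  case 2
  then obtain s where s: "z = v s x" using z by (auto simp: orbit_def)
  have "ext_orbit v z = orbit v z"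
    by (rule ext_orbit_plain) (use 2(1,2) in \<open>simp_all add: s to_saddle_def alpha_shift\<close>)
  then show ?thesis using 2(3) s by simp
qed

lemma tame_pap: assumes tame shows "ext_pap v"
proof -
  have eq: "closure (ext_orbit v x) = ext_orbit v x" for x by (rule closure_closed[OF tame_closed[OF assms]])
  show ?thesis unfolding ext_pap_def eq
  proof (rule partition_onI)
    show "\<Union>(range (ext_orbit v)) = UNIV" using in_ext_orbit by blast
    show "disjnt A B" if AB: "A \<in> range (ext_orbit v)" "B \<in> range (ext_orbit v)" "A \<noteq> B" for A B
    proof (rule ccontr)
      assume "\<not> disjnt A B"
      then obtain z where z: "z \<in> A" "z \<in> B" unfolding disjnt_def by blast
      obtain x y where "A = ext_orbit v x" "B = ext_orbit v y" using AB(1,2) by blast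
      then show False using tame_eq[OF assms, of z x] tame_eq[OF assms, of z y] z AB(3) by simp
    qed
    show "{} \<notin> range (ext_orbit v)" using in_ext_orbit by blast
  qed
qed

lemma tame_finite_Sing: assumes t: tame shows "finite (Sing v \<inter> closure (ext_orbit v x))"
proof -
  have eq: "closure (ext_orbit v x) = ext_orbit v x" by (rule closure_closed[OF tame_closed[OF t]])
  show ?thesis
  proof (cases rule: tame_cases[OF t, of x])
    case (1 p)
    have "y \<in> connections\<^sup>* `` {p}" if y: "y \<in> Sing v" "y \<in> ext_orbit v x" for y
    proof -
      obtain q where "q \<in> connections\<^sup>* `` {p}" "al y = {q}"
        using y(2) unfolding 1(3) W_unstable_def by blast
      then show ?thesis using rev.omega_Sing[of y] y(1) by simp
    qed
    then have "Sing v \<inter> ext_orbit v x \<subseteq> connections\<^sup>* `` {p}" by blast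
    then show ?thesis unfolding eq by (rule finite_subset[OF _ tame_finite[OF t 1(1)]])
  next
    case 2
    have "Sing v \<inter> orbit v x \<subseteq> {x}" by (auto simp: orbit_def Sing_v)
    then show ?thesis unfolding eq unfolding 2(3) by (rule finite_subset) simp
  qed
qed

lemma tame_rev: assumes t: tame shows "surface_flow.tame (rev_flow v)"
proof -
  interpret rv: surface_flow "rev_flow v" by (rule rev_surface_flow)
  have "finite ((connections\<inverse>)\<^sup>* `` {p})" if p: "saddle v p" for p
  proof (rule finite_subset)
    show "finite (connections\<^sup>* `` {p})" by (rule tame_finite[OF t p])
    show "(connections\<inverse>)\<^sup>* `` {p} \<subseteq> connections\<^sup>* `` {p}"
    proof
      fix q assume "q \<in> (connections\<inverse>)\<^sup>* `` {p}"
      then have qp: "(q, p) \<in> connections\<^sup>*" by (simp add: rtrancl_converse)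
      have "saddle v q" by (rule reaching_saddle[OF p qp])
      then show "q \<in> connections\<^sup>* `` {p}" using tame_sym[OF t _ qp] by blast
    qed
  qed
  then show ?thesis using t unfolding rv.tame_def tame_def connections_rev
    by (simp only: Sing_rev periodic_rev rev_flow_rev_flow saddle_rev) blast
qed

text \<open>If \<open>x\<close> lies on a connection from \<open>a\<close> to \<open>p\<close>, then
  \<open>a\<close> is reachable from \<open>p\<close>, so the positive extended orbit comes back
  along the unstable manifold of \<open>a\<close> to the past of \<open>x\<close>.\<close>

lemma tame_pos_recurrent: assumes t: tame shows "ext_pos_recurrent_at v x"
proof (cases rule: tame_cases[OF t, of x])
  case 2
  then show ?thesis by (simp add: ext_pos_recurrent_at_def)
next
  case (1 p)
  show ?thesis
  proof (cases "x \<in> Sing v")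
    case True
    then show ?thesis by (simp add: ext_pos_recurrent_at_def omega_Sing)
  next
    case x: False
    have ts: "to_saddle v x" using 1(1,2) unfolding to_saddle_def by blast
    have np: "\<not> periodic v x" by (rule not_periodic_if_to_saddle[OF x ts])
    obtain a b where ab: "saddle v a" "al x = {a}" "om x = {b}" "(a, b) \<in> connections"
      using tame_ends[OF t disjI1[OF ts]] by blast
    have "b = p" using ab(3) 1(2) by simp
    then have "(a, p) \<in> connections\<^sup>*" using ab(4) by blast
    then have pa: "(p, a) \<in> connections\<^sup>*" by (rule tame_sym[OF t ab(1)])
    \<comment> \<open>Points just before \<open>x\<close> on its own orbit: they lie on that
      unstable manifold, are not on the positive orbit, and tend to \<open>x\<close>.\<close>
    define y where "y n = v (- inverse (real (Suc n))) x" for n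
    have "y n \<in> pos_ext_orbit v x - pos_orbit v x" for n
    proof
      have "y n \<in> W_unstable v a" using ab(2) by (simp add: y_def W_unstable_def alpha_shift)
      then show "y n \<in> pos_ext_orbit v x" unfolding pos_ext_orbit_saddle[OF 1(2,1)] using pa by blast
      show "y n \<notin> pos_orbit v x"
      proof
        assume "y n \<in> pos_orbit v x"
        then obtain s where s: "s \<ge> 0" "v (- inverse (real (Suc n))) x = v s x" by (auto simp: pos_orbit_def y_def)
        have "- inverse (real (Suc n)) = s" by (rule nonperiodic_inj[OF x np s(2)])
        moreover have "0 < inverse (real (Suc n))" by simp
        ultimately show False using s(1) by linarith
      qed
    qed
    then have yc: "y n \<in> closure (pos_ext_orbit v x - pos_orbit v x)" for n using closure_subset by blast
    have "y \<longlonglongrightarrow> v (- 0) x" unfolding y_def by (intro tendsto_intros LIMSEQ_inverse_real_of_nat)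
    then have lim: "y \<longlonglongrightarrow> x" by simp
    have "x \<in> closure (pos_ext_orbit v x - pos_orbit v x)"
      by (rule Lim_in_closed_set[OF closed_closure _ sequentially_bot lim]) (simp add: yc)
    then show ?thesis by (simp add: ext_pos_recurrent_at_def)
  qed
qed

lemma ext_neg_recurrent_rev: "ext_neg_recurrent_at v x \<longleftrightarrow> ext_pos_recurrent_at (rev_flow v) x"
  by (simp add: ext_neg_recurrent_at_def ext_pos_recurrent_at_def)

lemma tame_recurrent: assumes tame shows "ext_recurrent v"
proof -
  interpret rv: surface_flow "rev_flow v" by (rule rev_surface_flow)
  show ?thesis unfolding ext_recurrent_def ext_neg_recurrent_rev
    using tame_pos_recurrent[OF assms] rv.tame_pos_recurrent[OF tame_rev[OF assms]] by blast
qed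

lemma reachable_subset:
  assumes p: "saddle v p" shows "connections\<^sup>* `` {p} \<subseteq> Sing v \<inter> ext_orbit v p"
proof
  fix q assume "q \<in> connections\<^sup>* `` {p}"
  then have q: "(p, q) \<in> connections\<^sup>*" by simp
  have pS: "om p = {p}" using p omega_Sing by (simp add: saddle_def)
  have qS: "q \<in> Sing v" using reachable_saddle[OF p q] by (simp add: saddle_def)
  then have "q \<in> W_unstable v q" using rev.omega_Sing[of q] by (simp add: W_unstable_def)
  then have "q \<in> pos_ext_orbit v p" unfolding pos_ext_orbit_saddle[OF pS p] using q by blast
  then show "q \<in> Sing v \<inter> ext_orbit v p" using qS by (simp add: ext_orbit_def)
qed

end

section \<open>Extended almost periodicity implies tameness\<close>

context surface_flow
begin

lemma to_saddle_limit:
  assumes "closed K" "invariant_set v K" "y \<in> K" "to_saddle v y"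
  shows "\<exists>p\<in>K. saddle v p \<and> p \<in> om y"
  using omega_subset[OF assms(1-3)] assms(4) unfolding to_saddle_def by blast

lemma not_to_saddle_plain:
  assumes "\<And>p. saddle v p ==> p \<notin> M" "closed M" "invariant_set v M" "z \<in> M"
  shows "\<not> to_saddle v z" "\<not> to_saddle (rev_flow v) z" "ext_orbit v z \<subseteq> M"
proof -
  have sub: "om z \<subseteq> M" "al z \<subseteq> M"
    using omega_subset[OF assms(2-4)] rev.omega_subset[of M z] assms(2-4) by simp_all
  show n: "\<not> to_saddle v z" "\<not> to_saddle (rev_flow v) z"
    using sub assms(1) unfolding to_saddle_rev unfolding to_saddle_def by blast+
  show "ext_orbit v z \<subseteq> M" unfolding ext_orbit_plain[OF n] by (rule orbit_subset[OF assms(3,4)])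
qed

lemma ext_orbit_singular: "x \<in> Sing v ==> \<not> saddle v x ==> ext_orbit v x = {x}"
proof -
  assume x: "x \<in> Sing v" "\<not> saddle v x"
  have "\<not> to_saddle v x" "\<not> to_saddle (rev_flow v) x"
    using x(2) omega_Sing[OF x(1)] rev.omega_Sing[of x] x(1) by (auto simp: to_saddle_def)
  then have "ext_orbit v x = orbit v x" by (rule ext_orbit_plain)
  then show ?thesis using x(1) by (auto simp: orbit_def Sing_def)
qed

lemma pap_class_eq:
  assumes "ext_pap v" "z \<in> closure (ext_orbit v x)" "z \<in> closure (ext_orbit v y)"
  shows "closure (ext_orbit v x) = closure (ext_orbit v y)"
proof -
  let ?P = "range (\<lambda>x. closure (ext_orbit v x))"
  have "disjoint ?P" using assms(1) by (simp add: ext_pap_def partition_on_def)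
  then show ?thesis using assms(2,3) unfolding disjoint_def by blast
qed

lemma pap_class:
  assumes "ext_pap v" "z \<in> closure (ext_orbit v x)" shows "closure (ext_orbit v z) = closure (ext_orbit v x)"
  by (rule pap_class_eq[OF assms(1) _ assms(2)]) (use closure_subset in_ext_orbit in blast)

text \<open>A singularity that is not a saddle is its own extended orbit, hence a class by itself,
  and cannot share a class with \<open>x\<close>.\<close>

lemma pap_class_saddles:
  assumes pap: "ext_pap v" and x: "x \<notin> Sing v \<or> saddle v x"
    and y: "y \<in> closure (ext_orbit v x)" "y \<in> Sing v"
  shows "saddle v y"
proof (rule ccontr)
  assume ns: "\<not> saddle v y"
  have "closure (ext_orbit v x) = {y}"
    using pap_class[OF pap y(1)] ext_orbit_singular[OF y(2) ns] by simp
  then have "x = y" using closure_subset in_ext_orbit[of x] by blast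
  then show False using x y(2) ns by blast
qed

text \<open>A limit point \<open>z\<close> of \<open>y\<close> has no saddle in its limit sets, so
  its extended orbit is its orbit and stays in \<open>om y\<close>. As \<open>z\<close> lies in the
  class of \<open>x\<close>, the closure of that orbit is the whole class.\<close>

lemma pap_class_minimal:
  assumes pap: "ext_pap v" and y: "y \<in> closure (ext_orbit v x)" and no: "\<And>p. saddle v p ==> p \<notin> om y"
  shows "closure (ext_orbit v x) \<subseteq> om y"
proof -
  obtain z where z: "z \<in> om y" using omega_nonempty[of y] by blast
  have "ext_orbit v z \<subseteq> om y" by (rule not_to_saddle_plain(3)[OF no]) (use z in simp_all)
  then have sub: "closure (ext_orbit v z) \<subseteq> om y" by (rule closure_minimal) simp
  have "z \<in> closure (ext_orbit v x)"
    using omega_subset[OF closed_closure closure_invariant[OF ext_orbit_invariant] y] z by blast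
  then show ?thesis using pap_class[OF pap] sub by simp
qed

text \<open>Besides the orbit of \<open>x\<close>, the extended orbit contains only separatrices of
  the finitely many saddles in its closure, so finitely many orbit closures cover the class.\<close>

lemma thin_class:
  assumes fin: "finite {p. saddle v p \<and> p \<in> closure (ext_orbit v x)}"
  shows "interior (closure (ext_orbit v x)) = {}"
proof -
  let ?C = "closure (ext_orbit v x)"
  have C: "closed ?C" "invariant_set v ?C" by (simp_all add: closure_invariant ext_orbit_invariant)
  define P where "P = {p. saddle v p \<and> p \<in> ?C}"
  have "\<exists>V. finite V \<and> W_stable v p \<union> W_unstable v p \<subseteq> (\<Union>y\<in>V. orbit v y)" if p: "p \<in> P" for p
    by (rule separatrices_of_saddle) (use p in \<open>simp add: P_def\<close>)
  then obtain V where V: "\<And>p. p \<in> P ==> finite (V p) \<and> W_stable v p \<union> W_unstable v p \<subseteq> (\<Union>y\<in>V p. orbit v y)"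
    by metis
  define Y where "Y = insert x (\<Union>p\<in>P. V p)"
  have "finite P" using fin unfolding P_def .
  then have Y: "finite Y" unfolding Y_def using V by blast
  have "ext_orbit v x \<subseteq> (\<Union>y\<in>Y. closure (orbit v y))"
  proof
    fix z assume z: "z \<in> ext_orbit v x"
    then have zC: "z \<in> ?C" using closure_subset by blast
    have lim: "om z \<subseteq> ?C" "al z \<subseteq> ?C"
      using omega_subset[OF C zC] rev.omega_subset[of ?C z] C zC by simp_all
    consider "z \<in> orbit v x" | "z \<in> separatrices v" using z ext_orbit_subset[of x] by blast
    then have "\<exists>y\<in>Y. z \<in> orbit v y"
    proof cases
      case 1 then show ?thesis by (simp add: Y_def)
    next
      case 2
      then obtain p where p: "saddle v p" "om z = {p} \<or> al z = {p}"
        unfolding separatrices_def mem_Collect_eq to_saddle_rev unfolding to_saddle_def by blast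
      then have pP: "p \<in> P" using lim by (auto simp: P_def)
      moreover have "z \<in> W_stable v p \<union> W_unstable v p" using p(2) by (auto simp: W_stable_def W_unstable_def)
      ultimately show ?thesis using V[OF pP] unfolding Y_def by blast
    qed
    then show "z \<in> (\<Union>y\<in>Y. closure (orbit v y))" using closure_subset by fast
  qed
  then have "?C \<subseteq> (\<Union>y\<in>Y. closure (orbit v y))" by (rule closure_minimal) (use Y in \<open>auto intro: closed_UN\<close>)
  then show ?thesis using interior_mono interior_closure_orbits_empty[OF Y] by blast
qed

lemma pap_to_saddle:
  assumes pap: "ext_pap v" and x: "x \<notin> Sing v" "\<not> periodic v x"
  shows "to_saddle v x"
proof (rule ccontr)
  assume nts: "\<not> to_saddle v x"
  interpret rv: surface_flow "rev_flow v" by (rule rev_surface_flow)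
  have rpap: "ext_pap (rev_flow v)" using pap by (simp add: ext_pap_def)
  define C where "C = closure (ext_orbit v x)"
  have C: "closed C" "invariant_set v C" by (simp_all add: C_def closure_invariant ext_orbit_invariant)
  have orbC: "closure (orbit v x) \<subseteq> C" unfolding C_def by (rule closure_mono[OF orbit_subset_ext])
  have KC: "om x \<subseteq> C" using omega_subset_closure_orbit orbC by blast
  have xC: "x \<in> C" unfolding C_def using closure_subset in_ext_orbit by blast
  have sadC: "saddle v y" if "y \<in> C" "y \<in> Sing v" for y
    using pap_class_saddles[OF pap disjI1[OF x(1)]] that unfolding C_def by blast
  have "finite (Sing v \<inter> C)" by (rule finite_Sing_saddles[OF C(1) sadC])
  moreover have "{p. saddle v p \<and> p \<in> C} \<subseteq> Sing v \<inter> C" by (auto simp: saddle_def)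
  ultimately have finC: "finite {p. saddle v p \<and> p \<in> C}" by (rule finite_subset[rotated])
  have thin: "interior C = {}" using thin_class finC unfolding C_def by blast
  have minF: "y \<in> om y \<or> (\<exists>p. saddle v p \<and> p \<in> om y)" if "y \<in> C" for y
    using pap_class_minimal[OF pap, of y x] that unfolding C_def by blast
  have minB: "y \<in> al y \<or> (\<exists>p. saddle v p \<and> p \<in> al y)" if "y \<in> C" for y
    using rv.pap_class_minimal[OF rpap, of y x] that unfolding C_def ext_orbit_rev omega_limit_rev saddle_rev by blast
  have "\<exists>V. open V \<and> V \<noteq> {} \<and> captured v V (closure (orbit v x))"
  proof (rule trap[OF x refl])
    show "finite {p \<in> om x. saddle v p}" by (rule finite_subset[OF _ finC]) (use KC in blast)
    show "om x \<noteq> {p}" if "saddle v p" for p using nts that unfolding to_saddle_def by blast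
    show "y \<in> om y \<or> (\<exists>p. saddle v p \<and> p \<in> om y)" if "y \<in> om x" for y
      using minF KC that by blast
    show "y \<in> al y \<or> (\<exists>p. saddle v p \<and> p \<in> al y)" if "y \<in> om x" for y
      using minB KC that by blast
    show "x \<in> om x" if "\<And>p. p \<in> om x ==> \<not> saddle v p"
      using minF[OF xC] that by blast
  qed
  then obtain V where V: "open V" "V \<noteq> {}" and alt: "captured v V (closure (orbit v x))"
    by (elim exE conjE) (rule that)
  have meet: "om z \<inter> C \<noteq> {} \<or> al z \<inter> C \<noteq> {}" if "z \<in> V" for z
    using alt orbC that by (elim disjE) blast+
  \<comment> \<open>A captured point has a limit point in \<open>C\<close>, so its class meets the
    class of \<open>x\<close> and equals it.\<close>
  have "V \<subseteq> C"
  proof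
    fix z assume "z \<in> V"
    then obtain w where w: "w \<in> C" "w \<in> om z \<union> al z" using meet by blast
    have "w \<in> closure (orbit v z)" using w(2) unfolding closure_orbit by blast
    then have "w \<in> closure (ext_orbit v z)" using closure_mono[OF orbit_subset_ext] by blast
    then have "closure (ext_orbit v z) = C" using pap_class_eq[OF pap] w(1) unfolding C_def by blast
    then show "z \<in> C" using closure_subset in_ext_orbit[of z] by blast
  qed
  then show False using interior_maximal[OF _ V(1)] thin V(2) by blast
qed

lemma pap_tame: assumes pap: "ext_pap v" shows tame
proof -
  interpret rv: surface_flow "rev_flow v" by (rule rev_surface_flow)
  have rpap: "ext_pap (rev_flow v)" using pap by (simp add: ext_pap_def)
  have "to_saddle v x \<and> to_saddle (rev_flow v) x" if "x \<notin> Sing v" "\<not> periodic v x" for x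
    using pap_to_saddle[OF pap that] rv.pap_to_saddle[OF rpap, of x, unfolded Sing_rev periodic_rev, OF that] ..
  moreover have "finite (connections\<^sup>* `` {p})" if p: "saddle v p" for p
  proof (rule finite_subset)
    show "connections\<^sup>* `` {p} \<subseteq> Sing v \<inter> closure (ext_orbit v p)"
      using reachable_subset[OF p] closure_subset by blast
    show "finite (Sing v \<inter> closure (ext_orbit v p))"
      by (rule finite_Sing_saddles[OF closed_closure pap_class_saddles[OF pap disjI2[OF p]]])
  qed
  ultimately show ?thesis unfolding tame_def by blast
qed

section \<open>Extended recurrence implies tameness\<close>

lemma recurrent_alternative:
  assumes "ext_pos_recurrent_at v y" shows "y \<in> om y \<or> to_saddle v y"
  using assms pos_ext_orbit_plain[of y] unfolding ext_pos_recurrent_at_def by auto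

lemma recurrent_to_saddle:
  assumes rec: "ext_recurrent v" and fin: "finite (Sing v \<inter> closure (ext_orbit v x))"
    and x: "x \<notin> Sing v" "\<not> periodic v x"
  shows "to_saddle v x"
proof (rule ccontr)
  assume nts: "\<not> to_saddle v x"
  interpret rv: surface_flow "rev_flow v" by (rule rev_surface_flow)
  have F: "y \<in> om y \<or> to_saddle v y" for y
    using recurrent_alternative rec unfolding ext_recurrent_def by blast
  have B: "y \<in> al y \<or> to_saddle (rev_flow v) y" for y
    using rv.recurrent_alternative[of y] rec unfolding ext_recurrent_def ext_neg_recurrent_rev by simp
  have xx: "x \<in> om x" using F nts by blast
  have "om x \<subseteq> closure (ext_orbit v x)"
    using omega_subset_closure_orbit closure_mono[OF orbit_subset_ext] by blast
  then have sub: "{p \<in> om x. saddle v p} \<subseteq> Sing v \<inter> closure (ext_orbit v x)"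
    by (auto simp: saddle_def)
  have "\<exists>V. open V \<and> V \<noteq> {} \<and> captured v V (closure (orbit v x))"
  proof (rule trap[OF x refl])
    show "finite {p \<in> om x. saddle v p}" by (rule finite_subset[OF sub fin])
    show "om x \<noteq> {p}" if "saddle v p" for p using nts that unfolding to_saddle_def by blast
    show "y \<in> om y \<or> (\<exists>p. saddle v p \<and> p \<in> om y)" for y
      using F[of y] unfolding to_saddle_def by blast
    show "y \<in> al y \<or> (\<exists>p. saddle v p \<and> p \<in> al y)" for y
      using B[of y] unfolding to_saddle_rev by blast
  qed (rule xx)
  then obtain V where V: "open V" "V \<noteq> {}" and alt: "captured v V (closure (orbit v x))"
    by (elim exE conjE) (rule that)
  \<comment> \<open>The points of \<open>V\<close> fail to be recurrent in one time direction, so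
    extended recurrence forces them to be separatrix points.\<close>
  from alt have nr: "(\<forall>z\<in>V. z \<notin> om z) \<or> (\<forall>z\<in>V. z \<notin> al z)" by (elim disjE) simp_all
  have "V \<subseteq> separatrices v" using nr F B unfolding separatrices_def by blast
  then show False using separatrices_thin[OF V(1)] V(2) by blast
qed

lemma recurrent_tame:
  assumes rec: "ext_recurrent v" and fin: "\<And>x. finite (Sing v \<inter> closure (ext_orbit v x))"
  shows tame
proof -
  interpret rv: surface_flow "rev_flow v" by (rule rev_surface_flow)
  have "ext_recurrent (rev_flow v)"
    using rec by (auto simp: ext_recurrent_def ext_neg_recurrent_at_def ext_pos_recurrent_at_def)
  from rv.recurrent_to_saddle[OF this, unfolded Sing_rev periodic_rev ext_orbit_rev, OF fin]
  have "to_saddle v x \<and> to_saddle (rev_flow v) x" if "x \<notin> Sing v" "\<not> periodic v x" for x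
    using recurrent_to_saddle[OF rec fin that] that by blast
  moreover have "finite (connections\<^sup>* `` {p})" if p: "saddle v p" for p
  proof (rule finite_subset[OF _ fin])
    show "connections\<^sup>* `` {p} \<subseteq> Sing v \<inter> closure (ext_orbit v p)"
      using reachable_subset[OF p] closure_subset by blast
  qed
  ultimately show ?thesis unfolding tame_def by blast
qed

section \<open>Closedness of the extended orbits implies tameness\<close>

lemma closed_alternative:
  assumes cl: "closed (ext_orbit v y)" and ny: "\<not> to_saddle v y" "y \<notin> om y"
  shows "om y \<subseteq> {z. to_saddle v z}" "to_saddle (rev_flow v) y"
proof -
  have disj: "om y \<inter> orbit v y = {}"
  proof (rule ccontr)
    assume "om y \<inter> orbit v y \<noteq> {}"
    then obtain t where t: "v t y \<in> om y" by (auto simp: orbit_def)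
    from omega_invariant[OF t, of "- t"] show False using ny(2) by simp
  qed
  have "om y \<subseteq> closure (ext_orbit v y)"
    using omega_subset_closure_orbit closure_mono[OF orbit_subset_ext] by blast
  then have sub: "om y \<subseteq> ext_orbit v y" using closure_closed[OF cl] by simp
  \<comment> \<open>As \<open>y\<close> does not converge to a saddle, everything beyond its orbit
    comes from the negative extension, that is from stable manifolds of saddles.\<close>
  have "ext_orbit v y \<subseteq> orbit v y \<union> {z. to_saddle v z}"
    using neg_ext_orbit_subset[of y] unfolding ext_orbit_def pos_ext_orbit_plain[OF ny(1)] orbit_pos_neg by blast
  then show "om y \<subseteq> {z. to_saddle v z}" using sub disj by blast
  show "to_saddle (rev_flow v) y"
  proof (rule ccontr)
    assume "\<not> ?thesis"
    then have "ext_orbit v y = orbit v y" by (rule ext_orbit_plain[OF ny(1)])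
    then show False using sub disj omega_nonempty[of y] by blast
  qed
qed

text \<open>For a nonrecurrent \<open>y\<close> not converging to a saddle, \<open>om y\<close>
  consists of points that do; the saddles they converge to belong to \<open>om y\<close>, which is
  closed and invariant.\<close>

lemma closed_saddle_limit:
  assumes cl: "closed (ext_orbit v y)"
  shows "y \<in> om y \<or> (\<exists>p. saddle v p \<and> p \<in> om y)"
proof (rule disjCI)
  assume no: "\<not> (\<exists>p. saddle v p \<and> p \<in> om y)"
  show "y \<in> om y"
  proof (rule ccontr)
    assume ny: "y \<notin> om y"
    have nts: "\<not> to_saddle v y" using no unfolding to_saddle_def by blast
    obtain z where z: "z \<in> om y" using omega_nonempty[of y] by blast
    then have "to_saddle v z" using closed_alternative(1)[OF cl nts ny] by blast
    from to_saddle_limit[OF omega_closed omega_invariant_set z this] show False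
      using omega_trans[OF z] no by blast
  qed
qed

lemma closed_to_saddle:
  assumes cl: "\<And>x. closed (ext_orbit v x)" and x: "x \<notin> Sing v" "\<not> periodic v x"
  shows "to_saddle v x"
proof (rule ccontr)
  assume nts: "\<not> to_saddle v x"
  interpret rv: surface_flow "rev_flow v" by (rule rev_surface_flow)
  have rcl: "closed (ext_orbit (rev_flow v) y)" for y using cl by simp
  \<comment> \<open>If \<open>x\<close> were recurrent, its limit set would lie in the closed
    extended orbit, hence on countably many orbits, and Baire's theorem would make \<open>x\<close>
    periodic.\<close>
  have nx: "x \<notin> om x"
  proof
    assume xx: "x \<in> om x"
    have "om x \<subseteq> closure (ext_orbit v x)"
      using omega_subset_closure_orbit closure_mono[OF orbit_subset_ext] by blast
    then have "om x \<subseteq> orbit v x \<union> separatrices v"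
      using ext_orbit_subset[of x] closure_closed[OF cl[of x]] by simp
    then show False using periodic_if_recurrent_thin[OF x(1) xx] x(2) by blast
  qed
  have ts: "to_saddle v y" if "y \<in> om x" for y
    using closed_alternative(1)[OF cl nts nx] that by blast
  have "saddle v y" if "y \<in> om x" "y \<in> Sing v" for y
    using ts[OF that(1)] omega_Sing[OF that(2)] by (auto simp: to_saddle_def)
  then have "finite (Sing v \<inter> om x)" by (intro finite_Sing_saddles) simp_all
  moreover have "{p \<in> om x. saddle v p} \<subseteq> Sing v \<inter> om x" by (auto simp: saddle_def)
  ultimately have fin: "finite {p \<in> om x. saddle v p}" by (rule finite_subset[rotated])
  have "\<exists>V. open V \<and> V \<noteq> {} \<and> captured v V (closure (orbit v x))"
  proof (rule trap[OF x refl fin])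
    show "om x \<noteq> {p}" if "saddle v p" for p using nts that unfolding to_saddle_def by blast
    show "y \<in> om y \<or> (\<exists>p. saddle v p \<and> p \<in> om y)" for y
      by (rule closed_saddle_limit[OF cl])
    show "y \<in> al y \<or> (\<exists>p. saddle v p \<and> p \<in> al y)" for y
      using rv.closed_saddle_limit[OF rcl, of y] by simp
    show "x \<in> om x" if no: "\<And>p. p \<in> om x ==> \<not> saddle v p"
      using closed_saddle_limit[OF cl, of x] no by blast
  qed
  then obtain V where V: "open V" "V \<noteq> {}" and alt: "captured v V (closure (orbit v x))"
    by (elim exE conjE) (rule that)
  from alt have nr: "(\<forall>z\<in>V. z \<notin> om z) \<or> (\<forall>z\<in>V. z \<notin> al z)" by (elim disjE) simp_all
  have F: "z \<in> separatrices v" if "z \<notin> om z" for z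
    using closed_alternative(2)[OF cl _ that] unfolding separatrices_def by blast
  have B: "z \<in> separatrices v" if "z \<notin> al z" for z
    using rv.closed_alternative(2)[OF rcl, of z] that unfolding separatrices_def omega_limit_rev rev_flow_rev_flow by blast
  have "V \<subseteq> separatrices v" using nr F B by blast
  then show False using separatrices_thin[OF V(1)] V(2) by blast
qed

lemma closed_tame: assumes cl: "\<And>x. closed (ext_orbit v x)" shows tame
proof -
  interpret rv: surface_flow "rev_flow v" by (rule rev_surface_flow)
  have rcl: "closed (ext_orbit (rev_flow v) y)" for y using cl by simp
  have "to_saddle v x \<and> to_saddle (rev_flow v) x" if "x \<notin> Sing v" "\<not> periodic v x" for x
    using closed_to_saddle[OF cl that] rv.closed_to_saddle[OF rcl, of x, unfolded Sing_rev periodic_rev, OF that] ..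
  moreover have "finite (connections\<^sup>* `` {p})" if p: "saddle v p" for p
  proof (rule finite_subset[OF reachable_subset[OF p]], rule finite_Sing_saddles[OF cl])
    fix y assume y: "y \<in> ext_orbit v p" "y \<in> Sing v"
    have "orbit v p = {p}" using p by (auto simp: saddle_def orbit_def Sing_def)
    then consider "y = p" | "y \<in> separatrices v" using y(1) ext_orbit_subset[of p] by blast
    then show "saddle v y" using p separatrices_Sing[OF _ y(2)] by cases simp_all
  qed
  ultimately show ?thesis unfolding tame_def by blast
qed

end

theorem proposition3p2:
  fixes v :: "real \<Rightarrow> 'a::{t2_space, second_countable_topology} \<Rightarrow> 'a"
  assumes "compact (UNIV :: 'a set)"
    and "surface (UNIV :: 'a set)"
    and "flow_on UNIV v"
    and "non_identical v"
    and "\<And>x. \<not> locally_dense (orbit v x)"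
  shows "(ext_pap v \<longleftrightarrow>
            ext_recurrent v \<and> (\<forall>x. finite (Sing v \<inter> closure (ext_orbit v x)))) \<and>
         (ext_recurrent v \<and> (\<forall>x. finite (Sing v \<inter> closure (ext_orbit v x))) \<longleftrightarrow>
            (\<forall>x. closed (ext_orbit v x)))"
proof -
  interpret surface_flow v by unfold_locales (use assms in auto)
  have "ext_pap v \<longleftrightarrow> tame" using pap_tame tame_pap by blast
  moreover have "ext_recurrent v \<and> (\<forall>x. finite (Sing v \<inter> closure (ext_orbit v x))) \<longleftrightarrow> tame"
    using recurrent_tame tame_recurrent tame_finite_Sing by blast
  moreover have "(\<forall>x. closed (ext_orbit v x)) \<longleftrightarrow> tame" using closed_tame tame_closed by blast
  ultimately show ?thesis by blast
qed

end
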